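(* Let $\Gamma$ be a finite subgroup of $\mathrm{SL}_2(\mathbb{C})$ and fix an orientation $\Omega$ of its McKay multigraph. For all dimension parameters $d,d^f\in\mathbb{Z}_{\ge0}^{\mathrm{Irr}}$, all stability parameters $\theta\in\mathbb{Q}^{\mathrm{Irr}}$ and all deformation parameters $\lambda\in\mathbb{C}^{\mathrm{Irr}}$, the functor $\mathcal{F}$ induces an isomorphism $$\tau:\mathcal{M}^\lambda_\theta(d,d^f)\xrightarrow{\ \sim\ }\mathcal{M}^\lambda_\theta\big(\mathcal{F}(V^d),\mathcal{F}(V^{d^f})\big)$$ from Nakajima's quiver variety of the framed McKay quiver to its $\Gamma$-module analogue.
   Context: **Notation.** $\mathrm{Irr}$ is the set of irreducible characters of $\Gamma$; $X_\chi$ an irreducible $\Gamma$-module with character $\chi$; $X_0=X_{\chi_0}$ the trivial one; $\delta_\chi=\dim X_\chi$; $X_{\mathrm{std}}=\mathbb{C}^2$ the standard representation, with canonical basis $(e_1,e_2)$ and character $\chi_{\mathrm{std}}$. All $\Gamma$-modules are finite-dimensional. The McKay multigraph has vertex set $\mathrm{Irr}$ and $\langle\chi\chi_{\mathrm{std}}|\chi'\rangle$ edges between $\chi$ and $\chi'$. $\overline{E}$ is the set of arrows of its double quiver (each edge replaced by two opposite arrows); $h',h''$ are source and target of $h\in\overline E$, $\bar h$ the reversed arrow. An orientation $\Omega$ gives a sign $\varepsilon:\overline{E}\to\{\pm1\}$, $\varepsilon(h)=1$ if $h$ is oriented as in $\Omega$ and $-1$ otherwise. For $d\in\mathbb{Z}_{\geq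 0}^{\mathrm{Irr}}$, $V^d=\bigoplus_\chi\mathbb{C}^{d_\chi}$ as $\mathrm{Irr}$-graded space. **GIT conventions.** For a character $\chi$ of a reductive group $H$ acting on affine $X$, $X/\!/_\chi H=\mathrm{Proj}\bigoplus_{m\ge0}\{f\in\mathbb{C}[X]:f(h.y)=\chi(h)^mf(y)\}$; if the character depends on a rational $\theta$, replace $\theta$ by a positive integral multiple. **Nakajima's variety.** For $\mathrm{Irr}$-graded finite-dimensional $V,V^f$: $\mathcal{R}_{V,V^f}=\bigoplus_{h\in\overline{E}}\mathrm{Hom}(V_{h'},V_{h''})\oplus\bigoplus_\chi\mathrm{Hom}(V^f_\chi,V_\chi)\oplus\bigoplus_\chi\mathrm{Hom}(V_\chi,V^f_\chi)\ni(x,v^1,v^2)$. $\mathrm{G}(V)=\prod_\chi\mathrm{GL}(V_\chi)$ acts by $(g.x)_h=g_{h''}x_hg_{h'}^{-1}$, $v^1_\chi\mapsto g_\chi v^1_\chi$, $v^2_\chi\mapsto v^2_\chi g_\chi^{-1}$. $\mu_\varepsilon(x,v^1,v^2)_\chi=\sum_{h''=\chi}\varepsilon(h)x_hx_{\bar h}+v^1_\chi v^2_\chi\in\mathrm{End}(V_\chi)$. Then $\mathcal{M}^\lambda_\theta(d,d^f)=\mu_\varepsilon^{-1}\big((\lambda(\chi)\mathrm{id})_\chi\big)/\!/_\theta\mathrm{G}(V^d)$ with $V=V^d$, $V^f=V^{d^f}$ and character $\prod_\chi\det(g_\chi)^{\theta(\chi)}$. **$\Gamma$-module analogue.** For $\Gamma$-modules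 $M,M^f$: $\mathcal{R}_{M,M^f}=\mathrm{Hom}_\Gamma(X_{\mathrm{std}}\otimes M,M)\oplus\mathrm{Hom}_\Gamma(M^f,M)\oplus\mathrm{Hom}_\Gamma(M,M^f)\ni(\Delta,Z_1,Z_2)$, with $\Delta_x(m)=\Delta(x\otimes m)$; $\mathrm{Aut}_\Gamma(M)$ (the $\Gamma$-equivariant linear automorphisms of $M$) acts by $g.(\Delta,Z_1,Z_2)=(g\Delta(\mathrm{id}\otimes g^{-1}),gZ_1,Z_2g^{-1})$; $\mu(\Delta,Z_1,Z_2)=\Delta_{e_1}\Delta_{e_2}-\Delta_{e_2}\Delta_{e_1}+Z_1Z_2\in\mathrm{End}_\Gamma(M)$. Let $\lambda$ also denote the element of $\mathrm{End}_\Gamma(M)$ acting on the $X_\chi$-isotypic component of $M$ by the scalar $\lambda(\chi)/\delta_\chi$. Then $\mathcal{M}^\lambda_\theta(M,M^f)=\mu^{-1}(\lambda)/\!/_\theta\mathrm{Aut}_\Gamma(M)$ with character $g\mapsto\prod_\chi\det(g|_{\mathrm{Hom}_\Gamma(X_\chi,M)})^{\theta(\chi)}$. **The functor $\mathcal{F}$.** For $h\in\overline{E}$ fix $y^0_h$: for $\Gamma\ne\mu_2$ (the cyclic group of order two), any nonzero element of $\mathrm{Hom}_\Gamma(X_{\mathrm{std}}\otimes X_{h'},X_{h''})$; for $\Gamma=\mu_2$ (with nontrivial irreducible $X_1$, $X_{\mathrm{std}}=X_1\oplus X_1$, arrows $h_1,h_2:\chi_0\to\chi_1$, $h_3,h_4:\chi_1\to\chi_0$,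 $\bar h_1=h_4$, $\bar h_3=h_2$), $y^0_{h_1}((a,b)\otimes1)=a$, $y^0_{h_2}((a,b)\otimes1)=b$, $y^0_{h_3}((a,b)\otimes c)=ac$, $y^0_{h_4}((a,b)\otimes c)=bc$. Put $y_h=\ell_hy_h^0$ with scalars $\ell_h\in\mathbb{C}^*$ chosen such that $\mathrm{Tr}([y_{\bar h}]_1[y_h]_2-[y_{\bar h}]_2[y_h]_1)=\varepsilon(\bar h)$ for all $h$, where $[y_h]_k=y_h(e_k\otimes-)\in\mathrm{Hom}(X_{h'},X_{h''})$. Then $\mathcal{F}(V)=\bigoplus_\chi V_\chi\otimes X_\chi$ for an $\mathrm{Irr}$-graded $V$, and $\mathcal{F}:\mathcal{R}_{V,V^f}\to\mathcal{R}_{\mathcal{F}(V),\mathcal{F}(V^f)}$ sends $(x,v^1,v^2)$ to $\Delta=\sum_hy_h\otimes x_h$, $Z_1=\sum_\chi v^1_\chi\otimes\frac{1}{\delta_\chi}\mathrm{id}_{X_\chi}$, $Z_2=\sum_\chi v^2_\chi\otimes\mathrm{id}_{X_\chi}$.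
   Formalization: For trivial Γ, the McKay multigraph is taken to have one loop, counted twice (two arrows in the double quiver), instead of ⟨χ₀χ_std|χ₀⟩ = 2 loops (four arrows), with which the claim fails: for d=1, d^f=0, θ=λ=0 it would give affine 4-space versus affine 2-space. *)

theory Defs
  imports
    "HOL-Analysis.Analysis"
    "HOL-Algebra.UnivPoly"
    "HOL-Algebra.QuotRing"
    "HOL-Library.Function_Algebras"
    "HOL-Combinatorics.Permutations"
    "Graph_Theory.Digraph"
begin

section \<open>Vectors and matrices indexed by finite sets\<close>

text \<open>
  The vector space with basis a finite set \<open>I\<close> consists of the functions on the index type that
  vanish outside \<open>I\<close>. A matrix with rows in \<open>I\<close> and columns in \<open>J\<close>, i.e. a linear map from the
  space on \<open>J\<close> to the space on \<open>I\<close>, is a vector indexed by \<open>I \<times> J\<close>. Tensor products and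
  direct sums correspond to products and disjoint sums of index sets.
\<close>

definition cscale :: "complex \<Rightarrow> ('i \<Rightarrow> complex) \<Rightarrow> 'i \<Rightarrow> complex" where
  "cscale c v = (\<lambda>i. c * v i)"

global_interpretation cfun: vector_space "cscale :: complex \<Rightarrow> ('i \<Rightarrow> complex) \<Rightarrow> 'i \<Rightarrow> complex"
  by unfold_locales (auto simp: cscale_def fun_eq_iff algebra_simps)

type_synonym ('i, 'j) cmat = "'i \<times> 'j \<Rightarrow> complex"

definition vecs :: "'i set \<Rightarrow> ('i \<Rightarrow> complex) set" where
  "vecs I = {v. \<forall>i. i \<notin> I \<longrightarrow> v i = 0}"

definition mats :: "'i set \<Rightarrow> 'j set \<Rightarrow> ('i, 'j) cmat set" where
  "mats I J = vecs (I \<times> J)"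

definition mvec :: "'j set \<Rightarrow> ('i, 'j) cmat \<Rightarrow> ('j \<Rightarrow> complex) \<Rightarrow> 'i \<Rightarrow> complex" where
  "mvec J A v = (\<lambda>i. \<Sum>j\<in>J. A (i, j) * v j)"

definition mmul :: "'j set \<Rightarrow> ('i, 'j) cmat \<Rightarrow> ('j, 'k) cmat \<Rightarrow> ('i, 'k) cmat" where
  "mmul J A B = (\<lambda>(i, k). \<Sum>j\<in>J. A (i, j) * B (j, k))"

definition mone :: "'i set \<Rightarrow> ('i, 'i) cmat" where
  "mone I = (\<lambda>(i, j). if i \<in> I \<and> i = j then 1 else 0)"

definition mtrace :: "'i set \<Rightarrow> ('i, 'i) cmat \<Rightarrow> complex" where
  "mtrace I A = (\<Sum>i\<in>I. A (i, i))"

definition mdet :: "'i set \<Rightarrow> ('i, 'i) cmat \<Rightarrow> complex" where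
  "mdet I A = (\<Sum>p | p permutes I. of_int (sign p) * (\<Prod>i\<in>I. A (i, p i)))"

definition mGL :: "'i set \<Rightarrow> ('i, 'i) cmat set" where
  "mGL I = {A \<in> mats I I. \<exists>B\<in>mats I I. mmul I A B = mone I \<and> mmul I B A = mone I}"

definition minv :: "'i set \<Rightarrow> ('i, 'i) cmat \<Rightarrow> ('i, 'i) cmat" where
  "minv I A = (THE B. B \<in> mats I I \<and> mmul I A B = mone I \<and> mmul I B A = mone I)"

definition kron :: "('a, 'b) cmat \<Rightarrow> ('c, 'd) cmat \<Rightarrow> ('a \<times> 'c, 'b \<times> 'd) cmat" where
  "kron A B = (\<lambda>((a, c), (b, d)). A (a, b) * B (c, d))"

text \<open>Determinant of a linear endomorphism \<open>T\<close> of a finite-dimensional subspace \<open>W\<close>: the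
  determinant of its matrix in some basis, the basis itself serving as index set.\<close>

definition endo_det :: "('i \<Rightarrow> complex) set \<Rightarrow> (('i \<Rightarrow> complex) \<Rightarrow> ('i \<Rightarrow> complex)) \<Rightarrow> complex" where
  "endo_det W T =
    (let Bs = (SOME Bs. finite Bs \<and> cfun.independent Bs \<and> cfun.span Bs = W)
     in mdet Bs (\<lambda>(a, b). cfun.representation Bs (T b) a))"


section \<open>Modules over a finite subgroup of SL(2)\<close>

type_synonym mat2 = "complex^2^2"

definition SL2 :: "mat2 monoid" where
  "SL2 = \<lparr>carrier = {A. det A = 1}, monoid.mult = (**), one = mat 1\<rparr>"

record 'i gmodule =
  gidx :: "'i set"
  gact :: "mat2 \<Rightarrow> ('i, 'i) cmat"

definition is_gmodule :: "mat2 set \<Rightarrow> 'i gmodule \<Rightarrow> bool" where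
  "is_gmodule \<Gamma> M \<longleftrightarrow>
    finite (gidx M) \<and>
    (\<forall>g\<in>\<Gamma>. gact M g \<in> mats (gidx M) (gidx M)) \<and>
    gact M (mat 1) = mone (gidx M) \<and>
    (\<forall>g\<in>\<Gamma>. \<forall>h\<in>\<Gamma>. gact M (g ** h) = mmul (gidx M) (gact M g) (gact M h))"

definition ghom :: "mat2 set \<Rightarrow> 'i gmodule \<Rightarrow> 'j gmodule \<Rightarrow> ('j, 'i) cmat set" where
  "ghom \<Gamma> M N = {A \<in> mats (gidx N) (gidx M).
     \<forall>g\<in>\<Gamma>. mmul (gidx M) A (gact M g) = mmul (gidx N) (gact N g) A}"

definition gaut :: "mat2 set \<Rightarrow> 'i gmodule \<Rightarrow> ('i, 'i) cmat set" where
  "gaut \<Gamma> M = ghom \<Gamma> M M \<inter> mGL (gidx M)"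

definition irreducible_gmodule :: "mat2 set \<Rightarrow> 'i gmodule \<Rightarrow> bool" where
  "irreducible_gmodule \<Gamma> M \<longleftrightarrow>
    is_gmodule \<Gamma> M \<and> gidx M \<noteq> {} \<and>
    (\<forall>W. cfun.subspace W \<and> W \<subseteq> vecs (gidx M) \<and>
         (\<forall>g\<in>\<Gamma>. \<forall>w\<in>W. mvec (gidx M) (gact M g) w \<in> W)
       \<longrightarrow> W = {0} \<or> W = vecs (gidx M))"

type_synonym chr = "mat2 \<Rightarrow> complex"

definition gchar :: "mat2 set \<Rightarrow> 'i gmodule \<Rightarrow> chr" where
  "gchar \<Gamma> M = (\<lambda>g\<in>\<Gamma>. mtrace (gidx M) (gact M g))"

definition Irr :: "mat2 set \<Rightarrow> chr set" where
  "Irr \<Gamma> = {gchar \<Gamma> M | M :: nat gmodule. irreducible_gmodule \<Gamma> M}"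

definition char_inner :: "mat2 set \<Rightarrow> chr \<Rightarrow> chr \<Rightarrow> complex" where
  "char_inner \<Gamma> \<phi> \<psi> = (\<Sum>g\<in>\<Gamma>. \<phi> g * cnj (\<psi> g)) / of_nat (card \<Gamma>)"

definition gtensor :: "'i gmodule \<Rightarrow> 'j gmodule \<Rightarrow> ('i \<times> 'j) gmodule" where
  "gtensor M N = \<lparr>gidx = gidx M \<times> gidx N, gact = (\<lambda>g. kron (gact M g) (gact N g))\<rparr>"

text \<open>The standard representation; its basis vectors \<open>e\<^sub>1, e\<^sub>2\<close> have the indices \<open>1, 2 :: 2\<close>.\<close>

definition Xstd :: "2 gmodule" where
  "Xstd = \<lparr>gidx = UNIV, gact = (\<lambda>g. \<lambda>(i, j). g $ i $ j)\<rparr>"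

text \<open>A choice of an irreducible module for every irreducible character, realised on a
  coordinate space (so that one-dimensional ones live on the scalars themselves).\<close>

definition irr_family :: "mat2 set \<Rightarrow> (chr \<Rightarrow> nat gmodule) \<Rightarrow> bool" where
  "irr_family \<Gamma> X \<longleftrightarrow>
    (\<forall>\<psi>\<in>Irr \<Gamma>. irreducible_gmodule \<Gamma> (X \<psi>) \<and> gchar \<Gamma> (X \<psi>) = \<psi> \<and> (\<exists>n. gidx (X \<psi>) = {..<n}))"

definition gdim :: "'i gmodule \<Rightarrow> nat" where
  "gdim M = card (gidx M)"

text \<open>\<open>bcol k A\<close> is the partial map \<open>m \<mapsto> A (e\<^sub>k \<otimes> m)\<close>.\<close>

definition bcol :: "2 \<Rightarrow> ('a, 2 \<times> 'b) cmat \<Rightarrow> ('a, 'b) cmat" where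
  "bcol k A = (\<lambda>(a, b). A (a, (k, b)))"

definition isotypic :: "mat2 set \<Rightarrow> 'j gmodule \<Rightarrow> 'i gmodule \<Rightarrow> ('i \<Rightarrow> complex) set" where
  "isotypic \<Gamma> S M = cfun.span {mvec (gidx S) \<phi> v | \<phi> v. \<phi> \<in> ghom \<Gamma> S M \<and> v \<in> vecs (gidx S)}"


section \<open>The McKay multigraph and its double quiver\<close>

text \<open>
  An oriented McKay multigraph is a digraph whose underlying undirected multigraph has the
  prescribed numbers of edges. A loop contributes two to the number of edges from its vertex to
  itself, as usual for adjacency matrices, so that the double quiver always has
  \<open>char_inner \<Gamma> (\<psi> * \<psi>\<^sub>s\<^sub>t\<^sub>d) \<psi>'\<close> arrows from \<open>\<psi>\<close> to \<open>\<psi>'\<close>. Loops occur for the trivial group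
  only, where this convention produces the Jordan quiver.
\<close>

definition oriented_McKay :: "mat2 set \<Rightarrow> (chr, 'e) pre_digraph \<Rightarrow> bool" where
  "oriented_McKay \<Gamma> Q \<longleftrightarrow>
    fin_digraph Q \<and> verts Q = Irr \<Gamma> \<and>
    (\<forall>\<psi>\<in>Irr \<Gamma>. \<forall>\<psi>'\<in>Irr \<Gamma>.
       of_nat ((if \<psi> = \<psi>' then 2 else 1) * card {e \<in> arcs Q. {tail Q e, head Q e} = {\<psi>, \<psi>'}})
         = char_inner \<Gamma> (\<lambda>g. \<psi> g * gchar \<Gamma> Xstd g) \<psi>')"

definition double_quiver :: "('v, 'e) pre_digraph \<Rightarrow> ('v, 'e \<times> bool) pre_digraph" where
  "double_quiver Q = \<lparr>verts = verts Q, arcs = arcs Q \<times> UNIV,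
     tail = (\<lambda>(e, b). if b then tail Q e else head Q e),
     head = (\<lambda>(e, b). if b then head Q e else tail Q e)\<rparr>"

definition arev :: "'e \<times> bool \<Rightarrow> 'e \<times> bool" where
  "arev = (\<lambda>(e, b). (e, \<not> b))"

definition asign :: "'e \<times> bool \<Rightarrow> complex" where
  "asign = (\<lambda>(e, b). if b then 1 else - 1)"


section \<open>GIT quotients\<close>

subsection \<open>Regular functions and semi-invariants\<close>

inductive_set polyfun :: "('p \<Rightarrow> complex) set \<Rightarrow> ('p \<Rightarrow> complex) set" for G where
  const: "(\<lambda>_. c) \<in> polyfun G"
| gen: "f \<in> G \<Longrightarrow> f \<in> polyfun G"
| add: "f \<in> polyfun G \<Longrightarrow> g \<in> polyfun G \<Longrightarrow> (\<lambda>p. f p + g p) \<in> polyfun G"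
| mult: "f \<in> polyfun G \<Longrightarrow> g \<in> polyfun G \<Longrightarrow> (\<lambda>p. f p * g p) \<in> polyfun G"

text \<open>
  A GIT problem: a vector space \<open>amb\<close> (inside a larger coordinate space with coordinate
  functions \<open>coords\<close>), equations \<open>eqs\<close> for a closed subset, a group with its
  action, and a character.
\<close>

record ('p, 'g) git_problem =
  amb :: "'p set"
  coords :: "('p \<Rightarrow> complex) set"
  eqs :: "('p \<Rightarrow> complex) set"
  grp :: "'g set"
  gop :: "'g \<Rightarrow> 'p \<Rightarrow> 'p"
  gchi :: "'g \<Rightarrow> complex"

definition amb_ring :: "('p, 'g) git_problem \<Rightarrow> ('p \<Rightarrow> complex) ring" where
  "amb_ring D = \<lparr>carrier = (\<lambda>f. restrict f (amb D)) ` polyfun (coords D),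
     mult = (\<lambda>f g. \<lambda>p\<in>amb D. f p * g p), one = (\<lambda>p\<in>amb D. 1),
     zero = (\<lambda>p\<in>amb D. 0), add = (\<lambda>f g. \<lambda>p\<in>amb D. f p + g p)\<rparr>"

definition zero_locus :: "('p, 'g) git_problem \<Rightarrow> 'p set" where
  "zero_locus D = {p \<in> amb D. \<forall>f\<in>eqs D. f p = 0}"

text \<open>The closed subset carries two possible structures: that of a variety (flag \<open>True\<close>), defined
  by the ideal of all functions vanishing on it, and that of a scheme-theoretic fibre (flag
  \<open>False\<close>), defined by the ideal which the equations generate.\<close>

definition defining_ideal :: "bool \<Rightarrow> ('p, 'g) git_problem \<Rightarrow> ('p \<Rightarrow> complex) set" where
  "defining_ideal red D =
    (if red then {f \<in> carrier (amb_ring D). \<forall>p\<in>zero_locus D. f p = 0}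
     else genideal (amb_ring D) ((\<lambda>f. restrict f (amb D)) ` eqs D))"

definition coord_ring :: "bool \<Rightarrow> ('p, 'g) git_problem \<Rightarrow> ('p \<Rightarrow> complex) set ring" where
  "coord_ring red D = amb_ring D Quot defining_ideal red D"

text \<open>Functions \<open>f\<close> on the closed subset with \<open>f (h . y) = (gchi h) ^ m * f y\<close>; the equality is one of
  functions on the closed subset, i.e. modulo its ideal.\<close>

definition semi_invariants ::
  "bool \<Rightarrow> ('p, 'g) git_problem \<Rightarrow> nat \<Rightarrow> ('p \<Rightarrow> complex) set set" where
  "semi_invariants red D m = {c \<in> carrier (coord_ring red D).
     \<forall>f\<in>c. \<forall>h\<in>grp D.
       (\<lambda>y\<in>amb D. f (gop D h y) - gchi D h ^ m * f y) \<in> defining_ideal red D}"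

text \<open>The external direct sum over all degrees \<open>m\<close> of the semi-invariants, as a graded
  subring of the univariate polynomial ring over the coordinate ring: the sequence \<open>a\<close> stands for
  the sum of the \<open>a m * t ^ m\<close>.\<close>

definition semi_inv_ring ::
  "bool \<Rightarrow> ('p, 'g) git_problem \<Rightarrow>
    (('p \<Rightarrow> complex) set, nat \<Rightarrow> ('p \<Rightarrow> complex) set) up_ring" where
  "semi_inv_ring red D = (UP (coord_ring red D))
     \<lparr>carrier := {a \<in> carrier (UP (coord_ring red D)). \<forall>m. a m \<in> semi_invariants red D m}\<rparr>"

definition fun_class :: "bool \<Rightarrow> ('p, 'g) git_problem \<Rightarrow> ('p \<Rightarrow> complex) \<Rightarrow> ('p \<Rightarrow> complex) set" where
  "fun_class red D f = a_r_coset (amb_ring D) (defining_ideal red D) (restrict f (amb D))"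

definition semi_inv_const ::
  "bool \<Rightarrow> ('p, 'g) git_problem \<Rightarrow> complex \<Rightarrow> nat \<Rightarrow> ('p \<Rightarrow> complex) set" where
  "semi_inv_const red D c =
    (\<lambda>n. if n = 0 then fun_class red D (\<lambda>_. c) else \<zero>\<^bsub>coord_ring red D\<^esub>)"


subsection \<open>Ringed spaces over the complex numbers\<close>

record ('x, 's) cspace =
  ctop :: "'x topology"
  sections :: "'x set \<Rightarrow> 's ring"
  cres :: "'x set \<Rightarrow> 'x set \<Rightarrow> 's \<Rightarrow> 's"
  cconst :: "'x set \<Rightarrow> complex \<Rightarrow> 's"

definition cpre :: "('x, 's) cspace \<Rightarrow> ('x \<Rightarrow> 'y) \<Rightarrow> 'y set \<Rightarrow> 'x set" where
  "cpre X f U = {x \<in> topspace (ctop X). f x \<in> U}"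

text \<open>For locally ringed spaces, an isomorphism of ringed spaces is automatically local, hence an
  isomorphism of locally ringed spaces (of schemes).\<close>

definition cspace_iso ::
  "('x, 's) cspace \<Rightarrow> ('y, 't) cspace \<Rightarrow> ('x \<Rightarrow> 'y) \<Rightarrow> ('y set \<Rightarrow> 't \<Rightarrow> 's) \<Rightarrow> bool" where
  "cspace_iso X Y f fs \<longleftrightarrow>
    homeomorphic_map (ctop X) (ctop Y) f \<and>
    (\<forall>U. openin (ctop Y) U \<longrightarrow>
       fs U \<in> ring_iso (sections Y U) (sections X (cpre X f U)) \<and>
       (\<forall>c. fs U (cconst Y U c) = cconst X (cpre X f U) c) \<and>
       (\<forall>V s. openin (ctop Y) V \<and> V \<subseteq> U \<and> s \<in> carrier (sections Y U) \<longrightarrow>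
          fs V (cres Y U V s) = cres X (cpre X f U) (cpre X f V) (fs U s)))"


subsection \<open>Proj of a graded ring\<close>

text \<open>Graded rings are rings of sequences, the \<open>m\<close>-th entry being the component of degree \<open>m\<close>.\<close>

definition homog :: "(nat \<Rightarrow> 'c, 'm) ring_scheme \<Rightarrow> nat \<Rightarrow> (nat \<Rightarrow> 'c) set" where
  "homog A m = {a \<in> carrier A. \<forall>n. n \<noteq> m \<longrightarrow> a n = \<zero>\<^bsub>A\<^esub> n}"

definition hcomp :: "(nat \<Rightarrow> 'c, 'm) ring_scheme \<Rightarrow> nat \<Rightarrow> (nat \<Rightarrow> 'c) \<Rightarrow> nat \<Rightarrow> 'c" where
  "hcomp A m a = (\<lambda>n. if n = m then a n else \<zero>\<^bsub>A\<^esub> n)"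

definition Proj_points :: "(nat \<Rightarrow> 'c, 'm) ring_scheme \<Rightarrow> (nat \<Rightarrow> 'c) set set" where
  "Proj_points A = {P. primeideal P A \<and> (\<forall>a\<in>P. \<forall>m. hcomp A m a \<in> P) \<and>
     \<not> {a \<in> carrier A. a 0 = \<zero>\<^bsub>A\<^esub> 0} \<subseteq> P}"

definition Proj_top :: "(nat \<Rightarrow> 'c, 'm) ring_scheme \<Rightarrow> (nat \<Rightarrow> 'c) set topology" where
  "Proj_top A =
    topology_generated_by {{P \<in> Proj_points A. f \<notin> P} | f. \<exists>m>0. f \<in> homog A m}"

text \<open>The degree zero part of the homogeneous localisation at \<open>P\<close>; \<open>hfrac A P a s\<close> is the fraction
  \<open>a / s\<close>, as the class of all pairs representing it.\<close>

definition hfrac :: "(nat \<Rightarrow> 'c, 'm) ring_scheme \<Rightarrow> (nat \<Rightarrow> 'c) set \<Rightarrow> (nat \<Rightarrow> 'c) \<Rightarrow> (nat \<Rightarrow> 'c)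
    \<Rightarrow> ((nat \<Rightarrow> 'c) \<times> (nat \<Rightarrow> 'c)) set" where
  "hfrac A P a s = {(b, t). (\<exists>n. b \<in> homog A n \<and> t \<in> homog A n) \<and> t \<notin> P \<and>
     (\<exists>k. \<exists>u\<in>homog A k. u \<notin> P \<and> u \<otimes>\<^bsub>A\<^esub> ((a \<otimes>\<^bsub>A\<^esub> t) \<ominus>\<^bsub>A\<^esub> (b \<otimes>\<^bsub>A\<^esub> s)) = \<zero>\<^bsub>A\<^esub>)}"

definition hloc :: "(nat \<Rightarrow> 'c, 'm) ring_scheme \<Rightarrow> (nat \<Rightarrow> 'c) set
    \<Rightarrow> ((nat \<Rightarrow> 'c) \<times> (nat \<Rightarrow> 'c)) set ring" where
  "hloc A P = \<lparr>
     carrier = {hfrac A P a s | a s. (\<exists>n. a \<in> homog A n \<and> s \<in> homog A n) \<and> s \<notin> P},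
     mult = (\<lambda>S T. \<Union>(a, s)\<in>S. \<Union>(b, t)\<in>T. hfrac A P (a \<otimes>\<^bsub>A\<^esub> b) (s \<otimes>\<^bsub>A\<^esub> t)),
     one = hfrac A P \<one>\<^bsub>A\<^esub> \<one>\<^bsub>A\<^esub>,
     zero = hfrac A P \<zero>\<^bsub>A\<^esub> \<one>\<^bsub>A\<^esub>,
     add = (\<lambda>S T. \<Union>(a, s)\<in>S. \<Union>(b, t)\<in>T.
              hfrac A P ((a \<otimes>\<^bsub>A\<^esub> t) \<oplus>\<^bsub>A\<^esub> (b \<otimes>\<^bsub>A\<^esub> s)) (s \<otimes>\<^bsub>A\<^esub> t))\<rparr>"

text \<open>Sections over \<open>U\<close>: functions into the stalks which are locally fractions.\<close>

definition Proj_sections :: "(nat \<Rightarrow> 'c, 'm) ring_scheme \<Rightarrow> (nat \<Rightarrow> 'c) set set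
    \<Rightarrow> ((nat \<Rightarrow> 'c) set \<Rightarrow> ((nat \<Rightarrow> 'c) \<times> (nat \<Rightarrow> 'c)) set) ring" where
  "Proj_sections A U = \<lparr>
     carrier = {\<sigma> \<in> Pi\<^sub>E U (\<lambda>P. carrier (hloc A P)).
        \<forall>P\<in>U. \<exists>V a s n. openin (Proj_top A) V \<and> P \<in> V \<and> V \<subseteq> U \<and>
          a \<in> homog A n \<and> s \<in> homog A n \<and> (\<forall>P'\<in>V. s \<notin> P' \<and> \<sigma> P' = hfrac A P' a s)},
     mult = (\<lambda>\<sigma> \<tau>. \<lambda>P\<in>U. \<sigma> P \<otimes>\<^bsub>hloc A P\<^esub> \<tau> P),
     one = (\<lambda>P\<in>U. \<one>\<^bsub>hloc A P\<^esub>),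
     zero = (\<lambda>P\<in>U. \<zero>\<^bsub>hloc A P\<^esub>),
     add = (\<lambda>\<sigma> \<tau>. \<lambda>P\<in>U. \<sigma> P \<oplus>\<^bsub>hloc A P\<^esub> \<tau> P)\<rparr>"

text \<open>\<open>\<kappa>\<close> is the structure map from the complex numbers to the graded ring.\<close>

definition Proj :: "(nat \<Rightarrow> 'c, 'm) ring_scheme \<Rightarrow> (complex \<Rightarrow> nat \<Rightarrow> 'c) \<Rightarrow>
    ((nat \<Rightarrow> 'c) set, (nat \<Rightarrow> 'c) set \<Rightarrow> ((nat \<Rightarrow> 'c) \<times> (nat \<Rightarrow> 'c)) set) cspace" where
  "Proj A \<kappa> = \<lparr>ctop = Proj_top A, sections = Proj_sections A,
     cres = (\<lambda>U V \<sigma>. restrict \<sigma> V),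
     cconst = (\<lambda>U c. \<lambda>P\<in>U. hfrac A P (\<kappa> c) \<one>\<^bsub>A\<^esub>)\<rparr>"

text \<open>The morphism from \<open>Proj A\<close> to \<open>Proj B\<close> induced by a graded ring homomorphism
  \<open>\<phi>\<close> from \<open>B\<close> to \<open>A\<close>: on points, and on sections over \<open>U\<close>.\<close>

definition Proj_map ::
  "(nat \<Rightarrow> 'd, 'n) ring_scheme \<Rightarrow> ((nat \<Rightarrow> 'd) \<Rightarrow> nat \<Rightarrow> 'c) \<Rightarrow> (nat \<Rightarrow> 'c) set \<Rightarrow> (nat \<Rightarrow> 'd) set"
  where
  "Proj_map B \<phi> P = {b \<in> carrier B. \<phi> b \<in> P}"

definition Proj_comorphism ::
  "(nat \<Rightarrow> 'c, 'm) ring_scheme \<Rightarrow> (nat \<Rightarrow> 'd, 'n) ring_scheme \<Rightarrow> ((nat \<Rightarrow> 'd) \<Rightarrow> nat \<Rightarrow> 'c)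
    \<Rightarrow> (nat \<Rightarrow> 'd) set set
    \<Rightarrow> ((nat \<Rightarrow> 'd) set \<Rightarrow> ((nat \<Rightarrow> 'd) \<times> (nat \<Rightarrow> 'd)) set)
    \<Rightarrow> (nat \<Rightarrow> 'c) set \<Rightarrow> ((nat \<Rightarrow> 'c) \<times> (nat \<Rightarrow> 'c)) set" where
  "Proj_comorphism A B \<phi> U \<sigma> =
    (\<lambda>P\<in>{P \<in> topspace (Proj_top A). Proj_map B \<phi> P \<in> U}.
       \<Union>(b, t)\<in>\<sigma> (Proj_map B \<phi> P). hfrac A P (\<phi> b) (\<phi> t))"

definition git_quotient where
  "git_quotient red D = Proj (semi_inv_ring red D) (semi_inv_const red D)"

subsection \<open>Isomorphisms of GIT quotients induced by a map\<close>

text \<open>The pullback of semi-invariants along \<open>F\<close>, from the problem \<open>D'\<close> to the problem \<open>D\<close>.\<close>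

definition pullback ::
  "bool \<Rightarrow> ('p, 'g) git_problem \<Rightarrow> ('p \<Rightarrow> 'q) \<Rightarrow>
    (nat \<Rightarrow> ('q \<Rightarrow> complex) set) \<Rightarrow> nat \<Rightarrow> ('p \<Rightarrow> complex) set" where
  "pullback red D F a = (\<lambda>m. \<Union>f\<in>a m. fun_class red D (\<lambda>p. f (F p)))"

text \<open>\<open>F\<close> restricts to a morphism between the closed subsets, its pullback is a homomorphism of
  the graded rings of semi-invariants, and the induced morphism between the
  quotients is defined everywhere and an isomorphism.\<close>

definition induces_git_iso ::
  "bool \<Rightarrow> ('p, 'g) git_problem \<Rightarrow> ('q, 'h) git_problem \<Rightarrow> ('p \<Rightarrow> 'q) \<Rightarrow> bool" where
  "induces_git_iso red D D' F \<longleftrightarrow>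
    F ` amb D \<subseteq> amb D' \<and>
    F ` zero_locus D \<subseteq> zero_locus D' \<and>
    (\<forall>f\<in>carrier (amb_ring D'). (\<lambda>p\<in>amb D. f (F p)) \<in> carrier (amb_ring D)) \<and>
    (\<forall>f\<in>defining_ideal red D'. (\<lambda>p\<in>amb D. f (F p)) \<in> defining_ideal red D) \<and>
    pullback red D F \<in> ring_hom (semi_inv_ring red D') (semi_inv_ring red D) \<and>
    cspace_iso (git_quotient red D) (git_quotient red D')
      (Proj_map (semi_inv_ring red D') (pullback red D F))
      (Proj_comorphism (semi_inv_ring red D) (semi_inv_ring red D') (pullback red D F))"


section \<open>Nakajima's quiver variety\<close>

type_synonym 'e nak_point =
  "('e \<times> bool \<Rightarrow> (nat, nat) cmat) \<times> (chr \<Rightarrow> (nat, nat) cmat) \<times> (chr \<Rightarrow> (nat, nat) cmat)"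

definition nak_space ::
  "(chr, 'e) pre_digraph \<Rightarrow> (chr \<Rightarrow> nat) \<Rightarrow> (chr \<Rightarrow> nat) \<Rightarrow> 'e nak_point set" where
  "nak_space Q d df = {(x, v1, v2).
     (\<forall>h\<in>arcs (double_quiver Q).
        x h \<in> mats {..<d (head (double_quiver Q) h)} {..<d (tail (double_quiver Q) h)}) \<and>
     (\<forall>h. h \<notin> arcs (double_quiver Q) \<longrightarrow> x h = 0) \<and>
     (\<forall>\<psi>\<in>verts Q. v1 \<psi> \<in> mats {..<d \<psi>} {..<df \<psi>} \<and> v2 \<psi> \<in> mats {..<df \<psi>} {..<d \<psi>}) \<and>
     (\<forall>\<psi>. \<psi> \<notin> verts Q \<longrightarrow> v1 \<psi> = 0 \<and> v2 \<psi> = 0)}"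

definition nak_coords :: "('e nak_point \<Rightarrow> complex) set" where
  "nak_coords = range (\<lambda>(h, ij). \<lambda>(x, v1, v2). x h ij)
     \<union> range (\<lambda>(\<psi>, ij). \<lambda>(x, v1, v2). v1 \<psi> ij)
     \<union> range (\<lambda>(\<psi>, ij). \<lambda>(x, v1, v2). v2 \<psi> ij)"

definition nak_group :: "(chr, 'e) pre_digraph \<Rightarrow> (chr \<Rightarrow> nat) \<Rightarrow> (chr \<Rightarrow> (nat, nat) cmat) set" where
  "nak_group Q d = {g. (\<forall>\<psi>\<in>verts Q. g \<psi> \<in> mGL {..<d \<psi>}) \<and> (\<forall>\<psi>. \<psi> \<notin> verts Q \<longrightarrow> g \<psi> = 0)}"

definition nak_action ::
  "(chr, 'e) pre_digraph \<Rightarrow> (chr \<Rightarrow> nat) \<Rightarrow> (chr \<Rightarrow> (nat, nat) cmat) \<Rightarrow> 'e nak_point \<Rightarrow> 'e nak_point"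
  where
  "nak_action Q d g = (\<lambda>(x, v1, v2).
     (\<lambda>h. let s = tail (double_quiver Q) h; t = head (double_quiver Q) h in
        mmul {..<d t} (g t) (mmul {..<d s} (x h) (minv {..<d s} (g s))),
      \<lambda>\<psi>. mmul {..<d \<psi>} (g \<psi>) (v1 \<psi>),
      \<lambda>\<psi>. mmul {..<d \<psi>} (v2 \<psi>) (minv {..<d \<psi>} (g \<psi>))))"

definition nak_moment ::
  "(chr, 'e) pre_digraph \<Rightarrow> (chr \<Rightarrow> nat) \<Rightarrow> (chr \<Rightarrow> nat) \<Rightarrow> 'e nak_point \<Rightarrow> chr \<Rightarrow> (nat, nat) cmat" where
  "nak_moment Q d df = (\<lambda>(x, v1, v2) \<psi>.
     (\<Sum>h | h \<in> arcs (double_quiver Q) \<and> head (double_quiver Q) h = \<psi>.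
        cscale (asign h) (mmul {..<d (tail (double_quiver Q) h)} (x h) (x (arev h))))
     + mmul {..<df \<psi>} (v1 \<psi>) (v2 \<psi>))"

definition nak_character ::
  "(chr, 'e) pre_digraph \<Rightarrow> (chr \<Rightarrow> nat) \<Rightarrow> (chr \<Rightarrow> int) \<Rightarrow> (chr \<Rightarrow> (nat, nat) cmat) \<Rightarrow> complex" where
  "nak_character Q d \<theta> g = (\<Prod>\<psi>\<in>verts Q. mdet {..<d \<psi>} (g \<psi>) powi \<theta> \<psi>)"

definition nakajima_problem ::
  "(chr, 'e) pre_digraph \<Rightarrow> (chr \<Rightarrow> complex) \<Rightarrow> (chr \<Rightarrow> int) \<Rightarrow> (chr \<Rightarrow> nat) \<Rightarrow> (chr \<Rightarrow> nat)
    \<Rightarrow> ('e nak_point, chr \<Rightarrow> (nat, nat) cmat) git_problem" where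
  "nakajima_problem Q lam \<theta> d df = \<lparr>
     amb = nak_space Q d df,
     coords = nak_coords,
     eqs = {\<lambda>p. nak_moment Q d df p \<psi> ij - cscale (lam \<psi>) (mone {..<d \<psi>}) ij | \<psi> ij. \<psi> \<in> verts Q},
     grp = nak_group Q d,
     gop = nak_action Q d,
     gchi = nak_character Q d \<theta>\<rparr>"


section \<open>The analogue for modules\<close>

type_synonym ('i, 'j) gm_point = "('i, 2 \<times> 'i) cmat \<times> ('i, 'j) cmat \<times> ('j, 'i) cmat"

definition gm_space :: "mat2 set \<Rightarrow> 'i gmodule \<Rightarrow> 'j gmodule \<Rightarrow> ('i, 'j) gm_point set" where
  "gm_space \<Gamma> M Mf = ghom \<Gamma> (gtensor Xstd M) M \<times> ghom \<Gamma> Mf M \<times> ghom \<Gamma> M Mf"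

definition gm_coords :: "(('i, 'j) gm_point \<Rightarrow> complex) set" where
  "gm_coords = range (\<lambda>k. \<lambda>(\<Delta>, Z1, Z2). \<Delta> k) \<union> range (\<lambda>k. \<lambda>(\<Delta>, Z1, Z2). Z1 k)
     \<union> range (\<lambda>k. \<lambda>(\<Delta>, Z1, Z2). Z2 k)"

definition gm_action ::
  "'i gmodule \<Rightarrow> ('i, 'i) cmat \<Rightarrow> ('i, 'j) gm_point \<Rightarrow> ('i, 'j) gm_point" where
  "gm_action M g = (\<lambda>(\<Delta>, Z1, Z2).
     (mmul (gidx M) g (mmul (UNIV \<times> gidx M) \<Delta> (kron (mone UNIV) (minv (gidx M) g))),
      mmul (gidx M) g Z1,
      mmul (gidx M) Z2 (minv (gidx M) g)))"

definition gm_moment :: "'i gmodule \<Rightarrow> 'j gmodule \<Rightarrow> ('i, 'j) gm_point \<Rightarrow> ('i, 'i) cmat" where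
  "gm_moment M Mf = (\<lambda>(\<Delta>, Z1, Z2).
     mmul (gidx M) (bcol 1 \<Delta>) (bcol 2 \<Delta>) - mmul (gidx M) (bcol 2 \<Delta>) (bcol 1 \<Delta>)
     + mmul (gidx Mf) Z1 Z2)"

definition gm_lambda ::
  "mat2 set \<Rightarrow> (chr \<Rightarrow> nat gmodule) \<Rightarrow> 'i gmodule \<Rightarrow> (chr \<Rightarrow> complex) \<Rightarrow> ('i, 'i) cmat" where
  "gm_lambda \<Gamma> X M lam = (THE L. L \<in> ghom \<Gamma> M M \<and>
     (\<forall>\<psi>\<in>Irr \<Gamma>. \<forall>v\<in>isotypic \<Gamma> (X \<psi>) M.
        mvec (gidx M) L v = cscale (lam \<psi> / of_nat (gdim (X \<psi>))) v))"

definition gm_character ::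
  "mat2 set \<Rightarrow> (chr \<Rightarrow> nat gmodule) \<Rightarrow> 'i gmodule \<Rightarrow> (chr \<Rightarrow> int) \<Rightarrow> ('i, 'i) cmat \<Rightarrow> complex" where
  "gm_character \<Gamma> X M \<theta> g =
    (\<Prod>\<psi>\<in>Irr \<Gamma>. endo_det (ghom \<Gamma> (X \<psi>) M) (\<lambda>\<phi>. mmul (gidx M) g \<phi>) powi \<theta> \<psi>)"

definition gmodule_problem ::
  "mat2 set \<Rightarrow> (chr \<Rightarrow> nat gmodule) \<Rightarrow> (chr \<Rightarrow> complex) \<Rightarrow> (chr \<Rightarrow> int) \<Rightarrow> 'i gmodule \<Rightarrow> 'j gmodule
    \<Rightarrow> (('i, 'j) gm_point, ('i, 'i) cmat) git_problem" where
  "gmodule_problem \<Gamma> X lam \<theta> M Mf = \<lparr>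
     amb = gm_space \<Gamma> M Mf,
     coords = gm_coords,
     eqs = range (\<lambda>ij p. gm_moment M Mf p ij - gm_lambda \<Gamma> X M lam ij),
     grp = gaut \<Gamma> M,
     gop = gm_action M,
     gchi = gm_character \<Gamma> X M \<theta>\<rparr>"


section \<open>The functor\<close>

text \<open>For the group of order two,
  the two edges may be numbered in either order.\<close>

definition mu2 :: "mat2 set" where
  "mu2 = {mat 1, - mat 1}"

definition arrow_maps ::
  "mat2 set \<Rightarrow> (chr \<Rightarrow> nat gmodule) \<Rightarrow> (chr, 'e) pre_digraph
    \<Rightarrow> ('e \<times> bool \<Rightarrow> (nat, 2 \<times> nat) cmat) \<Rightarrow> bool" where
  "arrow_maps \<Gamma> X Q y0 \<longleftrightarrow>
    (if \<Gamma> \<noteq> mu2 then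
       \<forall>h\<in>arcs (double_quiver Q).
         y0 h \<in> ghom \<Gamma> (gtensor Xstd (X (tail (double_quiver Q) h))) (X (head (double_quiver Q) h))
         \<and> y0 h \<noteq> 0
     else
       \<exists>h1 h2 h3 h4 \<psi>0 \<psi>1.
         \<psi>0 = (\<lambda>g\<in>\<Gamma>. 1) \<and> \<psi>1 \<noteq> \<psi>0 \<and>
         distinct [h1, h2, h3, h4] \<and> arcs (double_quiver Q) = {h1, h2, h3, h4} \<and>
         (\<forall>h\<in>{h1, h2}. tail (double_quiver Q) h = \<psi>0 \<and> head (double_quiver Q) h = \<psi>1) \<and>
         (\<forall>h\<in>{h3, h4}. tail (double_quiver Q) h = \<psi>1 \<and> head (double_quiver Q) h = \<psi>0) \<and>
         arev h1 = h4 \<and> arev h3 = h2 \<and>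
         (\<forall>h\<in>{h1, h3}. y0 h = (\<lambda>(i, (k, j)). if i = 0 \<and> k = 1 \<and> j = 0 then 1 else 0)) \<and>
         (\<forall>h\<in>{h2, h4}. y0 h = (\<lambda>(i, (k, j)). if i = 0 \<and> k = 2 \<and> j = 0 then 1 else 0)))"

definition normalised_arrow_maps ::
  "(chr \<Rightarrow> nat gmodule) \<Rightarrow> (chr, 'e) pre_digraph \<Rightarrow> ('e \<times> bool \<Rightarrow> (nat, 2 \<times> nat) cmat) \<Rightarrow> bool" where
  "normalised_arrow_maps X Q y \<longleftrightarrow>
    (\<forall>h\<in>arcs (double_quiver Q).
       let s = gidx (X (tail (double_quiver Q) h)); t = gidx (X (head (double_quiver Q) h)) in
       mtrace s (mmul t (bcol 1 (y (arev h))) (bcol 2 (y h))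
               - mmul t (bcol 2 (y (arev h))) (bcol 1 (y h))) = asign (arev h))"

text \<open>The triple \<open>(\<psi>, i, j)\<close> indexes the tensor product of the \<open>i\<close>-th basis vector of \<open>V\<^sub>\<psi>\<close> with the
  \<open>j\<close>-th basis vector of \<open>X \<psi>\<close>.\<close>

definition F_module ::
  "mat2 set \<Rightarrow> (chr \<Rightarrow> nat gmodule) \<Rightarrow> (chr \<Rightarrow> nat) \<Rightarrow> (chr \<times> nat \<times> nat) gmodule" where
  "F_module \<Gamma> X d = \<lparr>
     gidx = (SIGMA \<psi> : Irr \<Gamma>. {..<d \<psi>} \<times> gidx (X \<psi>)),
     gact = (\<lambda>g. \<lambda>((\<psi>, i, j), (\<psi>', i', j')).
        if \<psi> \<in> Irr \<Gamma> \<and> \<psi> = \<psi>' then mone {..<d \<psi>} (i, i') * gact (X \<psi>) g (j, j') else 0)\<rparr>"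

definition F_map ::
  "mat2 set \<Rightarrow> (chr \<Rightarrow> nat gmodule) \<Rightarrow> (chr, 'e) pre_digraph
    \<Rightarrow> ('e \<times> bool \<Rightarrow> (nat, 2 \<times> nat) cmat)
    \<Rightarrow> 'e nak_point \<Rightarrow> (chr \<times> nat \<times> nat, chr \<times> nat \<times> nat) gm_point" where
  "F_map \<Gamma> X Q y = (\<lambda>(x, v1, v2).
     (\<lambda>((\<psi>', i', j'), (k, (\<psi>, i, j))).
        \<Sum>h | h \<in> arcs (double_quiver Q) \<and>
             tail (double_quiver Q) h = \<psi> \<and> head (double_quiver Q) h = \<psi>'.
          x h (i', i) * y h (j', (k, j)),
      \<lambda>((\<psi>', i', j'), (\<psi>, i, j)).
        if \<psi> \<in> Irr \<Gamma> \<and> \<psi> = \<psi>'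
        then v1 \<psi> (i', i) * (1 / of_nat (gdim (X \<psi>)) * mone (gidx (X \<psi>)) (j', j)) else 0,
      \<lambda>((\<psi>', i', j'), (\<psi>, i, j)).
        if \<psi> \<in> Irr \<Gamma> \<and> \<psi> = \<psi>'
        then v2 \<psi> (i', i) * mone (gidx (X \<psi>)) (j', j) else 0))"

end

theory Submission
  imports Defs "HOL-Computational_Algebra.Fundamental_Theorem_Algebra"
begin

text \<open>
  By Schur's lemma, homomorphisms between \<open>F(V)\<close> and \<open>F(V')\<close> are the block matrices with blocks
  \<open>a\<^sub>\<chi> \<otimes> id\<close>. The maps \<open>y\<^sub>h\<close> for the arrows \<open>h\<close> from \<open>\<chi>\<close> to \<open>\<chi>'\<close> form a basis of the homomorphisms
  from \<open>X\<^sub>s\<^sub>t\<^sub>d \<otimes> X\<^sub>\<chi>\<close> to \<open>X\<^sub>\<chi>\<^sub>'\<close>: their number is the dimension of that space, and multiplicities above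
  one occur only for the trivial group and the group of order two, which are treated by hand. Hence
  \<open>F\<close> is a linear isomorphism of representation spaces, equivariant along \<open>g \<mapsto> g \<otimes> id\<close>, an isomorphism
  of groups that matches the two characters. Again by Schur's lemma, the trace normalisation makes
  the antisymmetrised composite of \<open>y\<^sub>h\<close> and \<open>y\<^sub>k\<close> equal to \<open>\<epsilon>(h) / \<delta>\<^sub>\<chi>\<close> times the identity if \<open>k\<close> is
  the reverse of \<open>h\<close>, and zero otherwise; so the moment maps correspond up to the factors \<open>1 / \<delta>\<^sub>\<chi>\<close>,
  and these also relate the two versions of \<open>\<lambda>\<close>. Pulling back functions therefore identifies the
  graded rings of semi-invariants, and with them their Proj.
\<close>

section \<open>Linear algebra on coordinate spaces\<close>

text \<open>Being a basis is the delicate point about the \<open>y h\<close>. A dimension count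
  needs them to be independent, and for the trivial group nothing but nonvanishing is prescribed for
  the map of a loop and that of its reverse; there the trace normalisation itself is the determinant
  that separates them. Parallel arrows are confined to subgroups of {1, -1} without any
  classification of the finite groups. The only input is that traces have absolute value at most 2,
  and this constant comes from tr(g^2) = tr(g)^2 - 2, applied to an element of largest absolute
  trace. The flag \<open>red\<close> covers the variety as well as the scheme-theoretic fibre. For
  the latter a bijection of zero loci says too little, so every equation is shown to pull back to a
  scalar multiple of an equation, and conversely. For an abstract GIT problem the ideal need not be
  stable under the group, so the semi-invariants need not form a ring. This is why ring axioms are
  transported and carried along instead of being proved.\<close>

lemma matsI: "(\<And>i j. i \<notin> I \<or> j \<notin> J \<Longrightarrow> A (i, j) = 0) \<Longrightarrow> A \<in> mats I J"
  by (auto simp: mats_def vecs_def)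

lemma matsD: "A \<in> mats I J \<Longrightarrow> i \<notin> I \<or> j \<notin> J \<Longrightarrow> A (i, j) = 0"
  by (auto simp: mats_def vecs_def)

lemma mats_eqI:
  assumes "A \<in> mats I J" "B \<in> mats I J" "\<And>i j. i \<in> I \<Longrightarrow> j \<in> J \<Longrightarrow> A (i, j) = B (i, j)"
  shows "A = B"
proof
  fix x show "A x = B x" using assms by (cases x) (metis matsD)
qed

lemma mmul_apply: "mmul J A B (i, k) = (\<Sum>j\<in>J. A (i, j) * B (j, k))"
  by (simp add: mmul_def)

lemma mmul_assoc: "mmul K (mmul J A B) C = mmul J A (mmul K B C)"
proof
  fix x
  show "mmul K (mmul J A B) C x = mmul J A (mmul K B C) x"
    by (cases x) (simp add: mmul_apply sum_distrib_left sum_distrib_right mult.assoc sum.swap[of _ K])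
qed

lemma mmul_mats: "A \<in> mats I J \<Longrightarrow> B \<in> mats J K \<Longrightarrow> mmul J A B \<in> mats I K"
  by (intro matsI) (auto simp: mmul_apply matsD)

lemma mone_apply: "mone I (i, j) = (if i \<in> I \<and> i = j then 1 else 0)"
  by (simp add: mone_def)

lemma mone_mats: "mone I \<in> mats I I"
  by (intro matsI) (auto simp: mone_apply)

lemma mmul_mone_left: assumes "finite I" "A \<in> mats I J" shows "mmul I (mone I) A = A"
proof (rule mats_eqI)
  show "mmul I (mone I) A \<in> mats I J" using mone_mats assms mmul_mats by blast
qed (use assms in \<open>auto simp: mmul_apply mone_apply mult_delta_left mult_delta_right cong: if_cong\<close>)

lemma mmul_mone_right: assumes "finite J" "A \<in> mats I J" shows "mmul J A (mone J) = A"
proof (rule mats_eqI)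
  show "mmul J A (mone J) \<in> mats I J" using mone_mats assms mmul_mats by blast
qed (use assms in \<open>auto simp: mmul_apply mone_apply mult_delta_left mult_delta_right cong: if_cong\<close>)

lemma cscale_apply: "cscale c v i = c * v i"
  by (simp add: cscale_def)

lemma mmul_linear:
  "mmul J (A + A') B = mmul J A B + mmul J A' B" "mmul J A (B + B') = mmul J A B + mmul J A B'"
  "mmul J (A - A') B = mmul J A B - mmul J A' B" "mmul J A (B - B') = mmul J A B - mmul J A B'"
  "mmul J (cscale c A) B = cscale c (mmul J A B)" "mmul J A (cscale c B) = cscale c (mmul J A B)"
  by (auto simp: mmul_def cscale_def fun_eq_iff algebra_simps sum.distrib sum_subtractf sum_distrib_left)

lemma mmul_zero: "mmul J 0 B = 0" "mmul J A 0 = 0"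
  by (auto simp: mmul_def fun_eq_iff)

lemma mmul_sum_left: "mmul J (\<Sum>s\<in>S. A s) B = (\<Sum>s\<in>S. mmul J (A s) B)"
  by (induction S rule: infinite_finite_induct) (simp_all only: sum.infinite sum.empty sum.insert mmul_linear mmul_zero not_False_eq_True)

lemma mmul_sum_right: "mmul J A (\<Sum>s\<in>S. B s) = (\<Sum>s\<in>S. mmul J A (B s))"
  by (induction S rule: infinite_finite_induct) (simp_all only: sum.infinite sum.empty sum.insert mmul_linear mmul_zero not_False_eq_True)

lemmas mmul_sum = mmul_sum_left mmul_sum_right

lemma sum_apply: "(\<Sum>s\<in>S. f s) x = (\<Sum>s\<in>S. f s x :: 'a :: comm_monoid_add)"
  by (induction S rule: infinite_finite_induct) auto

lemma mats_linear:
  "A \<in> mats I J \<Longrightarrow> B \<in> mats I J \<Longrightarrow> A + B \<in> mats I J"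
  "A \<in> mats I J \<Longrightarrow> B \<in> mats I J \<Longrightarrow> A - B \<in> mats I J"
  "A \<in> mats I J \<Longrightarrow> cscale c A \<in> mats I J" "0 \<in> mats I J"
  by (auto simp: mats_def vecs_def cscale_def)

lemma mats_sum: "(\<And>s. s \<in> S \<Longrightarrow> A s \<in> mats I J) \<Longrightarrow> (\<Sum>s\<in>S. A s) \<in> mats I J"
  by (induction S rule: infinite_finite_induct) (auto simp: mats_linear)

lemma mtrace_mmul_commute: "mtrace I (mmul J A B) = mtrace J (mmul I B A)"
  unfolding mtrace_def mmul_apply by (subst sum.swap) (simp add: mult.commute)

lemma mtrace_linear: "mtrace I (A - B) = mtrace I A - mtrace I B" "mtrace I (cscale c A) = c * mtrace I A"
  by (auto simp: mtrace_def cscale_def sum_subtractf sum_distrib_left)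

lemma mtrace_mone: "finite I \<Longrightarrow> mtrace I (mone I) = of_nat (card I)"
  by (simp add: mtrace_def mone_apply)

lemma mvec_mvec: "mvec J A (mvec K B v) = mvec K (mmul J A B) v"
  by (auto simp: mvec_def mmul_apply sum_distrib_left sum_distrib_right mult.assoc sum.swap[of _ K] fun_eq_iff)

lemma mvec_vecs: "A \<in> mats I J \<Longrightarrow> mvec J A v \<in> vecs I"
  by (auto simp: mvec_def vecs_def matsD)

lemma mvec_linear: "mvec J A (u + v) = mvec J A u + mvec J A v" "mvec J A (u - v) = mvec J A u - mvec J A v"
  "mvec J A (cscale c v) = cscale c (mvec J A v)" "mvec J A 0 = 0"
  by (auto simp: mvec_def cscale_def fun_eq_iff algebra_simps sum.distrib sum_subtractf sum_distrib_left)

lemma mvec_mlinear: "mvec J (A + B) v = mvec J A v + mvec J B v" "mvec J (A - B) v = mvec J A v - mvec J B v"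
  "mvec J (cscale c A) v = cscale c (mvec J A v)"
  by (auto simp: mvec_def cscale_def fun_eq_iff algebra_simps sum.distrib sum_subtractf sum_distrib_left)

lemma mvec_sum: "mvec J A (\<Sum>s\<in>S. f s) = (\<Sum>s\<in>S. mvec J A (f s))"
  by (induction S rule: infinite_finite_induct) (simp_all only: sum.infinite sum.empty sum.insert mvec_linear not_False_eq_True)

lemma mvec_mone: assumes "finite I" "v \<in> vecs I" shows "mvec I (mone I) v = v"
proof
  fix k show "mvec I (mone I) v k = v k"
    using assms by (cases "k \<in> I") (auto simp: mvec_def mone_apply vecs_def mult_delta_left)
qed

section \<open>Standard basis vectors, bases of subspaces, invertibility and eigenvectors\<close>

definition ue :: "'i \<Rightarrow> 'i \<Rightarrow> complex" where "ue i = (\<lambda>k. if k = i then 1 else 0)"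

lemma ue_vecs: "i \<in> I \<Longrightarrow> ue i \<in> vecs I"
  by (auto simp: ue_def vecs_def)

lemma mvec_ue: "finite J \<Longrightarrow> j \<in> J \<Longrightarrow> mvec J A (ue j) = (\<lambda>i. A (i, j))"
  by (auto simp: mvec_def ue_def fun_eq_iff mult_delta_left mult_delta_right cong: if_cong)

lemma vecs_expand: assumes "finite I" "v \<in> vecs I" shows "v = (\<Sum>i\<in>I. cscale (v i) (ue i))"
proof
  fix k show "v k = (\<Sum>i\<in>I. cscale (v i) (ue i)) k"
    using assms by (auto simp: sum_apply cscale_def ue_def vecs_def mult_delta_left mult_delta_right cong: if_cong)
qed

lemma mat_eqI:
  assumes "A \<in> mats I J" "B \<in> mats I J" "finite J" "\<And>v. v \<in> vecs J \<Longrightarrow> mvec J A v = mvec J B v"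
  shows "A = B"
proof (rule mats_eqI[OF assms(1,2)])
  fix i j assume "j \<in> J"
  then show "A (i, j) = B (i, j)"
    using assms(4)[OF ue_vecs] mvec_ue[OF assms(3)] by (metis (no_types, lifting))
qed

lemma subspace_vecs: "cfun.subspace (vecs I)"
  by (auto simp: cfun.subspace_def vecs_def cscale_def)

lemma span_ue: assumes "finite I" shows "cfun.span (ue ` I) = vecs I"
proof
  show "cfun.span (ue ` I) \<subseteq> vecs I"
    by (rule cfun.span_minimal) (auto simp: subspace_vecs ue_vecs)
  show "vecs I \<subseteq> cfun.span (ue ` I)"
  proof
    fix v :: "'a \<Rightarrow> complex" assume v: "v \<in> vecs I"
    have "(\<Sum>i\<in>I. cscale (v i) (ue i)) \<in> cfun.span (ue ` I)"
      by (intro cfun.span_sum cfun.span_scale cfun.span_base) auto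
    then show "v \<in> cfun.span (ue ` I)" using vecs_expand[OF assms v] by simp
  qed
qed

lemma independent_vecs_bound:
  assumes "finite I" "cfun.independent S" "S \<subseteq> vecs I"
  shows "finite S \<and> card S \<le> card I"
proof -
  have "finite S \<and> card S \<le> card (ue ` I)"
    using assms by (intro cfun.independent_span_bound) (auto simp: span_ue)
  then show ?thesis using card_image_le[OF assms(1), of ue] by linarith
qed

lemma subspace_basis:
  assumes "finite I" "cfun.subspace W" "W \<subseteq> vecs I"
  obtains B where "finite B" "B \<subseteq> W" "cfun.independent B" "cfun.span B = W"
proof -
  obtain B where B: "B \<subseteq> W" "cfun.independent B" "W \<subseteq> cfun.span B"
    using cfun.maximal_independent_subset[of W] by blast
  moreover have "cfun.span B \<subseteq> W" using B(1) assms(2) by (rule cfun.span_minimal)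
  moreover have "finite B" using independent_vecs_bound[OF assms(1) B(2)] B(1) assms(3) by blast
  ultimately show thesis using that by blast
qed

text \<open>Otherwise a vector of \<open>W\<close> outside the span could be added to
  \<open>Y\<close>, giving an independent set larger than the spanning set \<open>B\<close>.\<close>

lemma independent_card_span:
  assumes "finite B" "cfun.span B = W" "finite Y" "Y \<subseteq> W" "cfun.independent Y" "card B \<le> card Y"
  shows "cfun.span Y = W"
proof
  show "cfun.span Y \<subseteq> W" using assms cfun.span_minimal cfun.subspace_span by metis
  show "W \<subseteq> cfun.span Y"
  proof
    fix v assume v: "v \<in> W"
    show "v \<in> cfun.span Y"
    proof (rule ccontr)
      assume nv: "v \<notin> cfun.span Y"
      then have "cfun.independent (insert v Y)" using assms(5) cfun.independent_insertI by blast
      then have "card (insert v Y) \<le> card B"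
        using cfun.independent_span_bound[of B "insert v Y"] assms v by auto
      moreover have "v \<notin> Y" using nv cfun.span_base by blast
      ultimately show False using assms by simp
    qed
  qed
qed

text \<open>Preimages of the unit vectors are the columns of a right inverse. It is also a left
  inverse because \<open>A\<close> sends \<open>B A v - v\<close> to zero and is injective.
  Different index sets are allowed since Schur's lemma compares two modules.\<close>

lemma inverse_matrixI:
  assumes A: "A \<in> mats I J" and fin: "finite I" "finite J"
    and inj: "\<And>v. v \<in> vecs J \<Longrightarrow> mvec J A v = 0 \<Longrightarrow> v = 0"
    and surj: "\<And>w. w \<in> vecs I \<Longrightarrow> \<exists>v\<in>vecs J. mvec J A v = w"
  obtains B where "B \<in> mats J I" "mmul J A B = mone I" "mmul I B A = mone J"
proof -
  have "\<exists>v\<in>vecs J. mvec J A v = ue i" if "i \<in> I" for i by (rule surj[OF ue_vecs[OF that]])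
  then obtain b where b: "\<And>i. i \<in> I \<Longrightarrow> b i \<in> vecs J \<and> mvec J A (b i) = ue i" by metis
  define B where "B = (\<lambda>(j, i). if i \<in> I then b i j else 0)"
  have B: "B \<in> mats J I" using b by (intro matsI) (auto simp: B_def vecs_def)
  have AB: "mmul J A B = mone I"
  proof (rule mats_eqI[OF mmul_mats[OF A B] mone_mats])
    fix i k assume "i \<in> I" "k \<in> I"
    then have "mmul J A B (i, k) = mvec J A (b k) i" by (simp add: mmul_apply mvec_def B_def)
    then show "mmul J A B (i, k) = mone I (i, k)" using b \<open>i \<in> I\<close> \<open>k \<in> I\<close> by (auto simp: ue_def mone_apply)
  qed
  have "mmul I B A = mone J"
  proof (rule mat_eqI[OF mmul_mats[OF B A] mone_mats fin(2)])
    fix v :: "'b \<Rightarrow> complex" assume v: "v \<in> vecs J"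
    have "mvec J A (mvec J (mmul I B A) v - v) = 0"
      using mmul_mone_left[OF fin(1) A] by (simp add: mvec_linear mvec_mvec AB flip: mmul_assoc)
    moreover have "mvec J (mmul I B A) v - v \<in> vecs J"
      using v mvec_vecs[OF mmul_mats[OF B A]] cfun.subspace_diff[OF subspace_vecs] by blast
    ultimately have "mvec J (mmul I B A) v - v = 0" by (rule inj[rotated])
    then show "mvec J (mmul I B A) v = mvec J (mone J) v"
      unfolding mvec_mone[OF fin(2) v] by (simp only: eq_iff_diff_eq_0[symmetric])
  qed
  then show thesis using that B AB by blast
qed

text \<open>An injective endomorphism sends a basis to an independent family of the same size, hence
  to a spanning one, so it is onto.\<close>

lemma injective_square_inverse:
  assumes A: "A \<in> mats I I" and fin: "finite I"
    and inj: "\<And>v. v \<in> vecs I \<Longrightarrow> mvec I A v = 0 \<Longrightarrow> v = 0"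
  obtains B where "B \<in> mats I I" "mmul I A B = mone I" "mmul I B A = mone I"
proof -
  obtain Bs :: "('a \<Rightarrow> complex) set" where Bs: "finite Bs" "Bs \<subseteq> vecs I" "cfun.independent Bs" "cfun.span Bs = vecs I"
    using subspace_basis[OF fin subspace_vecs] by blast
  interpret p: vector_space_pair "cscale :: _ \<Rightarrow> ('a \<Rightarrow> complex) \<Rightarrow> _" "cscale :: _ \<Rightarrow> ('a \<Rightarrow> complex) \<Rightarrow> _"
    by unfold_locales
  have lin: "Vector_Spaces.linear cscale cscale (mvec I A)"
    unfolding Vector_Spaces.linear_iff by (auto simp: mvec_linear cfun.vector_space_axioms)
  have injon: "inj_on (mvec I A) (vecs I)"
  proof (rule inj_onI)
    fix u v assume uv: "u \<in> vecs I" "v \<in> vecs I" "mvec I A u = mvec I A v"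
    then have "u - v \<in> vecs I" "mvec I A (u - v) = 0"
      using cfun.subspace_diff[OF subspace_vecs] by (auto simp: mvec_linear)
    then have "u - v = 0" by (rule inj)
    then show "u = v" by (simp only: eq_iff_diff_eq_0[symmetric])
  qed
  have "cfun.independent (mvec I A ` Bs)"
    using p.linear_independent_injective_image[OF lin Bs(3)] injon Bs(4) by simp
  moreover have "card (mvec I A ` Bs) = card Bs"
    using injon Bs(2) by (intro card_image) (rule inj_on_subset)
  ultimately have sp: "cfun.span (mvec I A ` Bs) = vecs I"
    using mvec_vecs[OF A] by (intro independent_card_span[OF Bs(1,4) finite_imageI[OF Bs(1)]]) auto
  show thesis
  proof (rule inverse_matrixI[OF A fin fin inj])
    fix w :: "'a \<Rightarrow> complex" assume "w \<in> vecs I"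
    then have "w \<in> mvec I A ` cfun.span Bs" using p.linear_span_image[OF lin, of Bs] sp by simp
    then show "\<exists>v\<in>vecs I. mvec I A v = w" using Bs(4) by auto
  qed (use that in auto)
qed

text \<open>The trace is found without completing \<open>B\<close> to a basis of the whole space:
  the columns of \<open>K\<close> are expanded in \<open>B\<close>, and exchanging the sums leaves
  the sum over \<open>b\<close> of the \<open>b\<close>-coordinate of \<open>K b\<close>, which is
  1. For the averaging operator this turns characters into dimensions.\<close>

lemma trace_projection:
  assumes fin: "finite I" and K: "K \<in> mats I I" and W: "cfun.span B = W" "cfun.independent B" "finite B" "W \<subseteq> vecs I"
    and KW: "\<And>v. v \<in> vecs I \<Longrightarrow> mvec I K v \<in> W" and Kid: "\<And>v. v \<in> W \<Longrightarrow> mvec I K v = v"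
  shows "mtrace I K = of_nat (card B)"
proof -
  let ?r = "cfun.representation B"
  have BW: "B \<subseteq> W" using W cfun.span_superset by blast
  have e: "K (i, j) = (\<Sum>b\<in>B. ?r (mvec I K (ue j)) b * b i)" if "j \<in> I" for i j
  proof -
    have "mvec I K (ue j) \<in> cfun.span B" using KW[OF ue_vecs[OF that]] W by simp
    then have "(\<Sum>b\<in>B. cscale (?r (mvec I K (ue j)) b) b) = mvec I K (ue j)"
      using W by (intro cfun.sum_representation_eq) auto
    then show ?thesis using mvec_ue[OF fin that, of K] by (metis (mono_tags, lifting) cscale_apply sum.cong sum_apply)
  qed
  have "mtrace I K = (\<Sum>i\<in>I. \<Sum>b\<in>B. ?r (mvec I K (ue i)) b * b i)"
    unfolding mtrace_def using e by simp
  also have "\<dots> = (\<Sum>b\<in>B. \<Sum>i\<in>I. b i * ?r (mvec I K (ue i)) b)"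
    by (subst sum.swap) (simp add: mult.commute)
  also have "\<dots> = (\<Sum>b\<in>B. ?r (\<Sum>i\<in>I. cscale (b i) (mvec I K (ue i))) b)"
  proof (rule sum.cong[OF refl])
    fix b assume "b \<in> B"
    have m: "mvec I K (ue i) \<in> cfun.span B" if "i \<in> I" for i using KW[OF ue_vecs[OF that]] W by simp
    have "?r (\<Sum>i\<in>I. cscale (b i) (mvec I K (ue i))) = (\<lambda>b'. \<Sum>i\<in>I. ?r (cscale (b i) (mvec I K (ue i))) b')"
      using W m by (intro cfun.representation_sum) (auto intro: cfun.span_scale)
    then show "(\<Sum>i\<in>I. b i * ?r (mvec I K (ue i)) b) = ?r (\<Sum>i\<in>I. cscale (b i) (mvec I K (ue i))) b"
      using cfun.representation_scale[OF W(2) m] by simp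
  qed
  also have "\<dots> = (\<Sum>b\<in>B. ?r b b)"
  proof (rule sum.cong[OF refl])
    fix b assume b: "b \<in> B"
    have "(\<Sum>i\<in>I. cscale (b i) (mvec I K (ue i))) = mvec I K (\<Sum>i\<in>I. cscale (b i) (ue i))"
      by (simp add: mvec_sum mvec_linear)
    also have "\<dots> = b" using vecs_expand[OF fin, of b, symmetric] Kid[of b] b BW W(4) by (simp add: subset_iff)
    finally show "?r (\<Sum>i\<in>I. cscale (b i) (mvec I K (ue i))) b = ?r b b" by simp
  qed
  also have "\<dots> = of_nat (card B)" using cfun.representation_basis[OF W(2)] by simp
  finally show ?thesis .
qed

text \<open>The first linear dependence among the iterates of a unit vector gives a monic polynomial
  \<open>p\<close> with \<open>p(A)\<close> killing that vector. If \<open>p = (x - a) q\<close>,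
  then \<open>q(A)\<close> applied to the vector is an eigenvector for \<open>a\<close>.\<close>

lemma eigenvector_exists:
  assumes fin: "finite I" "I \<noteq> {}" and A: "A \<in> mats I I"
  obtains c v where "v \<in> vecs I" "v \<noteq> 0" "mvec I A v = cscale c v"
proof -
  obtain i0 where i0: "i0 \<in> I" using fin by blast
  define w where "w k = (mvec I A ^^ k) (ue i0)" for k
  have w0: "w 0 = ue i0" and wS: "w (Suc k) = mvec I A (w k)" for k by (auto simp: w_def)
  have wv: "w k \<in> vecs I" for k by (cases k) (auto simp: w0 wS ue_vecs i0 mvec_vecs[OF A])
  have "\<exists>k. w k \<in> cfun.span (w ` {..<k})"
  proof (rule ccontr)
    assume "\<not> ?thesis"
    then have n: "w k \<notin> cfun.span (w ` {..<k})" for k by blast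
    have "cfun.independent (w ` {..<k}) \<and> card (w ` {..<k}) = k" for k
    proof (induction k)
      case (Suc k)
      have "w k \<notin> w ` {..<k}" using n[of k] cfun.span_superset[of "w ` {..<k}"] by blast
      then show ?case using Suc n[of k] cfun.independent_insert[of "w k" "w ` {..<k}"] by (simp add: lessThan_Suc)
    qed (simp add: cfun.independent_empty)
    then show False using independent_vecs_bound[OF fin(1), of "w ` {..<Suc (card I)}"] wv by fastforce
  qed
  \<comment> \<open>No iterate before the \<open>k\<close>-th depends on its predecessors; at the
    end this keeps the eigenvector from vanishing.\<close>
  define k where "k = (LEAST k. w k \<in> cfun.span (w ` {..<k}))"
  have k: "w k \<in> cfun.span (w ` {..<k})" unfolding k_def using \<open>\<exists>k. _\<close> by (rule LeastI_ex)
  have kmin: "w j \<notin> cfun.span (w ` {..<j})" if "j < k" for j using that not_less_Least unfolding k_def by blast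
  have "inj_on w {..<k}"
  proof (rule linorder_inj_onI)
    fix i j assume "i < j" "j \<in> {..<k}"
    then show "w i \<noteq> w j" using kmin[of j] cfun.span_base[of "w i" "w ` {..<j}"] by auto
  qed auto
  obtain u' where "w k = (\<Sum>v\<in>w ` {..<k}. cscale (u' v) v)" using k cfun.span_finite[of "w ` {..<k}"] by auto
  then obtain u where u: "w k = (\<Sum>i<k. cscale (u i) (w i))"
    using sum.reindex[OF \<open>inj_on w {..<k}\<close>, of "\<lambda>v. cscale (u' v) v"] by (auto simp: comp_def)
  have "k \<noteq> 0"
  proof
    assume "k = 0"
    then have "ue i0 = 0" using k w0 by simp
    then show False by (auto simp: ue_def fun_eq_iff split: if_splits)
  qed
  define p where "p = Polynomial.monom 1 k - (\<Sum>i<k. Polynomial.monom (u i) i)"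
  have cp: "Polynomial.coeff p i = (if i = k then 1 else if i < k then - u i else 0)" for i
    by (auto simp: p_def coeff_sum)
  have dp: "Polynomial.degree p = k"
    by (rule antisym[OF degree_le le_degree]) (auto simp: cp)
  then have "\<not> constant (poly p)" using \<open>k \<noteq> 0\<close> by (simp add: constant_degree)
  then obtain a where "poly p a = 0" using fundamental_theorem_of_algebra by blast
  then obtain q where q: "p = [:- a, 1:] * q" using poly_eq_0_iff_dvd[of p a] by (auto simp: dvd_def)
  have "p \<noteq> 0" using dp \<open>k \<noteq> 0\<close> by auto
  then have "q \<noteq> 0" using q by auto
  then have dq: "Suc (Polynomial.degree q) = k" using dp q degree_mult_eq[of "[:-a, 1:]" q] by simp
  then have q1: "Polynomial.coeff q (k - 1) = 1" using cp[of k] q coeff_eq_0[of q k] by (cases k) auto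
  \<comment> \<open>\<open>z\<close> is \<open>q(A)\<close> applied to the start vector. Comparing
    coefficients in \<open>p = (x - a) q\<close>, which is the fact \<open>cq\<close>, shows that
    \<open>A z - a z\<close> is \<open>p(A)\<close> applied to it.\<close>
  define z where "z = (\<Sum>i<k. cscale (Polynomial.coeff q i) (w i))"
  have cq: "(case i of 0 \<Rightarrow> 0 | Suc j \<Rightarrow> Polynomial.coeff q j) - a * Polynomial.coeff q i = Polynomial.coeff p i" for i
    using q by (cases i) auto
  have "mvec I A z - cscale a z = 0"
  proof -
    have "mvec I A z = (\<Sum>i<k. cscale (Polynomial.coeff q i) (w (Suc i)))" by (simp add: z_def mvec_sum mvec_linear wS)
    also have "\<dots> = (\<Sum>i<Suc k. cscale (case i of 0 \<Rightarrow> 0 | Suc j \<Rightarrow> Polynomial.coeff q j) (w i))"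
      by (subst sum.lessThan_Suc_shift) simp
    finally have 1: "mvec I A z = (\<Sum>i<Suc k. cscale (case i of 0 \<Rightarrow> 0 | Suc j \<Rightarrow> Polynomial.coeff q j) (w i))" .
    have "Polynomial.coeff q k = 0" using dq by (intro coeff_eq_0) auto
    then have 2: "cscale a z = (\<Sum>i<Suc k. cscale (a * Polynomial.coeff q i) (w i))"
      by (simp add: z_def cfun.scale_sum_right)
    have "mvec I A z - cscale a z = (\<Sum>i<Suc k. cscale (Polynomial.coeff p i) (w i))"
      unfolding 1 2 sum_subtractf[symmetric] cfun.scale_left_diff_distrib[symmetric] cq ..
    also have "\<dots> = w k - (\<Sum>i<k. cscale (u i) (w i))"
      by (simp add: cp sum_negf)
    finally show ?thesis using u by simp
  qed
  moreover have "z \<noteq> 0"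
  proof
    assume "z = 0"
    obtain j where j: "k = Suc j" using \<open>k \<noteq> 0\<close> by (cases k) auto
    \<comment> \<open>\<open>q\<close> is monic of degree \<open>j\<close>, so \<open>z = 0\<close>
      would express \<open>w j\<close> by earlier iterates.\<close>
    have "w j = - (\<Sum>i<j. cscale (Polynomial.coeff q i) (w i))"
      using \<open>z = 0\<close> q1 unfolding z_def j by (simp add: eq_neg_iff_add_eq_0 add.commute)
    moreover have "- (\<Sum>i<j. cscale (Polynomial.coeff q i) (w i)) \<in> cfun.span (w ` {..<j})"
      by (intro cfun.span_neg cfun.span_sum cfun.span_scale cfun.span_base) auto
    ultimately show False using kmin[of j] j by simp
  qed
  moreover have "z \<in> vecs I" unfolding z_def
    by (intro cfun.subspace_sum[OF subspace_vecs] cfun.subspace_scale[OF subspace_vecs] wv)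
  ultimately show thesis using that[of z a] by simp
qed

section \<open>Schur's lemma and averaging\<close>

lemma group_SL2: "group SL2"
proof (rule groupI)
  fix A assume "A \<in> carrier SL2"
  then have d: "det A = 1" by (simp add: SL2_def)
  then have "invertible A" by (simp add: invertible_det_nz)
  then obtain A' where m: "A' ** A = mat 1" by (auto simp: invertible_def)
  then have "det A' * det A = det (mat 1 :: mat2)" by (metis det_mul)
  then have "A' \<in> carrier SL2" using d by (simp add: SL2_def)
  then show "\<exists>B\<in>carrier SL2. B \<otimes>\<^bsub>SL2\<^esub> A = \<one>\<^bsub>SL2\<^esub>" using m by (auto simp: SL2_def)
qed (auto simp: SL2_def det_mul matrix_mul_assoc)

lemma is_gmoduleD:
  assumes "is_gmodule \<Gamma> M"
  shows "finite (gidx M)" "g \<in> \<Gamma> \<Longrightarrow> gact M g \<in> mats (gidx M) (gidx M)"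
    "gact M (mat 1) = mone (gidx M)"
    "g \<in> \<Gamma> \<Longrightarrow> h \<in> \<Gamma> \<Longrightarrow> gact M (g ** h) = mmul (gidx M) (gact M g) (gact M h)"
  using assms by (auto simp: is_gmodule_def)

lemma ghomI:
  "A \<in> mats (gidx N) (gidx M) \<Longrightarrow> (\<And>g. g \<in> \<Gamma> \<Longrightarrow> mmul (gidx M) A (gact M g) = mmul (gidx N) (gact N g) A)
    \<Longrightarrow> A \<in> ghom \<Gamma> M N"
  by (simp add: ghom_def)

lemma ghomD:
  assumes "A \<in> ghom \<Gamma> M N"
  shows "A \<in> mats (gidx N) (gidx M)"
    "g \<in> \<Gamma> \<Longrightarrow> mmul (gidx M) A (gact M g) = mmul (gidx N) (gact N g) A"
  using assms by (auto simp: ghom_def)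

lemma subspace_ghom: "cfun.subspace (ghom \<Gamma> M N)"
  unfolding cfun.subspace_def by (auto simp: ghom_def mats_linear mmul_linear mmul_zero)

lemma ghom_vecs: "ghom \<Gamma> M N \<subseteq> vecs (gidx N \<times> gidx M)"
  by (auto simp: ghom_def mats_def)

lemma irreducibleD:
  assumes "irreducible_gmodule \<Gamma> M"
  shows "is_gmodule \<Gamma> M" "gidx M \<noteq> {}"
    "cfun.subspace W \<Longrightarrow> W \<subseteq> vecs (gidx M) \<Longrightarrow> (\<And>g w. g \<in> \<Gamma> \<Longrightarrow> w \<in> W \<Longrightarrow> mvec (gidx M) (gact M g) w \<in> W)
       \<Longrightarrow> W = {0} \<or> W = vecs (gidx M)"
  using assms unfolding irreducible_gmodule_def by auto

text \<open>An eigenspace is a nonzero submodule, hence everything.\<close>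

lemma schur_scalar:
  assumes M: "irreducible_gmodule \<Gamma> M" and A: "A \<in> ghom \<Gamma> M M"
  obtains c where "A = cscale c (mone (gidx M))"
proof -
  note fin = is_gmoduleD(1)[OF irreducibleD(1)[OF M]]
  obtain c v where v: "v \<in> vecs (gidx M)" "v \<noteq> 0" "mvec (gidx M) A v = cscale c v"
    by (rule eigenvector_exists[OF fin irreducibleD(2)[OF M] ghomD(1)[OF A]])
  let ?W = "{v \<in> vecs (gidx M). mvec (gidx M) A v = cscale c v}"
  have "?W = {0} \<or> ?W = vecs (gidx M)"
  proof (rule irreducibleD(3)[OF M])
    show "cfun.subspace ?W"
      using subspace_vecs[of "gidx M"] unfolding cfun.subspace_def mem_Collect_eq mvec_linear
      by (simp add: cfun.scale_right_distrib mult.commute)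
    fix g w assume g: "g \<in> \<Gamma>" and w: "w \<in> ?W"
    have "mvec (gidx M) A (mvec (gidx M) (gact M g) w) = mvec (gidx M) (gact M g) (mvec (gidx M) A w)"
      by (simp add: mvec_mvec ghomD(2)[OF A g])
    then show "mvec (gidx M) (gact M g) w \<in> ?W"
      using w mvec_vecs[OF is_gmoduleD(2)[OF irreducibleD(1)[OF M] g]] by (simp add: mvec_linear)
  qed auto
  then have W: "?W = vecs (gidx M)" using v by auto
  have "A = cscale c (mone (gidx M))"
  proof (rule mat_eqI[OF ghomD(1)[OF A] _ fin])
    show "cscale c (mone (gidx M)) \<in> mats (gidx M) (gidx M)" by (simp add: mats_linear mone_mats)
    show "mvec (gidx M) A v = mvec (gidx M) (cscale c (mone (gidx M))) v" if "v \<in> vecs (gidx M)" for v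
      using W that fin by (auto simp: mvec_mlinear mvec_mone)
  qed
  then show thesis by (rule that)
qed

text \<open>Kernel and image of a nonzero homomorphism are submodules, so it is invertible, and
  conjugate actions have equal traces. Equality of characters is the useful conclusion because the
  modules \<open>X\<close> are indexed by characters.\<close>

lemma schur_iso:
  assumes M: "irreducible_gmodule \<Gamma> M" and N: "irreducible_gmodule \<Gamma> N"
    and A: "A \<in> ghom \<Gamma> M N" "A \<noteq> 0" and sub: "\<And>g h. g \<in> \<Gamma> \<Longrightarrow> h \<in> \<Gamma> \<Longrightarrow> g ** h \<in> \<Gamma>"
  shows "gchar \<Gamma> M = gchar \<Gamma> N"
proof -
  let ?I = "gidx M" and ?J = "gidx N"
  note finM = is_gmoduleD(1)[OF irreducibleD(1)[OF M]] and finN = is_gmoduleD(1)[OF irreducibleD(1)[OF N]]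
  note actM = is_gmoduleD(2)[OF irreducibleD(1)[OF M]] and actN = is_gmoduleD(2)[OF irreducibleD(1)[OF N]]
  note Am = ghomD(1)[OF A(1)]
  have comm: "mvec ?I A (mvec ?I (gact M g) w) = mvec ?J (gact N g) (mvec ?I A w)" if "g \<in> \<Gamma>" for g w
    by (simp add: mvec_mvec ghomD(2)[OF A(1) that])
  have nz: "\<exists>v\<in>vecs ?I. mvec ?I A v \<noteq> 0"
  proof (rule ccontr)
    assume "\<not> ?thesis"
    then have "A = 0"
      by (intro mat_eqI[OF Am mats_linear(4) finM]) (auto simp: mvec_def fun_eq_iff)
    then show False using A by simp
  qed
  have "{v \<in> vecs ?I. mvec ?I A v = 0} = {0} \<or> {v \<in> vecs ?I. mvec ?I A v = 0} = vecs ?I"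
  proof (rule irreducibleD(3)[OF M])
    show "cfun.subspace {v \<in> vecs ?I. mvec ?I A v = 0}"
      using subspace_vecs[of ?I] by (auto simp: cfun.subspace_def mvec_linear)
    fix g w assume "g \<in> \<Gamma>" "w \<in> {v \<in> vecs ?I. mvec ?I A v = 0}"
    then show "mvec ?I (gact M g) w \<in> {v \<in> vecs ?I. mvec ?I A v = 0}"
      using mvec_vecs[OF actM] by (auto simp: comm mvec_linear)
  qed auto
  then have inj: "v = 0" if "v \<in> vecs ?I" "mvec ?I A v = 0" for v using nz that by auto
  have "mvec ?I A ` vecs ?I = {0} \<or> mvec ?I A ` vecs ?I = vecs ?J"
  proof (rule irreducibleD(3)[OF N])
    show "cfun.subspace (mvec ?I A ` vecs ?I)"
      unfolding cfun.subspace_def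
    proof (intro conjI ballI allI)
      show "0 \<in> mvec ?I A ` vecs ?I"
        using cfun.subspace_0[OF subspace_vecs] mvec_linear(4) by (metis image_iff)
      fix x y c assume xy: "x \<in> mvec ?I A ` vecs ?I" "y \<in> mvec ?I A ` vecs ?I"
      then obtain u v where "u \<in> vecs ?I" "v \<in> vecs ?I" "x = mvec ?I A u" "y = mvec ?I A v" by blast
      then show "x + y \<in> mvec ?I A ` vecs ?I"
        using cfun.subspace_add[OF subspace_vecs] mvec_linear(1) by (metis imageI)
    next
      fix x and c :: complex assume "x \<in> mvec ?I A ` vecs ?I"
      then obtain u where "u \<in> vecs ?I" "x = mvec ?I A u" by blast
      then show "cscale c x \<in> mvec ?I A ` vecs ?I"
        using cfun.subspace_scale[OF subspace_vecs] mvec_linear(3) by (metis imageI)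
    qed
    show "mvec ?I A ` vecs ?I \<subseteq> vecs ?J" using mvec_vecs[OF Am] by blast
    fix g w assume "g \<in> \<Gamma>" "w \<in> mvec ?I A ` vecs ?I"
    then show "mvec ?J (gact N g) w \<in> mvec ?I A ` vecs ?I"
      using mvec_vecs[OF actM] by (auto simp flip: comm)
  qed
  then have "mvec ?I A ` vecs ?I = vecs ?J" using nz by blast
  then have surj: "\<exists>v\<in>vecs ?I. mvec ?I A v = w" if "w \<in> vecs ?J" for w using that by (metis imageE)
  obtain B where B: "B \<in> mats ?I ?J" "mmul ?I A B = mone ?J" "mmul ?J B A = mone ?I"
    using inverse_matrixI[OF Am finN finM inj surj] by blast
  have "mtrace ?I (gact M g) = mtrace ?J (gact N g)" if g: "g \<in> \<Gamma>" for g
  proof -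
    \<comment> \<open>Insert \<open>B A = 1\<close>, move \<open>A\<close> past the action, and
      rotate under the trace.\<close>
    have "mtrace ?I (gact M g) = mtrace ?I (mmul ?J B (mmul ?I A (gact M g)))"
      using mmul_mone_left[OF finM actM[OF g]] by (simp add: B(3) flip: mmul_assoc)
    also have "\<dots> = mtrace ?J (mmul ?J (gact N g) (mmul ?I A B))"
      by (subst mtrace_mmul_commute) (simp add: ghomD(2)[OF A(1) g] mmul_assoc)
    also have "\<dots> = mtrace ?J (gact N g)"
      using mmul_mone_right[OF finN actN[OF g]] by (simp add: B(2))
    finally show ?thesis .
  qed
  then show ?thesis by (auto simp: gchar_def fun_eq_iff)
qed

section \<open>Averaging over the group and dimensions of homomorphism spaces\<close>

locale finite_SL2 =
  fixes \<Gamma> :: "mat2 set"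
  assumes subgroup: "subgroup \<Gamma> SL2" and fin: "finite \<Gamma>"
begin

definition gi :: "mat2 \<Rightarrow> mat2" where "gi g = inv\<^bsub>SL2\<^esub> g"

lemma SL2_simps: "\<one>\<^bsub>SL2\<^esub> = mat 1" "g \<otimes>\<^bsub>SL2\<^esub> h = g ** h" "g \<in> carrier SL2 \<longleftrightarrow> det g = 1"
  by (auto simp: SL2_def)

lemma one_in: "mat 1 \<in> \<Gamma>" and mult_in: "g \<in> \<Gamma> \<Longrightarrow> h \<in> \<Gamma> \<Longrightarrow> g ** h \<in> \<Gamma>" and gi_in: "g \<in> \<Gamma> \<Longrightarrow> gi g \<in> \<Gamma>"
  and det_1: "g \<in> \<Gamma> \<Longrightarrow> det g = 1"
  using subgroup.one_closed[OF subgroup] subgroup.m_closed[OF subgroup] subgroup.m_inv_closed[OF subgroup]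
   subgroup.mem_carrier[OF subgroup] by (simp_all add: SL2_simps gi_def)

lemma gi_left: "g \<in> \<Gamma> \<Longrightarrow> gi g ** g = mat 1" and gi_right: "g \<in> \<Gamma> \<Longrightarrow> g ** gi g = mat 1"
  using group.l_inv[OF group_SL2] group.r_inv[OF group_SL2] subgroup.mem_carrier[OF subgroup]
  by (simp_all add: SL2_simps gi_def)

lemma gi_gi: "g \<in> \<Gamma> \<Longrightarrow> gi (gi g) = g"
  using group.inv_inv[OF group_SL2] subgroup.mem_carrier[OF subgroup] by (simp add: gi_def)

lemma gi_mult: "g \<in> \<Gamma> \<Longrightarrow> h \<in> \<Gamma> \<Longrightarrow> gi (g ** h) = gi h ** gi g"
  using group.inv_mult_group[OF group_SL2, of g h] subgroup.mem_carrier[OF subgroup] by (simp add: gi_def SL2_simps)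

lemma sum_translate: "g \<in> \<Gamma> \<Longrightarrow> (\<Sum>h\<in>\<Gamma>. f (g ** h)) = (\<Sum>h\<in>\<Gamma>. f h)"
  by (rule sum.reindex_bij_witness[of _ "\<lambda>h. gi g ** h" "\<lambda>h. g ** h"])
    (auto simp: matrix_mul_assoc gi_left gi_right mult_in gi_in)

lemma card_pos: "card \<Gamma> > 0"
  using fin one_in by (auto simp: card_gt_0_iff)

text \<open>Left unnormalised: on matrices of the right shape it is \<open>card \<Gamma>\<close>
  times the projection onto the equivariant maps.\<close>

definition averaging :: "'i gmodule \<Rightarrow> 'j gmodule \<Rightarrow> ('j, 'i) cmat \<Rightarrow> ('j, 'i) cmat" where
  "averaging M N A = (\<Sum>g\<in>\<Gamma>. mmul (gidx N) (gact N g) (mmul (gidx M) A (gact M (gi g))))"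

text \<open>Replacing the summation variable \<open>g\<close> by \<open>k ** g\<close> moves the
  action of \<open>k\<close> from one side of \<open>A\<close> to the other.\<close>

lemma averaging_ghom:
  assumes M: "is_gmodule \<Gamma> M" and N: "is_gmodule \<Gamma> N" and A: "A \<in> mats (gidx N) (gidx M)"
  shows "averaging M N A \<in> ghom \<Gamma> M N"
proof (rule ghomI)
  let ?I = "gidx M" and ?J = "gidx N"
  show "averaging M N A \<in> mats ?J ?I"
    unfolding averaging_def
    by (intro mats_sum mmul_mats[OF is_gmoduleD(2)[OF N] mmul_mats[OF A is_gmoduleD(2)[OF M]]] gi_in)
  fix k assume k: "k \<in> \<Gamma>"
  have "mmul ?I (averaging M N A) (gact M k)
    = (\<Sum>g\<in>\<Gamma>. mmul ?J (gact N g) (mmul ?I A (gact M (gi g ** k))))"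
    unfolding averaging_def using k by (simp add: mmul_sum mmul_assoc is_gmoduleD(4)[OF M] gi_in)
  also have "\<dots> = (\<Sum>g\<in>\<Gamma>. mmul ?J (gact N (k ** g)) (mmul ?I A (gact M (gi (k ** g) ** k))))"
    by (rule sum_translate[OF k, symmetric])
  also have "\<dots> = (\<Sum>g\<in>\<Gamma>. mmul ?J (mmul ?J (gact N k) (gact N g)) (mmul ?I A (gact M (gi g))))"
    using k by (intro sum.cong refl)
      (simp add: is_gmoduleD(4)[OF N] gi_mult gi_left flip: matrix_mul_assoc)
  also have "\<dots> = mmul ?J (gact N k) (averaging M N A)"
    by (simp add: averaging_def mmul_sum mmul_assoc)
  finally show "mmul ?I (averaging M N A) (gact M k) = mmul ?J (gact N k) (averaging M N A)" .
qed

lemma averaging_fix: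
  assumes M: "is_gmodule \<Gamma> M" and A: "A \<in> ghom \<Gamma> M N"
  shows "averaging M N A = cscale (of_nat (card \<Gamma>)) A"
proof -
  have "mmul (gidx N) (gact N g) (mmul (gidx M) A (gact M (gi g))) = A" if g: "g \<in> \<Gamma>" for g
  proof -
    have "mmul (gidx N) (gact N g) (mmul (gidx M) A (gact M (gi g))) = mmul (gidx M) A (gact M (g ** gi g))"
      using g gi_in by (simp add: is_gmoduleD(4)[OF M] ghomD(2)[OF A, symmetric] flip: mmul_assoc)
    then show ?thesis using g M ghomD(1)[OF A] by (simp add: gi_right is_gmoduleD mmul_mone_right)
  qed
  then have "averaging M N A = (\<Sum>g\<in>\<Gamma>. A)" unfolding averaging_def by (rule sum.cong[OF refl])
  then show ?thesis by (auto simp: fun_eq_iff sum_apply cscale_def)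
qed

lemma gchar_apply: "g \<in> \<Gamma> \<Longrightarrow> gchar \<Gamma> M g = mtrace (gidx M) (gact M g)"
  by (simp add: gchar_def)

text \<open>Averaging divided by \<open>card \<Gamma>\<close> projects onto the homomorphism space,
  so its trace is the dimension. \<open>K\<close> is the matrix of this projection on the space of
  all matrices, and the trace of \<open>K\<close> factors into characters.\<close>

lemma ghom_basis:
  assumes M: "is_gmodule \<Gamma> M" and N: "is_gmodule \<Gamma> N"
  obtains B where "finite B" "B \<subseteq> ghom \<Gamma> M N" "cfun.independent B" "cfun.span B = ghom \<Gamma> M N"
    "of_nat (card B) * of_nat (card \<Gamma>) = (\<Sum>g\<in>\<Gamma>. gchar \<Gamma> N g * gchar \<Gamma> M (gi g))"
proof -
  let ?I = "gidx M" and ?J = "gidx N" and ?n = "of_nat (card \<Gamma>) :: complex"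
  have finIJ: "finite (?J \<times> ?I)" using M N by (simp add: is_gmoduleD)
  obtain B where B: "finite B" "B \<subseteq> ghom \<Gamma> M N" "cfun.independent B" "cfun.span B = ghom \<Gamma> M N"
    using subspace_basis[OF finIJ subspace_ghom ghom_vecs] by blast
  define K where "K = (\<lambda>((a, b), (c, d)). (\<Sum>g\<in>\<Gamma>. gact N g (a, c) * gact M (gi g) (d, b)) / ?n)"
  have KA: "mvec (?J \<times> ?I) K A = cscale (1 / ?n) (averaging M N A)" for A
  proof
    fix x :: "'b \<times> 'a" obtain a b where x: "x = (a, b)" by fastforce
    have "mvec (?J \<times> ?I) K A (a, b)
      = (\<Sum>c\<in>?J. \<Sum>d\<in>?I. \<Sum>g\<in>\<Gamma>. gact N g (a, c) * gact M (gi g) (d, b) * A (c, d)) / ?n"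
      by (simp add: mvec_def sum.cartesian_product' K_def sum_distrib_right sum_divide_distrib)
    also have "(\<Sum>c\<in>?J. \<Sum>d\<in>?I. \<Sum>g\<in>\<Gamma>. gact N g (a, c) * gact M (gi g) (d, b) * A (c, d))
       = (\<Sum>c\<in>?J. \<Sum>g\<in>\<Gamma>. \<Sum>d\<in>?I. gact N g (a, c) * gact M (gi g) (d, b) * A (c, d))"
      by (intro sum.cong refl sum.swap)
    also have "\<dots> = (\<Sum>g\<in>\<Gamma>. \<Sum>c\<in>?J. \<Sum>d\<in>?I. gact N g (a, c) * gact M (gi g) (d, b) * A (c, d))"
      by (rule sum.swap)
    also have "\<dots> = averaging M N A (a, b)"
      by (simp add: averaging_def sum_apply mmul_apply sum_distrib_left mult_ac)
    finally show "mvec (?J \<times> ?I) K A x = cscale (1 / ?n) (averaging M N A) x"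
      by (simp add: x cscale_def)
  qed
  have "mtrace (?J \<times> ?I) K = of_nat (card B)"
  proof (rule trace_projection[OF finIJ _ B(4,3,1) ghom_vecs])
    show "K \<in> mats (?J \<times> ?I) (?J \<times> ?I)"
      using matsD[OF is_gmoduleD(2)[OF M]] matsD[OF is_gmoduleD(2)[OF N]] gi_in
      by (intro matsI) (force simp: K_def intro!: sum.neutral)
    show "mvec (?J \<times> ?I) K v \<in> ghom \<Gamma> M N" if "v \<in> vecs (?J \<times> ?I)" for v
      unfolding KA using averaging_ghom[OF M N, of v] that cfun.subspace_scale[OF subspace_ghom]
      by (auto simp: mats_def)
    show "mvec (?J \<times> ?I) K v = v" if "v \<in> ghom \<Gamma> M N" for v
      unfolding KA averaging_fix[OF M that] using card_pos by (auto simp: cscale_def)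
  qed
  also have "mtrace (?J \<times> ?I) K = (\<Sum>a\<in>?J. \<Sum>b\<in>?I. \<Sum>g\<in>\<Gamma>. gact N g (a, a) * gact M (gi g) (b, b)) / ?n"
    by (simp add: mtrace_def sum.cartesian_product' K_def sum_divide_distrib)
  also have "(\<Sum>a\<in>?J. \<Sum>b\<in>?I. \<Sum>g\<in>\<Gamma>. gact N g (a, a) * gact M (gi g) (b, b))
     = (\<Sum>a\<in>?J. \<Sum>g\<in>\<Gamma>. \<Sum>b\<in>?I. gact N g (a, a) * gact M (gi g) (b, b))"
    by (intro sum.cong refl sum.swap)
  also have "\<dots> = (\<Sum>g\<in>\<Gamma>. \<Sum>a\<in>?J. \<Sum>b\<in>?I. gact N g (a, a) * gact M (gi g) (b, b))"
    by (rule sum.swap)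
  also have "\<dots> = (\<Sum>g\<in>\<Gamma>. gchar \<Gamma> N g * gchar \<Gamma> M (gi g))"
    by (simp add: gchar_apply gi_in mtrace_def sum_product)
  finally have "of_nat (card B) * ?n = (\<Sum>g\<in>\<Gamma>. gchar \<Gamma> N g * gchar \<Gamma> M (gi g))"
    using card_pos by (simp add: field_simps)
  then show thesis using that B by blast
qed

text \<open>Averaging the standard Hermitian form makes the action unitary.\<close>

lemma gchar_inverse:
  assumes M: "is_gmodule \<Gamma> M" and g: "g \<in> \<Gamma>"
  shows "gchar \<Gamma> M (gi g) = cnj (gchar \<Gamma> M g)"
proof -
  let ?I = "gidx M"
  note finI = is_gmoduleD(1)[OF M] and act = is_gmoduleD(2)[OF M]
  define ad where "ad A = (\<lambda>(i, j). cnj (A (j, i)))" for A :: "('a, 'a) cmat"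
  have ad_mats: "ad A \<in> mats ?I ?I" if "A \<in> mats ?I ?I" for A
    using that by (intro matsI) (auto simp: ad_def matsD)
  have ad_mult: "ad (mmul ?I A B) = mmul ?I (ad B) (ad A)" for A B
    by (auto simp: ad_def mmul_def fun_eq_iff mult.commute)
  have mvec_ad: "mvec ?I (ad A) w i = (\<Sum>k\<in>?I. cnj (A (k, i)) * w k)" for A w i
    by (simp add: mvec_def ad_def)
  \<comment> \<open>The averaged Hermitian form: \<open>inv\<close> says that the action of
    \<open>g\<close> preserves it, \<open>pos\<close> that it is nondegenerate.\<close>
  define H where "H = (\<Sum>h\<in>\<Gamma>. mmul ?I (ad (gact M h)) (gact M h))"
  have Hm: "H \<in> mats ?I ?I" unfolding H_def by (intro mats_sum mmul_mats ad_mats act)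
  have inv: "mmul ?I (ad (gact M g)) (mmul ?I H (gact M g)) = H"
  proof -
    have "mmul ?I (ad (gact M g)) (mmul ?I H (gact M g))
       = (\<Sum>h\<in>\<Gamma>. mmul ?I (ad (gact M (h ** g))) (gact M (h ** g)))"
      using g by (simp add: H_def mmul_sum mmul_assoc is_gmoduleD(4)[OF M] ad_mult)
    also have "\<dots> = H" unfolding H_def
      by (rule sum.reindex_bij_witness[of _ "\<lambda>h. h ** gi g" "\<lambda>h. h ** g"])
        (auto simp: g gi_left gi_right mult_in gi_in simp flip: matrix_mul_assoc)
    finally show ?thesis .
  qed
  have pos: "v = 0" if v: "v \<in> vecs ?I" "mvec ?I H v = 0" for v
  proof -
    have "(\<Sum>i\<in>?I. cnj (v i) * mvec ?I (mmul ?I (ad A) A) v i)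
        = of_real (\<Sum>i\<in>?I. (cmod (mvec ?I A v i))\<^sup>2)" for A
    proof -
      have "(\<Sum>i\<in>?I. cnj (v i) * mvec ?I (mmul ?I (ad A) A) v i)
        = (\<Sum>i\<in>?I. \<Sum>k\<in>?I. cnj (v i) * (cnj (A (k, i)) * mvec ?I A v k))"
        by (simp add: mvec_mvec[symmetric] mvec_ad sum_distrib_left)
      also have "\<dots> = (\<Sum>k\<in>?I. cnj (mvec ?I A v k) * mvec ?I A v k)"
        by (subst sum.swap) (simp add: mvec_def[of _ A v] sum_distrib_right sum_distrib_left mult_ac)
      finally show ?thesis by (simp only: of_real_sum complex_norm_square mult.commute)
    qed
    then have "of_real (\<Sum>h\<in>\<Gamma>. \<Sum>i\<in>?I. (cmod (mvec ?I (gact M h) v i))\<^sup>2)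
      = (\<Sum>h\<in>\<Gamma>. \<Sum>i\<in>?I. cnj (v i) * mvec ?I (mmul ?I (ad (gact M h)) (gact M h)) v i)" by simp
    also have "\<dots> = (\<Sum>i\<in>?I. cnj (v i) * mvec ?I H v i)"
      by (subst sum.swap) (simp add: H_def mvec_def sum_apply sum_distrib_left sum_distrib_right sum.swap[of _ ?I \<Gamma>])
    also have "\<dots> = 0" using v by simp
    finally have "(\<Sum>h\<in>\<Gamma>. \<Sum>i\<in>?I. (cmod (mvec ?I (gact M h) v i))\<^sup>2) = 0" by (simp only: of_real_eq_0_iff)
    then have "\<forall>h\<in>\<Gamma>. (\<Sum>i\<in>?I. (cmod (mvec ?I (gact M h) v i))\<^sup>2) = 0"
      using fin by (subst (asm) sum_nonneg_eq_0_iff) (auto intro: sum_nonneg)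
    \<comment> \<open>The summand of the identity element alone forces \<open>v = 0\<close>.\<close>
    then have "(\<Sum>i\<in>?I. (cmod (mvec ?I (mone ?I) v i))\<^sup>2) = 0" using one_in is_gmoduleD(3)[OF M] by force
    then have "\<forall>i\<in>?I. (cmod (v i))\<^sup>2 = 0"
      using finI v(1) by (subst (asm) sum_nonneg_eq_0_iff) (auto simp: mvec_mone)
    then show "v = 0" using v(1) by (auto simp: vecs_def fun_eq_iff)
  qed
  obtain H' where H': "H' \<in> mats ?I ?I" "mmul ?I H H' = mone ?I" "mmul ?I H' H = mone ?I"
    using injective_square_inverse[OF Hm finI pos] by blast
  have "mmul ?I (gact M g) (gact M (gi g)) = mone ?I"
    using is_gmoduleD(4)[OF M g gi_in[OF g]] g is_gmoduleD(3)[OF M] by (simp add: gi_right)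
  \<comment> \<open>Invariance of \<open>H\<close> says that \<open>H\<close> conjugates the action
    of the inverse into the adjoint of the action of \<open>g\<close>, so these two have the same
    trace.\<close>
  then have "mmul ?I (ad (gact M g)) H = mmul ?I H (gact M (gi g))"
    using arg_cong[OF inv, of "\<lambda>A. mmul ?I A (gact M (gi g))"] Hm
    by (simp add: mmul_assoc mmul_mone_right finI)
  then have "mmul ?I H' (mmul ?I (ad (gact M g)) H) = gact M (gi g)"
    using act[OF gi_in[OF g]] finI by (simp add: H'(3) mmul_mone_left flip: mmul_assoc)
  then have "mtrace ?I (gact M (gi g)) = mtrace ?I (mmul ?I (ad (gact M g)) (mmul ?I H H'))"
    by (metis mtrace_mmul_commute mmul_assoc)
  also have "\<dots> = mtrace ?I (ad (gact M g))"
    using ad_mats[OF act[OF g]] finI by (simp add: H' mmul_mone_right)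
  also have "\<dots> = cnj (mtrace ?I (gact M g))" by (simp add: mtrace_def ad_def)
  finally show ?thesis using g gi_in by (simp add: gchar_apply)
qed

end

section \<open>Multiplicities in tensor products with the standard representation\<close>

lemma kron_apply: "kron A B ((a, c), (b, d)) = A (a, b) * B (c, d)"
  by (simp add: kron_def)

lemma kron_mmul: "kron (mmul J A A') (mmul K B B') = mmul (J \<times> K) (kron A B) (kron A' B')"
proof
  fix x :: "('a \<times> 'b) \<times> ('c \<times> 'd)"
  obtain a c b d where "x = ((a, b), (c, d))" by (metis surj_pair)
  then show "kron (mmul J A A') (mmul K B B') x = mmul (J \<times> K) (kron A B) (kron A' B') x"
    by (simp add: kron_apply mmul_apply sum.cartesian_product' sum_product mult_ac)
qed

lemma kron_mats: "A \<in> mats I K \<Longrightarrow> B \<in> mats J L \<Longrightarrow> kron A B \<in> mats (I \<times> J) (K \<times> L)"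
  by (intro matsI) (auto simp: kron_def, (use matsD[of A] matsD[of B] in blast)+)

lemma gmodule_gtensor:
  assumes M: "is_gmodule \<Gamma> M" and N: "is_gmodule \<Gamma> N"
  shows "is_gmodule \<Gamma> (gtensor M N)"
proof -
  have "kron (mone (gidx M)) (mone (gidx N)) = mone (gidx M \<times> gidx N)"
    by (auto simp: kron_def mone_def fun_eq_iff)
  then show ?thesis
    using M N by (auto simp: is_gmodule_def gtensor_def kron_mmul kron_mats)
qed

lemma gmodule_Xstd: "is_gmodule \<Gamma> Xstd"
  by (auto simp: is_gmodule_def Xstd_def mats_def vecs_def mone_def mmul_def mat_def
      matrix_matrix_mult_def fun_eq_iff)

section \<open>Traces of elements of a finite subgroup of SL(2), and a bound on
  multiplicities\<close>

context finite_SL2 begin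

lemma gchar_gtensor: "g \<in> \<Gamma> \<Longrightarrow> gchar \<Gamma> (gtensor M N) g = gchar \<Gamma> M g * gchar \<Gamma> N g"
  by (simp add: gchar_apply gtensor_def mtrace_def sum.cartesian_product' kron_apply sum_product)

lemma gchar_one: "is_gmodule \<Gamma> M \<Longrightarrow> gchar \<Gamma> M (mat 1) = of_nat (gdim M)"
  by (simp add: gchar_apply one_in is_gmoduleD mtrace_mone gdim_def)

lemma gchar_Xstd: "g \<in> \<Gamma> \<Longrightarrow> gchar \<Gamma> Xstd g = g$1$1 + g$2$2"
  by (simp add: gchar_apply Xstd_def mtrace_def sum_2)

text \<open>For determinant one in size two, inversion exchanges the diagonal entries, so
  \<open>g\<close> and its inverse have equal traces; by \<open>gchar_inverse\<close> these traces
  are conjugate to each other.\<close>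

lemma gchar_Xstd_real: assumes g: "g \<in> \<Gamma>" shows "cnj (gchar \<Gamma> Xstd g) = gchar \<Gamma> Xstd g"
proof -
  let ?h = "gi g"
  have "g ** ?h = mat 1" using gi_right g by simp
  then have e: "(g ** ?h) $ i $ j = (mat 1 :: mat2) $ i $ j" for i j by simp
  have d: "g$1$1 * g$2$2 - g$1$2 * g$2$1 = 1" using det_1[OF g] by (simp add: det_2)
  have e11: "g$1$1 * ?h$1$1 + g$1$2 * ?h$2$1 = 1" "g$2$1 * ?h$1$1 + g$2$2 * ?h$2$1 = 0"
    "g$1$1 * ?h$1$2 + g$1$2 * ?h$2$2 = 0" "g$2$1 * ?h$1$2 + g$2$2 * ?h$2$2 = 1"
    using e[of 1 1] e[of 2 1] e[of 1 2] e[of 2 2] by (simp_all add: matrix_matrix_mult_def sum_2 mat_def)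
  \<comment> \<open>Cramer's rule as a polynomial identity: the brackets are entries of
    \<open>g ** ?h\<close> and the determinant, whose values are known.\<close>
  have "?h$1$1 = g$2$2 * (g$1$1 * ?h$1$1 + g$1$2 * ?h$2$1) - g$1$2 * (g$2$1 * ?h$1$1 + g$2$2 * ?h$2$1)
     + ?h$1$1 * (1 - (g$1$1 * g$2$2 - g$1$2 * g$2$1))" by (simp add: algebra_simps)
  then have 1: "?h$1$1 = g$2$2" unfolding e11 d by simp
  have "?h$2$2 = g$1$1 * (g$2$1 * ?h$1$2 + g$2$2 * ?h$2$2) - g$2$1 * (g$1$1 * ?h$1$2 + g$1$2 * ?h$2$2)
     + ?h$2$2 * (1 - (g$1$1 * g$2$2 - g$1$2 * g$2$1))" by (simp add: algebra_simps)
  then have 2: "?h$2$2 = g$1$1" unfolding e11 d by simp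
  have "gchar \<Gamma> Xstd (gi g) = gchar \<Gamma> Xstd g" using 1 2 g gi_in by (simp add: gchar_Xstd)
  then show ?thesis using gchar_inverse[OF gmodule_Xstd g] by simp
qed

text \<open>The Cayley-Hamilton identity for determinant one.\<close>

lemma square_entries:
  assumes g: "g \<in> \<Gamma>" shows "(g ** g) $ i $ j = (g$1$1 + g$2$2) * g $ i $ j - (mat 1 :: mat2) $ i $ j"
proof -
  have d: "g$1$1 * g$2$2 = 1 + g$1$2 * g$2$1" using det_1[OF g] by (simp add: det_2 algebra_simps)
  have "\<forall>i j. (g ** g) $ i $ j = (g$1$1 + g$2$2) * g $ i $ j - (mat 1 :: mat2) $ i $ j"
    using d by (simp add: forall_2 matrix_matrix_mult_def sum_2 mat_def algebra_simps)
  then show ?thesis by blast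
qed

text \<open>At an element of largest absolute trace \<open>T\<close> the square has trace
  \<open>t^2 - 2\<close>, whose absolute value is at least \<open>T^2 - 2\<close> and at most
  \<open>T\<close>. Hence \<open>(T - 2) (T + 1) <= 0\<close>. This takes the place of
  diagonalisation and roots of unity.\<close>

lemma trace_le_2: assumes "g \<in> \<Gamma>" shows "cmod (gchar \<Gamma> Xstd g) \<le> 2"
proof -
  let ?t = "\<lambda>g. cmod (gchar \<Gamma> Xstd g)"
  let ?T = "Max (?t ` \<Gamma>)"
  have ne: "?t ` \<Gamma> \<noteq> {}" using one_in by blast
  have "?T \<in> ?t ` \<Gamma>" using Max_in[OF _ ne] fin by simp
  then obtain h where h': "?T = ?t h" "h \<in> \<Gamma>" by (rule imageE)
  note h = h'(2) h'(1)[symmetric]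
  have "?t (h ** h) \<le> ?T" using fin mult_in[OF h(1) h(1)] by (intro Max_ge) auto
  moreover have "gchar \<Gamma> Xstd (h ** h) = (gchar \<Gamma> Xstd h)\<^sup>2 - 2"
    using h(1) mult_in[OF h(1) h(1)]
    by (simp add: gchar_Xstd square_entries mat_def power2_eq_square) (simp add: algebra_simps)
  moreover have "cmod ((gchar \<Gamma> Xstd h)\<^sup>2 - 2) \<ge> (?t h)\<^sup>2 - 2"
    using norm_triangle_ineq2[of "(gchar \<Gamma> Xstd h)\<^sup>2" 2] by (simp add: norm_power)
  ultimately have "(?T)\<^sup>2 - 2 \<le> ?T" using h by simp
  then have "(?T - 2) * (?T + 1) \<le> 0" by (simp add: algebra_simps power2_eq_square)
  moreover have "?T \<ge> 0" using h(2) norm_ge_zero by metis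
  ultimately have "?T \<le> 2" by (smt (verit) mult_pos_pos)
  moreover have "?t g \<le> ?T" using fin assms by (intro Max_ge) auto
  ultimately show ?thesis by simp
qed

text \<open>Trace 2 makes \<open>g - 1\<close> square to zero, so the powers of \<open>g\<close> are
  the matrices \<open>a k\<close>, that is \<open>1 + k (g - 1)\<close>. They are pairwise distinct
  unless \<open>g = 1\<close>, which a finite group excludes.\<close>

lemma trace_2: assumes g: "g \<in> \<Gamma>" and t: "gchar \<Gamma> Xstd g = 2" shows "g = mat 1"
proof (rule ccontr)
  assume ng: "g \<noteq> mat 1"
  define a where "a k = (\<chi> i j. (mat 1 :: mat2) $ i $ j + of_nat k * (g $ i $ j - (mat 1 :: mat2) $ i $ j))" for k :: nat
  have t': "g$1$1 + g$2$2 = 2" using t g by (simp add: gchar_Xstd)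
  have step: "g ** a k = a (Suc k)" for k
  proof -
    have "(g ** a k) $ i $ j = (1 - of_nat k) * (g ** mat 1) $ i $ j + of_nat k * (g ** g) $ i $ j" for i j
      by (simp add: a_def matrix_matrix_mult_def sum_distrib_left sum.distrib sum_subtractf algebra_simps
           del: matrix_mul_rid)
    then have "(g ** a k) $ i $ j = a (Suc k) $ i $ j" for i j
      unfolding square_entries[OF g] t' by (simp add: a_def algebra_simps)
    then show ?thesis by (simp add: vec_eq_iff)
  qed
  have "a k \<in> \<Gamma>" for k
  proof (induction k)
    case 0
    have "a 0 = mat 1" by (simp add: a_def vec_eq_iff)
    then show ?case using one_in by simp
  next
    case (Suc k)
    then show ?case using step[of k] mult_in[OF g] by metis
  qed
  moreover have "inj a"
  proof (rule injI)
    fix k l assume kl: "a k = a l"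
    obtain i j where ij: "g $ i $ j \<noteq> (mat 1 :: mat2) $ i $ j" using ng by (auto simp: vec_eq_iff)
    have "a k $ i $ j = a l $ i $ j" using kl by simp
    then show "k = l" using ij by (simp add: a_def)
  qed
  ultimately show False using fin finite_subset[of "range a" \<Gamma>] finite_imageD[of a UNIV] by auto
qed

text \<open>The trace is real, so it is 2 or -2. In the second case \<open>g ** g\<close> has trace
  2, hence is the identity, and Cayley-Hamilton then yields \<open>g = -1\<close>.\<close>

lemma trace_extremal: assumes g: "g \<in> \<Gamma>" and t: "cmod (gchar \<Gamma> Xstd g) \<ge> 2" shows "g = mat 1 \<or> g = - mat 1"
proof -
  let ?t = "gchar \<Gamma> Xstd g"
  have "cmod ?t = 2" using t trace_le_2[OF g] by simp
  moreover have re: "?t = of_real (Re ?t)" using gchar_Xstd_real[OF g] by (auto simp: complex_eq_iff)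
  ultimately have "\<bar>Re ?t\<bar> = 2" by (metis norm_of_real)
  then consider "?t = 2" | "?t = -2" using re by (metis abs_eq_iff' of_real_minus of_real_numeral)
  then show ?thesis
  proof cases
    case 1
    then show ?thesis using trace_2 g by simp
  next
    case 2
    then have t': "g$1$1 + g$2$2 = -2" using g by (simp add: gchar_Xstd)
    have "gchar \<Gamma> Xstd (g ** g) = 2"
    proof -
      have "(g ** g)$1$1 + (g ** g)$2$2 = (g$1$1 + g$2$2) * (g$1$1 + g$2$2) - 2"
        unfolding square_entries[OF g] by (simp add: mat_def algebra_simps)
      then show ?thesis unfolding t' using mult_in[OF g g] by (simp add: gchar_Xstd)
    qed
    then have "g ** g = mat 1" using trace_2 mult_in[OF g g] by simp
    then have "(mat 1 :: mat2) $ i $ j = - 2 * g $ i $ j - (mat 1 :: mat2) $ i $ j" for i j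
      using square_entries[OF g, of i j] t' by simp
    moreover have "x = - 2 * y - x \<Longrightarrow> y = - x" for x y :: complex
      by (simp add: complex_eq_iff)
    ultimately have "g $ i $ j = - (mat 1 :: mat2) $ i $ j" for i j by blast
    then have "g = - mat 1" by (simp add: vec_eq_iff)
    then show ?thesis by simp
  qed
qed

text \<open>Endomorphisms are scalars by Schur's lemma, so the dimension in
  \<open>ghom_basis\<close> is one.\<close>

lemma schur_dim:
  assumes M: "irreducible_gmodule \<Gamma> M"
  shows "(\<Sum>g\<in>\<Gamma>. gchar \<Gamma> M g * cnj (gchar \<Gamma> M g)) = of_nat (card \<Gamma>)"
proof -
  let ?I = "gidx M"
  note gm = irreducibleD(1)[OF M]
  obtain B where B: "finite B" "B \<subseteq> ghom \<Gamma> M M" "cfun.independent B" "cfun.span B = ghom \<Gamma> M M"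
    "of_nat (card B) * of_nat (card \<Gamma>) = (\<Sum>g\<in>\<Gamma>. gchar \<Gamma> M g * gchar \<Gamma> M (gi g))"
    using ghom_basis[OF gm gm] by blast
  have "B \<subseteq> cfun.span {mone ?I}"
  proof
    fix A assume "A \<in> B"
    then obtain c where "A = cscale c (mone ?I)" using schur_scalar[OF M] B(2) by blast
    then show "A \<in> cfun.span {mone ?I}" by (simp add: cfun.span_base cfun.span_scale)
  qed
  then have "card B \<le> 1" using cfun.independent_span_bound[of "{mone ?I}" B] B(3) by simp
  moreover have "card B \<noteq> 0"
  proof
    assume "card B = 0"
    then have "ghom \<Gamma> M M = {0}" using B by auto
    moreover have "mone ?I \<in> ghom \<Gamma> M M"
      using is_gmoduleD(1,2)[OF gm] by (intro ghomI mone_mats) (metis mmul_mone_left mmul_mone_right)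
    ultimately have "mone ?I = 0" by blast
    moreover obtain i where "i \<in> ?I" using irreducibleD(2)[OF M] by blast
    ultimately show False using mone_apply[of ?I i i] by simp
  qed
  ultimately have "card B = 1" by simp
  then show ?thesis using B(5) gchar_inverse[OF gm] by simp
qed

text \<open>The sum \<open>?E\<close> of all group elements is equivariant, hence a scalar, and this
  scalar is nonzero. Since \<open>g\<close> fixes \<open>?E\<close>, it acts as the identity, and
  its character value is the dimension.\<close>

lemma gchar_nonzero_if_sum_nonzero:
  assumes M: "irreducible_gmodule \<Gamma> M" and s: "(\<Sum>g\<in>\<Gamma>. gchar \<Gamma> M g) \<noteq> 0" and g: "g \<in> \<Gamma>"
  shows "gchar \<Gamma> M g \<noteq> 0"
proof -
  let ?I = "gidx M"
  note gm = irreducibleD(1)[OF M]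
  note finI = is_gmoduleD(1)[OF gm]
  let ?E = "\<Sum>g\<in>\<Gamma>. gact M g"
  have left: "mmul ?I (gact M h) ?E = ?E" if h: "h \<in> \<Gamma>" for h
  proof -
    have "mmul ?I (gact M h) ?E = (\<Sum>g\<in>\<Gamma>. gact M (h ** g))" using h by (simp add: mmul_sum is_gmoduleD(4)[OF gm])
    then show ?thesis using sum_translate[OF h] by simp
  qed
  have "mmul ?I ?E (gact M h) = ?E" if h: "h \<in> \<Gamma>" for h
  proof -
    have "mmul ?I ?E (gact M h) = (\<Sum>g\<in>\<Gamma>. gact M (g ** h))" using h by (simp add: mmul_sum is_gmoduleD(4)[OF gm])
    also have "\<dots> = ?E"
      by (rule sum.reindex_bij_witness[of _ "\<lambda>g. g ** gi h" "\<lambda>g. g ** h"])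
        (auto simp: h gi_left gi_right mult_in gi_in simp flip: matrix_mul_assoc)
    finally show ?thesis .
  qed
  then have "?E \<in> ghom \<Gamma> M M"
    using left by (intro ghomI mats_sum is_gmoduleD(2)[OF gm]) auto
  then obtain c where c: "?E = cscale c (mone ?I)" using schur_scalar[OF M] by blast
  have "(\<Sum>g\<in>\<Gamma>. gchar \<Gamma> M g) = mtrace ?I ?E"
    by (simp add: gchar_apply mtrace_def sum_apply sum.swap[of _ \<Gamma>])
  then have "c \<noteq> 0" using s c by (auto simp: mtrace_linear)
  have "cscale c (gact M g) = cscale c (mone ?I)"
    using left[OF g] is_gmoduleD(2)[OF gm g] finI unfolding c by (simp add: mmul_linear mmul_mone_right)
  then have "gact M g = mone ?I" using \<open>c \<noteq> 0\<close> by (auto simp: cscale_def fun_eq_iff)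
  then show ?thesis using g finI irreducibleD(2)[OF M] by (simp add: gchar_apply mtrace_mone)
qed

text \<open>With \<open>x, y, t\<close> the absolute values of the characters of \<open>M\<close>, \<open>N\<close> and the standard
  representation, the sum over the group of \<open>x\<^sup>2 + y\<^sup>2 - x t y = (x - y)\<^sup>2 + (2 - t) x y\<close> is at most
  \<open>(2 - k) * card \<Gamma>\<close>. As \<open>t \<le> 2\<close> with equality at \<open>\<plusminus>1\<close> only, both characters vanish off \<open>\<plusminus>1\<close>,
  and orthogonality to the trivial character then makes the multiplicity zero.\<close>

lemma central_if_multiplicity_ge_2:
  assumes M: "irreducible_gmodule \<Gamma> M" and N: "irreducible_gmodule \<Gamma> N" and k: "k \<ge> 2"
    and mult: "of_nat k * of_nat (card \<Gamma>) = (\<Sum>g\<in>\<Gamma>. gchar \<Gamma> M g * gchar \<Gamma> Xstd g * cnj (gchar \<Gamma> N g))"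
  shows "\<Gamma> \<subseteq> {mat 1, - mat 1}"
proof (rule ccontr)
  assume "\<not> ?thesis"
  then obtain g0 where g0: "g0 \<in> \<Gamma>" "g0 \<noteq> mat 1" "g0 \<noteq> - mat 1" by blast
  let ?x = "gchar \<Gamma> M" and ?y = "gchar \<Gamma> N" and ?t = "gchar \<Gamma> Xstd"
  let ?a = "\<lambda>g. cmod (?x g)" and ?b = "\<lambda>g. cmod (?y g)" and ?c = "\<lambda>g. cmod (?t g)"
  have norm: "(\<Sum>g\<in>\<Gamma>. (cmod (gchar \<Gamma> L g))\<^sup>2) = card \<Gamma>" if "irreducible_gmodule \<Gamma> L" for L :: "'c gmodule"
  proof -
    have "complex_of_real (\<Sum>g\<in>\<Gamma>. (cmod (gchar \<Gamma> L g))\<^sup>2) = of_real (card \<Gamma>)"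
      using schur_dim[OF that] by (simp only: of_real_sum complex_norm_square of_real_of_nat_eq)
    then show ?thesis by (simp only: of_real_eq_iff)
  qed
  have "real k * card \<Gamma> = cmod (\<Sum>g\<in>\<Gamma>. ?x g * ?t g * cnj (?y g))"
    using arg_cong[OF mult, of cmod] by (simp add: norm_mult)
  also have "\<dots> \<le> (\<Sum>g\<in>\<Gamma>. ?a g * ?c g * ?b g)"
    by (rule order_trans[OF norm_sum]) (simp add: norm_mult)
  finally have "(\<Sum>g\<in>\<Gamma>. (?a g)\<^sup>2) + (\<Sum>g\<in>\<Gamma>. (?b g)\<^sup>2) - (\<Sum>g\<in>\<Gamma>. ?a g * ?c g * ?b g) \<le> 2 * real (card \<Gamma>) - real k * real (card \<Gamma>)"
    using norm[OF M] norm[OF N] by simp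
  also have "\<dots> \<le> 0" using mult_right_mono[of 2 "real k" "real (card \<Gamma>)"] k by simp
  finally have le: "(\<Sum>g\<in>\<Gamma>. (?a g)\<^sup>2 + (?b g)\<^sup>2 - ?a g * ?c g * ?b g) \<le> 0"
    by (simp add: sum.distrib sum_subtractf)
  have dec: "(?a g)\<^sup>2 + (?b g)\<^sup>2 - ?a g * ?c g * ?b g = (?a g - ?b g)\<^sup>2 + (2 - ?c g) * (?a g * ?b g)" for g
    by (simp add: power2_eq_square algebra_simps)
  have nn: "(2 - ?c g) * (?a g * ?b g) \<ge> 0" if "g \<in> \<Gamma>" for g
    using trace_le_2[OF that] by simp
  have "(\<Sum>g\<in>\<Gamma>. (?a g)\<^sup>2 + (?b g)\<^sup>2 - ?a g * ?c g * ?b g) = 0"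
    using le nn by (intro antisym sum_nonneg) (simp_all add: dec)
  then have z: "(?a g - ?b g)\<^sup>2 + (2 - ?c g) * (?a g * ?b g) = 0" if "g \<in> \<Gamma>" for g
    unfolding dec using that nn fin by (subst (asm) sum_nonneg_eq_0_iff) auto
  have ab: "?a g = ?b g" if "g \<in> \<Gamma>" for g
    using z[OF that] nn[OF that] zero_le_power2[of "?a g - ?b g"] by (auto simp: add_nonneg_eq_0_iff)
  have off: "?x g = 0 \<and> ?y g = 0" if "g \<in> \<Gamma>" "g \<noteq> mat 1" "g \<noteq> - mat 1" for g
  proof -
    have "?c g < 2" using trace_extremal that by fastforce
    moreover have "(2 - ?c g) * (?a g * ?b g) = 0" using z[OF that(1)] ab[OF that(1)] by simp
    ultimately show ?thesis using ab[OF that(1)] by auto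
  qed
  \<comment> \<open>By \<open>off\<close> both characters vanish at \<open>g0\<close>, so
    \<open>gchar_nonzero_if_sum_nonzero\<close> makes both character sums zero.\<close>
  have "(\<Sum>g\<in>\<Gamma>. ?x g) = 0" using gchar_nonzero_if_sum_nonzero[OF M _ g0(1)] off[OF g0] by blast
  moreover have "(\<Sum>g\<in>\<Gamma>. ?y g) = 0" using gchar_nonzero_if_sum_nonzero[OF N _ g0(1)] off[OF g0] by blast
  moreover have ne: "mat 1 \<noteq> (- mat 1 :: mat2)" by (auto simp: vec_eq_iff mat_def)
  have red: "(\<Sum>g\<in>\<Gamma>. f g) = f (mat 1) + (if - mat 1 \<in> \<Gamma> then f (- mat 1) else 0)"
    if "\<And>g. g \<in> \<Gamma> \<Longrightarrow> g \<noteq> mat 1 \<Longrightarrow> g \<noteq> - mat 1 \<Longrightarrow> f g = 0" for f :: "mat2 \<Rightarrow> complex"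
  proof -
    have "(\<Sum>g\<in>\<Gamma>. f g) = (\<Sum>g\<in>\<Gamma> \<inter> {mat 1, - mat 1}. f g)"
      using that fin by (intro sum.mono_neutral_right) auto
    moreover have "\<Gamma> \<inter> {mat 1, - mat 1} = (if - mat 1 \<in> \<Gamma> then {mat 1, - mat 1} else {mat 1})"
      using one_in by auto
    ultimately show ?thesis using ne by auto
  qed
  ultimately have xy: "?x (mat 1) + (if - mat 1 \<in> \<Gamma> then ?x (- mat 1) else 0) = 0"
    "?y (mat 1) + (if - mat 1 \<in> \<Gamma> then ?y (- mat 1) else 0) = 0"
    using red[of ?x] red[of ?y] off by auto
  have x1: "?x (mat 1) = of_nat (gdim M)" "?y (mat 1) = of_nat (gdim N)"
    using gchar_one M N irreducibleD(1) by blast+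
  have "gdim M > 0" using M irreducibleD(2)[OF M] is_gmoduleD(1)[OF irreducibleD(1)[OF M]] by (auto simp: gdim_def card_gt_0_iff)
  then have m1: "- mat 1 \<in> \<Gamma>" using xy x1 by (auto split: if_splits)
  have xm: "?x (- mat 1) = - of_nat (gdim M)" "?y (- mat 1) = - of_nat (gdim N)"
    using xy x1 m1 by (auto simp: eq_neg_iff_add_eq_0 add.commute)
  have "?t (mat 1) = 2" "?t (- mat 1) = - 2" using m1 one_in by (simp_all add: gchar_Xstd mat_def)
  \<comment> \<open>With \<open>m\<close> and \<open>n\<close> the two dimensions, the contributions
    of 1 and -1 are \<open>2 m n\<close> and \<open>(-m) (-2) (-n)\<close>; they cancel.\<close>
  then have "(\<Sum>g\<in>\<Gamma>. ?x g * ?t g * cnj (?y g)) = 0"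
    using red[of "\<lambda>g. ?x g * ?t g * cnj (?y g)"] off x1 xm m1 by simp
  then show False using mult k card_pos by simp
qed

end

section \<open>Arrow maps as bases of homomorphism spaces\<close>

text \<open>After extending the family to a basis of all functions, the coordinate functional of
  \<open>y h\<close> is recorded by its values on the unit vectors of \<open>K\<close>. Explicit
  weights make the inverse of the functor visibly polynomial in the coordinates.\<close>

lemma dual_family:
  assumes fin: "finite K" and inj: "inj_on y H" and ind: "cfun.independent (y ` H)" and yK: "y ` H \<subseteq> vecs K"
  obtains w where "\<And>h h'. h \<in> H \<Longrightarrow> h' \<in> H \<Longrightarrow> (\<Sum>k\<in>K. w h k * y h' k) = (if h = h' then 1 else 0)"
proof -
  let ?E = "cfun.extend_basis (y ` H)"
  let ?r = "cfun.representation ?E"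
  have E: "cfun.independent ?E" "y ` H \<subseteq> ?E" "cfun.span ?E = UNIV"
    using cfun.independent_extend_basis[OF ind] cfun.extend_basis_superset[OF ind] cfun.span_extend_basis[OF ind]
    by auto
  have "(\<Sum>k\<in>K. ?r (ue k) (y h) * y h' k) = (if h = h' then 1 else 0)" if h: "h \<in> H" "h' \<in> H" for h h'
  proof -
    have "(\<Sum>k\<in>K. ?r (ue k) (y h) * y h' k) = (\<Sum>k\<in>K. ?r (cscale (y h' k) (ue k)) (y h))"
      using E by (simp add: cfun.representation_scale mult.commute)
    also have "\<dots> = ?r (\<Sum>k\<in>K. cscale (y h' k) (ue k)) (y h)"
      using E by (subst cfun.representation_sum) auto
    also have "\<dots> = ?r (y h') (y h)" using vecs_expand[OF fin, of "y h'", symmetric] yK h by (simp add: subset_iff)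
    also have "\<dots> = (if h = h' then 1 else 0)"
    proof -
      have "y h' \<in> ?E" using E(2) h by blast
      then show ?thesis using cfun.representation_basis[OF E(1), of "y h'"] h inj_on_eq_iff[OF inj] by simp
    qed
    finally show ?thesis .
  qed
  then show thesis by (rule that)
qed

lemma pair_independent:
  assumes "u p \<noteq> 0" "v p = 0" "v \<noteq> 0"
  shows "cfun.independent {u, v}" "u \<noteq> v"
proof -
  have "u \<notin> cfun.span {v}" using assms by (auto simp: cfun.span_singleton cscale_def)
  then show "cfun.independent {u, v}" using assms cfun.independent_insertI[of u "{v}"] cfun.dependent_single[of v] by auto
  show "u \<noteq> v" using assms by auto
qed

text \<open>The composite of \<open>b\<close> and \<open>a\<close> contracted with \<open>e\<^sub>1 \<otimes> e\<^sub>2 - e\<^sub>2 \<otimes> e\<^sub>1\<close>, which is invariant under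
  matrices of determinant one.\<close>

definition wedge :: "'j set \<Rightarrow> ('i, 2 \<times> 'j) cmat \<Rightarrow> ('j, 2 \<times> 'k) cmat \<Rightarrow> ('i, 'k) cmat" where
  "wedge J a b = mmul J (bcol 1 a) (bcol 2 b) - mmul J (bcol 2 a) (bcol 1 b)"

lemma bcol_mats: "A \<in> mats I (UNIV \<times> J) \<Longrightarrow> bcol k A \<in> mats I J"
  using matsD[of A] by (intro matsI) (auto simp: bcol_def)

text \<open>Equivariance read on the vectors \<open>e_k \<otimes> m\<close>: the matrix
  \<open>g\<close> sends \<open>e_k\<close> to the combination of basis vectors given by its
  \<open>k\<close>-th column.\<close>

lemma bcol_equivariant:
  assumes a: "a \<in> ghom \<Gamma> (gtensor Xstd Y) Z" and g: "g \<in> \<Gamma>"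
  shows "mmul (gidx Z) (gact Z g) (bcol k a)
     = cscale (g$1$k) (mmul (gidx Y) (bcol 1 a) (gact Y g)) + cscale (g$2$k) (mmul (gidx Y) (bcol 2 a) (gact Y g))"
proof
  fix x :: "'a \<times> 'b" obtain i j where x: "x = (i, j)" by fastforce
  have "mmul (gidx Z) (gact Z g) a (i, (k, j))
      = mmul (gidx (gtensor Xstd Y)) a (gact (gtensor Xstd Y) g) (i, (k, j))"
    using ghomD(2)[OF a g] by simp
  also have "\<dots> = (\<Sum>l\<in>UNIV. \<Sum>j'\<in>gidx Y. a (i, (l, j')) * (g$l$k * gact Y g (j', j)))"
    by (simp add: mmul_apply gtensor_def Xstd_def sum.cartesian_product' kron_apply)
  finally have *: "mmul (gidx Z) (gact Z g) a (i, (k, j))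
      = (\<Sum>l\<in>UNIV. \<Sum>j'\<in>gidx Y. a (i, (l, j')) * (g$l$k * gact Y g (j', j)))" .
  have "mmul (gidx Z) (gact Z g) (bcol k a) (i, j) = mmul (gidx Z) (gact Z g) a (i, (k, j))"
    by (simp add: mmul_apply bcol_def)
  then show "mmul (gidx Z) (gact Z g) (bcol k a) x
     = (cscale (g$1$k) (mmul (gidx Y) (bcol 1 a) (gact Y g)) + cscale (g$2$k) (mmul (gidx Y) (bcol 2 a) (gact Y g))) x"
    unfolding x * by (simp add: sum_2 mmul_apply bcol_def cscale_def sum_distrib_left mult_ac)
qed

lemma wedge_ghom:
  assumes a: "a \<in> ghom \<Gamma> (gtensor Xstd Y) Z" and b: "b \<in> ghom \<Gamma> (gtensor Xstd W) Y"
    and det: "\<And>g. g \<in> \<Gamma> \<Longrightarrow> det g = 1"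
  shows "wedge (gidx Y) a b \<in> ghom \<Gamma> W Z"
proof (rule ghomI)
  have am: "a \<in> mats (gidx Z) (UNIV \<times> gidx Y)" and bm: "b \<in> mats (gidx Y) (UNIV \<times> gidx W)"
    using ghomD(1)[OF a] ghomD(1)[OF b] by (simp_all add: gtensor_def Xstd_def)
  show "wedge (gidx Y) a b \<in> mats (gidx Z) (gidx W)"
    unfolding wedge_def by (intro mats_linear mmul_mats bcol_mats am bm)
  fix g assume g: "g \<in> \<Gamma>"
  let ?J = "gidx Y" and ?K = "gidx W"
  \<comment> \<open>\<open>R i j\<close> are the four composites before contraction. In the
    antisymmetric combination those with \<open>i = j\<close> cancel, and the others collect the
    determinant of \<open>g\<close>.\<close>
  define R where "R i j = mmul ?K (mmul ?J (bcol i a) (bcol j b)) (gact W g)" for i j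
  have L: "mmul (gidx Z) (gact Z g) (mmul ?J (bcol k a) (bcol l b))
    = cscale (g$1$k * g$1$l) (R 1 1) + cscale (g$1$k * g$2$l) (R 1 2) + cscale (g$2$k * g$1$l) (R 2 1)
      + cscale (g$2$k * g$2$l) (R 2 2)" for k l
  proof -
    have "mmul (gidx Z) (gact Z g) (mmul ?J (bcol k a) (bcol l b))
      = mmul ?J (mmul (gidx Z) (gact Z g) (bcol k a)) (bcol l b)"
      by (simp only: mmul_assoc)
    also have "\<dots> = cscale (g$1$k) (mmul ?J (bcol 1 a) (mmul ?J (gact Y g) (bcol l b)))
        + cscale (g$2$k) (mmul ?J (bcol 2 a) (mmul ?J (gact Y g) (bcol l b)))"
      unfolding bcol_equivariant[OF a g] mmul_linear mmul_assoc ..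
    also have "\<dots> = cscale (g$1$k * g$1$l) (R 1 1) + cscale (g$1$k * g$2$l) (R 1 2) + cscale (g$2$k * g$1$l) (R 2 1)
      + cscale (g$2$k * g$2$l) (R 2 2)"
      unfolding bcol_equivariant[OF b g] R_def mmul_linear mmul_assoc
      by (simp add: cscale_def fun_eq_iff algebra_simps)
    finally show ?thesis .
  qed
  have d: "g$1$1 * g$2$2 - g$1$2 * g$2$1 = 1" using det[OF g] by (simp add: det_2)
  have "mmul (gidx Z) (gact Z g) (wedge ?J a b) = cscale (g$1$1 * g$2$2 - g$1$2 * g$2$1) (R 1 2 - R 2 1)"
    unfolding wedge_def mmul_linear L by (simp add: cscale_def fun_eq_iff algebra_simps)
  also have "\<dots> = mmul ?K (wedge ?J a b) (gact W g)"
    unfolding d by (simp add: wedge_def R_def mmul_linear)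
  finally show "mmul ?K (wedge ?J a b) (gact W g) = mmul (gidx Z) (gact Z g) (wedge ?J a b)" ..
qed

section \<open>The double quiver and its arrow maps\<close>

locale mckay = finite_SL2 \<Gamma> for \<Gamma> :: "mat2 set" +
  fixes Q :: "(chr, 'e) pre_digraph"
    and X :: "chr \<Rightarrow> nat gmodule"
    and y0 :: "'e \<times> bool \<Rightarrow> (nat, 2 \<times> nat) cmat"
    and l :: "'e \<times> bool \<Rightarrow> complex"
  assumes quiver: "oriented_McKay \<Gamma> Q"
    and family: "irr_family \<Gamma> X"
    and maps: "arrow_maps \<Gamma> X Q y0"
    and l_nz: "\<forall>h\<in>arcs (double_quiver Q). l h \<noteq> 0"
    and normalised: "normalised_arrow_maps X Q (\<lambda>h. cscale (l h) (y0 h))"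
begin

abbreviation "Ar \<equiv> arcs (double_quiver Q)"
abbreviation "src \<equiv> tail (double_quiver Q)"
abbreviation "tgt \<equiv> head (double_quiver Q)"
abbreviation "n \<psi> \<equiv> gdim (X \<psi>)"
abbreviation "I \<psi> \<equiv> gidx (X \<psi>)"
definition y where "y h = cscale (l h) (y0 h)"
definition arr where "arr \<psi> \<psi>' = {h \<in> Ar. src h = \<psi> \<and> tgt h = \<psi>'}"

lemma irr: "\<psi> \<in> Irr \<Gamma> \<Longrightarrow> irreducible_gmodule \<Gamma> (X \<psi>)" "\<psi> \<in> Irr \<Gamma> \<Longrightarrow> gchar \<Gamma> (X \<psi>) = \<psi>"
  and idx: "\<psi> \<in> Irr \<Gamma> \<Longrightarrow> I \<psi> = {..<n \<psi>}"
  using family by (auto simp: irr_family_def gdim_def)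

lemma gm: "\<psi> \<in> Irr \<Gamma> \<Longrightarrow> is_gmodule \<Gamma> (X \<psi>)"
  using irr irreducibleD by blast

lemma n_pos: "\<psi> \<in> Irr \<Gamma> \<Longrightarrow> n \<psi> > 0"
  using irreducibleD(2)[OF irr(1)] idx by fastforce

lemma zero_idx: "\<psi> \<in> Irr \<Gamma> \<Longrightarrow> 0 \<in> I \<psi>"
  using n_pos idx by auto

lemma finI: "\<psi> \<in> Irr \<Gamma> \<Longrightarrow> finite (I \<psi>)"
  using idx by auto

lemma wf: "fin_digraph Q" and verts: "verts Q = Irr \<Gamma>"
  using quiver by (auto simp: oriented_McKay_def)

lemma finIrr: "finite (Irr \<Gamma>)"
  using fin_digraph.finite_verts[OF wf] verts by simp

lemma src_Irr: "h \<in> Ar \<Longrightarrow> src h \<in> Irr \<Gamma>" and tgt_Irr: "h \<in> Ar \<Longrightarrow> tgt h \<in> Irr \<Gamma>"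
  using wf_digraph.tail_in_verts[OF fin_digraph.axioms(1)[OF wf]]
    wf_digraph.head_in_verts[OF fin_digraph.axioms(1)[OF wf]] verts
  by (auto simp: double_quiver_def split: if_splits)

lemma finAr: "finite Ar"
  using fin_digraph.finite_arcs[OF wf] by (simp add: double_quiver_def)

lemma arev: "src (arev h) = tgt h" "tgt (arev h) = src h" "arev (arev h) = h" "arev h \<noteq> h"
  "arev h \<in> Ar \<longleftrightarrow> h \<in> Ar"
  by (auto simp: arev_def double_quiver_def split: prod.splits)

lemma finarr: "finite (arr \<psi> \<psi>')"
  using finAr by (simp add: arr_def)

text \<open>A loop counts twice as an edge and yields two arrows of the double quiver, while an edge
  between distinct vertices yields one arrow in each direction. So the multiplicity counts arrows in
  both cases.\<close>

lemma card_arr: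
  assumes "\<psi> \<in> Irr \<Gamma>" "\<psi>' \<in> Irr \<Gamma>"
  shows "of_nat (card (arr \<psi> \<psi>')) * of_nat (card \<Gamma>) = (\<Sum>g\<in>\<Gamma>. \<psi> g * gchar \<Gamma> Xstd g * cnj (\<psi>' g))"
proof -
  let ?S = "{e \<in> arcs Q. {tail Q e, head Q e} = {\<psi>, \<psi>'}}"
  have c: "card (arr \<psi> \<psi>') = (if \<psi> = \<psi>' then 2 else 1) * card ?S"
  proof (cases "\<psi> = \<psi>'")
    case True
    then have "arr \<psi> \<psi>' = ?S \<times> UNIV"
      by (auto simp: arr_def double_quiver_def split: if_splits)
    then show ?thesis using True by (simp add: card_cartesian_product)
  next
    case False
    have "bij_betw fst (arr \<psi> \<psi>') ?S"
      by (rule bij_betw_byWitness[where f' = "\<lambda>e. (e, tail Q e = \<psi>)"])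
        (use False in \<open>auto simp: arr_def double_quiver_def doubleton_eq_iff split: if_splits\<close>)
    then show ?thesis using False bij_betw_same_card by auto
  qed
  have "of_nat ((if \<psi> = \<psi>' then 2 else 1) * card ?S) = char_inner \<Gamma> (\<lambda>g. \<psi> g * gchar \<Gamma> Xstd g) \<psi>'"
    using quiver assms unfolding oriented_McKay_def by blast
  then show ?thesis using card_pos by (simp add: c char_inner_def)
qed

lemma arr_ge_2:
  assumes "\<psi> \<in> Irr \<Gamma>" "\<psi>' \<in> Irr \<Gamma>" "card (arr \<psi> \<psi>') \<ge> 2"
  shows "\<Gamma> = {mat 1} \<or> \<Gamma> = mu2"
proof -
  have "\<Gamma> \<subseteq> {mat 1, - mat 1}"
    using central_if_multiplicity_ge_2[OF irr(1)[OF assms(1)] irr(1)[OF assms(2)] assms(3)] card_arr[OF assms(1,2)]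
      irr(2) assms(1,2) by simp
  then show ?thesis using one_in by (auto simp: mu2_def)
qed

text \<open>The squared absolute values of an irreducible character sum to the group order, here at
  most two, and the identity alone contributes the squared dimension.\<close>

lemma dim_1:
  assumes "\<Gamma> = {mat 1} \<or> \<Gamma> = mu2" and \<psi>: "\<psi> \<in> Irr \<Gamma>"
  shows "n \<psi> = 1" "I \<psi> = {0}" "g \<in> \<Gamma> \<Longrightarrow> gact (X \<psi>) g (0, 0) = \<psi> g"
proof -
  have "card \<Gamma> \<le> 2" using assms(1) by (auto simp: mu2_def card_insert_if)
  have "complex_of_real (\<Sum>g\<in>\<Gamma>. (cmod (\<psi> g))\<^sup>2) = of_real (card \<Gamma>)"
    using schur_dim[OF irr(1)[OF \<psi>]] irr(2)[OF \<psi>] by (simp only: of_real_sum complex_norm_square of_real_of_nat_eq)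
  then have "(\<Sum>g\<in>\<Gamma>. (cmod (\<psi> g))\<^sup>2) = card \<Gamma>" by (simp only: of_real_eq_iff)
  moreover have "(cmod (\<psi> (mat 1)))\<^sup>2 \<le> (\<Sum>g\<in>\<Gamma>. (cmod (\<psi> g))\<^sup>2)"
    using fin one_in by (intro member_le_sum) auto
  moreover have "\<psi> (mat 1) = of_nat (n \<psi>)" using gchar_one[OF gm[OF \<psi>]] irr(2)[OF \<psi>] by simp
  ultimately have "(n \<psi>)\<^sup>2 \<le> card \<Gamma>" by simp
  then have "(n \<psi>)\<^sup>2 \<le> 2" using \<open>card \<Gamma> \<le> 2\<close> by simp
  then have "n \<psi> < 2" using power_mono[of 2 "n \<psi>" 2] by (cases "n \<psi> < 2") auto
  then show n1: "n \<psi> = 1" using n_pos[OF \<psi>] by simp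
  then show I0: "I \<psi> = {0}" using idx[OF \<psi>] by auto
  show "g \<in> \<Gamma> \<Longrightarrow> gact (X \<psi>) g (0, 0) = \<psi> g"
    using gchar_apply[of g "X \<psi>"] irr(2)[OF \<psi>] I0 by (simp add: mtrace_def)
qed

text \<open>Both group elements act on \<open>Xstd\<close> by scalars, so each coordinate form is
  equivariant up to that scalar, and the relation between \<open>s\<close> and \<open>t\<close>
  absorbs it.\<close>

lemma mu2_ghom:
  assumes m: "\<Gamma> = mu2" and s: "s \<in> Irr \<Gamma>" and t: "t \<in> Irr \<Gamma>" and st: "s (mat 1) = t (mat 1)" "s (- mat 1) = - t (- mat 1)"
  shows "(\<lambda>(i, (k, j)). if i = 0 \<and> k = c \<and> j = 0 then 1 else 0) \<in> ghom \<Gamma> (gtensor Xstd (X s)) (X t)" (is "?e \<in> _")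
proof (rule ghomI)
  note ds = dim_1[OF disjI2[OF m] s] and dt = dim_1[OF disjI2[OF m] t]
  have gi: "gidx (gtensor Xstd (X s)) = UNIV \<times> {0}" using ds by (simp add: gtensor_def Xstd_def)
  show summand_emb: "?e \<in> mats (I t) (gidx (gtensor Xstd (X s)))"
    unfolding gi dt(2) by (intro matsI) (auto split: if_splits)
  fix g assume g: "g \<in> \<Gamma>"
  then consider "g = mat 1" | "g = - mat 1" using m by (auto simp: mu2_def)
  \<comment> \<open>\<open>u\<close> is the scalar by which \<open>g\<close> acts on
    \<open>Xstd\<close>.\<close>
  then obtain u where u: "\<And>i j. g $ i $ j = u * (mat 1 :: mat2) $ i $ j" "u * s g = t g"
  proof cases
    case 1
    then show ?thesis using st by (intro that[of 1]) auto
  next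
    case 2
    then show ?thesis using st by (intro that[of "-1"]) auto
  qed
  show "mmul (gidx (gtensor Xstd (X s))) ?e (gact (gtensor Xstd (X s)) g) = mmul (I t) (gact (X t) g) ?e"
  proof (rule mats_eqI)
    have "is_gmodule \<Gamma> (gtensor Xstd (X s))" using gmodule_gtensor gmodule_Xstd gm[OF s] by blast
    then show "mmul (gidx (gtensor Xstd (X s))) ?e (gact (gtensor Xstd (X s)) g) \<in> mats (I t) (gidx (gtensor Xstd (X s)))"
      using summand_emb g by (intro mmul_mats) (auto dest: is_gmoduleD)
    show "mmul (I t) (gact (X t) g) ?e \<in> mats (I t) (gidx (gtensor Xstd (X s)))"
      using summand_emb g gm[OF t] by (intro mmul_mats) (auto dest: is_gmoduleD)
    fix i q assume "i \<in> I t" "q \<in> gidx (gtensor Xstd (X s))"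
    then obtain k where i: "i = 0" "q = (k, 0)" using gi dt(2) by auto
    have "mmul (gidx (gtensor Xstd (X s))) ?e (gact (gtensor Xstd (X s)) g) (i, q) = g $ c $ k * s g"
      unfolding gi i using ds(3)[OF g]
      by (simp add: mmul_apply sum.cartesian_product' gtensor_def kron_apply Xstd_def mult_delta_left)
    also have "\<dots> = t g * (if k = c then 1 else 0)" using u by (auto simp: mat_def)
    also have "\<dots> = mmul (I t) (gact (X t) g) ?e (i, q)"
      unfolding dt(2) i using dt(3)[OF g] by (simp add: mmul_apply)
    finally show "mmul (gidx (gtensor Xstd (X s))) ?e (gact (gtensor Xstd (X s)) g) (i, q)
      = mmul (I t) (gact (X t) g) ?e (i, q)" .
  qed
qed

lemma mu2_arrows:
  assumes m: "\<Gamma> = mu2"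
  obtains h1 h2 h3 h4 \<psi>0 \<psi>1 where
    "\<psi>0 = (\<lambda>g\<in>\<Gamma>. 1)" "\<psi>1 \<noteq> \<psi>0" "distinct [h1, h2, h3, h4]" "Ar = {h1, h2, h3, h4}"
    "src h1 = \<psi>0" "src h2 = \<psi>0" "tgt h1 = \<psi>1" "tgt h2 = \<psi>1"
    "src h3 = \<psi>1" "src h4 = \<psi>1" "tgt h3 = \<psi>0" "tgt h4 = \<psi>0" "arev h1 = h4" "arev h3 = h2"
    "\<And>h. h \<in> {h1, h3} \<Longrightarrow> y0 h = (\<lambda>(i, (k, j)). if i = 0 \<and> k = 1 \<and> j = 0 then 1 else 0)"
    "\<And>h. h \<in> {h2, h4} \<Longrightarrow> y0 h = (\<lambda>(i, (k, j)). if i = 0 \<and> k = 2 \<and> j = 0 then 1 else 0)"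
proof -
  have "\<not> \<Gamma> \<noteq> mu2" using m by simp
  from maps[unfolded arrow_maps_def if_not_P[OF this]] obtain h1 h2 h3 h4 \<psi>0 \<psi>1 where H:
    "\<psi>0 = (\<lambda>g\<in>\<Gamma>. 1)" "\<psi>1 \<noteq> \<psi>0" "distinct [h1, h2, h3, h4]" "Ar = {h1, h2, h3, h4}"
    "\<forall>h\<in>{h1, h2}. src h = \<psi>0 \<and> tgt h = \<psi>1" "\<forall>h\<in>{h3, h4}. src h = \<psi>1 \<and> tgt h = \<psi>0"
    "arev h1 = h4" "arev h3 = h2"
    "\<forall>h\<in>{h1, h3}. y0 h = (\<lambda>(i, (k, j)). if i = 0 \<and> k = 1 \<and> j = 0 then 1 else 0)"
    "\<forall>h\<in>{h2, h4}. y0 h = (\<lambda>(i, (k, j)). if i = 0 \<and> k = 2 \<and> j = 0 then 1 else 0)"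
    by (elim exE conjE) (rule that, assumption+)
  show thesis by (rule that[of \<psi>0 \<psi>1 h1 h2 h3 h4]) (use H in auto)
qed

text \<open>Equivariance is part of the prescription except for the group of order two, where
  formulas are prescribed instead. There \<open>mu2_ghom\<close> asks for
  \<open>\<psi>1 (- mat 1) = -1\<close>, which holds because this value squares to one and
  \<open>\<psi>1\<close> is not the trivial character.\<close>

lemma y0_ghom: assumes h: "h \<in> Ar" shows "y0 h \<in> ghom \<Gamma> (gtensor Xstd (X (src h))) (X (tgt h))" "y0 h \<noteq> 0"
proof -
  have "y0 h \<in> ghom \<Gamma> (gtensor Xstd (X (src h))) (X (tgt h)) \<and> y0 h \<noteq> 0"
  proof (cases "\<Gamma> = mu2")
    case False
    then show ?thesis using maps h by (simp add: arrow_maps_def)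
  next
    case True
    obtain h1 h2 h3 h4 \<psi>0 \<psi>1 where H:
    "\<psi>0 = (\<lambda>g\<in>\<Gamma>. 1)" "\<psi>1 \<noteq> \<psi>0" "distinct [h1, h2, h3, h4]" "Ar = {h1, h2, h3, h4}"
    "src h1 = \<psi>0" "src h2 = \<psi>0" "tgt h1 = \<psi>1" "tgt h2 = \<psi>1"
    "src h3 = \<psi>1" "src h4 = \<psi>1" "tgt h3 = \<psi>0" "tgt h4 = \<psi>0" "arev h1 = h4" "arev h3 = h2"
    "\<And>h. h \<in> {h1, h3} \<Longrightarrow> y0 h = (\<lambda>(i, (k, j)). if i = 0 \<and> k = 1 \<and> j = 0 then 1 else 0)"
    "\<And>h. h \<in> {h2, h4} \<Longrightarrow> y0 h = (\<lambda>(i, (k, j)). if i = 0 \<and> k = 2 \<and> j = 0 then 1 else 0)"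
      by (rule mu2_arrows[OF True]) blast
    have I0: "\<psi>0 \<in> Irr \<Gamma>" and I1: "\<psi>1 \<in> Irr \<Gamma>" using src_Irr[of h1] tgt_Irr[of h1] H(4-8) by auto
    have m: "- mat 1 \<in> \<Gamma>" "mat 1 \<in> \<Gamma>" using True by (auto simp: mu2_def)
    have p0: "\<psi>0 (mat 1) = 1" "\<psi>0 (- mat 1) = 1" using m H(1) by auto
    have p1: "\<psi>1 (mat 1) = 1" using gchar_one[OF gm[OF I1]] irr(2)[OF I1] dim_1[OF disjI2[OF True] I1] by simp
    have "gact (X \<psi>1) (mat 1) = mmul (I \<psi>1) (gact (X \<psi>1) (- mat 1)) (gact (X \<psi>1) (- mat 1))"
    proof -
      have "(- mat 1) ** (- mat 1) = (mat 1 :: mat2)"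
        by (simp add: vec_eq_iff matrix_matrix_mult_def mat_def forall_2 sum_2)
      then show ?thesis using is_gmoduleD(4)[OF gm[OF I1] m(1) m(1)] by simp
    qed
    then have "gact (X \<psi>1) (mat 1) (0, 0) = \<psi>1 (- mat 1) * \<psi>1 (- mat 1)"
      using dim_1(2,3)[OF disjI2[OF True] I1] m by (simp add: mmul_apply)
    then have "\<psi>1 (- mat 1) * \<psi>1 (- mat 1) = 1" using p1 dim_1(3)[OF disjI2[OF True] I1 m(2)] by simp
    then have "\<psi>1 (- mat 1) = 1 \<or> \<psi>1 (- mat 1) = -1" by (simp add: square_eq_1_iff)
    moreover have "\<psi>1 (- mat 1) \<noteq> 1"
    proof
      assume a: "\<psi>1 (- mat 1) = 1"
      have "\<psi>1 g = \<psi>0 g" for g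
      proof (cases "g \<in> \<Gamma>")
        case True
        then have "g = mat 1 \<or> g = - mat 1" using \<open>\<Gamma> = mu2\<close> by (auto simp: mu2_def)
        then show ?thesis using a p0 p1 by auto
      next
        case False
        have "gchar \<Gamma> (X \<psi>1) g = undefined" using False by (simp add: gchar_def)
        then show ?thesis using False H(1) irr(2)[OF I1] by simp
      qed
      then show False using H(2) by auto
    qed
    ultimately have p1m: "\<psi>1 (- mat 1) = -1" by blast
    have A: "(\<lambda>(i, (k, j)). if i = 0 \<and> k = c \<and> j = 0 then 1 else 0) \<in> ghom \<Gamma> (gtensor Xstd (X \<psi>0)) (X \<psi>1)"
      "(\<lambda>(i, (k, j)). if i = 0 \<and> k = c \<and> j = 0 then 1 else 0) \<in> ghom \<Gamma> (gtensor Xstd (X \<psi>1)) (X \<psi>0)" for c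
      using mu2_ghom[OF True I0 I1] mu2_ghom[OF True I1 I0] p0 p1 p1m by auto
    have nz: "(\<lambda>(i::nat, (k, j::nat)). if i = 0 \<and> k = c \<and> j = 0 then 1 else 0 :: complex) \<noteq> 0" for c :: 2
      by (auto simp: fun_eq_iff)
    have "h = h1 \<or> h = h2 \<or> h = h3 \<or> h = h4" using h H(4) by auto
    then show ?thesis using A[of 1] A[of 2] H(5-12) H(15)[of h] H(16)[of h] nz[of 1] nz[of 2] by auto
  qed
  then show "y0 h \<in> ghom \<Gamma> (gtensor Xstd (X (src h))) (X (tgt h))" "y0 h \<noteq> 0" by auto
qed

lemma y_ghom: assumes h: "h \<in> Ar" shows "y h \<in> ghom \<Gamma> (gtensor Xstd (X (src h))) (X (tgt h))" "y h \<noteq> 0"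
  using y0_ghom[OF h] l_nz h cfun.subspace_scale[OF subspace_ghom] by (auto simp: y_def)

lemma y_mats: assumes h: "h \<in> Ar" shows "y h \<in> mats (I (tgt h)) (UNIV \<times> I (src h))"
  using ghomD(1)[OF y_ghom(1)[OF h]] by (simp add: gtensor_def Xstd_def)


lemma trivial_Irr:
  assumes "\<Gamma> = {mat 1}" "\<psi> \<in> Irr \<Gamma>" "\<psi>' \<in> Irr \<Gamma>"
  shows "\<psi> = \<psi>'"
proof
  fix g
  have 1: "\<psi> (mat 1) = 1" if "\<psi> \<in> Irr \<Gamma>" for \<psi>
    using gchar_one[OF gm[OF that]] irr(2)[OF that] dim_1[OF disjI1[OF assms(1)] that] by simp
  \<comment> \<open>Characters are compared as functions on all matrices; off the group they take
    this default value.\<close>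
  have 2: "\<psi> g = undefined" if "\<psi> \<in> Irr \<Gamma>" "g \<notin> \<Gamma>" for \<psi>
    using gchar_def[of \<Gamma> "X \<psi>"] irr(2)[OF that(1)] that(2) by (metis restrict_apply)
  show "\<psi> g = \<psi>' g"
    using 1[OF assms(2)] 1[OF assms(3)] 2[OF assms(2)] 2[OF assms(3)] assms(1) by (cases "g \<in> \<Gamma>") auto
qed

text \<open>The standard representation of the trivial group is twice the trivial one, so the
  multiplicity two leaves a single loop and its reverse.\<close>

lemma trivial_arrows:
  assumes g1: "\<Gamma> = {mat 1}" and h: "h \<in> Ar"
  shows "Ar = {h, arev h}" "tgt h = src h"
proof -
  show st: "tgt h = src h" using trivial_Irr[OF g1] src_Irr[OF h] tgt_Irr[OF h] by blast
  let ?\<psi> = "src h"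
  have I: "?\<psi> \<in> Irr \<Gamma>" by (rule src_Irr[OF h])
  have "arr ?\<psi> ?\<psi> = Ar" using trivial_Irr[OF g1] src_Irr tgt_Irr I unfolding arr_def by blast
  moreover have "card (arr ?\<psi> ?\<psi>) = 2"
  proof -
    have "?\<psi> (mat 1) = 1"
      using gchar_one[OF gm[OF I]] irr(2)[OF I] dim_1[OF disjI1[OF g1] I] by simp
    moreover have "gchar \<Gamma> Xstd (mat 1) = 2" using gchar_Xstd[OF one_in] by (simp add: mat_def)
    moreover have "sum f \<Gamma> = f (mat 1)" for f :: "mat2 \<Rightarrow> complex" using g1 by simp
    moreover have "card \<Gamma> = 1" using g1 by simp
    ultimately have "of_nat (card (arr ?\<psi> ?\<psi>)) = (2 :: complex)"
      using card_arr[OF I I] by simp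
    then have "of_nat (card (arr ?\<psi> ?\<psi>)) = (of_nat 2 :: complex)" by simp
    then show ?thesis by (simp only: of_nat_eq_iff)
  qed
  ultimately have "card Ar = 2" by simp
  then show "Ar = {h, arev h}"
    using h arev(4,5)[of h] by (intro card_seteq[OF finAr, symmetric]) auto
qed

text \<open>This is the normalisation condition of the arrow \<open>arev h\<close>, rewritten with
  \<open>arev (arev h) = h\<close>.\<close>

lemma wedge_trace:
  assumes h: "h \<in> Ar" shows "mtrace (I (tgt h)) (wedge (I (src h)) (y h) (y (arev h))) = asign h"
  using normalised h arev(1,2,3)[of h] arev(5)[of h]
  unfolding normalised_arrow_maps_def wedge_def y_def Let_def by metis

text \<open>A single arrow has a nonzero map. For parallel arrows there are two reasons: over the
  trivial group the trace normalisation of \<open>h\<close> and its reverse excludes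
  proportionality, and over the group of order two the prescribed maps are different coordinate
  forms.\<close>

lemma y_independent:
  assumes \<psi>: "\<psi> \<in> Irr \<Gamma>" "\<psi>' \<in> Irr \<Gamma>"
  shows "inj_on y (arr \<psi> \<psi>') \<and> cfun.independent (y ` arr \<psi> \<psi>')"
proof (cases "card (arr \<psi> \<psi>') \<le> 1")
  case True
  then have "arr \<psi> \<psi>' = {} \<or> (\<exists>h. arr \<psi> \<psi>' = {h})"
    using finarr[of \<psi> \<psi>'] by (metis One_nat_def card_0_eq card_1_singletonE le_0_eq le_Suc_eq)
  then show ?thesis
  proof
    assume "\<exists>h. arr \<psi> \<psi>' = {h}"
    then obtain h where h: "arr \<psi> \<psi>' = {h}" by blast
    then have "h \<in> Ar" by (auto simp: arr_def)
    then show ?thesis using y_ghom(2)[of h] h cfun.dependent_single[of "y h"] by simp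
  qed (simp add: cfun.independent_empty)
next
  case False
  then have c2: "card (arr \<psi> \<psi>') \<ge> 2" by simp
  then have ne: "arr \<psi> \<psi>' \<noteq> {}" by auto
  from arr_ge_2[OF \<psi> c2] have "\<exists>h h'. arr \<psi> \<psi>' = {h, h'} \<and> h \<noteq> h' \<and> y h \<noteq> y h' \<and> cfun.independent {y h, y h'}"
  proof
    assume g1: "\<Gamma> = {mat 1}"
    obtain h where h: "h \<in> arr \<psi> \<psi>'" using ne by blast
    then have hA: "h \<in> Ar" by (simp add: arr_def)
    note t = trivial_arrows[OF g1 hA]
    have "src h = \<psi>" "tgt h = \<psi>'" using h by (auto simp: arr_def)
    then have arr: "arr \<psi> \<psi>' = {h, arev h}" using t arev(1,2)[of h] h by (auto simp: arr_def)
    have I0: "I (tgt h) = {0}" "I (src h) = {0}" using dim_1(2)[OF disjI1[OF g1]] src_Irr[OF hA] tgt_Irr[OF hA] by auto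
    \<comment> \<open>All modules are one-dimensional, so the normalised trace is the determinant of
      the two linear forms \<open>y h\<close> and \<open>y (arev h)\<close>.\<close>
    have w: "y h (0, (1, 0)) * y (arev h) (0, (2, 0)) - y h (0, (2, 0)) * y (arev h) (0, (1, 0)) = asign h"
      using wedge_trace[OF hA] by (simp add: I0 mtrace_def wedge_def mmul_apply bcol_def)
    have as: "asign h \<noteq> 0" by (simp add: asign_def split: prod.splits)
    have nsp: "y h \<notin> cfun.span {y (arev h)}"
    proof
      assume "y h \<in> cfun.span {y (arev h)}"
      then obtain c where "y h = cscale c (y (arev h))" by (auto simp: cfun.span_singleton)
      then show False using w as by (simp add: cscale_def)
    qed
    have "y (arev h) \<noteq> 0" using y_ghom(2) arev(5) hA by blast
    then have "cfun.independent {y h, y (arev h)}"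
      using nsp cfun.independent_insertI[of "y h" "{y (arev h)}"] cfun.dependent_single[of "y (arev h)"] by auto
    moreover have "y h \<noteq> y (arev h)" using nsp cfun.span_base by blast
    ultimately show ?thesis using arr arev(4)[of h] by metis
  next
    assume m: "\<Gamma> = mu2"
    obtain h1 h2 h3 h4 \<psi>0 \<psi>1 where H:
    "\<psi>0 = (\<lambda>g\<in>\<Gamma>. 1)" "\<psi>1 \<noteq> \<psi>0" "distinct [h1, h2, h3, h4]" "Ar = {h1, h2, h3, h4}"
    "src h1 = \<psi>0" "src h2 = \<psi>0" "tgt h1 = \<psi>1" "tgt h2 = \<psi>1"
    "src h3 = \<psi>1" "src h4 = \<psi>1" "tgt h3 = \<psi>0" "tgt h4 = \<psi>0" "arev h1 = h4" "arev h3 = h2"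
    "\<And>h. h \<in> {h1, h3} \<Longrightarrow> y0 h = (\<lambda>(i, (k, j)). if i = 0 \<and> k = 1 \<and> j = 0 then 1 else 0)"
    "\<And>h. h \<in> {h2, h4} \<Longrightarrow> y0 h = (\<lambda>(i, (k, j)). if i = 0 \<and> k = 2 \<and> j = 0 then 1 else 0)"
      by (rule mu2_arrows[OF m]) blast
    have ind: "cfun.independent {y h, y h'} \<and> y h \<noteq> y h'" if "h \<in> {h1, h3}" "h' \<in> {h2, h4}" for h h'
    proof -
      have A: "h \<in> Ar" "h' \<in> Ar" using that H(4) by auto
      have "y h (0, (1, 0)) \<noteq> 0" "y h' (0, (1, 0)) = 0"
        using l_nz A by (auto simp: y_def cscale_def H(15)[OF that(1)] H(16)[OF that(2)])
      then show ?thesis using pair_independent[of "y h" "(0, (1, 0))" "y h'"] y_ghom(2)[OF A(2)] by blast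
    qed
    obtain h where h: "h \<in> arr \<psi> \<psi>'" using ne by blast
    then have "h \<in> {h1, h2} \<or> h \<in> {h3, h4}" using H(4) by (auto simp: arr_def)
    then show ?thesis
    proof
      assume "h \<in> {h1, h2}"
      then have "src h = \<psi>0" "tgt h = \<psi>1" using H(5-8) by blast+
      then have "\<psi> = \<psi>0" "\<psi>' = \<psi>1" using h unfolding arr_def by simp_all
      then have "arr \<psi> \<psi>' = {h1, h2}"
        by (intro Set.set_eqI) (simp only: arr_def H(4) mem_Collect_eq insert_iff empty_iff, metis H(2,5-12))
      then show ?thesis using ind[of h1 h2] H(3) by (intro exI[of _ h1] exI[of _ h2]) simp
    next
      assume "h \<in> {h3, h4}"
      then have "src h = \<psi>1" "tgt h = \<psi>0" using H(9-12) by blast+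
      then have "\<psi> = \<psi>1" "\<psi>' = \<psi>0" using h unfolding arr_def by simp_all
      then have "arr \<psi> \<psi>' = {h3, h4}"
        by (intro Set.set_eqI) (simp only: arr_def H(4) mem_Collect_eq insert_iff empty_iff, metis H(2,5-12))
      then show ?thesis using ind[of h3 h4] H(3) by (intro exI[of _ h3] exI[of _ h4]) simp
    qed
  qed
  then show ?thesis by auto
qed

lemma arr_ghom: "h \<in> arr \<psi> \<psi>' \<Longrightarrow> y h \<in> ghom \<Gamma> (gtensor Xstd (X \<psi>)) (X \<psi>')"
  using y_ghom(1)[of h] by (auto simp: arr_def)

text \<open>Independence and counting suffice: \<open>card_arr\<close> gives as many arrows as
  \<open>ghom_basis\<close> gives dimensions.\<close>

lemma y_span:
  assumes \<psi>: "\<psi> \<in> Irr \<Gamma>" "\<psi>' \<in> Irr \<Gamma>"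
  shows "cfun.span (y ` arr \<psi> \<psi>') = ghom \<Gamma> (gtensor Xstd (X \<psi>)) (X \<psi>')"
proof -
  have gt: "is_gmodule \<Gamma> (gtensor Xstd (X \<psi>))" using gmodule_gtensor gmodule_Xstd gm \<psi> by blast
  obtain B where B: "finite B" "B \<subseteq> ghom \<Gamma> (gtensor Xstd (X \<psi>)) (X \<psi>')" "cfun.independent B"
    "cfun.span B = ghom \<Gamma> (gtensor Xstd (X \<psi>)) (X \<psi>')"
    "of_nat (card B) * of_nat (card \<Gamma>) = (\<Sum>g\<in>\<Gamma>. gchar \<Gamma> (X \<psi>') g * gchar \<Gamma> (gtensor Xstd (X \<psi>)) (gi g))"
    using ghom_basis[OF gt gm[OF \<psi>(2)]] by blast
  \<comment> \<open>\<open>ghom_basis\<close> involves inverse elements and therefore yields the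
    conjugate of the multiplicity sum; the two agree because the sum is a natural number.\<close>
  have "(\<Sum>g\<in>\<Gamma>. gchar \<Gamma> (X \<psi>') g * gchar \<Gamma> (gtensor Xstd (X \<psi>)) (gi g))
    = cnj (\<Sum>g\<in>\<Gamma>. \<psi> g * gchar \<Gamma> Xstd g * cnj (\<psi>' g))"
    using irr(2) \<psi> by (simp add: gchar_inverse[OF gt] gchar_gtensor mult_ac)
  also have "\<dots> = of_nat (card (arr \<psi> \<psi>')) * of_nat (card \<Gamma>)"
    using card_arr[OF \<psi>] by (metis complex_cnj_mult complex_cnj_of_nat)
  finally have "of_nat (card B) = (of_nat (card (arr \<psi> \<psi>')) :: complex)" using B(5) card_pos by simp
  then have cB: "card B = card (arr \<psi> \<psi>')" by (simp only: of_nat_eq_iff)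
  show ?thesis
    using y_independent[OF \<psi>] arr_ghom cB finarr
    by (intro independent_card_span[OF B(1,4)]) (auto simp: card_image)
qed

lemma y_expand:
  assumes \<psi>: "\<psi> \<in> Irr \<Gamma>" "\<psi>' \<in> Irr \<Gamma>" and A: "A \<in> ghom \<Gamma> (gtensor Xstd (X \<psi>)) (X \<psi>')"
  obtains c where "A = (\<Sum>h\<in>arr \<psi> \<psi>'. cscale (c h) (y h))"
proof -
  have "A \<in> range (\<lambda>u. \<Sum>v\<in>y ` arr \<psi> \<psi>'. cscale (u v) v)"
    using A y_span[OF \<psi>] cfun.span_finite[of "y ` arr \<psi> \<psi>'"] finarr by simp
  then obtain u where "A = (\<Sum>v\<in>y ` arr \<psi> \<psi>'. cscale (u v) v)" by blast
  also have "\<dots> = (\<Sum>h\<in>arr \<psi> \<psi>'. cscale (u (y h)) (y h))"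
    using y_independent[OF \<psi>] by (simp add: sum.reindex comp_def)
  finally show thesis by (rule that)
qed

text \<open>The weights are chosen once for each pair of vertices and then attached to an arrow
  through its source and target.\<close>

lemma y_dual:
  obtains w where "\<And>h h'. h \<in> Ar \<Longrightarrow> h' \<in> Ar \<Longrightarrow> src h = src h' \<Longrightarrow> tgt h = tgt h' \<Longrightarrow>
     (\<Sum>k\<in>I (tgt h) \<times> (UNIV \<times> I (src h)). w h k * y h' k) = (if h = h' then 1 else 0)"
proof -
  define P where "P \<psi> \<psi>' w \<longleftrightarrow> (\<forall>h\<in>arr \<psi> \<psi>'. \<forall>h'\<in>arr \<psi> \<psi>'.
      (\<Sum>k\<in>I \<psi>' \<times> (UNIV \<times> I \<psi>). w h k * y h' k) = (if h = h' then 1 else 0))" for \<psi> \<psi>' w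
  have "\<exists>w. \<forall>h\<in>arr \<psi> \<psi>'. \<forall>h'\<in>arr \<psi> \<psi>'.
      (\<Sum>k\<in>I \<psi>' \<times> (UNIV \<times> I \<psi>). w h k * y h' k) = (if h = h' then 1 else 0)"
    if \<psi>: "\<psi> \<in> Irr \<Gamma>" "\<psi>' \<in> Irr \<Gamma>" for \<psi> \<psi>'
  proof -
    have 1: "finite (I \<psi>' \<times> ((UNIV :: 2 set) \<times> I \<psi>))" using finI \<psi> by simp
    have 2: "y ` arr \<psi> \<psi>' \<subseteq> vecs (I \<psi>' \<times> (UNIV \<times> I \<psi>))"
      using y_mats unfolding mats_def arr_def by blast
    obtain w where "\<And>h h'. h \<in> arr \<psi> \<psi>' \<Longrightarrow> h' \<in> arr \<psi> \<psi>' \<Longrightarrow>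
      (\<Sum>k\<in>I \<psi>' \<times> (UNIV \<times> I \<psi>). w h k * y h' k) = (if h = h' then 1 else 0)"
      by (rule dual_family[OF 1 conjunct1[OF y_independent[OF \<psi>]] conjunct2[OF y_independent[OF \<psi>]] 2])
        (rule that)
    then show ?thesis by blast
  qed
  then have ex: "Ex (P \<psi> \<psi>')" if "\<psi> \<in> Irr \<Gamma>" "\<psi>' \<in> Irr \<Gamma>" for \<psi> \<psi>'
    unfolding P_def using that by blast
  define w where "w \<psi> \<psi>' = (SOME w. P \<psi> \<psi>' w)" for \<psi> \<psi>'
  have w: "(\<Sum>k\<in>I \<psi>' \<times> (UNIV \<times> I \<psi>). w \<psi> \<psi>' h k * y h' k) = (if h = h' then 1 else 0)"
    if "\<psi> \<in> Irr \<Gamma>" "\<psi>' \<in> Irr \<Gamma>" "h \<in> arr \<psi> \<psi>'" "h' \<in> arr \<psi> \<psi>'" for \<psi> \<psi>' h h'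
  proof -
    have "P \<psi> \<psi>' (w \<psi> \<psi>')" unfolding w_def using ex[OF that(1,2)] by (rule someI_ex)
    then show ?thesis using that(3,4) unfolding P_def by blast
  qed
  show thesis
  proof (rule that)
    fix h h' assume "h \<in> Ar" "h' \<in> Ar" "src h = src h'" "tgt h = tgt h'"
    then show "(\<Sum>k\<in>I (tgt h) \<times> (UNIV \<times> I (src h)). w (src h) (tgt h) h k * y h' k) = (if h = h' then 1 else 0)"
      by (intro w src_Irr tgt_Irr) (auto simp: arr_def)
  qed
qed

section \<open>Composites of two arrow maps\<close>

lemma schur:
  assumes "\<psi> \<in> Irr \<Gamma>" "\<psi>' \<in> Irr \<Gamma>" "A \<in> ghom \<Gamma> (X \<psi>) (X \<psi>')"
  shows "\<psi> \<noteq> \<psi>' \<Longrightarrow> A = 0" "\<psi> = \<psi>' \<Longrightarrow> \<exists>c. A = cscale c (mone (I \<psi>))"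
proof -
  assume ne: "\<psi> \<noteq> \<psi>'"
  show "A = 0"
  proof (rule ccontr)
    assume "A \<noteq> 0"
    from schur_iso[OF irr(1)[OF assms(1)] irr(1)[OF assms(2)] assms(3) this mult_in]
    show False using ne irr(2) assms(1,2) by simp
  qed
next
  assume "\<psi> = \<psi>'"
  then have "A \<in> ghom \<Gamma> (X \<psi>) (X \<psi>)" using assms(3) by simp
  from schur_scalar[OF irr(1)[OF assms(1)] this] show "\<exists>c. A = cscale c (mone (I \<psi>))" by blast
qed

text \<open>If \<open>h2\<close> is not the reverse of \<open>h\<close> there are parallel arrows, so the group is trivial or of
  order two, and the two summands of the wedge vanish or cancel for the explicit maps.\<close>

lemma wedge_arrow_maps:
  assumes h: "h \<in> Ar" "h2 \<in> Ar" and c: "tgt h2 = src h"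
  shows "wedge (I (src h)) (y h) (y h2)
    = (if h2 = arev h then cscale (asign h / of_nat (n (tgt h))) (mone (I (tgt h))) else 0)"
proof -
  let ?W = "wedge (I (src h)) (y h) (y h2)"
  have W: "?W \<in> ghom \<Gamma> (X (src h2)) (X (tgt h))"
    using y_ghom(1)[OF h(1)] y_ghom(1)[OF h(2)] det_1 c by (intro wedge_ghom) auto
  show ?thesis
  proof (cases "h2 = arev h")
    case True
    then have "src h2 = tgt h" using arev by simp
    then obtain a where a: "?W = cscale a (mone (I (tgt h)))"
      using schur(2)[OF src_Irr[OF h(2)] tgt_Irr[OF h(1)] W] by auto
    \<comment> \<open>Taking traces determines the scalar from Schur's lemma.\<close>
    then have "a * of_nat (n (tgt h)) = asign h"
      using wedge_trace[OF h(1)] True finI[OF tgt_Irr[OF h(1)]] by (simp add: mtrace_linear mtrace_mone gdim_def)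
    then have "a = asign h / of_nat (n (tgt h))" using n_pos[OF tgt_Irr[OF h(1)]] by (simp add: field_simps)
    then show ?thesis using a True by simp
  next
    case False
    have "?W = 0"
    proof (cases "src h2 = tgt h")
      case neq: False
      then show ?thesis using schur(1)[OF src_Irr[OF h(2)] tgt_Irr[OF h(1)] W] by simp
    next
      case True
      let ?p = "tgt h" and ?q = "src h"
      have "{h2, arev h} \<subseteq> arr ?p ?q" using True c h arev by (auto simp: arr_def)
      then have "card {h2, arev h} \<le> card (arr ?p ?q)" by (intro card_mono finarr)
      then have "card (arr ?p ?q) \<ge> 2" using False by simp
      then have G: "\<Gamma> = {mat 1} \<or> \<Gamma> = mu2" using arr_ge_2 src_Irr tgt_Irr h by blast
      note d = dim_1[OF G]
      from G show ?thesis
      proof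
        assume g1: "\<Gamma> = {mat 1}"
        \<comment> \<open>Here \<open>h2\<close> is \<open>h\<close> itself. Maps between
          one-dimensional modules commute, so the wedge of \<open>y h\<close> with itself
          vanishes.\<close>
        then have "h2 = h" using trivial_arrows[OF g1 h(1)] h(2) False by auto
        moreover have I0: "I (src h) = {0}" "I (tgt h) = {0}" using d(2) src_Irr tgt_Irr h(1) by blast+
        ultimately have "?W \<in> mats {0} {0}" using ghomD(1)[OF W] by simp
        then show ?thesis
          by (rule mats_eqI[OF _ mats_linear(4)])
            (simp add: \<open>h2 = h\<close> I0 wedge_def mmul_apply bcol_def mult.commute)
      next
        assume m: "\<Gamma> = mu2"
        obtain h1 h2' h3 h4 \<psi>0 \<psi>1 where H:
        "\<psi>0 = (\<lambda>g\<in>\<Gamma>. 1)" "\<psi>1 \<noteq> \<psi>0" "distinct [h1, h2', h3, h4]" "Ar = {h1, h2', h3, h4}"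
        "src h1 = \<psi>0" "src h2' = \<psi>0" "tgt h1 = \<psi>1" "tgt h2' = \<psi>1"
        "src h3 = \<psi>1" "src h4 = \<psi>1" "tgt h3 = \<psi>0" "tgt h4 = \<psi>0" "arev h1 = h4" "arev h3 = h2'"
        "\<And>h. h \<in> {h1, h3} \<Longrightarrow> y0 h = (\<lambda>(i, (k, j)). if i = 0 \<and> k = 1 \<and> j = 0 then 1 else 0)"
        "\<And>h. h \<in> {h2', h4} \<Longrightarrow> y0 h = (\<lambda>(i, (k, j)). if i = 0 \<and> k = 2 \<and> j = 0 then 1 else 0)"
          by (rule mu2_arrows[OF m]) blast
        have r: "arev h4 = h1" "arev h2' = h3" using arev(3) H(13,14) by metis+
        \<comment> \<open>\<open>h1\<close> and \<open>h3\<close> use the first coordinate,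
          \<open>h2'\<close> and \<open>h4\<close> the second. Reversal exchanges the two kinds, so
          two composable arrows that are not reverse to each other are of the same kind.\<close>
        have "(h \<in> {h1, h3} \<and> h2 \<in> {h1, h3}) \<or> (h \<in> {h2', h4} \<and> h2 \<in> {h2', h4})"
          using h c True False H(2,4-14) r by auto
        then show ?thesis
        proof
          assume "h \<in> {h1, h3} \<and> h2 \<in> {h1, h3}"
          then have "bcol 2 (y h) = 0" "bcol 2 (y h2) = 0"
            using H(15)[of h] H(15)[of h2] by (auto simp: y_def bcol_def cscale_def fun_eq_iff)
          then show ?thesis by (simp add: wedge_def mmul_zero)
        next
          assume "h \<in> {h2', h4} \<and> h2 \<in> {h2', h4}"
          then have "bcol 1 (y h) = 0" "bcol 1 (y h2) = 0"
            using H(16)[of h] H(16)[of h2] by (auto simp: y_def bcol_def cscale_def fun_eq_iff)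
          then show ?thesis by (simp add: wedge_def mmul_zero)
        qed
      qed
    qed
    then show ?thesis using False by simp
  qed
qed

end

section \<open>Determinants\<close>

text \<open>The left side is the determinant of the matrix whose \<open>i\<close>-th row is row
  \<open>f i\<close> of \<open>B\<close>: permuting rows gives a sign, repeating a row gives zero.
  This is the combinatorial core of multiplicativity.\<close>

lemma mdet_rows:
  fixes B :: "('i, 'i) cmat"
  assumes fin: "finite I" and f: "f \<in> I \<rightarrow>\<^sub>E I"
  shows "(\<Sum>p | p permutes I. of_int (sign p) * (\<Prod>i\<in>I. B (f i, p i)))
    = (if inj_on f I then of_int (sign (\<lambda>i. if i \<in> I then f i else i)) * mdet I B else 0)"
proof (cases "inj_on f I")
  case True
  let ?q = "\<lambda>i. if i \<in> I then f i else i"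
  have "f ` I = I" using True f by (intro endo_inj_surj[OF fin]) auto
  then have "bij_betw ?q I I" using True by (auto simp: bij_betw_def inj_on_def)
  then have q: "?q permutes I" by (rule bij_imp_permutes) auto
  have "(\<Sum>p | p permutes I. of_int (sign p) * (\<Prod>i\<in>I. B (f i, p i)))
      = (\<Sum>p | p permutes I. of_int (sign (p \<circ> ?q)) * (\<Prod>i\<in>I. B (f i, (p \<circ> ?q) i)))"
    by (rule sum_permutations_compose_right[OF q])
  also have "\<dots> = (\<Sum>p | p permutes I. of_int (sign ?q) * (of_int (sign p) * (\<Prod>i\<in>I. B (i, p i))))"
  proof (rule sum.cong[OF refl])
    fix p assume "p \<in> {p. p permutes I}"
    then have p: "p permutes I" by simp
    have "sign (p \<circ> ?q) = sign p * sign ?q"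
      using p q fin by (intro sign_compose) (auto simp: permutation_permutes)
    moreover have "(\<Prod>i\<in>I. B (f i, (p \<circ> ?q) i)) = (\<Prod>i\<in>I. ((\<lambda>i. B (i, p i)) \<circ> ?q) i)"
      by (intro prod.cong) auto
    ultimately show "of_int (sign (p \<circ> ?q)) * (\<Prod>i\<in>I. B (f i, (p \<circ> ?q) i))
       = of_int (sign ?q) * (of_int (sign p) * (\<Prod>i\<in>I. B (i, p i)))"
      using prod.permute[OF q, of "\<lambda>i. B (i, p i)"] by simp
  qed
  finally show ?thesis using True by (simp add: mdet_def sum_distrib_left)
next
  case False
  then obtain a b where ab: "a \<in> I" "b \<in> I" "a \<noteq> b" "f a = f b" by (auto simp: inj_on_def)
  \<comment> \<open>Composition with the transposition of two equal rows flips every sign and leaves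
    the products unchanged, so the sum is its own negative.\<close>
  let ?t = "Transposition.transpose a b"
  have t: "?t permutes I" using ab by (simp add: permutes_swap_id)
  let ?S = "\<Sum>p | p permutes I. of_int (sign p) * (\<Prod>i\<in>I. B (f i, p i))"
  have "?S = (\<Sum>p | p permutes I. of_int (sign (p \<circ> ?t)) * (\<Prod>i\<in>I. B (f i, (p \<circ> ?t) i)))"
    by (rule sum_permutations_compose_right[OF t])
  also have "\<dots> = (\<Sum>p | p permutes I. - (of_int (sign p) * (\<Prod>i\<in>I. B (f i, p i))))"
  proof (rule sum.cong[OF refl])
    fix p assume "p \<in> {p. p permutes I}"
    then have p: "p permutes I" by simp
    have "sign (p \<circ> ?t) = - sign p"
      using p t fin ab by (subst sign_compose) (auto simp: permutation_permutes sign_swap_id)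
    moreover have "f (?t i) = f i" for i using ab by (auto simp: Transposition.transpose_def)
    then have "(\<Prod>i\<in>I. B (f i, (p \<circ> ?t) i)) = (\<Prod>i\<in>I. ((\<lambda>i. B (f i, p i)) \<circ> ?t) i)"
      by simp
    ultimately show "of_int (sign (p \<circ> ?t)) * (\<Prod>i\<in>I. B (f i, (p \<circ> ?t) i))
       = - (of_int (sign p) * (\<Prod>i\<in>I. B (f i, p i)))"
      using prod.permute[OF t, of "\<lambda>i. B (f i, p i)"] by simp
  qed
  finally have "?S = - ?S" by (simp only: sum_negf)
  then have "?S = 0" by simp
  then show ?thesis using False by simp
qed

text \<open>Expanding the product of the row sums gives a sum over all self-maps \<open>f\<close> of
  \<open>I\<close>; by \<open>mdet_rows\<close> only the injective ones survive, and these are the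
  permutations.\<close>

lemma mdet_mmul:
  assumes fin: "finite I"
  shows "mdet I (mmul I A B) = mdet I A * mdet I B"
proof -
  let ?e = "\<lambda>f i. if i \<in> I then f i else i"
  have finE: "finite (I \<rightarrow>\<^sub>E I)" using fin by (simp add: finite_PiE)
  have "mdet I (mmul I A B) = (\<Sum>p | p permutes I. of_int (sign p) * (\<Sum>f\<in>I \<rightarrow>\<^sub>E I. \<Prod>i\<in>I. A (i, f i) * B (f i, p i)))"
    using fin by (simp add: mdet_def mmul_apply prod_sum_PiE)
  also have "\<dots> = (\<Sum>f\<in>I \<rightarrow>\<^sub>E I. (\<Prod>i\<in>I. A (i, f i)) * (\<Sum>p | p permutes I. of_int (sign p) * (\<Prod>i\<in>I. B (f i, p i))))"
    unfolding sum_distrib_left prod.distrib by (subst sum.swap) (simp add: mult_ac)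
  also have "\<dots> = (\<Sum>f\<in>I \<rightarrow>\<^sub>E I. if inj_on f I then (\<Prod>i\<in>I. A (i, f i)) * (of_int (sign (?e f)) * mdet I B) else 0)"
    using mdet_rows[OF fin] by (intro sum.cong refl) simp
  also have "\<dots> = (\<Sum>f\<in>{f \<in> I \<rightarrow>\<^sub>E I. inj_on f I}. (\<Prod>i\<in>I. A (i, f i)) * (of_int (sign (?e f)) * mdet I B))"
    using finE by (simp add: sum.inter_filter)
  \<comment> \<open>Permutations are the identity off \<open>I\<close>, whereas elements of the
    function set are \<open>undefined\<close> there; \<open>?e\<close> and \<open>restrict\<close>
    translate between the two.\<close>
  also have "\<dots> = (\<Sum>p | p permutes I. (\<Prod>i\<in>I. A (i, p i)) * (of_int (sign p) * mdet I B))"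
  proof (rule sum.reindex_bij_witness[of _ "\<lambda>p. restrict p I" ?e])
    fix f assume f: "f \<in> {f \<in> I \<rightarrow>\<^sub>E I. inj_on f I}"
    then show "restrict (?e f) I = f" by (auto simp: fun_eq_iff PiE_iff extensional_def)
    have "f ` I = I" using f by (intro endo_inj_surj[OF fin]) auto
    then have "bij_betw (?e f) I I" using f by (auto simp: bij_betw_def inj_on_def)
    then show "?e f \<in> {p. p permutes I}" by (auto intro: bij_imp_permutes)
    show "(\<Prod>i\<in>I. A (i, ?e f i)) * (of_int (sign (?e f)) * mdet I B)
       = (\<Prod>i\<in>I. A (i, f i)) * (of_int (sign (?e f)) * mdet I B)"
      by (simp cong: prod.cong)
  next
    fix p assume p: "p \<in> {p. p permutes I}"
    then show "?e (restrict p I) = p" by (auto simp: fun_eq_iff permutes_not_in)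
    show "restrict p I \<in> {f \<in> I \<rightarrow>\<^sub>E I. inj_on f I}"
      using p permutes_inj_on[of p I I] by (auto simp: permutes_in_image inj_on_restrict_eq)
  qed
  also have "\<dots> = mdet I A * mdet I B"
    by (simp add: mdet_def[of I A] sum_distrib_left sum_distrib_right mult_ac)
  finally show ?thesis .
qed

lemma mdet_mone: assumes fin: "finite I" shows "mdet I (mone I) = 1"
proof -
  have "(\<Sum>p | p permutes I. of_int (sign p) * (\<Prod>i\<in>I. mone I (i, p i)))
    = (\<Sum>p\<in>{id}. of_int (sign p) * (\<Prod>i\<in>I. mone I (i, p i)))"
  proof (rule sum.mono_neutral_right)
    show "\<forall>p\<in>{p. p permutes I} - {id}. of_int (sign p) * (\<Prod>i\<in>I. mone I (i, p i)) = 0"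
    proof
      fix p assume p: "p \<in> {p. p permutes I} - {id}"
      then obtain i where "p i \<noteq> i" by (auto simp: fun_eq_iff)
      moreover have "i \<in> I" using p \<open>p i \<noteq> i\<close> by (auto dest: permutes_not_in)
      ultimately have "\<exists>i\<in>I. mone I (i, p i) = 0" by (intro bexI[of _ i]) (auto simp: mone_apply)
      then show "of_int (sign p) * (\<Prod>i\<in>I. mone I (i, p i)) = 0" using fin by (simp add: prod_zero_iff)
    qed
  qed (use fin in \<open>auto simp: finite_permutations permutes_id\<close>)
  then show ?thesis by (simp add: mdet_def mone_apply)
qed

text \<open>Conjugation by \<open>f\<close> identifies the permutations of the two index sets and
  preserves signs.\<close>

lemma mdet_reindex:
  assumes f: "bij_betw f I J" and fin: "finite I"
  shows "mdet J A = mdet I (\<lambda>(i, j). A (f i, f j))"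
proof -
  have inj: "inj_on f I" and fI: "f ` I = J" using f by (auto simp: bij_betw_def)
  have "mdet I (\<lambda>(i, j). A (f i, f j)) = (\<Sum>p | p permutes I. of_int (sign p) * (\<Prod>i\<in>I. A (f i, f (p i))))"
    by (simp add: mdet_def)
  also have "\<dots> = mdet J A" unfolding mdet_def
  proof (rule sum.reindex_bij_witness[of _ "map_permutation J (inv_into I f)" "map_permutation I f"])
    fix p assume p: "p \<in> {p. p permutes I}"
    then show "map_permutation J (inv_into I f) (map_permutation I f p) = p"
      using f inj by (intro map_permutation_compose_inv) auto
    show "map_permutation I f p \<in> {p. p permutes J}" using p f map_permutation_permutes by blast
    have "(\<Prod>j\<in>J. A (j, map_permutation I f p j)) = (\<Prod>i\<in>I. A (f i, map_permutation I f p (f i)))"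
      unfolding fI[symmetric] by (rule prod.reindex_cong[OF inj refl refl])
    also have "\<dots> = (\<Prod>i\<in>I. A (f i, f (p i)))"
      using inj by (intro prod.cong refl) (simp add: map_permutation_apply)
    finally show "of_int (sign (map_permutation I f p)) * (\<Prod>j\<in>J. A (j, map_permutation I f p j))
       = of_int (sign p) * (\<Prod>i\<in>I. A (f i, f (p i)))"
      using p sign_map_permutation[OF inj, of p] fin by simp
  next
    fix p assume p: "p \<in> {p. p permutes J}"
    have g: "bij_betw (inv_into I f) J I" using f by (rule bij_betw_inv_into)
    then show "map_permutation J (inv_into I f) p \<in> {p. p permutes I}" using p map_permutation_permutes by blast
    show "map_permutation I f (map_permutation J (inv_into I f) p) = p"
      using g p fI by (intro map_permutation_compose_inv) (auto intro: f_inv_into_f)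
  qed
  finally show ?thesis ..
qed

text \<open>\<open>endo_det\<close> uses some chosen basis \<open>Bs\<close>. The transition matrix
  \<open>P\<close> to the basis \<open>b\<close> satisfies \<open>?M P = P Gf\<close> and is
  invertible, so multiplicativity gives equal determinants. Since \<open>mdet\<close> needs one
  index set for rows and columns, \<open>G\<close> is first carried over to \<open>Bs\<close> along
  the bijection \<open>f\<close>.\<close>

lemma endo_det_eq:
  fixes b :: "'i \<Rightarrow> 'k \<Rightarrow> complex"
  assumes fin: "finite I" and inj: "inj_on b I" and ind: "cfun.independent (b ` I)" and W: "cfun.span (b ` I) = W"
    and T: "\<And>u v. T (u + v) = T u + T v" "\<And>c v. T (cscale c v) = cscale c (T v)"
    and Tb: "\<And>i. i \<in> I \<Longrightarrow> T (b i) = (\<Sum>j\<in>I. cscale (G (j, i)) (b j))"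
  shows "endo_det W T = mdet I G"
proof -
  define Bs where "Bs = (SOME Bs. finite Bs \<and> cfun.independent Bs \<and> cfun.span Bs = W)"
  have Bs: "finite Bs" "cfun.independent Bs" "cfun.span Bs = W"
    using someI[of "\<lambda>Bs. finite Bs \<and> cfun.independent Bs \<and> cfun.span Bs = W" "b ` I"] fin ind W
    unfolding Bs_def by auto
  let ?r = "cfun.representation Bs" and ?s = "cfun.representation (b ` I)"
  have T0: "T 0 = 0" using T(2)[of 0 0] by (simp add: cscale_def zero_fun_def)
  have Tsum: "T (\<Sum>i\<in>S. f i) = (\<Sum>i\<in>S. T (f i))" for f :: "_ \<Rightarrow> 'k \<Rightarrow> complex" and S
    by (induction S rule: infinite_finite_induct) (simp_all only: sum.infinite sum.empty sum.insert T0 T(1) not_False_eq_True)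
  have "card Bs = card (b ` I)"
  proof (rule antisym)
    show "card Bs \<le> card (b ` I)"
      using cfun.independent_span_bound[of "b ` I" Bs] cfun.span_superset[of Bs] Bs W fin by simp
    show "card (b ` I) \<le> card Bs"
      using cfun.independent_span_bound[of Bs "b ` I"] cfun.span_superset[of "b ` I"] Bs W ind by simp
  qed
  then have "card I = card Bs" using inj by (simp add: card_image)
  then obtain f where f: "bij_betw f I Bs" using fin Bs(1) finite_same_card_bij by blast
  let ?M = "\<lambda>(c, a). ?r (T a) c"
  define Gf where "Gf = (\<lambda>(c, a). G (inv_into I f c, inv_into I f a))"
  define P where "P = (\<lambda>(c, a). ?r (b (inv_into I f a)) c)"
  define R where "R = (\<lambda>(c, a). ?s a (b (inv_into I f c)))"
  have finv: "inv_into I f (f i) = i" if "i \<in> I" for i using f that by (simp add: bij_betw_def)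
  have fI: "f i \<in> Bs" if "i \<in> I" for i using f that by (auto simp: bij_betw_def)
  have sumB: "(\<Sum>c\<in>Bs. h c) = (\<Sum>i\<in>I. h (f i))" for h :: "_ \<Rightarrow> complex"
    by (rule sum.reindex_bij_betw[OF f, symmetric])
  have bW: "b i \<in> cfun.span Bs" if "i \<in> I" for i using cfun.span_base[of "b i" "b ` I"] W Bs(3) that by simp
  have BsW: "c \<in> cfun.span Bs" if "c \<in> Bs" for c using that by (rule cfun.span_base)
  have TW: "T v \<in> cfun.span Bs" if v: "v \<in> cfun.span Bs" for v
  proof -
    have "v \<in> range (\<lambda>u. \<Sum>w\<in>b ` I. cscale (u w) w)"
      using v Bs(3) W cfun.span_finite[of "b ` I"] fin by simp
    then obtain u where "v = (\<Sum>w\<in>b ` I. cscale (u w) w)" by blast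
    moreover have "T w \<in> cfun.span Bs" if "w \<in> b ` I" for w
      using that by (auto simp: Tb intro!: cfun.span_sum cfun.span_scale bW)
    ultimately show ?thesis by (simp add: Tsum T(2) cfun.span_sum cfun.span_scale)
  qed
  have repsum: "?r (\<Sum>i\<in>S. cscale (u i) (w i)) c = (\<Sum>i\<in>S. u i * ?r (w i) c)"
    if "\<And>i. i \<in> S \<Longrightarrow> w i \<in> cfun.span Bs" for S u c and w :: "_ \<Rightarrow> 'k \<Rightarrow> complex"
  proof -
    have "?r (\<Sum>i\<in>S. cscale (u i) (w i)) = (\<lambda>c. \<Sum>i\<in>S. ?r (cscale (u i) (w i)) c)"
      using that by (intro cfun.representation_sum Bs(2) cfun.span_scale)
    then show ?thesis using that by (simp add: cfun.representation_scale[OF Bs(2)])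
  qed
  have expB: "(\<Sum>c\<in>Bs. cscale (?r v c) c) = v" if "v \<in> cfun.span Bs" for v
    using that Bs by (intro cfun.sum_representation_eq) auto
  have expb: "(\<Sum>i\<in>I. cscale (?s v (b i)) (b i)) = v" if "v \<in> cfun.span Bs" for v
  proof -
    have "(\<Sum>w\<in>b ` I. cscale (?s v w) w) = v"
      using that Bs(3) W fin by (intro cfun.sum_representation_eq[OF ind]) auto
    then show ?thesis using sum.reindex[OF inj, of "\<lambda>w. cscale (?s v w) w"] by (simp add: comp_def)
  qed
  have "mmul Bs ?M P (c, f i) = mmul Bs P Gf (c, f i)" if i: "i \<in> I" for c i
  proof -
    have "mmul Bs ?M P (c, f i) = (\<Sum>a\<in>Bs. ?r (b i) a * ?r (T a) c)"
      using i by (simp add: mmul_apply P_def finv mult.commute)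
    also have "\<dots> = ?r (\<Sum>a\<in>Bs. cscale (?r (b i) a) (T a)) c"
      using TW BsW by (intro repsum[symmetric]) auto
    also have "(\<Sum>a\<in>Bs. cscale (?r (b i) a) (T a)) = T (\<Sum>a\<in>Bs. cscale (?r (b i) a) a)"
      by (simp add: Tsum T(2))
    also have "\<dots> = (\<Sum>j\<in>I. cscale (G (j, i)) (b j))" using expB[OF bW[OF i]] Tb[OF i] by simp
    also have "?r \<dots> c = (\<Sum>j\<in>I. G (j, i) * ?r (b j) c)" using bW by (intro repsum) auto
    also have "\<dots> = mmul Bs P Gf (c, f i)" using i by (simp add: mmul_apply P_def Gf_def sumB finv mult.commute)
    finally show ?thesis .
  qed
  then have MP: "mmul Bs ?M P (c, a) = mmul Bs P Gf (c, a)" if "a \<in> Bs" for a c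
    using that f by (auto simp: bij_betw_def)
  have PR: "mmul Bs P R (c, a) = mone Bs (c, a)" if "a \<in> Bs" "c \<in> Bs" for a c
  proof -
    have "mmul Bs P R (c, a) = (\<Sum>i\<in>I. ?s a (b i) * ?r (b i) c)"
      by (simp add: mmul_apply P_def R_def sumB finv mult.commute)
    also have "\<dots> = ?r (\<Sum>i\<in>I. cscale (?s a (b i)) (b i)) c" using bW by (intro repsum[symmetric]) auto
    also have "\<dots> = mone Bs (c, a)"
      using expb[OF BsW[OF that(1)]] cfun.representation_basis[OF Bs(2) that(1)] that by (simp add: mone_apply)
    finally show ?thesis .
  qed
  \<comment> \<open>The matrix identities above are available on \<open>Bs\<close> only; the
    determinant depends on no other entries.\<close>
  have cong: "mdet Bs A = mdet Bs A'" if "\<And>c a. c \<in> Bs \<Longrightarrow> a \<in> Bs \<Longrightarrow> A (c, a) = A' (c, a)" for A A'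
    unfolding mdet_def using that by (intro sum.cong refl arg_cong2[of _ _ _ _ "(*)"] prod.cong) (auto simp: permutes_in_image)
  have "mdet Bs P * mdet Bs R = 1"
    using cong[of "mmul Bs P R" "mone Bs"] PR by (simp add: mdet_mmul[OF Bs(1), symmetric] mdet_mone[OF Bs(1)])
  then have "mdet Bs P \<noteq> 0" by auto
  moreover have "mdet Bs ?M * mdet Bs P = mdet Bs P * mdet Bs Gf"
    using cong[of "mmul Bs ?M P" "mmul Bs P Gf"] MP by (simp add: mdet_mmul[OF Bs(1), symmetric])
  ultimately have "mdet Bs ?M = mdet Bs Gf" by simp
  also have "mdet Bs Gf = mdet I (\<lambda>(i, j). Gf (f i, f j))" by (rule mdet_reindex[OF f fin])
  also have "\<dots> = mdet I G"
    unfolding mdet_def using finv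
    by (intro sum.cong refl arg_cong2[of _ _ _ _ "(*)"] prod.cong) (auto simp: Gf_def permutes_in_image)
  finally show ?thesis by (simp add: endo_det_def Bs_def[symmetric])
qed

section \<open>Homomorphisms between the modules in the image of the functor\<close>

lemma gidx_gtensor_Xstd: "gidx (gtensor Xstd L) = UNIV \<times> gidx L"
  by (simp add: gtensor_def Xstd_def)

lemma sum_support:
  assumes "finite J" "inj_on e K" "e ` K \<subseteq> J" "\<And>r. r \<in> J \<Longrightarrow> r \<notin> e ` K \<Longrightarrow> f r = 0"
  shows "sum f J = (\<Sum>k\<in>K. f (e k))"
proof -
  have "sum f J = sum f (e ` K)" using assms by (intro sum.mono_neutral_right) auto
  then show ?thesis using assms(2) by (simp add: sum.reindex comp_def)
qed

definition blockmat :: "mat2 set \<Rightarrow> (chr \<Rightarrow> nat gmodule) \<Rightarrow> (chr \<Rightarrow> (nat, nat) cmat)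
    \<Rightarrow> (chr \<times> nat \<times> nat, chr \<times> nat \<times> nat) cmat" where
  "blockmat \<Gamma> X a = (\<lambda>((\<psi>', i', j'), (\<psi>, i, j)).
     if \<psi> \<in> Irr \<Gamma> \<and> \<psi> = \<psi>' then a \<psi> (i', i) * mone (gidx (X \<psi>)) (j', j) else 0)"

section \<open>Block matrices and Schur's lemma for the modules \<open>M d\<close>\<close>

context mckay begin

abbreviation "M d \<equiv> F_module \<Gamma> X d"
abbreviation "J d \<equiv> gidx (M d)"
abbreviation "bd \<equiv> blockmat \<Gamma> X"
abbreviation "dmats d' d a \<equiv> \<forall>\<psi>\<in>Irr \<Gamma>. a \<psi> \<in> mats {..<d' \<psi>} {..<d \<psi>}"

lemma J_iff: "(\<psi>, i, j) \<in> J d \<longleftrightarrow> \<psi> \<in> Irr \<Gamma> \<and> i < d \<psi> \<and> j \<in> I \<psi>"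
  by (auto simp: F_module_def)

lemma finJ: "finite (J d)"
  using finIrr finI by (simp add: F_module_def)

lemma act_apply:
  "gact (M d) g ((\<psi>, i, j), (\<psi>', i', j')) =
     (if \<psi> \<in> Irr \<Gamma> \<and> \<psi> = \<psi>' \<and> i < d \<psi> \<and> i = i' then gact (X \<psi>) g (j, j') else 0)"
  by (auto simp: F_module_def mone_apply)

lemma act_mats: "g \<in> \<Gamma> \<Longrightarrow> gact (M d) g \<in> mats (J d) (J d)"
  by (intro matsI) (auto simp: act_apply J_iff dest: matsD[OF is_gmoduleD(2)[OF gm]])

text \<open>The action is diagonal in the multiplicity index, so a sum against one of its rows runs
  over \<open>I \<psi>\<close> only. The block matrices \<open>bd a\<close> behave the other way
  round and leave the module index fixed.\<close>

lemma act_row: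
  assumes "(\<psi>, i, j) \<in> J d" shows "(\<Sum>r\<in>J d. gact (M d) g ((\<psi>, i, j), r) * f r) = (\<Sum>k\<in>I \<psi>. gact (X \<psi>) g (j, k) * f (\<psi>, i, k))"
  using assms
  by (subst sum_support[OF finJ, of "\<lambda>k. (\<psi>, i, k)" "I \<psi>"]) (auto simp: J_iff act_apply inj_on_def split: if_splits)

lemma act_col:
  assumes "(\<psi>, i, j) \<in> J d" shows "(\<Sum>r\<in>J d. f r * gact (M d) g (r, (\<psi>, i, j))) = (\<Sum>k\<in>I \<psi>. f (\<psi>, i, k) * gact (X \<psi>) g (k, j))"
  using assms
  by (subst sum_support[OF finJ, of "\<lambda>k. (\<psi>, i, k)" "I \<psi>"]) (auto simp: J_iff act_apply inj_on_def split: if_splits)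

lemma bd_apply: "bd a ((\<psi>', i', j'), (\<psi>, i, j)) =
    (if \<psi> \<in> Irr \<Gamma> \<and> \<psi> = \<psi>' \<and> j \<in> I \<psi> \<and> j' = j then a \<psi> (i', i) else 0)"
  by (auto simp: blockmat_def mone_apply)

lemma bd_mats: "dmats d' d a \<Longrightarrow> bd a \<in> mats (J d') (J d)"
  by (intro matsI) (auto simp: bd_apply J_iff, (metis lessThan_iff matsD)+)

lemma bd_row:
  assumes "\<psi> \<in> Irr \<Gamma>" "j \<in> I \<psi>" shows "(\<Sum>r\<in>J d. bd a ((\<psi>, i, j), r) * f r) = (\<Sum>k<d \<psi>. a \<psi> (i, k) * f (\<psi>, k, j))"
  using assms
  by (subst sum_support[OF finJ, of "\<lambda>k. (\<psi>, k, j)" "{..<d \<psi>}"]) (auto simp: J_iff bd_apply inj_on_def split: if_splits)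

lemma bd_col:
  assumes "\<psi> \<in> Irr \<Gamma>" "j \<in> I \<psi>" shows "(\<Sum>r\<in>J d. f r * bd a (r, (\<psi>, i, j))) = (\<Sum>k<d \<psi>. f (\<psi>, k, j) * a \<psi> (k, i))"
  using assms
  by (subst sum_support[OF finJ, of "\<lambda>k. (\<psi>, k, j)" "{..<d \<psi>}"]) (auto simp: J_iff bd_apply inj_on_def split: if_splits)

lemma bd_cong: "(\<And>\<psi>. \<psi> \<in> Irr \<Gamma> \<Longrightarrow> a \<psi> = b \<psi>) \<Longrightarrow> bd a = bd b"
  by (auto simp: blockmat_def fun_eq_iff)

lemma bd_eqI:
  assumes "A \<in> mats (J d') (J d)" "dmats d' d a"
    "\<And>\<psi> i j \<psi>' i' j'. (\<psi>', i', j') \<in> J d' \<Longrightarrow> (\<psi>, i, j) \<in> J d \<Longrightarrow>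
      A ((\<psi>', i', j'), (\<psi>, i, j)) = (if \<psi> = \<psi>' \<and> j' = j then a \<psi> (i', i) else 0)"
  shows "A = bd a"
proof (rule mats_eqI[OF assms(1) bd_mats[OF assms(2)]])
  fix p q assume pq: "p \<in> J d'" "q \<in> J d"
  obtain \<psi>' i' j' where p: "p = (\<psi>', i', j')" by (cases p)
  obtain \<psi> i j where q: "q = (\<psi>, i, j)" by (cases q)
  show "A (p, q) = bd a (p, q)" using assms(3)[of \<psi>' i' j' \<psi> i j] pq unfolding p q by (auto simp: J_iff bd_apply)
qed

lemma bd_inj:
  assumes "bd a = bd b" "dmats d' d a" "dmats d' d b" "\<psi> \<in> Irr \<Gamma>"
  shows "a \<psi> = b \<psi>"
proof (rule mats_eqI)
  fix i' i
  have "bd a ((\<psi>, i', 0), (\<psi>, i, 0)) = bd b ((\<psi>, i', 0), (\<psi>, i, 0))" using assms(1) by simp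
  then show "a \<psi> (i', i) = b \<psi> (i', i)" using assms(4) zero_idx by (simp add: bd_apply)
qed (use assms in auto)

lemma bd_mmul:
  assumes "dmats d'' d' a" "dmats d' d b"
  shows "mmul (J d') (bd a) (bd b) = bd (\<lambda>\<psi>. mmul {..<d' \<psi>} (a \<psi>) (b \<psi>))"
proof (rule bd_eqI)
  show "mmul (J d') (bd a) (bd b) \<in> mats (J d'') (J d)" by (intro mmul_mats bd_mats assms)
  show "dmats d'' d (\<lambda>\<psi>. mmul {..<d' \<psi>} (a \<psi>) (b \<psi>))" using assms mmul_mats by blast
qed (auto simp: mmul_apply bd_row bd_apply J_iff)

lemma bd_mone: "mone (J d) = bd (\<lambda>\<psi>. mone {..<d \<psi>})"
  by (rule bd_eqI[of _ d d]) (auto simp: mone_mats mone_apply J_iff)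

lemma bd_linear: "bd a - bd b = bd (\<lambda>\<psi>. a \<psi> - b \<psi>)" "bd a + bd b = bd (\<lambda>\<psi>. a \<psi> + b \<psi>)"
  "cscale c (bd a) = bd (\<lambda>\<psi>. cscale c (a \<psi>))"
  by (auto simp: blockmat_def cscale_def fun_eq_iff algebra_simps)

text \<open>Fixing both multiplicity indices amounts to composing with the inclusion of one copy of
  \<open>X \<psi>\<close> and the projection to one copy of \<open>X \<psi>'\<close>.\<close>

lemma ghom_block:
  assumes A: "A \<in> ghom \<Gamma> (M d) (M d')" and \<psi>: "\<psi> \<in> Irr \<Gamma>" "i < d \<psi>" and \<psi>': "\<psi>' \<in> Irr \<Gamma>" "i' < d' \<psi>'"
  shows "(\<lambda>(j', j). A ((\<psi>', i', j'), (\<psi>, i, j))) \<in> ghom \<Gamma> (X \<psi>) (X \<psi>')" (is "?B \<in> _")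
proof (rule ghomI)
  show Bm: "?B \<in> mats (I \<psi>') (I \<psi>)"
    using matsD[OF ghomD(1)[OF A]] by (intro matsI) (auto simp: J_iff)
  fix g assume g: "g \<in> \<Gamma>"
  show "mmul (I \<psi>) ?B (gact (X \<psi>) g) = mmul (I \<psi>') (gact (X \<psi>') g) ?B"
  proof (rule mats_eqI)
    show "mmul (I \<psi>) ?B (gact (X \<psi>) g) \<in> mats (I \<psi>') (I \<psi>)"
      "mmul (I \<psi>') (gact (X \<psi>') g) ?B \<in> mats (I \<psi>') (I \<psi>)"
      using Bm g is_gmoduleD(2)[OF gm] \<psi> \<psi>' mmul_mats by blast+
    fix j' j assume j: "j' \<in> I \<psi>'" "j \<in> I \<psi>"
    have "mmul (J d) A (gact (M d) g) ((\<psi>', i', j'), (\<psi>, i, j))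
        = mmul (J d') (gact (M d') g) A ((\<psi>', i', j'), (\<psi>, i, j))"
      using ghomD(2)[OF A g] by simp
    then show "mmul (I \<psi>) ?B (gact (X \<psi>) g) (j', j) = mmul (I \<psi>') (gact (X \<psi>') g) ?B (j', j)"
      using j \<psi> \<psi>' by (simp add: mmul_apply act_col act_row J_iff)
  qed
qed

lemma ghom_bd:
  assumes A: "A \<in> ghom \<Gamma> (M d) (M d')"
  obtains a where "dmats d' d a" "A = bd a"
proof -
  \<comment> \<open>By Schur's lemma each diagonal block is a scalar matrix, so its entry at
    \<open>(0, 0)\<close> is that scalar.\<close>
  define a where "a \<psi> = (\<lambda>(i', i). if i' < d' \<psi> \<and> i < d \<psi> then A ((\<psi>, i', 0), (\<psi>, i, 0)) else 0)" for \<psi>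
  have a: "dmats d' d a" by (auto simp: a_def intro!: matsI split: if_splits)
  have "A = bd a"
  proof (rule bd_eqI[OF ghomD(1)[OF A] a, simplified J_iff])
    fix \<psi> i j \<psi>' i' j' assume *: "\<psi>' \<in> Irr \<Gamma> \<and> i' < d' \<psi>' \<and> j' \<in> I \<psi>'" "\<psi> \<in> Irr \<Gamma> \<and> i < d \<psi> \<and> j \<in> I \<psi>"
    let ?B = "\<lambda>(j', j). A ((\<psi>', i', j'), (\<psi>, i, j))"
    have B: "?B \<in> ghom \<Gamma> (X \<psi>) (X \<psi>')" using ghom_block[OF A] * by blast
    show "A ((\<psi>', i', j'), (\<psi>, i, j)) = (if \<psi> = \<psi>' \<and> j' = j then a \<psi> (i', i) else 0)"
    proof (cases "\<psi> = \<psi>'")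
      case True
      then obtain c where c: "?B = cscale c (mone (I \<psi>))" using schur(2)[OF _ _ B] * by blast
      have "?B (k', k) = (if k \<in> I \<psi> \<and> k' = k then c else 0)" for k' k
        unfolding c by (auto simp: cscale_def mone_apply)
      then show ?thesis using True * zero_idx[of \<psi>] by (simp add: a_def)
    next
      case False
      then have "?B = 0" using schur(1)[OF _ _ B] * by blast
      then have "?B (j', j) = 0" by simp
      then show ?thesis using False by simp
    qed
  qed
  then show thesis using that a by blast
qed

lemma bd_ghom: assumes "dmats d' d a" shows "bd a \<in> ghom \<Gamma> (M d) (M d')"
proof (rule ghomI)
  fix g assume g: "g \<in> \<Gamma>"
  show "mmul (J d) (bd a) (gact (M d) g) = mmul (J d') (gact (M d') g) (bd a)"
  proof (rule mats_eqI)
    show "mmul (J d) (bd a) (gact (M d) g) \<in> mats (J d') (J d)"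
      "mmul (J d') (gact (M d') g) (bd a) \<in> mats (J d') (J d)"
      by (intro mmul_mats bd_mats assms act_mats g)+
    fix p q assume pq: "p \<in> J d'" "q \<in> J d"
    obtain \<psi>' i' j' where p: "p = (\<psi>', i', j')" by (cases p)
    obtain \<psi> i j where q: "q = (\<psi>, i, j)" by (cases q)
    show "mmul (J d) (bd a) (gact (M d) g) (p, q) = mmul (J d') (gact (M d') g) (bd a) (p, q)"
      using pq unfolding p q mmul_apply
      by (simp add: act_col act_row) (cases "\<psi> = \<psi>'"; simp add: bd_apply J_iff mult_delta_left mult_delta_right finI)
  qed
qed (rule bd_mats[OF assms])

text \<open>The group acts on \<open>k\<close> and on the module indices but never on the
  multiplicity indices, so equivariance decouples into blocks. One direction shows that the functor
  produces equivariant maps, the other lets each block be expanded in the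
  \<open>y h\<close>.\<close>

lemma tensor_block_iff:
  assumes D: "D \<in> mats (J d) (UNIV \<times> J d)"
  shows "D \<in> ghom \<Gamma> (gtensor Xstd (M d)) (M d) \<longleftrightarrow>
    (\<forall>\<psi>\<in>Irr \<Gamma>. \<forall>i<d \<psi>. \<forall>\<psi>'\<in>Irr \<Gamma>. \<forall>i'<d \<psi>'.
       (\<lambda>(j', (k, j)). D ((\<psi>', i', j'), (k, (\<psi>, i, j)))) \<in> ghom \<Gamma> (gtensor Xstd (X \<psi>)) (X \<psi>'))"
proof -
  let ?B = "\<lambda>\<psi> i \<psi>' i'. \<lambda>(j', (k, j)). D ((\<psi>', i', j'), (k, (\<psi>, i, j)))"
  note gi = gidx_gtensor_Xstd
  have left: "mmul (UNIV \<times> J d) D (gact (gtensor Xstd (M d)) g) ((\<psi>', i', j'), (k, (\<psi>, i, j)))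
    = mmul (UNIV \<times> I \<psi>) (?B \<psi> i \<psi>' i') (gact (gtensor Xstd (X \<psi>)) g) (j', (k, j))"
    if "(\<psi>, i, j) \<in> J d" for g \<psi> i j \<psi>' i' j' k
  proof -
    have "(\<Sum>r\<in>J d. D ((\<psi>', i', j'), (l, r)) * (g $ l $ k * gact (M d) g (r, (\<psi>, i, j))))
      = (\<Sum>k'\<in>I \<psi>. D ((\<psi>', i', j'), (l, (\<psi>, i, k'))) * (g $ l $ k * gact (X \<psi>) g (k', j)))" for l
      using act_col[OF that, of "\<lambda>r. D ((\<psi>', i', j'), (l, r)) * g $ l $ k" g] by (simp add: mult.assoc)
    then show ?thesis by (simp add: mmul_apply sum.cartesian_product' gtensor_def Xstd_def kron_apply)
  qed
  have right: "mmul (J d) (gact (M d) g) D ((\<psi>', i', j'), (k, (\<psi>, i, j)))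
    = mmul (I \<psi>') (gact (X \<psi>') g) (?B \<psi> i \<psi>' i') (j', (k, j))"
    if "(\<psi>', i', j') \<in> J d" for g \<psi> i j \<psi>' i' j' k
    using act_row[OF that] by (simp add: mmul_apply)
  have Bm: "?B \<psi> i \<psi>' i' \<in> mats (I \<psi>') (UNIV \<times> I \<psi>)" if "\<psi> \<in> Irr \<Gamma>" "\<psi>' \<in> Irr \<Gamma>" for \<psi> i \<psi>' i'
  proof (rule matsI)
    fix a and q :: "2 \<times> nat" assume *: "a \<notin> I \<psi>' \<or> q \<notin> UNIV \<times> I \<psi>"
    obtain k j where "q = (k, j)" by fastforce
    then show "?B \<psi> i \<psi>' i' (a, q) = 0"
      using * matsD[OF D, of "(\<psi>', i', a)" "(k, (\<psi>, i, j))"] by (auto simp: J_iff)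
  qed
  have gtM: "gact (gtensor Xstd (M d)) g \<in> mats (UNIV \<times> J d) (UNIV \<times> J d)" if "g \<in> \<Gamma>" for g
    using kron_mats[OF is_gmoduleD(2)[OF gmodule_Xstd that] act_mats[OF that]]
    by (simp add: gtensor_def Xstd_def)
  have gtX: "gact (gtensor Xstd (X \<psi>)) g \<in> mats (UNIV \<times> I \<psi>) (UNIV \<times> I \<psi>)" if "g \<in> \<Gamma>" "\<psi> \<in> Irr \<Gamma>" for g \<psi>
    using kron_mats[OF is_gmoduleD(2)[OF gmodule_Xstd that(1)] is_gmoduleD(2)[OF gm[OF that(2)] that(1)]]
    by (simp add: gtensor_def Xstd_def)
  show ?thesis
  proof
    assume Dg: "D \<in> ghom \<Gamma> (gtensor Xstd (M d)) (M d)"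
    show "\<forall>\<psi>\<in>Irr \<Gamma>. \<forall>i<d \<psi>. \<forall>\<psi>'\<in>Irr \<Gamma>. \<forall>i'<d \<psi>'. ?B \<psi> i \<psi>' i' \<in> ghom \<Gamma> (gtensor Xstd (X \<psi>)) (X \<psi>')"
    proof (intro ballI allI impI ghomI)
      fix \<psi> i \<psi>' i' assume \<psi>: "\<psi> \<in> Irr \<Gamma>" "i < d \<psi>" "\<psi>' \<in> Irr \<Gamma>" "i' < d \<psi>'"
      show Bm': "?B \<psi> i \<psi>' i' \<in> mats (I \<psi>') (gidx (gtensor Xstd (X \<psi>)))" unfolding gi by (rule Bm[OF \<psi>(1,3)])
      fix g assume g: "g \<in> \<Gamma>"
      show "mmul (gidx (gtensor Xstd (X \<psi>))) (?B \<psi> i \<psi>' i') (gact (gtensor Xstd (X \<psi>)) g)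
         = mmul (I \<psi>') (gact (X \<psi>') g) (?B \<psi> i \<psi>' i')"
      proof (rule mats_eqI)
        show "mmul (gidx (gtensor Xstd (X \<psi>))) (?B \<psi> i \<psi>' i') (gact (gtensor Xstd (X \<psi>)) g) \<in> mats (I \<psi>') (UNIV \<times> I \<psi>)"
          unfolding gi by (rule mmul_mats[OF Bm[OF \<psi>(1,3)] gtX[OF g \<psi>(1)]])
        show "mmul (I \<psi>') (gact (X \<psi>') g) (?B \<psi> i \<psi>' i') \<in> mats (I \<psi>') (UNIV \<times> I \<psi>)"
          by (rule mmul_mats[OF is_gmoduleD(2)[OF gm[OF \<psi>(3)] g] Bm[OF \<psi>(1,3)]])
        fix j' and q :: "2 \<times> nat" assume j: "j' \<in> I \<psi>'" "q \<in> UNIV \<times> I \<psi>"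
        then obtain k j where q: "q = (k, j)" "j \<in> I \<psi>" by blast
        have "mmul (UNIV \<times> J d) D (gact (gtensor Xstd (M d)) g) ((\<psi>', i', j'), (k, (\<psi>, i, j)))
          = mmul (J d) (gact (M d) g) D ((\<psi>', i', j'), (k, (\<psi>, i, j)))"
          using ghomD(2)[OF Dg g] unfolding gi by (rule fun_cong)
        then show "mmul (gidx (gtensor Xstd (X \<psi>))) (?B \<psi> i \<psi>' i') (gact (gtensor Xstd (X \<psi>)) g) (j', q)
          = mmul (I \<psi>') (gact (X \<psi>') g) (?B \<psi> i \<psi>' i') (j', q)"
          using left[of \<psi> i j] right[of \<psi>' i' j'] \<psi> j q unfolding gi q by (simp add: J_iff)
      qed
    qed
  next
    assume *: "\<forall>\<psi>\<in>Irr \<Gamma>. \<forall>i<d \<psi>. \<forall>\<psi>'\<in>Irr \<Gamma>. \<forall>i'<d \<psi>'. ?B \<psi> i \<psi>' i' \<in> ghom \<Gamma> (gtensor Xstd (X \<psi>)) (X \<psi>')"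
    show "D \<in> ghom \<Gamma> (gtensor Xstd (M d)) (M d)"
    proof (rule ghomI)
      show "D \<in> mats (J d) (gidx (gtensor Xstd (M d)))" using D by (simp add: gi)
      fix g assume g: "g \<in> \<Gamma>"
      show "mmul (gidx (gtensor Xstd (M d))) D (gact (gtensor Xstd (M d)) g) = mmul (J d) (gact (M d) g) D"
      proof (rule mats_eqI)
        show "mmul (gidx (gtensor Xstd (M d))) D (gact (gtensor Xstd (M d)) g) \<in> mats (J d) (UNIV \<times> J d)"
          unfolding gi by (rule mmul_mats[OF D gtM[OF g]])
        show "mmul (J d) (gact (M d) g) D \<in> mats (J d) (UNIV \<times> J d)" by (rule mmul_mats[OF act_mats[OF g] D])
        fix p and q :: "2 \<times> chr \<times> nat \<times> nat" assume pq: "p \<in> J d" "q \<in> UNIV \<times> J d"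
        obtain \<psi>' i' j' where p: "p = (\<psi>', i', j')" by (cases p)
        obtain k \<psi> i j where q: "q = (k, (\<psi>, i, j))" by (metis surj_pair)
        have J: "(\<psi>', i', j') \<in> J d" "(\<psi>, i, j) \<in> J d" using pq p q by auto
        then have "?B \<psi> i \<psi>' i' \<in> ghom \<Gamma> (gtensor Xstd (X \<psi>)) (X \<psi>')" using * by (simp add: J_iff)
        from ghomD(2)[OF this g]
        show "mmul (gidx (gtensor Xstd (M d))) D (gact (gtensor Xstd (M d)) g) (p, q) = mmul (J d) (gact (M d) g) D (p, q)"
          using left[OF J(2)] right[OF J(1)] unfolding gi p q by simp
      qed
    qed
  qed
qed

end

section \<open>The isomorphism of representation spaces\<close>

text \<open>Separates the multiplicity index \<open>i\<close> from the module index \<open>j\<close>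
  in the composite of two sums of pure tensors.\<close>

lemma sum_mult_swap:
  fixes A B Y Z :: "_ \<Rightarrow> _ \<Rightarrow> 'r :: comm_semiring_0"
  shows "(\<Sum>i\<in>S. \<Sum>j\<in>T. (\<Sum>h\<in>U. A h i * Y h j) * (\<Sum>k\<in>V. B k i * Z k j))
    = (\<Sum>h\<in>U. \<Sum>k\<in>V. (\<Sum>i\<in>S. A h i * B k i) * (\<Sum>j\<in>T. Y h j * Z k j))"
proof -
  let ?t = "\<lambda>i j h k. (A h i * Y h j) * (B k i * Z k j)"
  have "(\<Sum>i\<in>S. \<Sum>j\<in>T. (\<Sum>h\<in>U. A h i * Y h j) * (\<Sum>k\<in>V. B k i * Z k j))
    = (\<Sum>i\<in>S. \<Sum>j\<in>T. \<Sum>h\<in>U. \<Sum>k\<in>V. ?t i j h k)"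
    by (simp only: sum_product)
  also have "\<dots> = (\<Sum>i\<in>S. \<Sum>h\<in>U. \<Sum>j\<in>T. \<Sum>k\<in>V. ?t i j h k)" by (intro sum.cong refl sum.swap)
  also have "\<dots> = (\<Sum>h\<in>U. \<Sum>i\<in>S. \<Sum>j\<in>T. \<Sum>k\<in>V. ?t i j h k)" by (rule sum.swap)
  also have "\<dots> = (\<Sum>h\<in>U. \<Sum>i\<in>S. \<Sum>k\<in>V. \<Sum>j\<in>T. ?t i j h k)" by (intro sum.cong refl sum.swap)
  also have "\<dots> = (\<Sum>h\<in>U. \<Sum>k\<in>V. \<Sum>i\<in>S. \<Sum>j\<in>T. ?t i j h k)" by (intro sum.cong refl sum.swap)
  also have "\<dots> = (\<Sum>h\<in>U. \<Sum>k\<in>V. (\<Sum>i\<in>S. A h i * B k i) * (\<Sum>j\<in>T. Y h j * Z k j))"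
    by (simp only: sum_product mult_ac)
  finally show ?thesis .
qed

lemma minv_eq:
  assumes "finite I" "A \<in> mats I I" "B \<in> mats I I" "mmul I A B = mone I" "mmul I B A = mone I"
  shows "minv I A = B"
  unfolding minv_def
proof (rule the_equality)
  fix C assume C: "C \<in> mats I I \<and> mmul I A C = mone I \<and> mmul I C A = mone I"
  have "C = mmul I C (mmul I A B)" using C assms mmul_mone_right by metis
  also have "\<dots> = B" using C assms mmul_mone_left mmul_assoc by metis
  finally show "C = B" .
qed (use assms in blast)

lemma mGL_minv:
  assumes "finite I" "A \<in> mGL I"
  shows "minv I A \<in> mats I I" "mmul I A (minv I A) = mone I" "mmul I (minv I A) A = mone I" "A \<in> mats I I"
proof -
  obtain B where "A \<in> mats I I" "B \<in> mats I I" "mmul I A B = mone I" "mmul I B A = mone I"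
    using assms by (auto simp: mGL_def)
  then show "minv I A \<in> mats I I" "mmul I A (minv I A) = mone I" "mmul I (minv I A) A = mone I" "A \<in> mats I I"
    using minv_eq[OF assms(1)] by auto
qed

section \<open>The functor on representation spaces, moment maps and characters\<close>

context mckay begin

lemma sum_J: "(\<Sum>r\<in>J d. f r) = (\<Sum>\<psi>\<in>Irr \<Gamma>. \<Sum>i<d \<psi>. \<Sum>j\<in>I \<psi>. f (\<psi>, i, j))"
proof -
  have "(\<Sum>r\<in>J d. f r) = (\<Sum>(\<psi>, q)\<in>(SIGMA \<psi>:Irr \<Gamma>. {..<d \<psi>} \<times> I \<psi>). f (\<psi>, q))"
    by (simp add: F_module_def split_def)
  also have "\<dots> = (\<Sum>\<psi>\<in>Irr \<Gamma>. \<Sum>q\<in>{..<d \<psi>} \<times> I \<psi>. f (\<psi>, q))"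
    using finIrr finI by (intro sum.Sigma[symmetric]) auto
  finally show ?thesis by (simp add: sum.cartesian_product')
qed

definition F_Delta :: "('e \<times> bool \<Rightarrow> (nat, nat) cmat) \<Rightarrow> (chr \<times> nat \<times> nat, 2 \<times> chr \<times> nat \<times> nat) cmat" where
  "F_Delta x = (\<lambda>((\<psi>', i', j'), (k, (\<psi>, i, j))). \<Sum>h\<in>arr \<psi> \<psi>'. x h (i', i) * y h (j', (k, j)))"

abbreviation "Fm \<equiv> F_map \<Gamma> X Q y"

lemma Fm_apply: "Fm (x, v1, v2) = (F_Delta x, bd (\<lambda>\<psi>. cscale (1 / of_nat (n \<psi>)) (v1 \<psi>)), bd v2)"
  unfolding F_map_def F_Delta_def arr_def blockmat_def cscale_def by (auto intro!: ext split: prod.splits)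

abbreviation "xgood d x \<equiv> (\<forall>h\<in>Ar. x h \<in> mats {..<d (tgt h)} {..<d (src h)}) \<and> (\<forall>h. h \<notin> Ar \<longrightarrow> x h = 0)"

lemma nak_space_iff: "(x, v1, v2) \<in> nak_space Q d df \<longleftrightarrow> xgood d x \<and> dmats d df v1 \<and> dmats df d v2 \<and>
    (\<forall>\<psi>. \<psi> \<notin> Irr \<Gamma> \<longrightarrow> v1 \<psi> = 0 \<and> v2 \<psi> = 0)"
  unfolding nak_space_def verts by auto

lemma F_Delta_mats: assumes "xgood d x" shows "F_Delta x \<in> mats (J d) (UNIV \<times> J d)"
proof (rule matsI)
  fix p and q :: "2 \<times> chr \<times> nat \<times> nat" assume pq: "p \<notin> J d \<or> q \<notin> UNIV \<times> J d"
  obtain \<psi>' i' j' where p: "p = (\<psi>', i', j')" by (cases p)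
  obtain k \<psi> i j where q: "q = (k, (\<psi>, i, j))" by (metis surj_pair)
  have "x h (i', i) * y h (j', (k, j)) = 0" if "h \<in> arr \<psi> \<psi>'" for h
  proof -
    have h: "h \<in> Ar" "src h = \<psi>" "tgt h = \<psi>'" using that by (auto simp: arr_def)
    have "x h \<in> mats {..<d \<psi>'} {..<d \<psi>}" "y h \<in> mats (I \<psi>') (UNIV \<times> I \<psi>)"
      using assms h y_mats[OF h(1)] by auto
    moreover have "\<psi> \<in> Irr \<Gamma>" "\<psi>' \<in> Irr \<Gamma>" using src_Irr[OF h(1)] tgt_Irr[OF h(1)] h by auto
    moreover have "\<not> i' < d \<psi>' \<or> \<not> i < d \<psi> \<or> j' \<notin> I \<psi>' \<or> j \<notin> I \<psi>"
      using pq calculation(3,4) by (auto simp: p q J_iff)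
    ultimately show ?thesis using matsD[of "x h" _ _ i' i] matsD[of "y h" _ _ j' "(k, j)"] by auto
  qed
  then have "(\<Sum>h\<in>arr \<psi> \<psi>'. x h (i', i) * y h (j', (k, j))) = 0" by (rule sum.neutral[OF ballI])
  then show "F_Delta x (p, q) = 0" by (simp add: p q F_Delta_def)
qed

lemma F_Delta_ghom: assumes "xgood d x" shows "F_Delta x \<in> ghom \<Gamma> (gtensor Xstd (M d)) (M d)"
  unfolding tensor_block_iff[OF F_Delta_mats[OF assms]]
proof (intro ballI allI impI)
  fix \<psi> i \<psi>' i' assume \<psi>: "\<psi> \<in> Irr \<Gamma>" "\<psi>' \<in> Irr \<Gamma>"
  have "(\<lambda>(j', (k, j)). F_Delta x ((\<psi>', i', j'), (k, (\<psi>, i, j)))) = (\<Sum>h\<in>arr \<psi> \<psi>'. cscale (x h (i', i)) (y h))"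
    by (auto simp: F_Delta_def fun_eq_iff sum_apply cscale_def)
  also have "\<dots> \<in> ghom \<Gamma> (gtensor Xstd (X \<psi>)) (X \<psi>')"
    by (intro cfun.subspace_sum[OF subspace_ghom] cfun.subspace_scale[OF subspace_ghom] arr_ghom)
  finally show "(\<lambda>(j', (k, j)). F_Delta x ((\<psi>', i', j'), (k, (\<psi>, i, j)))) \<in> ghom \<Gamma> (gtensor Xstd (X \<psi>)) (X \<psi>')" .
qed

text \<open>Pairing with a dual family recovers \<open>x\<close> from its image, so the inverse of the functor on
  representation spaces is given by linear functions of the coordinates.\<close>

definition dual_y where "dual_y = (SOME dual_y. \<forall>h\<in>Ar. \<forall>h'\<in>Ar. src h = src h' \<longrightarrow> tgt h = tgt h' \<longrightarrow>
     (\<Sum>k\<in>I (tgt h) \<times> (UNIV \<times> I (src h)). dual_y h k * y h' k) = (if h = h' then 1 else 0))"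

lemma dual_y: "h \<in> Ar \<Longrightarrow> h' \<in> Ar \<Longrightarrow> src h = src h' \<Longrightarrow> tgt h = tgt h' \<Longrightarrow>
     (\<Sum>k\<in>I (tgt h) \<times> (UNIV \<times> I (src h)). dual_y h k * y h' k) = (if h = h' then 1 else 0)"
proof -
  have "\<exists>dual_y. \<forall>h\<in>Ar. \<forall>h'\<in>Ar. src h = src h' \<longrightarrow> tgt h = tgt h' \<longrightarrow>
     (\<Sum>k\<in>I (tgt h) \<times> (UNIV \<times> I (src h)). dual_y h k * y h' k) = (if h = h' then 1 else 0)"
    by (rule y_dual) blast
  from someI_ex[OF this, folded dual_y_def]
  show "h \<in> Ar \<Longrightarrow> h' \<in> Ar \<Longrightarrow> src h = src h' \<Longrightarrow> tgt h = tgt h' \<Longrightarrow>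
     (\<Sum>k\<in>I (tgt h) \<times> (UNIV \<times> I (src h)). dual_y h k * y h' k) = (if h = h' then 1 else 0)" by blast
qed

definition coef :: "(chr \<times> nat \<times> nat, 2 \<times> chr \<times> nat \<times> nat) cmat \<Rightarrow> 'e \<times> bool \<Rightarrow> nat \<Rightarrow> nat \<Rightarrow> complex" where
  "coef D h i' i = (\<Sum>k\<in>I (tgt h) \<times> (UNIV \<times> I (src h)). dual_y h k * D ((tgt h, i', fst k), (fst (snd k), (src h, i, snd (snd k)))))"

lemma coef_F_Delta: assumes h: "h \<in> Ar" shows "coef (F_Delta x) h i' i = x h (i', i)"
proof -
  let ?K = "I (tgt h) \<times> ((UNIV :: 2 set) \<times> I (src h))" and ?H = "arr (src h) (tgt h)"
  have "coef (F_Delta x) h i' i = (\<Sum>k\<in>?K. \<Sum>h'\<in>?H. x h' (i', i) * (dual_y h k * y h' k))"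
    by (simp add: coef_def F_Delta_def sum_distrib_left mult_ac)
  also have "\<dots> = (\<Sum>h'\<in>?H. x h' (i', i) * (\<Sum>k\<in>?K. dual_y h k * y h' k))"
    by (subst sum.swap) (simp add: sum_distrib_left)
  also have "\<dots> = (\<Sum>h'\<in>?H. x h' (i', i) * (if h = h' then 1 else 0))"
  proof (intro sum.cong refl)
    fix h' assume "h' \<in> ?H"
    then show "x h' (i', i) * (\<Sum>k\<in>?K. dual_y h k * y h' k) = x h' (i', i) * (if h = h' then 1 else 0)"
      using dual_y[OF h, of h'] by (auto simp: arr_def)
  qed
  also have "\<dots> = x h (i', i)"
  proof -
    have "h \<in> ?H" using h by (simp add: arr_def)
    then show ?thesis using sum.delta'[OF finarr, of h "\<lambda>h'. x h' (i', i)" "src h" "tgt h"]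
      by (simp add: mult_delta_right cong: if_cong)
  qed
  finally show ?thesis .
qed

text \<open>The candidate is read off with \<open>coef\<close> and cut to the index ranges that
  \<open>xgood\<close> demands. Each block of \<open>D\<close> expands in the arrow maps, and
  \<open>coef\<close> returns exactly the expansion coefficients.\<close>

lemma F_Delta_surj:
  assumes D: "D \<in> ghom \<Gamma> (gtensor Xstd (M d)) (M d)"
  shows "\<exists>x. xgood d x \<and> F_Delta x = D"
proof (intro exI conjI)
  let ?x = "\<lambda>h. \<lambda>(i', i). if h \<in> Ar \<and> i' < d (tgt h) \<and> i < d (src h) then coef D h i' i else 0"
  show good: "\<forall>h\<in>Ar. ?x h \<in> mats {..<d (tgt h)} {..<d (src h)}" "\<forall>h. h \<notin> Ar \<longrightarrow> ?x h = 0"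
    by (auto simp: fun_eq_iff intro!: matsI split: if_splits)
  have Dm: "D \<in> mats (J d) (UNIV \<times> J d)" using ghomD(1)[OF D] by (simp add: gtensor_def Xstd_def)
  have "F_Delta ?x \<in> mats (J d) (UNIV \<times> J d)" using good by (intro F_Delta_mats) blast
  then show "F_Delta ?x = D"
  proof (rule mats_eqI[OF _ Dm])
    fix p and q :: "2 \<times> chr \<times> nat \<times> nat" assume pq: "p \<in> J d" "q \<in> UNIV \<times> J d"
    obtain \<psi>' i' j' where p: "p = (\<psi>', i', j')" by (cases p)
    obtain k \<psi> i j where q: "q = (k, (\<psi>, i, j))" by (metis surj_pair)
    have \<psi>: "\<psi> \<in> Irr \<Gamma>" "\<psi>' \<in> Irr \<Gamma>" "i < d \<psi>" "i' < d \<psi>'" using pq by (auto simp: p q J_iff)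
    let ?B = "\<lambda>(j', (k, j)). D ((\<psi>', i', j'), (k, (\<psi>, i, j)))"
    have "?B \<in> ghom \<Gamma> (gtensor Xstd (X \<psi>)) (X \<psi>')"
      using D \<psi> unfolding tensor_block_iff[OF Dm] by blast
    then obtain c where c: "?B = (\<Sum>h\<in>arr \<psi> \<psi>'. cscale (c h) (y h))"
      using y_expand[OF \<psi>(1,2)] by blast
    have B: "D ((\<psi>', i', a), (b, (\<psi>, i, e))) = (\<Sum>h\<in>arr \<psi> \<psi>'. c h * y h (a, (b, e)))" for a b e
      using fun_cong[OF c, of "(a, (b, e))"] by (simp add: sum_apply cscale_def)
    have "?x h (i', i) = c h" if h: "h \<in> arr \<psi> \<psi>'" for h
    proof -
      have hA: "h \<in> Ar" "src h = \<psi>" "tgt h = \<psi>'" using h by (auto simp: arr_def)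
      \<comment> \<open>For this fixed block the coefficients \<open>c h\<close> are viewed as
        constant matrices, so that \<open>coef_F_Delta\<close> applies.\<close>
      have "coef D h i' i = coef (F_Delta (\<lambda>h _. c h)) h i' i"
        by (simp add: coef_def hA B F_Delta_def)
      then show ?thesis using coef_F_Delta[OF hA(1)] hA \<psi> by simp
    qed
    then show "F_Delta ?x (p, q) = D (p, q)" by (simp add: p q F_Delta_def B cong: sum.cong)
  qed
qed

lemma F_bij: "bij_betw Fm (nak_space Q d df) (gm_space \<Gamma> (M d) (M df))"
  unfolding bij_betw_def
proof
  show "inj_on Fm (nak_space Q d df)"
  proof (rule inj_onI)
    fix p q assume p: "p \<in> nak_space Q d df" and q: "q \<in> nak_space Q d df" and eq: "Fm p = Fm q"
    obtain x v1 v2 where p': "p = (x, v1, v2)" by (cases p)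
    obtain x' v1' v2' where q': "q = (x', v1', v2')" by (cases q)
    note P = p[unfolded p' nak_space_iff] and Qs = q[unfolded q' nak_space_iff]
    have E: "F_Delta x = F_Delta x'" "bd (\<lambda>\<psi>. cscale (1 / of_nat (n \<psi>)) (v1 \<psi>)) = bd (\<lambda>\<psi>. cscale (1 / of_nat (n \<psi>)) (v1' \<psi>))" "bd v2 = bd v2'"
      using eq unfolding p' q' Fm_apply by auto
    have "x h = x' h" for h
    proof (cases "h \<in> Ar")
      case True
      have "x h (i', i) = x' h (i', i)" for i' i using coef_F_Delta[OF True] E(1) by metis
      then show ?thesis by (auto simp: fun_eq_iff)
    qed (use P Qs in metis)
    moreover have "v1 \<psi> = v1' \<psi> \<and> v2 \<psi> = v2' \<psi>" for \<psi>
    proof (cases "\<psi> \<in> Irr \<Gamma>")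
      case True
      have "cscale (1 / of_nat (n \<psi>)) (v1 \<psi>) = cscale (1 / of_nat (n \<psi>)) (v1' \<psi>)"
        by (rule bd_inj[OF E(2) _ _ True, of d df]) (use P Qs mats_linear(3) in blast)+
      then have "v1 \<psi> = v1' \<psi>" using n_pos[OF True] by (auto simp: cscale_def fun_eq_iff)
      moreover have "v2 \<psi> = v2' \<psi>" by (rule bd_inj[OF E(3) _ _ True, of df d]) (use P Qs in blast)+
      ultimately show ?thesis by simp
    qed (use P Qs in metis)
    ultimately show "p = q" unfolding p' q' by auto
  qed
  show "Fm ` nak_space Q d df = gm_space \<Gamma> (M d) (M df)"
  proof
    show "Fm ` nak_space Q d df \<subseteq> gm_space \<Gamma> (M d) (M df)"
    proof
      fix z assume "z \<in> Fm ` nak_space Q d df"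
      then obtain x v1 v2 where p: "(x, v1, v2) \<in> nak_space Q d df" "z = Fm (x, v1, v2)" by auto
      note P = p(1)[unfolded nak_space_iff]
      have "dmats d df (\<lambda>\<psi>. cscale (1 / of_nat (n \<psi>)) (v1 \<psi>))" using P mats_linear(3) by blast
      from bd_ghom[OF this] show "z \<in> gm_space \<Gamma> (M d) (M df)"
        using P F_Delta_ghom[of x d] bd_ghom[where a = v2 and d' = df and d = d] unfolding p(2) Fm_apply gm_space_def by simp
    qed
    show "gm_space \<Gamma> (M d) (M df) \<subseteq> Fm ` nak_space Q d df"
    proof
      fix z assume "z \<in> gm_space \<Gamma> (M d) (M df)"
      then obtain D Z1 Z2 where z: "z = (D, Z1, Z2)" "D \<in> ghom \<Gamma> (gtensor Xstd (M d)) (M d)"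
        "Z1 \<in> ghom \<Gamma> (M df) (M d)" "Z2 \<in> ghom \<Gamma> (M d) (M df)" by (auto simp: gm_space_def)
      obtain x where x: "xgood d x" "F_Delta x = D" using F_Delta_surj[OF z(2)] by blast
      obtain a where a: "dmats d df a" "Z1 = bd a" by (rule ghom_bd[OF z(3)])
      obtain b where b: "dmats df d b" "Z2 = bd b" by (rule ghom_bd[OF z(4)])
      \<comment> \<open>The factor \<open>n \<psi>\<close> undoes the \<open>1 / n \<psi>\<close> in
        the first framing component; off \<open>Irr \<Gamma>\<close> the value has to be zero for a
        point of \<open>nak_space\<close>.\<close>
      let ?a = "\<lambda>\<psi>. if \<psi> \<in> Irr \<Gamma> then cscale (of_nat (n \<psi>)) (a \<psi>) else 0"
      let ?b = "\<lambda>\<psi>. if \<psi> \<in> Irr \<Gamma> then b \<psi> else 0"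
      have "(x, ?a, ?b) \<in> nak_space Q d df" using x a(1) b(1) unfolding nak_space_iff by (simp add: mats_linear(3))
      moreover have "bd (\<lambda>\<psi>. cscale (1 / of_nat (n \<psi>)) (?a \<psi>)) = bd a" "bd ?b = bd b"
        using n_pos by (auto intro!: bd_cong simp: cscale_def)
      then have "Fm (x, ?a, ?b) = z" unfolding Fm_apply z(1) x(2) a(2) b(2) by simp
      ultimately show "z \<in> Fm ` nak_space Q d df" by blast
    qed
  qed
qed

text \<open>The composite is a sum over composable pairs of arrows of a multiplicity factor times a
  wedge of arrow maps. \<open>wedge_arrow_maps\<close> leaves only the pairs of an arrow and its
  reverse, weighted by the sign and by \<open>1 / n\<close> of the target.\<close>

lemma F_Delta_wedge:
  assumes x: "xgood d x"
  shows "wedge (J d) (F_Delta x) (F_Delta x) = bd (\<lambda>\<psi>. cscale (1 / of_nat (n \<psi>)) (\<Sum>h | h \<in> Ar \<and> tgt h = \<psi>.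
        cscale (asign h) (mmul {..<d (src h)} (x h) (x (arev h)))))"
    and "dmats d d (\<lambda>\<psi>. (\<Sum>h | h \<in> Ar \<and> tgt h = \<psi>. cscale (asign h) (mmul {..<d (src h)} (x h) (x (arev h)))))"
proof -
  let ?m = "\<lambda>\<psi>. \<Sum>h | h \<in> Ar \<and> tgt h = \<psi>. cscale (asign h) (mmul {..<d (src h)} (x h) (x (arev h)))"
  have xx: "mmul {..<d (src h)} (x h) (x (arev h)) \<in> mats {..<d (tgt h)} {..<d (tgt h)}" if "h \<in> Ar" for h
    using x that arev(1,2,5)[of h] by (intro mmul_mats) auto
  then show dm: "dmats d d ?m" by (auto intro!: mats_sum mats_linear)
  have dm': "dmats d d (\<lambda>\<psi>. cscale (1 / of_nat (n \<psi>)) (?m \<psi>))" using dm mats_linear(3) by blast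
  show "wedge (J d) (F_Delta x) (F_Delta x) = bd (\<lambda>\<psi>. cscale (1 / of_nat (n \<psi>)) (?m \<psi>))"
  proof (rule bd_eqI[OF _ dm'])
    show "wedge (J d) (F_Delta x) (F_Delta x) \<in> mats (J d) (J d)"
      unfolding wedge_def by (intro mats_linear mmul_mats bcol_mats F_Delta_mats x)
    fix \<psi>'' i'' j'' \<psi> i j
    assume J: "(\<psi>, i, j) \<in> J d" "(\<psi>'', i'', j'') \<in> J d"
    have E: "mmul (J d) (bcol a (F_Delta x)) (bcol b (F_Delta x)) ((\<psi>, i, j), (\<psi>'', i'', j''))
      = (\<Sum>\<psi>'\<in>Irr \<Gamma>. \<Sum>h\<in>arr \<psi>' \<psi>. \<Sum>h2\<in>arr \<psi>'' \<psi>'. mmul {..<d \<psi>'} (x h) (x h2) (i, i'')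
          * mmul (I \<psi>') (bcol a (y h)) (bcol b (y h2)) (j, j''))" for a b
    proof -
      have "mmul (J d) (bcol a (F_Delta x)) (bcol b (F_Delta x)) ((\<psi>, i, j), (\<psi>'', i'', j''))
        = (\<Sum>\<psi>'\<in>Irr \<Gamma>. \<Sum>i'<d \<psi>'. \<Sum>j'\<in>I \<psi>'. (\<Sum>h\<in>arr \<psi>' \<psi>. x h (i, i') * y h (j, (a, j')))
            * (\<Sum>h2\<in>arr \<psi>'' \<psi>'. x h2 (i', i'') * y h2 (j', (b, j''))))"
        by (simp add: mmul_apply sum_J bcol_def F_Delta_def)
      also have "\<dots> = (\<Sum>\<psi>'\<in>Irr \<Gamma>. \<Sum>h\<in>arr \<psi>' \<psi>. \<Sum>h2\<in>arr \<psi>'' \<psi>'. (\<Sum>i'<d \<psi>'. x h (i, i') * x h2 (i', i''))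
          * (\<Sum>j'\<in>I \<psi>'. y h (j, (a, j')) * y h2 (j', (b, j''))))"
        by (intro sum.cong refl sum_mult_swap)
      finally show ?thesis by (simp add: mmul_apply bcol_def)
    qed
    have "wedge (J d) (F_Delta x) (F_Delta x) ((\<psi>, i, j), (\<psi>'', i'', j''))
      = (\<Sum>\<psi>'\<in>Irr \<Gamma>. \<Sum>h\<in>arr \<psi>' \<psi>. \<Sum>h2\<in>arr \<psi>'' \<psi>'. mmul {..<d \<psi>'} (x h) (x h2) (i, i'')
          * wedge (I \<psi>') (y h) (y h2) (j, j''))"
      unfolding wedge_def by (simp add: E sum_subtractf right_diff_distrib)
    also have "\<dots> = (\<Sum>\<psi>'\<in>Irr \<Gamma>. \<Sum>h\<in>arr \<psi>' \<psi>. if \<psi> = \<psi>'' \<and> j = j'' then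
         asign h / of_nat (n \<psi>) * mmul {..<d (src h)} (x h) (x (arev h)) (i, i'') else 0)"
    proof (intro sum.cong refl)
      fix \<psi>' h assume h: "h \<in> arr \<psi>' \<psi>"
      then have hA: "h \<in> Ar" "src h = \<psi>'" "tgt h = \<psi>" by (auto simp: arr_def)
      have "(\<Sum>h2\<in>arr \<psi>'' \<psi>'. mmul {..<d \<psi>'} (x h) (x h2) (i, i'') * wedge (I \<psi>') (y h) (y h2) (j, j''))
        = (\<Sum>h2\<in>arr \<psi>'' \<psi>'. if h2 = arev h then mmul {..<d \<psi>'} (x h) (x h2) (i, i'')
             * (asign h / of_nat (n \<psi>) * mone (I \<psi>) (j, j'')) else 0)"
      proof (intro sum.cong refl)
        fix h2 assume "h2 \<in> arr \<psi>'' \<psi>'"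
        then have "h2 \<in> Ar" "tgt h2 = src h" using hA by (auto simp: arr_def)
        from wedge_arrow_maps[OF hA(1) this]
        show "mmul {..<d \<psi>'} (x h) (x h2) (i, i'') * wedge (I \<psi>') (y h) (y h2) (j, j'') =
           (if h2 = arev h then mmul {..<d \<psi>'} (x h) (x h2) (i, i'') * (asign h / of_nat (n \<psi>) * mone (I \<psi>) (j, j'')) else 0)"
          by (simp add: hA cscale_def)
      qed
      also have "\<dots> = (if arev h \<in> arr \<psi>'' \<psi>' then mmul {..<d \<psi>'} (x h) (x (arev h)) (i, i'')
             * (asign h / of_nat (n \<psi>) * mone (I \<psi>) (j, j'')) else 0)"
        by (rule sum.delta[OF finarr])
      also have "arev h \<in> arr \<psi>'' \<psi>' \<longleftrightarrow> \<psi> = \<psi>''" using hA arev(1,2,5)[of h] by (auto simp: arr_def)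
      finally show "(\<Sum>h2\<in>arr \<psi>'' \<psi>'. mmul {..<d \<psi>'} (x h) (x h2) (i, i'') * wedge (I \<psi>') (y h) (y h2) (j, j''))
        = (if \<psi> = \<psi>'' \<and> j = j'' then asign h / of_nat (n \<psi>) * mmul {..<d (src h)} (x h) (x (arev h)) (i, i'') else 0)"
        using J hA by (simp add: mone_apply J_iff)
    qed
    also have "\<dots> = (if \<psi>'' = \<psi> \<and> j = j'' then cscale (1 / of_nat (n \<psi>'')) (?m \<psi>'') (i, i'') else 0)"
    proof (cases "\<psi> = \<psi>'' \<and> j = j''")
      case True
      let ?g = "\<lambda>h. asign h / of_nat (n \<psi>) * mmul {..<d (src h)} (x h) (x (arev h)) (i, i'')"
      \<comment> \<open>Grouping by source turns the double sum over vertices and arrows into one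
        sum over all arrows ending at \<open>\<psi>\<close>.\<close>
      have "arr \<psi>' \<psi> = {h \<in> {h. h \<in> Ar \<and> tgt h = \<psi>}. src h = \<psi>'}" for \<psi>' by (auto simp: arr_def)
      then have "(\<Sum>\<psi>'\<in>Irr \<Gamma>. \<Sum>h\<in>arr \<psi>' \<psi>. ?g h) = (\<Sum>h | h \<in> Ar \<and> tgt h = \<psi>. ?g h)"
        using finAr finIrr src_Irr by (simp only:) (intro sum.group, auto)
      also have "\<dots> = cscale (1 / of_nat (n \<psi>)) (?m \<psi>) (i, i'')"
        by (simp add: cscale_def sum_apply sum_divide_distrib)
      finally show ?thesis using True by simp
    qed auto
    finally show "wedge (J d) (F_Delta x) (F_Delta x) ((\<psi>, i, j), (\<psi>'', i'', j''))
      = (if \<psi>'' = \<psi> \<and> j = j'' then cscale (1 / of_nat (n \<psi>'')) (?m \<psi>'') (i, i'') else 0)" .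
  qed
qed

text \<open>The wedge contributes \<open>1 / n \<psi>\<close>, and the framing term has the same
  factor from the first framing component of \<open>F_map\<close>; so each block of the moment map
  is rescaled as a whole.\<close>

lemma gm_moment_F_map:
  assumes p: "p \<in> nak_space Q d df"
  shows "gm_moment (M d) (M df) (Fm p) = bd (\<lambda>\<psi>. cscale (1 / of_nat (n \<psi>)) (nak_moment Q d df p \<psi>))"
    "dmats d d (nak_moment Q d df p)"
proof -
  obtain x v1 v2 where p': "p = (x, v1, v2)" by (cases p)
  note P = p[unfolded p' nak_space_iff]
  have x: "xgood d x" using P by blast
  have v: "dmats d df (\<lambda>\<psi>. cscale (1 / of_nat (n \<psi>)) (v1 \<psi>))" "dmats df d v2" using P mats_linear(3) by blast+
  have "gm_moment (M d) (M df) (Fm p) = wedge (J d) (F_Delta x) (F_Delta x)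
     + mmul (J df) (bd (\<lambda>\<psi>. cscale (1 / of_nat (n \<psi>)) (v1 \<psi>))) (bd v2)"
    by (simp add: p' Fm_apply gm_moment_def wedge_def)
  also have "\<dots> = bd (\<lambda>\<psi>. cscale (1 / of_nat (n \<psi>)) (nak_moment Q d df p \<psi>))"
    unfolding F_Delta_wedge(1)[OF x] bd_mmul[OF v] bd_linear
    by (simp add: p' nak_moment_def mmul_linear cfun.scale_right_distrib)
  finally show "gm_moment (M d) (M df) (Fm p) = bd (\<lambda>\<psi>. cscale (1 / of_nat (n \<psi>)) (nak_moment Q d df p \<psi>))" .
  show "dmats d d (nak_moment Q d df p)"
  proof
    fix \<psi> assume \<psi>: "\<psi> \<in> Irr \<Gamma>"
    have "mmul {..<df \<psi>} (v1 \<psi>) (v2 \<psi>) \<in> mats {..<d \<psi>} {..<d \<psi>}" using P \<psi> by (intro mmul_mats) auto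
    then show "nak_moment Q d df p \<psi> \<in> mats {..<d \<psi>} {..<d \<psi>}"
      unfolding p' nak_moment_def using F_Delta_wedge(2)[OF x] \<psi> by (simp add: mats_linear(1))
  qed
qed

text \<open>The embedding of \<open>X \<psi>\<close> onto the \<open>i\<close>-th copy of \<open>X \<psi>\<close> in \<open>M d\<close>.\<close>

definition summand_emb :: "chr \<Rightarrow> nat \<Rightarrow> (chr \<times> nat \<times> nat, nat) cmat" where
  "summand_emb \<psi> i = (\<lambda>((\<psi>', i', j'), j). if \<psi>' = \<psi> \<and> i' = i then mone (I \<psi>) (j', j) else 0)"

lemma summand_emb_apply: "summand_emb \<psi> i ((\<psi>', i', j'), j) = (if \<psi>' = \<psi> \<and> i' = i \<and> j' = j \<and> j \<in> I \<psi> then 1 else 0)"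
  by (auto simp: summand_emb_def mone_apply)

lemma summand_emb_ghom: assumes \<psi>: "\<psi> \<in> Irr \<Gamma>" "i < d \<psi>" shows "summand_emb \<psi> i \<in> ghom \<Gamma> (X \<psi>) (M d)"
proof (rule ghomI)
  show summand_emb: "summand_emb \<psi> i \<in> mats (J d) (I \<psi>)" using \<psi> by (intro matsI) (auto simp: summand_emb_apply J_iff)
  fix g assume g: "g \<in> \<Gamma>"
  show "mmul (I \<psi>) (summand_emb \<psi> i) (gact (X \<psi>) g) = mmul (J d) (gact (M d) g) (summand_emb \<psi> i)"
  proof (rule mats_eqI)
    show "mmul (I \<psi>) (summand_emb \<psi> i) (gact (X \<psi>) g) \<in> mats (J d) (I \<psi>)"
      using summand_emb is_gmoduleD(2)[OF gm[OF \<psi>(1)] g] by (rule mmul_mats)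
    show "mmul (J d) (gact (M d) g) (summand_emb \<psi> i) \<in> mats (J d) (I \<psi>)"
      using act_mats[OF g] summand_emb by (rule mmul_mats)
    fix p j assume p: "p \<in> J d" and j: "j \<in> I \<psi>"
    obtain \<psi>' i' j' where p': "p = (\<psi>', i', j')" by (cases p)
    have "mmul (I \<psi>) (summand_emb \<psi> i) (gact (X \<psi>) g) (p, j) = (if \<psi>' = \<psi> \<and> i' = i then gact (X \<psi>) g (j', j) else 0)"
    proof (cases "\<psi>' = \<psi> \<and> i' = i")
      case True
      then have "j' \<in> I \<psi>" using p p' by (simp add: J_iff)
      have "mmul (I \<psi>) (summand_emb \<psi> i) (gact (X \<psi>) g) (p, j) = (\<Sum>k\<in>I \<psi>. if j' = k then gact (X \<psi>) g (k, j) else 0)"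
        using True by (auto simp: mmul_apply p' summand_emb_apply intro!: sum.cong)
      then show ?thesis using True \<open>j' \<in> I \<psi>\<close> finI[OF \<psi>(1)] by simp
    next
      case False
      then have "summand_emb \<psi> i ((\<psi>', i', j'), k) = 0" for k by (auto simp: summand_emb_apply)
      then show ?thesis unfolding if_not_P[OF False] by (simp add: mmul_apply p')
    qed
    moreover have "mmul (J d) (gact (M d) g) (summand_emb \<psi> i) (p, j) = (\<Sum>k\<in>I \<psi>'. gact (X \<psi>') g (j', k) * summand_emb \<psi> i ((\<psi>', i', k), j))"
      using act_row[of \<psi>' i' j' d g "\<lambda>r. summand_emb \<psi> i (r, j)"] p p' by (simp add: mmul_apply)
    moreover have "\<dots> = (if \<psi>' = \<psi> \<and> i' = i then gact (X \<psi>) g (j', j) else 0)"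
    proof (cases "\<psi>' = \<psi> \<and> i' = i")
      case True
      have "(\<Sum>k\<in>I \<psi>'. gact (X \<psi>') g (j', k) * summand_emb \<psi> i ((\<psi>', i', k), j))
        = (\<Sum>k\<in>I \<psi>. if k = j then gact (X \<psi>) g (j', k) else 0)"
        using True j by (intro sum.cong) (auto simp: summand_emb_apply)
      then show ?thesis using True j finI[OF \<psi>(1)] by simp
    qed (auto simp: summand_emb_apply)
    ultimately show "mmul (I \<psi>) (summand_emb \<psi> i) (gact (X \<psi>) g) (p, j) = mmul (J d) (gact (M d) g) (summand_emb \<psi> i) (p, j)" by simp
  qed
qed

text \<open>Onto each copy of \<open>X \<psi>\<close> the map \<open>\<phi>\<close> is a scalar by
  Schur's lemma, visible at row \<open>(\<psi>, i, 0)\<close> and column \<open>0\<close>; into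
  copies of other irreducibles it vanishes.\<close>

lemma ghom_summand_emb:
  assumes \<psi>: "\<psi> \<in> Irr \<Gamma>" and \<phi>: "\<phi> \<in> ghom \<Gamma> (X \<psi>) (M d)"
  shows "\<phi> = (\<Sum>i<d \<psi>. cscale (\<phi> ((\<psi>, i, 0), 0)) (summand_emb \<psi> i))" (is "_ = ?S")
proof (rule mats_eqI[OF ghomD(1)[OF \<phi>]])
  show "?S \<in> mats (J d) (I \<psi>)"
    using ghomD(1)[OF summand_emb_ghom[where d = d, OF \<psi>]] by (intro mats_sum mats_linear) auto
  fix p j assume p: "p \<in> J d" and j: "j \<in> I \<psi>"
  obtain \<psi>' i' j' where p': "p = (\<psi>', i', j')" by (cases p)
  have P: "\<psi>' \<in> Irr \<Gamma>" "i' < d \<psi>'" "j' \<in> I \<psi>'" using p p' by (auto simp: J_iff)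
  let ?B = "\<lambda>(j', j). \<phi> ((\<psi>', i', j'), j)"
  have Bm: "?B \<in> mats (I \<psi>') (I \<psi>)"
    using matsD[OF ghomD(1)[OF \<phi>]] by (intro matsI) (auto simp: J_iff)
  have "?B \<in> ghom \<Gamma> (X \<psi>) (X \<psi>')"
  proof (rule ghomI[OF Bm])
    fix g assume g: "g \<in> \<Gamma>"
    show "mmul (I \<psi>) ?B (gact (X \<psi>) g) = mmul (I \<psi>') (gact (X \<psi>') g) ?B"
    proof (rule mats_eqI)
      show "mmul (I \<psi>) ?B (gact (X \<psi>) g) \<in> mats (I \<psi>') (I \<psi>)"
        using Bm is_gmoduleD(2)[OF gm[OF \<psi>] g] by (rule mmul_mats)
      show "mmul (I \<psi>') (gact (X \<psi>') g) ?B \<in> mats (I \<psi>') (I \<psi>)"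
        using is_gmoduleD(2)[OF gm[OF P(1)] g] Bm by (rule mmul_mats)
      fix a b assume ab: "a \<in> I \<psi>'" "b \<in> I \<psi>"
      have "mmul (I \<psi>) \<phi> (gact (X \<psi>) g) ((\<psi>', i', a), b) = mmul (J d) (gact (M d) g) \<phi> ((\<psi>', i', a), b)"
        using ghomD(2)[OF \<phi> g] by simp
      then show "mmul (I \<psi>) ?B (gact (X \<psi>) g) (a, b) = mmul (I \<psi>') (gact (X \<psi>') g) ?B (a, b)"
        using act_row[of \<psi>' i' a d g "\<lambda>r. \<phi> (r, b)"] P ab by (simp add: mmul_apply J_iff)
    qed
  qed
  note B = schur[OF \<psi> P(1) this]
  show "\<phi> (p, j) = ?S (p, j)"
  proof (cases "\<psi> = \<psi>'")
    case True
    then obtain c where c: "?B = cscale c (mone (I \<psi>))" using B(2) by blast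
    have cc: "\<phi> ((\<psi>', i', a), b) = (if a \<in> I \<psi> \<and> a = b then c else 0)" for a b
      using fun_cong[OF c, of "(a, b)"] by (auto simp: cscale_def mone_apply)
    have "?S (p, j) = (\<Sum>i<d \<psi>. if i' = i then \<phi> ((\<psi>, i, 0), 0) * (if j' = j then 1 else 0) else 0)"
      using True j by (auto simp: sum_apply cscale_def p' summand_emb_apply mult_delta_right cong: if_cong)
    also have "\<dots> = \<phi> ((\<psi>, i', 0), 0) * (if j' = j then 1 else 0)"
      using P True by (subst sum.delta') auto
    finally show ?thesis using True cc[of 0 0] cc[of j' j] zero_idx[OF \<psi>] j unfolding p' by auto
  next
    case False
    then have "\<phi> (p, j) = 0" using fun_cong[OF B(1)[OF False], of "(j', j)"] by (simp add: p')
    then show ?thesis using False by (simp add: p' sum_apply cscale_def summand_emb_apply)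
  qed
qed

text \<open>The entries at \<open>((\<psi>, i', 0), 0)\<close> act as a dual basis, which gives
  injectivity and independence.\<close>

lemma summand_emb_basis:
  assumes \<psi>: "\<psi> \<in> Irr \<Gamma>"
  shows "inj_on (summand_emb \<psi>) {..<d \<psi>}" "cfun.independent (summand_emb \<psi> ` {..<d \<psi>})"
    "cfun.span (summand_emb \<psi> ` {..<d \<psi>}) = ghom \<Gamma> (X \<psi>) (M d)"
proof -
  have e: "summand_emb \<psi> i ((\<psi>, i', 0), 0) = (if i = i' then 1 else 0)" for i i'
    using zero_idx[OF \<psi>] by (auto simp: summand_emb_apply)
  show inj: "inj_on (summand_emb \<psi>) {..<d \<psi>}" using e by (metis inj_onI zero_neq_one)
  show "cfun.independent (summand_emb \<psi> ` {..<d \<psi>})"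
  proof (rule cfun.independent_if_scalars_zero)
    fix f x assume s: "(\<Sum>x\<in>summand_emb \<psi> ` {..<d \<psi>}. cscale (f x) x) = 0" and x: "x \<in> summand_emb \<psi> ` {..<d \<psi>}"
    obtain i where i: "i < d \<psi>" "x = summand_emb \<psi> i" using x by auto
    have "0 = (\<Sum>k<d \<psi>. cscale (f (summand_emb \<psi> k)) (summand_emb \<psi> k)) ((\<psi>, i, 0), 0)"
      using s inj by (simp add: sum.reindex comp_def)
    also have "\<dots> = (\<Sum>k<d \<psi>. if k = i then f (summand_emb \<psi> k) else 0)"
      by (simp add: sum_apply cscale_def e mult_delta_right cong: if_cong)
    also have "\<dots> = f (summand_emb \<psi> i)" using i by simp
    finally show "f x = 0" using i by simp
  qed simp
  show "cfun.span (summand_emb \<psi> ` {..<d \<psi>}) = ghom \<Gamma> (X \<psi>) (M d)"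
  proof
    show "cfun.span (summand_emb \<psi> ` {..<d \<psi>}) \<subseteq> ghom \<Gamma> (X \<psi>) (M d)"
      using summand_emb_ghom[OF \<psi>] by (intro cfun.span_minimal subspace_ghom) auto
    show "ghom \<Gamma> (X \<psi>) (M d) \<subseteq> cfun.span (summand_emb \<psi> ` {..<d \<psi>})"
    proof
      fix \<phi> assume "\<phi> \<in> ghom \<Gamma> (X \<psi>) (M d)"
      from ghom_summand_emb[OF \<psi> this] show "\<phi> \<in> cfun.span (summand_emb \<psi> ` {..<d \<psi>})"
        by (metis (no_types, lifting) cfun.span_base cfun.span_scale cfun.span_sum imageI)
    qed
  qed
qed

text \<open>In the basis of these embeddings, composition with \<open>bd a\<close> has matrix
  \<open>a \<psi>\<close>; together with \<open>endo_det_eq\<close> this identifies the two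
  characters.\<close>

lemma bd_summand_emb:
  assumes \<psi>: "\<psi> \<in> Irr \<Gamma>" and a: "dmats d d a" and i: "i < d \<psi>"
  shows "mmul (J d) (bd a) (summand_emb \<psi> i) = (\<Sum>k<d \<psi>. cscale (a \<psi> (k, i)) (summand_emb \<psi> k))" (is "?L = ?R")
proof (rule mats_eqI)
  show "?L \<in> mats (J d) (I \<psi>)"
    using bd_mats[OF a] ghomD(1)[OF summand_emb_ghom[where d = d, OF \<psi> i]] by (rule mmul_mats)
  show "?R \<in> mats (J d) (I \<psi>)"
    using ghomD(1)[OF summand_emb_ghom[where d = d, OF \<psi>]] by (intro mats_sum mats_linear) auto
  fix p j assume p: "p \<in> J d" and j: "j \<in> I \<psi>"
  obtain \<psi>' i' j' where p': "p = (\<psi>', i', j')" by (cases p)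
  have P: "\<psi>' \<in> Irr \<Gamma>" "i' < d \<psi>'" "j' \<in> I \<psi>'" using p p' by (auto simp: J_iff)
  have L: "?L (p, j) = (\<Sum>k<d \<psi>'. a \<psi>' (i', k) * summand_emb \<psi> i ((\<psi>', k, j'), j))"
    using bd_row[OF P(1,3), where f = "\<lambda>r. summand_emb \<psi> i (r, j)"] by (simp add: mmul_apply p')
  show "?L (p, j) = ?R (p, j)"
  proof (cases "\<psi>' = \<psi> \<and> j' = j")
    case True
    have "?L (p, j) = (\<Sum>k<d \<psi>. if k = i then a \<psi> (i', k) else 0)"
      unfolding L using True j by (auto simp: summand_emb_apply mult_delta_right cong: if_cong)
    moreover have "?R (p, j) = (\<Sum>k<d \<psi>. if i' = k then a \<psi> (k, i) else 0)"
      using True j by (auto simp: sum_apply cscale_def p' summand_emb_apply mult_delta_right cong: if_cong)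
    ultimately show ?thesis using P True i by simp
  next
    case False
    then have "?L (p, j) = 0" "?R (p, j) = 0"
      unfolding L by (auto simp: summand_emb_apply sum_apply cscale_def p')
    then show ?thesis by simp
  qed
qed

lemma gm_character_blockmat:
  assumes a: "dmats d d a"
  shows "gm_character \<Gamma> X (M d) \<theta> (bd a) = nak_character Q d \<theta> a"
proof -
  have "endo_det (ghom \<Gamma> (X \<psi>) (M d)) (\<lambda>\<phi>. mmul (J d) (bd a) \<phi>) = mdet {..<d \<psi>} (a \<psi>)" if \<psi>: "\<psi> \<in> Irr \<Gamma>" for \<psi>
    by (rule endo_det_eq[OF _ summand_emb_basis[OF \<psi>]])
      (simp_all only: finite_lessThan mmul_linear bd_summand_emb[OF \<psi> a] lessThan_iff)
  then show ?thesis by (simp add: gm_character_def nak_character_def verts)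
qed

lemma mvec_summand_emb: assumes "\<psi> \<in> Irr \<Gamma>" "j \<in> I \<psi>" shows "mvec (I \<psi>) (summand_emb \<psi> i) (ue j) = ue (\<psi>, i, j)"
  unfolding mvec_ue[OF finI[OF assms(1)] assms(2)] using assms(2) by (auto simp: summand_emb_apply ue_def)

text \<open>\<open>gm_lambda\<close> is a definite description, so uniqueness matters too: every
  unit vector is the image of a unit vector under some \<open>summand_emb\<close>, hence lies in an
  isotypic component, and the unit vectors determine the matrix.\<close>

lemma gm_lambda_blockmat: "gm_lambda \<Gamma> X (M d) lam = bd (\<lambda>\<psi>. cscale (lam \<psi> / of_nat (n \<psi>)) (mone {..<d \<psi>}))" (is "_ = bd ?L")
  unfolding gm_lambda_def
proof (rule the_equality)
  have Lm: "dmats d d ?L" by (auto intro: mats_linear mone_mats)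
  have L: "mvec (J d) (bd ?L) v = cscale (lam \<psi> / of_nat (n \<psi>)) v"
    if \<psi>: "\<psi> \<in> Irr \<Gamma>" and v: "v \<in> isotypic \<Gamma> (X \<psi>) (M d)" for \<psi> v
  proof -
    let ?c = "lam \<psi> / of_nat (n \<psi>)"
    have "isotypic \<Gamma> (X \<psi>) (M d) \<subseteq> {v. mvec (J d) (bd ?L) v = cscale ?c v}"
      unfolding isotypic_def
    proof (rule cfun.span_minimal)
      show "cfun.subspace {v. mvec (J d) (bd ?L) v = cscale ?c v}"
        unfolding cfun.subspace_def mem_Collect_eq mvec_linear
        by (simp add: cfun.scale_right_distrib mult.commute)
      have "mmul (J d) (bd ?L) \<phi> = cscale ?c \<phi>" if \<phi>: "\<phi> \<in> ghom \<Gamma> (X \<psi>) (M d)" for \<phi>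
      proof -
        have e: "mmul (J d) (bd ?L) (summand_emb \<psi> i) = cscale ?c (summand_emb \<psi> i)" if "i < d \<psi>" for i
        proof -
          have "mmul (J d) (bd ?L) (summand_emb \<psi> i) = (\<Sum>k<d \<psi>. if k = i then cscale ?c (summand_emb \<psi> k) else 0)"
            unfolding bd_summand_emb[OF \<psi> Lm that] by (intro sum.cong refl) (auto simp: cscale_def mone_apply fun_eq_iff)
          then show ?thesis using that by simp
        qed
        have "mmul (J d) (bd ?L) \<phi> = (\<Sum>i<d \<psi>. cscale (\<phi> ((\<psi>, i, 0), 0)) (mmul (J d) (bd ?L) (summand_emb \<psi> i)))"
          by (subst ghom_summand_emb[OF \<psi> \<phi>]) (simp add: mmul_sum mmul_linear)
        also have "\<dots> = (\<Sum>i<d \<psi>. cscale ?c (cscale (\<phi> ((\<psi>, i, 0), 0)) (summand_emb \<psi> i)))"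
          by (intro sum.cong refl) (simp add: e mult.commute)
        also have "\<dots> = cscale ?c \<phi>"
          by (subst (2) ghom_summand_emb[OF \<psi> \<phi>]) (simp add: cfun.scale_sum_right)
        finally show ?thesis .
      qed
      then show "{mvec (I \<psi>) \<phi> v |\<phi> v. \<phi> \<in> ghom \<Gamma> (X \<psi>) (M d) \<and> v \<in> vecs (I \<psi>)}
         \<subseteq> {v. mvec (J d) (bd ?L) v = cscale ?c v}"
        by (auto simp: mvec_mvec mvec_mlinear)
    qed
    then show ?thesis using v by blast
  qed
  then show "bd ?L \<in> ghom \<Gamma> (M d) (M d) \<and> (\<forall>\<psi>\<in>Irr \<Gamma>. \<forall>v\<in>isotypic \<Gamma> (X \<psi>) (M d).
      mvec (J d) (bd ?L) v = cscale (lam \<psi> / of_nat (n \<psi>)) v)"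
    using bd_ghom[OF Lm] by blast
  fix L' assume L': "L' \<in> ghom \<Gamma> (M d) (M d) \<and> (\<forall>\<psi>\<in>Irr \<Gamma>. \<forall>v\<in>isotypic \<Gamma> (X \<psi>) (M d).
      mvec (J d) L' v = cscale (lam \<psi> / of_nat (n \<psi>)) v)"
  show "L' = bd ?L"
  proof (rule mats_eqI[OF ghomD(1)[OF conjunct1[OF L']] bd_mats[OF Lm]])
    fix p q assume "p \<in> J d" and q: "q \<in> J d"
    obtain \<psi> i j where q': "q = (\<psi>, i, j)" by (cases q)
    have Q: "\<psi> \<in> Irr \<Gamma>" "i < d \<psi>" "j \<in> I \<psi>" using q q' by (auto simp: J_iff)
    have "ue q \<in> isotypic \<Gamma> (X \<psi>) (M d)"
      unfolding isotypic_def q' mvec_summand_emb[OF Q(1,3), of i, symmetric]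
      using summand_emb_ghom[where d = d, OF Q(1,2)] ue_vecs[OF Q(3)] by (intro cfun.span_base) blast
    then have "mvec (J d) L' (ue q) = mvec (J d) (bd ?L) (ue q)" using L' L Q(1) by simp
    then show "L' (p, q) = bd ?L (p, q)" unfolding mvec_ue[OF finJ q] by (rule fun_cong)
  qed
qed

section \<open>The two groups and their actions\<close>

lemma nak_group_iff: "g \<in> nak_group Q d \<longleftrightarrow> (\<forall>\<psi>\<in>Irr \<Gamma>. g \<psi> \<in> mGL {..<d \<psi>}) \<and> (\<forall>\<psi>. \<psi> \<notin> Irr \<Gamma> \<longrightarrow> g \<psi> = 0)"
  by (auto simp: nak_group_def verts)

lemma bd_minv:
  assumes g: "g \<in> nak_group Q d"
  shows "dmats d d g" "dmats d d (\<lambda>\<psi>. minv {..<d \<psi>} (g \<psi>))" "minv (J d) (bd g) = bd (\<lambda>\<psi>. minv {..<d \<psi>} (g \<psi>))"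
    "bd g \<in> gaut \<Gamma> (M d)"
proof -
  let ?g' = "\<lambda>\<psi>. minv {..<d \<psi>} (g \<psi>)"
  have G: "g \<psi> \<in> mGL {..<d \<psi>}" if "\<psi> \<in> Irr \<Gamma>" for \<psi> using g that by (simp add: nak_group_iff)
  show gm: "dmats d d g" and gm': "dmats d d ?g'" using mGL_minv[OF _ G] by auto
  have inv: "mmul (J d) (bd g) (bd ?g') = mone (J d)" "mmul (J d) (bd ?g') (bd g) = mone (J d)"
    unfolding bd_mmul[OF gm gm'] bd_mmul[OF gm' gm] bd_mone using mGL_minv[OF _ G] by (auto intro: bd_cong)
  then show "minv (J d) (bd g) = bd ?g'" by (intro minv_eq finJ bd_mats gm gm')
  show "bd g \<in> gaut \<Gamma> (M d)"
    using bd_ghom[OF gm] bd_mats[OF gm] bd_mats[OF gm'] inv by (auto simp: gaut_def mGL_def)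
qed

text \<open>The inverse of an equivariant map is equivariant, hence again of the form
  \<open>bd b\<close>, and injectivity of \<open>bd\<close> turns the two matrix identities into
  identities in each block.\<close>

lemma gaut_surj:
  assumes A: "A \<in> gaut \<Gamma> (M d)"
  shows "\<exists>g\<in>nak_group Q d. bd g = A"
proof -
  obtain B where B: "B \<in> mats (J d) (J d)" "mmul (J d) A B = mone (J d)" "mmul (J d) B A = mone (J d)"
    using A by (auto simp: gaut_def mGL_def)
  have Ag: "A \<in> ghom \<Gamma> (M d) (M d)" using A by (simp add: gaut_def)
  have "B \<in> ghom \<Gamma> (M d) (M d)"
  proof (rule ghomI[OF B(1)])
    fix g assume g: "g \<in> \<Gamma>"
    let ?r = "gact (M d) g"
    have "mmul (J d) B ?r = mmul (J d) B (mmul (J d) ?r (mmul (J d) A B))"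
      using mmul_mone_right[OF finJ act_mats[OF g]] B(2) by simp
    also have "\<dots> = mmul (J d) (mmul (J d) B (mmul (J d) A ?r)) B"
      by (simp add: ghomD(2)[OF Ag g] mmul_assoc)
    also have "\<dots> = mmul (J d) ?r B"
      using mmul_mone_left[OF finJ act_mats[OF g]] B(3) by (simp flip: mmul_assoc)
    finally show "mmul (J d) B ?r = mmul (J d) ?r B" .
  qed
  then obtain b where b: "dmats d d b" "B = bd b" by (rule ghom_bd)
  obtain a where a: "dmats d d a" "A = bd a" by (rule ghom_bd[OF Ag])
  have m: "dmats d d (\<lambda>\<psi>. mone {..<d \<psi>})" by (simp add: mone_mats)
  have ab: "dmats d d (\<lambda>\<psi>. mmul {..<d \<psi>} (a \<psi>) (b \<psi>))" "dmats d d (\<lambda>\<psi>. mmul {..<d \<psi>} (b \<psi>) (a \<psi>))"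
    using a b mmul_mats by blast+
  have e: "bd (\<lambda>\<psi>. mmul {..<d \<psi>} (a \<psi>) (b \<psi>)) = bd (\<lambda>\<psi>. mone {..<d \<psi>})"
    "bd (\<lambda>\<psi>. mmul {..<d \<psi>} (b \<psi>) (a \<psi>)) = bd (\<lambda>\<psi>. mone {..<d \<psi>})"
    using B(2,3) unfolding a(2) b(2) bd_mmul[OF a(1) b(1)] bd_mmul[OF b(1) a(1)] bd_mone by auto
  have "a \<psi> \<in> mGL {..<d \<psi>}" if \<psi>: "\<psi> \<in> Irr \<Gamma>" for \<psi>
    using bd_inj[OF e(1) ab(1) m \<psi>] bd_inj[OF e(2) ab(2) m \<psi>] a b \<psi> by (auto simp: mGL_def)
  then have "(\<lambda>\<psi>. if \<psi> \<in> Irr \<Gamma> then a \<psi> else 0) \<in> nak_group Q d" by (simp add: nak_group_iff)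
  moreover have "bd (\<lambda>\<psi>. if \<psi> \<in> Irr \<Gamma> then a \<psi> else 0) = A" unfolding a(2) by (rule bd_cong) simp
  ultimately show ?thesis by blast
qed

lemma nak_action_closed:
  assumes g: "g \<in> nak_group Q d" and p: "p \<in> nak_space Q d df"
  shows "nak_action Q d g p \<in> nak_space Q d df"
proof -
  obtain x v1 v2 where p': "p = (x, v1, v2)" by (cases p)
  note P = p[unfolded p' nak_space_iff]
  note G = bd_minv(1,2)[OF g]
  have "mmul {..<d (tgt h)} (g (tgt h)) (mmul {..<d (src h)} (x h) (minv {..<d (src h)} (g (src h))))
    \<in> mats {..<d (tgt h)} {..<d (src h)}" if h: "h \<in> Ar" for h
    by (intro mmul_mats) (use G P h src_Irr[OF h] tgt_Irr[OF h] in auto)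
  moreover have "mmul {..<d \<psi>} (g \<psi>) (v1 \<psi>) \<in> mats {..<d \<psi>} {..<df \<psi>}"
    "mmul {..<d \<psi>} (v2 \<psi>) (minv {..<d \<psi>} (g \<psi>)) \<in> mats {..<df \<psi>} {..<d \<psi>}" if "\<psi> \<in> Irr \<Gamma>" for \<psi>
    using G P that by (auto intro!: mmul_mats)
  ultimately show ?thesis using P unfolding p' nak_action_def
    by (simp add: nak_space_iff Let_def mmul_zero)
qed

text \<open>The group acts on the multiplicity factor and the arrow maps on the module factor, so
  conjugation passes through the sum over arrows.\<close>

lemma F_map_action:
  assumes g: "g \<in> nak_group Q d" and p: "p \<in> nak_space Q d df"
  shows "Fm (nak_action Q d g p) = gm_action (M d) (bd g) (Fm p)"
proof -
  obtain x v1 v2 where p': "p = (x, v1, v2)" by (cases p)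
  note P = p[unfolded p' nak_space_iff]
  let ?g' = "\<lambda>\<psi>. minv {..<d \<psi>} (g \<psi>)"
  note G = bd_minv(1,2)[OF g]
  let ?x = "\<lambda>h. mmul {..<d (tgt h)} (g (tgt h)) (mmul {..<d (src h)} (x h) (?g' (src h)))"
  have v: "dmats d df (\<lambda>\<psi>. cscale (1 / of_nat (n \<psi>)) (v1 \<psi>))" "dmats df d v2" using P mats_linear(3) by blast+
  have xg: "xgood d x" using P by blast
  have xg': "xgood d ?x" using nak_action_closed[OF g p] unfolding p' nak_action_def by (simp add: nak_space_iff Let_def)
  let ?R = "mmul (J d) (bd g) (mmul (UNIV \<times> J d) (F_Delta x) (kron (mone UNIV) (bd ?g')))"
  have "F_Delta ?x = ?R"
  proof (rule mats_eqI[OF F_Delta_mats[OF xg']])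
    show "?R \<in> mats (J d) (UNIV \<times> J d)"
      by (intro mmul_mats bd_mats[OF G(1)] F_Delta_mats[OF xg] kron_mats mone_mats bd_mats[OF G(2)])
    fix p and q :: "2 \<times> chr \<times> nat \<times> nat" assume pq: "p \<in> J d" "q \<in> UNIV \<times> J d"
    obtain \<psi>' i' j' where p: "p = (\<psi>', i', j')" by (cases p)
    obtain k \<psi> i j where q: "q = (k, (\<psi>, i, j))" by (metis surj_pair)
    have \<psi>: "\<psi> \<in> Irr \<Gamma>" "\<psi>' \<in> Irr \<Gamma>" "j \<in> I \<psi>" "j' \<in> I \<psi>'" using pq by (auto simp: p q J_iff)
    \<comment> \<open>The identity on the \<open>Xstd\<close> factor keeps the index
      \<open>k\<close>, and a block matrix changes only the multiplicity index.\<close>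
    have in1: "mmul (UNIV \<times> J d) (F_Delta x) (kron (mone UNIV) (bd ?g')) (r, q)
      = (\<Sum>i3<d \<psi>. F_Delta x (r, (k, (\<psi>, i3, j))) * ?g' \<psi> (i3, i))" for r
    proof -
      have "mmul (UNIV \<times> J d) (F_Delta x) (kron (mone UNIV) (bd ?g')) (r, q)
        = (\<Sum>l\<in>UNIV. \<Sum>s\<in>J d. F_Delta x (r, (l, s)) * ((if l = k then 1 else 0) * bd ?g' (s, (\<psi>, i, j))))"
        by (simp add: mmul_apply sum.cartesian_product' q kron_apply mone_apply)
      also have "\<dots> = (\<Sum>l\<in>UNIV. if l = k then (\<Sum>s\<in>J d. F_Delta x (r, (l, s)) * bd ?g' (s, (\<psi>, i, j))) else 0)"
        by (intro sum.cong refl) auto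
      also have "\<dots> = (\<Sum>s\<in>J d. F_Delta x (r, (k, s)) * bd ?g' (s, (\<psi>, i, j)))" by simp
      also have "\<dots> = (\<Sum>i3<d \<psi>. F_Delta x (r, (k, (\<psi>, i3, j))) * ?g' \<psi> (i3, i))"
        by (rule bd_col[OF \<psi>(1,3)])
      finally show ?thesis .
    qed
    have "?R (p, q) = (\<Sum>i2<d \<psi>'. g \<psi>' (i', i2) * (\<Sum>i3<d \<psi>. F_Delta x ((\<psi>', i2, j'), (k, (\<psi>, i3, j))) * ?g' \<psi> (i3, i)))"
      using bd_row[OF \<psi>(2,4), where f = "\<lambda>r. mmul (UNIV \<times> J d) (F_Delta x) (kron (mone UNIV) (bd ?g')) (r, q)"]
      by (simp add: mmul_apply[of "J d"] p in1)
    also have "\<dots> = (\<Sum>i2<d \<psi>'. \<Sum>i3<d \<psi>. \<Sum>h\<in>arr \<psi> \<psi>'. g \<psi>' (i', i2) * (x h (i2, i3) * ?g' \<psi> (i3, i)) * y h (j', (k, j)))"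
      by (simp add: F_Delta_def sum_distrib_left sum_distrib_right mult_ac)
    also have "\<dots> = (\<Sum>i2<d \<psi>'. \<Sum>h\<in>arr \<psi> \<psi>'. \<Sum>i3<d \<psi>. g \<psi>' (i', i2) * (x h (i2, i3) * ?g' \<psi> (i3, i)) * y h (j', (k, j)))"
      by (intro sum.cong refl sum.swap)
    also have "\<dots> = (\<Sum>h\<in>arr \<psi> \<psi>'. \<Sum>i2<d \<psi>'. \<Sum>i3<d \<psi>. g \<psi>' (i', i2) * (x h (i2, i3) * ?g' \<psi> (i3, i)) * y h (j', (k, j)))"
      by (rule sum.swap)
    also have "\<dots> = (\<Sum>h\<in>arr \<psi> \<psi>'. ?x h (i', i) * y h (j', (k, j)))"
    proof (intro sum.cong refl)
      fix h assume "h \<in> arr \<psi> \<psi>'"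
      then have "src h = \<psi>" "tgt h = \<psi>'" by (auto simp: arr_def)
      then show "(\<Sum>i2<d \<psi>'. \<Sum>i3<d \<psi>. g \<psi>' (i', i2) * (x h (i2, i3) * ?g' \<psi> (i3, i)) * y h (j', (k, j)))
        = ?x h (i', i) * y h (j', (k, j))"
        by (simp add: mmul_apply sum_distrib_left sum_distrib_right)
    qed
    finally show "F_Delta ?x (p, q) = ?R (p, q)" by (simp add: F_Delta_def p q)
  qed
  moreover have "bd (\<lambda>\<psi>. cscale (1 / of_nat (n \<psi>)) (mmul {..<d \<psi>} (g \<psi>) (v1 \<psi>)))
     = mmul (J d) (bd g) (bd (\<lambda>\<psi>. cscale (1 / of_nat (n \<psi>)) (v1 \<psi>)))"
    unfolding bd_mmul[OF G(1) v(1)] by (simp add: mmul_linear)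
  moreover have "bd (\<lambda>\<psi>. mmul {..<d \<psi>} (v2 \<psi>) (?g' \<psi>)) = mmul (J d) (bd v2) (bd ?g')"
    unfolding bd_mmul[OF v(2) G(2)] ..
  ultimately show ?thesis
    unfolding p' nak_action_def Fm_apply gm_action_def prod.case bd_minv(3)[OF g] Let_def by simp
qed

end

section \<open>Proj of isomorphic graded rings\<close>

lemma Proj_sections_local:
  assumes "\<sigma> \<in> carrier (Proj_sections R U)" "P \<in> U"
  shows "\<exists>V a s n. openin (Proj_top R) V \<and> P \<in> V \<and> V \<subseteq> U \<and> a \<in> homog R n \<and> s \<in> homog R n \<and>
    (\<forall>P'\<in>V. s \<notin> P' \<and> \<sigma> P' = hfrac R P' a s)"
  using assms by (simp add: Proj_sections_def)

text \<open>Commutativity is carried along instead of assumed: the existence of a prime ideal of \<open>A\<close> or of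
  \<open>B\<close> already contains it, and without it both Proj are empty.\<close>

locale graded_iso =
  fixes A :: "(nat \<Rightarrow> 'c, 'm) ring_scheme"
    and B :: "(nat \<Rightarrow> 'd, 'n) ring_scheme"
    and \<phi> :: "(nat \<Rightarrow> 'd) \<Rightarrow> nat \<Rightarrow> 'c"
    and \<phi>0 :: "'d \<Rightarrow> 'c"
  assumes iso: "\<phi> \<in> ring_iso B A"
    and cring_pullback: "cring A \<Longrightarrow> cring B"
    and coeff: "a \<in> carrier B \<Longrightarrow> \<phi> a m = \<phi>0 (a m)"
    and zero_coeff: "\<phi>0 (\<zero>\<^bsub>B\<^esub> m) = \<zero>\<^bsub>A\<^esub> m"
    and coeff_eq_zero: "a \<in> carrier B \<Longrightarrow> \<phi>0 (a m) = \<zero>\<^bsub>A\<^esub> m \<Longrightarrow> a m = \<zero>\<^bsub>B\<^esub> m"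
    and homog_mult: "cring B \<Longrightarrow> a \<in> homog B m \<Longrightarrow> b \<in> homog B n \<Longrightarrow> a \<otimes>\<^bsub>B\<^esub> b \<in> homog B (m + n)"
    and homog_add: "cring B \<Longrightarrow> a \<in> homog B m \<Longrightarrow> b \<in> homog B m \<Longrightarrow> a \<oplus>\<^bsub>B\<^esub> b \<in> homog B m"
    and one_homog: "cring B \<Longrightarrow> \<one>\<^bsub>B\<^esub> \<in> homog B 0"
    and hcomp_closed: "cring B \<Longrightarrow> a \<in> carrier B \<Longrightarrow> hcomp B m a \<in> carrier B"
begin

lemma phi_closed: "a \<in> carrier B \<Longrightarrow> \<phi> a \<in> carrier A"
  and phi_mult: "a \<in> carrier B \<Longrightarrow> b \<in> carrier B \<Longrightarrow> \<phi> (a \<otimes>\<^bsub>B\<^esub> b) = \<phi> a \<otimes>\<^bsub>A\<^esub> \<phi> b"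
  and phi_add: "a \<in> carrier B \<Longrightarrow> b \<in> carrier B \<Longrightarrow> \<phi> (a \<oplus>\<^bsub>B\<^esub> b) = \<phi> a \<oplus>\<^bsub>A\<^esub> \<phi> b"
  and phi_one: "\<phi> \<one>\<^bsub>B\<^esub> = \<one>\<^bsub>A\<^esub>"
  and phi_bij: "bij_betw \<phi> (carrier B) (carrier A)"
  using iso by (auto simp: ring_iso_def ring_hom_def)

lemma phi_inj: "a \<in> carrier B \<Longrightarrow> b \<in> carrier B \<Longrightarrow> \<phi> a = \<phi> b \<longleftrightarrow> a = b"
  using phi_bij by (auto simp: bij_betw_def inj_on_def)

lemma phi_surj: assumes "x \<in> carrier A" obtains a where "a \<in> carrier B" "x = \<phi> a"
  using phi_bij assms by (auto simp: bij_betw_def)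

lemma phi_zero: assumes "cring B" shows "\<phi> \<zero>\<^bsub>B\<^esub> = \<zero>\<^bsub>A\<^esub>"
proof
  interpret B: cring B by fact
  show "\<phi> \<zero>\<^bsub>B\<^esub> m = \<zero>\<^bsub>A\<^esub> m" for m
    using coeff[of "\<zero>\<^bsub>B\<^esub>" m] zero_coeff by simp
qed

lemma cring_iff: "cring A \<longleftrightarrow> cring B"
proof
  assume "cring B"
  \<comment> \<open>The notion of ring homomorphism does not mention zero, so the transported ring
    has \<open>\<phi> \<zero>\<close> as its zero; \<open>phi_zero\<close> identifies it with that
    of \<open>A\<close>.\<close>
  then have "cring (A\<lparr>zero := \<phi> \<zero>\<^bsub>B\<^esub>\<rparr>)"
    using cring.ring_iso_imp_img_cring iso by blast
  then show "cring A" using phi_zero \<open>cring B\<close> by simp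
qed (rule cring_pullback)

lemma ring_hom: "cring B \<Longrightarrow> ring_hom_cring B A \<phi>"
  using iso cring_iff unfolding ring_iso_def
  by (intro ring_hom_cring.intro ring_hom_cring_axioms.intro) auto

lemma phi_coeff_zero_iff: "a \<in> carrier B \<Longrightarrow> \<phi> a m = \<zero>\<^bsub>A\<^esub> m \<longleftrightarrow> a m = \<zero>\<^bsub>B\<^esub> m"
  using coeff coeff_eq_zero zero_coeff by metis

lemma phi_homog: "a \<in> carrier B \<Longrightarrow> \<phi> a \<in> homog A m \<longleftrightarrow> a \<in> homog B m"
  using phi_coeff_zero_iff phi_closed by (auto simp: homog_def)

lemma homog_carrier: "a \<in> homog B m \<Longrightarrow> a \<in> carrier B" "x \<in> homog A m \<Longrightarrow> x \<in> carrier A"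
  by (auto simp: homog_def)

lemma homog_phi: "a \<in> homog B m \<Longrightarrow> \<phi> a \<in> homog A m"
  using phi_homog homog_carrier by blast

lemma homog_surj: assumes "x \<in> homog A m" obtains a where "a \<in> homog B m" "x = \<phi> a"
  using assms homog_carrier phi_surj phi_homog by metis

lemma phi_hcomp: "cring B \<Longrightarrow> a \<in> carrier B \<Longrightarrow> \<phi> (hcomp B m a) = hcomp A m (\<phi> a)"
  using coeff hcomp_closed zero_coeff by (fastforce simp: hcomp_def)

lemma Proj_points_cring: "P \<in> Proj_points A \<Longrightarrow> cring A \<and> cring B" "P' \<in> Proj_points B \<Longrightarrow> cring A \<and> cring B"
  using cring_iff by (auto simp: Proj_points_def primeideal_def)

section \<open>The homeomorphism of the underlying spaces\<close>

abbreviation pmap where "pmap \<equiv> Proj_map B \<phi>"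

lemma pmap_iff: "a \<in> carrier B \<Longrightarrow> a \<in> pmap P \<longleftrightarrow> \<phi> a \<in> P"
  by (auto simp: Proj_map_def)

lemma pmap_points: assumes P: "P \<in> Proj_points A" shows "pmap P \<in> Proj_points B"
proof -
  have cr: "cring A" "cring B" using Proj_points_cring assms by auto
  interpret h: ring_hom_cring B A \<phi> using ring_hom cr by simp
  interpret B: cring B by fact
  have P': "primeideal P A" "\<And>a m. a \<in> P \<Longrightarrow> hcomp A m a \<in> P"
    "\<not> {a \<in> carrier A. a 0 = \<zero>\<^bsub>A\<^esub> 0} \<subseteq> P"
    using P by (auto simp: Proj_points_def)
  have "primeideal (pmap P) B"
    unfolding Proj_map_def
    by (rule ring_hom_ring.primeideal_vimage[OF _ cr(2) P'(1)])
      (rule ring_hom_ringI2, use cr h.homh in \<open>auto simp: cring_def\<close>)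
  moreover have "hcomp B m a \<in> pmap P" if "a \<in> pmap P" for a m
    using that P'(2) hcomp_closed phi_hcomp cr by (auto simp: Proj_map_def)
  moreover have "\<not> {a \<in> carrier B. a 0 = \<zero>\<^bsub>B\<^esub> 0} \<subseteq> pmap P"
  proof -
    obtain x where x: "x \<in> carrier A" "x 0 = \<zero>\<^bsub>A\<^esub> 0" "x \<notin> P" using P'(3) by blast
    obtain a where "a \<in> carrier B" "x = \<phi> a" using phi_surj x(1) by metis
    then show ?thesis using x phi_coeff_zero_iff pmap_iff by auto
  qed
  ultimately show ?thesis by (auto simp: Proj_points_def)
qed

lemma image_pmap: assumes "P \<in> Proj_points A" shows "\<phi> ` pmap P = P"
proof -
  interpret primeideal P A using assms by (auto simp: Proj_points_def)
  show ?thesis using a_subset by (auto simp: Proj_map_def elim!: phi_surj)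
qed

text \<open>The image of a prime ideal is treated as its preimage under the inverse
  isomorphism.\<close>

lemma image_points: assumes P: "P \<in> Proj_points B" shows "\<phi> ` P \<in> Proj_points A" "pmap (\<phi> ` P) = P"
proof -
  have cr: "cring A" "cring B" using Proj_points_cring assms by auto
  interpret h: ring_hom_cring B A \<phi> using ring_hom cr by simp
  interpret B: cring B by fact
  have P': "primeideal P B" "\<And>a m. a \<in> P \<Longrightarrow> hcomp B m a \<in> P"
    "\<not> {a \<in> carrier B. a 0 = \<zero>\<^bsub>B\<^esub> 0} \<subseteq> P"
    using P by (auto simp: Proj_points_def)
  interpret P: primeideal P B by fact
  let ?g = "inv_into (carrier B) \<phi>"
  have g: "?g (\<phi> a) = a" if "a \<in> carrier B" for a
    using that phi_bij by (simp add: bij_betw_def)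
  have mem: "\<phi> a \<in> \<phi> ` P \<longleftrightarrow> a \<in> P" if "a \<in> carrier B" for a
    using that P.a_subset phi_inj by blast
  have gi: "?g \<in> ring_iso A B"
    using ring_iso_set_sym[OF _ iso] cr by (simp add: cring_def)
  have "primeideal {x \<in> carrier A. ?g x \<in> P} A"
    by (rule ring_hom_ring.primeideal_vimage[OF _ cr(1) P'(1)])
      (rule ring_hom_ringI2, use cr gi in \<open>auto simp: cring_def ring_iso_def\<close>)
  moreover have "{x \<in> carrier A. ?g x \<in> P} = \<phi> ` P"
    using P.a_subset g phi_closed by (auto elim!: phi_surj)
  ultimately have "primeideal (\<phi> ` P) A" by simp
  moreover have "hcomp A m x \<in> \<phi> ` P" if "x \<in> \<phi> ` P" for x m
    using that P'(2) P.a_subset by (auto simp flip: phi_hcomp[OF cr(2)])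
  moreover have "\<not> {a \<in> carrier A. a 0 = \<zero>\<^bsub>A\<^esub> 0} \<subseteq> \<phi> ` P"
  proof -
    obtain a where "a \<in> carrier B" "a 0 = \<zero>\<^bsub>B\<^esub> 0" "a \<notin> P" using P'(3) by blast
    then show ?thesis using phi_coeff_zero_iff mem phi_closed by blast
  qed
  ultimately show "\<phi> ` P \<in> Proj_points A" by (auto simp: Proj_points_def)
  show "pmap (\<phi> ` P) = P" using mem P.a_subset by (auto simp: Proj_map_def)
qed

lemma pmap_D:
  assumes "f \<in> homog B m" "P \<in> Proj_points A"
  shows "P \<in> {P \<in> Proj_points A. \<phi> f \<notin> P} \<longleftrightarrow> pmap P \<in> {P \<in> Proj_points B. f \<notin> P}"
  using assms pmap_points pmap_iff homog_carrier by auto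

text \<open>The basic open sets \<open>D_+(f)\<close> of Proj; the underlying space is their
  union.\<close>

definition Dopen where "Dopen R = {{P \<in> Proj_points R. f \<notin> P} | f. \<exists>m>0. f \<in> homog R m}"

lemma topspace_Proj: "topspace (Proj_top A) = \<Union>(Dopen A)" "topspace (Proj_top B) = \<Union>(Dopen B)"
  by (simp_all add: Proj_top_def Dopen_def)

lemma topspace_subset: "topspace (Proj_top A) \<subseteq> Proj_points A" "topspace (Proj_top B) \<subseteq> Proj_points B"
  unfolding topspace_Proj by (auto simp: Dopen_def)

lemma pmap_topspace: assumes "P \<in> Proj_points A"
  shows "pmap P \<in> topspace (Proj_top B) \<longleftrightarrow> P \<in> topspace (Proj_top A)"
proof -
  have "(\<exists>f m. m > 0 \<and> f \<in> homog B m \<and> f \<notin> pmap P) \<longleftrightarrow> (\<exists>f m. m > 0 \<and> f \<in> homog A m \<and> f \<notin> P)"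
    using homog_surj homog_phi pmap_iff homog_carrier by metis
  then show ?thesis unfolding topspace_Proj Dopen_def using assms pmap_points by blast
qed

text \<open>Under both maps the basic open sets of \<open>f\<close> and \<open>\<phi> f\<close>
  correspond, and every homogeneous element of \<open>A\<close> is of the form
  \<open>\<phi> f\<close> with \<open>f\<close> of the same degree.\<close>

lemma pmap_homeomorphic_maps:
  "homeomorphic_maps (Proj_top A) (Proj_top B) pmap (\<lambda>P. \<phi> ` P)"
  unfolding homeomorphic_maps_def
proof (intro conjI ballI)
  show "continuous_map (Proj_top A) (Proj_top B) pmap"
    unfolding Proj_top_def[of B] continuous_on_generated_topo_iff Dopen_def[symmetric]
  proof (intro conjI allI impI)
    fix U assume "U \<in> Dopen B"
    then obtain f m where f: "U = {P \<in> Proj_points B. f \<notin> P}" "m > 0" "f \<in> homog B m"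
      by (auto simp: Dopen_def)
    have "pmap -` U \<inter> topspace (Proj_top A) = {P \<in> Proj_points A. \<phi> f \<notin> P}" (is "_ = ?D")
    proof -
      have "?D \<in> Dopen A" using f homog_phi by (auto simp: Dopen_def)
      then have "?D \<subseteq> topspace (Proj_top A)" unfolding topspace_Proj by blast
      then show ?thesis using topspace_subset pmap_D[OF f(3)] f(1) by blast
    qed
    moreover have "openin (Proj_top A) ?D"
      unfolding Proj_top_def using f homog_phi by (intro topology_generated_by_Basis) auto
    ultimately show "openin (Proj_top A) (pmap -` U \<inter> topspace (Proj_top A))" by simp
  next
    show "pmap ` topspace (Proj_top A) \<subseteq> \<Union> (Dopen B)"
      unfolding topspace_Proj(2)[symmetric] using pmap_topspace topspace_subset by blast
  qed
  show "continuous_map (Proj_top B) (Proj_top A) (\<lambda>P. \<phi> ` P)"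
    unfolding Proj_top_def[of A] continuous_on_generated_topo_iff Dopen_def[symmetric]
  proof (intro conjI allI impI)
    fix U assume "U \<in> Dopen A"
    then obtain f m where f: "U = {P \<in> Proj_points A. \<phi> f \<notin> P}" "m > 0" "f \<in> homog B m"
      by (auto simp: Dopen_def elim: homog_surj)
    have "(\<lambda>P. \<phi> ` P) -` U \<inter> topspace (Proj_top B) = {P \<in> Proj_points B. f \<notin> P}" (is "_ = ?D")
    proof -
      have "?D \<in> Dopen B" using f by (auto simp: Dopen_def)
      then have "?D \<subseteq> topspace (Proj_top B)" unfolding topspace_Proj by blast
      moreover have "\<phi> f \<in> \<phi> ` P \<longleftrightarrow> f \<in> P" if "P \<in> Proj_points B" for P
        using pmap_iff[of f "\<phi> ` P"] image_points(2)[OF that] homog_carrier f(3) by blast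
      ultimately have "P \<in> (\<lambda>P. \<phi> ` P) -` U \<inter> topspace (Proj_top B) \<longleftrightarrow> P \<in> ?D" for P
        unfolding f(1) vimage_eq Int_iff mem_Collect_eq
        using topspace_subset(2) image_points(1)[of P] by (metis (mono_tags, lifting) mem_Collect_eq subsetD)
      then show ?thesis by (rule Set.set_eqI)
    qed
    moreover have "openin (Proj_top B) ?D"
      unfolding Proj_top_def using f by (intro topology_generated_by_Basis) auto
    ultimately show "openin (Proj_top B) ((\<lambda>P. \<phi> ` P) -` U \<inter> topspace (Proj_top B))" by simp
  next
    have "\<phi> ` P \<in> topspace (Proj_top A)" if "P \<in> topspace (Proj_top B)" for P
      using that topspace_subset image_points pmap_topspace by (metis subsetD)
    then show "(\<lambda>P. \<phi> ` P) ` topspace (Proj_top B) \<subseteq> \<Union> (Dopen A)"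
      unfolding topspace_Proj(1)[symmetric] by blast
  qed
qed (use topspace_subset image_pmap image_points in blast)+

text \<open>A fraction is the set of all pairs representing it. Numerators, denominators and
  annihilating elements correspond under \<open>\<phi>\<close>, so a class is mapped onto a
  class.\<close>

lemma hfrac_image:
  assumes P: "P \<in> Proj_points A" and "a \<in> carrier B" "s \<in> carrier B"
  shows "map_prod \<phi> \<phi> ` hfrac B (pmap P) a s = hfrac A P (\<phi> a) (\<phi> s)"
proof -
  have cr: "cring A" "cring B" using Proj_points_cring assms by auto
  interpret h: ring_hom_cring B A \<phi> using ring_hom cr by simp
  have eq: "u \<otimes>\<^bsub>B\<^esub> ((a \<otimes>\<^bsub>B\<^esub> t) \<ominus>\<^bsub>B\<^esub> (b \<otimes>\<^bsub>B\<^esub> s)) = \<zero>\<^bsub>B\<^esub>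
     \<longleftrightarrow> \<phi> u \<otimes>\<^bsub>A\<^esub> ((\<phi> a \<otimes>\<^bsub>A\<^esub> \<phi> t) \<ominus>\<^bsub>A\<^esub> (\<phi> b \<otimes>\<^bsub>A\<^esub> \<phi> s)) = \<zero>\<^bsub>A\<^esub>"
    if "u \<in> carrier B" "b \<in> carrier B" "t \<in> carrier B" for u b t
  proof -
    have "\<phi> (u \<otimes>\<^bsub>B\<^esub> ((a \<otimes>\<^bsub>B\<^esub> t) \<ominus>\<^bsub>B\<^esub> (b \<otimes>\<^bsub>B\<^esub> s)))
        = \<phi> u \<otimes>\<^bsub>A\<^esub> ((\<phi> a \<otimes>\<^bsub>A\<^esub> \<phi> t) \<ominus>\<^bsub>A\<^esub> (\<phi> b \<otimes>\<^bsub>A\<^esub> \<phi> s))"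
      using that assms by (simp add: h.R.minus_eq h.S.minus_eq)
    then show ?thesis
      using phi_inj[of "u \<otimes>\<^bsub>B\<^esub> ((a \<otimes>\<^bsub>B\<^esub> t) \<ominus>\<^bsub>B\<^esub> (b \<otimes>\<^bsub>B\<^esub> s))" "\<zero>\<^bsub>B\<^esub>"] phi_zero cr that assms
      by simp
  qed
  have mem: "(b, t) \<in> hfrac B (pmap P) a s \<longleftrightarrow> (\<phi> b, \<phi> t) \<in> hfrac A P (\<phi> a) (\<phi> s)"
    if "b \<in> carrier B" "t \<in> carrier B" for b t
  proof -
    have "(\<exists>k. \<exists>u\<in>homog B k. u \<notin> pmap P \<and> u \<otimes>\<^bsub>B\<^esub> ((a \<otimes>\<^bsub>B\<^esub> t) \<ominus>\<^bsub>B\<^esub> (b \<otimes>\<^bsub>B\<^esub> s)) = \<zero>\<^bsub>B\<^esub>)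
      \<longleftrightarrow> (\<exists>k. \<exists>u\<in>homog A k. u \<notin> P \<and> u \<otimes>\<^bsub>A\<^esub> ((\<phi> a \<otimes>\<^bsub>A\<^esub> \<phi> t) \<ominus>\<^bsub>A\<^esub> (\<phi> b \<otimes>\<^bsub>A\<^esub> \<phi> s)) = \<zero>\<^bsub>A\<^esub>)"
    proof (intro ex_cong1 iffI; elim bexE conjE)
      fix k u assume u: "u \<in> homog B k" "u \<notin> pmap P"
        "u \<otimes>\<^bsub>B\<^esub> ((a \<otimes>\<^bsub>B\<^esub> t) \<ominus>\<^bsub>B\<^esub> (b \<otimes>\<^bsub>B\<^esub> s)) = \<zero>\<^bsub>B\<^esub>"
      then show "\<exists>u\<in>homog A k. u \<notin> P \<and> u \<otimes>\<^bsub>A\<^esub> ((\<phi> a \<otimes>\<^bsub>A\<^esub> \<phi> t) \<ominus>\<^bsub>A\<^esub> (\<phi> b \<otimes>\<^bsub>A\<^esub> \<phi> s)) = \<zero>\<^bsub>A\<^esub>"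
        using eq[of u b t] that homog_phi homog_carrier pmap_iff by (intro bexI[of _ "\<phi> u"]) auto
    next
      fix k v assume v: "v \<in> homog A k" "v \<notin> P"
        "v \<otimes>\<^bsub>A\<^esub> ((\<phi> a \<otimes>\<^bsub>A\<^esub> \<phi> t) \<ominus>\<^bsub>A\<^esub> (\<phi> b \<otimes>\<^bsub>A\<^esub> \<phi> s)) = \<zero>\<^bsub>A\<^esub>"
      then obtain u where "u \<in> homog B k" "v = \<phi> u" using homog_surj by metis
      then show "\<exists>u\<in>homog B k. u \<notin> pmap P \<and> u \<otimes>\<^bsub>B\<^esub> ((a \<otimes>\<^bsub>B\<^esub> t) \<ominus>\<^bsub>B\<^esub> (b \<otimes>\<^bsub>B\<^esub> s)) = \<zero>\<^bsub>B\<^esub>"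
        using eq[of u b t] v that homog_carrier pmap_iff by (intro bexI[of _ u]) auto
    qed
    then show ?thesis using that phi_homog pmap_iff by (simp add: hfrac_def)
  qed
  have sub: "hfrac B (pmap P) a s \<subseteq> carrier B \<times> carrier B"
    "hfrac A P (\<phi> a) (\<phi> s) \<subseteq> carrier A \<times> carrier A"
    by (auto simp: hfrac_def homog_def)
  show ?thesis
  proof (intro Set.set_eqI iffI)
    fix z assume "z \<in> map_prod \<phi> \<phi> ` hfrac B (pmap P) a s"
    then show "z \<in> hfrac A P (\<phi> a) (\<phi> s)" using mem sub(1) by auto
  next
    fix z assume z: "z \<in> hfrac A P (\<phi> a) (\<phi> s)"
    obtain x y where xy: "z = (x, y)" by fastforce
    then have "x \<in> carrier A" "y \<in> carrier A" using sub(2) z by auto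
    then obtain b t where bt: "b \<in> carrier B" "x = \<phi> b" "t \<in> carrier B" "y = \<phi> t"
      using phi_surj by metis
    then have "(b, t) \<in> hfrac B (pmap P) a s" using mem z xy by simp
    then show "z \<in> map_prod \<phi> \<phi> ` hfrac B (pmap P) a s" using bt xy by force
  qed
qed

text \<open>Reflexivity and transitivity of equality of fractions, in the form of a union of classes
  as it occurs in \<open>Proj_comorphism\<close>.\<close>

lemma hfrac_class:
  assumes P: "P \<in> Proj_points B" and as: "a \<in> homog B n" "s \<in> homog B n" "s \<notin> P"
  shows "(\<Union>(b, t)\<in>hfrac B P a s. hfrac B P b t) = hfrac B P a s"
proof -
  have cr: "cring B" using Proj_points_cring assms by auto
  interpret primeideal P B using P by (auto simp: Proj_points_def)
  have c: "a \<in> carrier B" "s \<in> carrier B" using as homog_carrier by auto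
  have "s \<otimes>\<^bsub>B\<^esub> ((a \<otimes>\<^bsub>B\<^esub> s) \<ominus>\<^bsub>B\<^esub> (a \<otimes>\<^bsub>B\<^esub> s)) = \<zero>\<^bsub>B\<^esub>"
    using c by (simp add: minus_eq r_neg)
  then have "(a, s) \<in> hfrac B P a s"
    using as by (auto simp: hfrac_def)
  moreover have "hfrac B P b t \<subseteq> hfrac B P a s" if "(b, t) \<in> hfrac B P a s" for b t
  proof (clarify)
    fix b' t' assume bt': "(b', t') \<in> hfrac B P b t"
    from that obtain n1 k u where 1: "b \<in> homog B n1" "t \<in> homog B n1" "t \<notin> P"
      "u \<in> homog B k" "u \<notin> P" "u \<otimes>\<^bsub>B\<^esub> ((a \<otimes>\<^bsub>B\<^esub> t) \<ominus>\<^bsub>B\<^esub> (b \<otimes>\<^bsub>B\<^esub> s)) = \<zero>\<^bsub>B\<^esub>"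
      by (auto simp: hfrac_def)
    from bt' obtain n2 l v where 2: "b' \<in> homog B n2" "t' \<in> homog B n2" "t' \<notin> P"
      "v \<in> homog B l" "v \<notin> P" "v \<otimes>\<^bsub>B\<^esub> ((b \<otimes>\<^bsub>B\<^esub> t') \<ominus>\<^bsub>B\<^esub> (b' \<otimes>\<^bsub>B\<^esub> t)) = \<zero>\<^bsub>B\<^esub>"
      by (auto simp: hfrac_def)
    have c': "b \<in> carrier B" "t \<in> carrier B" "u \<in> carrier B" "b' \<in> carrier B" "t' \<in> carrier B" "v \<in> carrier B"
      using 1 2 homog_carrier by auto
    \<comment> \<open>\<open>u\<close> annihilates \<open>a t - b s\<close> and \<open>v\<close>
      annihilates \<open>b t' - b' t\<close>; the extra factor \<open>t\<close> makes
      \<open>t (a t' - b' s)\<close> a combination of these two.\<close>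
    let ?w = "(u \<otimes>\<^bsub>B\<^esub> v) \<otimes>\<^bsub>B\<^esub> t"
    have "?w \<in> homog B (k + l + n1)" by (rule homog_mult[OF cr homog_mult[OF cr 1(4) 2(4)] 1(2)])
    moreover have "?w \<notin> P"
      using 1(3,5) 2(5) c' I_prime[of u v] I_prime[of "u \<otimes>\<^bsub>B\<^esub> v" t] by auto
    moreover have "?w \<otimes>\<^bsub>B\<^esub> ((a \<otimes>\<^bsub>B\<^esub> t') \<ominus>\<^bsub>B\<^esub> (b' \<otimes>\<^bsub>B\<^esub> s))
       = (v \<otimes>\<^bsub>B\<^esub> t') \<otimes>\<^bsub>B\<^esub> (u \<otimes>\<^bsub>B\<^esub> ((a \<otimes>\<^bsub>B\<^esub> t) \<ominus>\<^bsub>B\<^esub> (b \<otimes>\<^bsub>B\<^esub> s)))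
         \<oplus>\<^bsub>B\<^esub> (u \<otimes>\<^bsub>B\<^esub> s) \<otimes>\<^bsub>B\<^esub> (v \<otimes>\<^bsub>B\<^esub> ((b \<otimes>\<^bsub>B\<^esub> t') \<ominus>\<^bsub>B\<^esub> (b' \<otimes>\<^bsub>B\<^esub> t)))"
      using c c' by algebra
    then have "?w \<otimes>\<^bsub>B\<^esub> ((a \<otimes>\<^bsub>B\<^esub> t') \<ominus>\<^bsub>B\<^esub> (b' \<otimes>\<^bsub>B\<^esub> s)) = \<zero>\<^bsub>B\<^esub>"
      unfolding 1(6) 2(6) using c c' by simp
    ultimately show "(b', t') \<in> hfrac B P a s"
      using 2 by (auto simp: hfrac_def)
  qed
  ultimately show ?thesis by fast
qed

section \<open>Stalks of the structure sheaf\<close>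

lemma hloc_elem:
  "S \<in> carrier (hloc R P) \<longleftrightarrow> (\<exists>a s n. S = hfrac R P a s \<and> a \<in> homog R n \<and> s \<in> homog R n \<and> s \<notin> P)"
  by (auto simp: hloc_def)

lemma hloc_subset: "S \<in> carrier (hloc R P) \<Longrightarrow> S \<subseteq> carrier R \<times> carrier R"
  by (auto simp: hloc_elem hfrac_def homog_def)

text \<open>\<open>Proj_comorphism\<close> is defined by a union of classes of fractions. On a saturated set of fractions
  that union is the image under \<open>\<phi> \<times> \<phi>\<close>.\<close>

definition fracs where "fracs P = {(a, s). (\<exists>n. a \<in> homog B n \<and> s \<in> homog B n) \<and> s \<notin> P}"

definition saturated where
  "saturated P S \<longleftrightarrow> S \<subseteq> fracs P \<and> (\<Union>(b, t)\<in>S. hfrac B P b t) = S"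

lemma hfrac_saturated:
  assumes P: "P \<in> Proj_points B" and "(a, s) \<in> fracs P"
  shows "saturated P (hfrac B P a s)"
proof -
  obtain n where "a \<in> homog B n" "s \<in> homog B n" "s \<notin> P" using assms(2) by (auto simp: fracs_def)
  then have "(\<Union>(b, t)\<in>hfrac B P a s. hfrac B P b t) = hfrac B P a s" by (rule hfrac_class[OF P])
  moreover have "hfrac B P a s \<subseteq> fracs P" by (auto simp: hfrac_def fracs_def)
  ultimately show ?thesis by (simp add: saturated_def)
qed

lemma hloc_saturated:
  assumes P: "P \<in> Proj_points B" and "S \<in> carrier (hloc B P)"
  shows "saturated P S"
  using assms hfrac_saturated by (fastforce simp: hloc_elem fracs_def)

lemma saturated_UN:
  assumes "\<And>i. i \<in> I \<Longrightarrow> saturated P (S i)"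
  shows "saturated P (\<Union>i\<in>I. S i)"
proof -
  have "(\<Union>z\<in>(\<Union>i\<in>I. S i). case z of (b, t) \<Rightarrow> hfrac B P b t)
      = (\<Union>i\<in>I. \<Union>z\<in>S i. case z of (b, t) \<Rightarrow> hfrac B P b t)"
    by (rule UN_UN_flatten)
  then show ?thesis using assms by (auto simp: saturated_def)
qed

text \<open>Products and sums in the stalk are unions of classes over all pairs of representatives.
  Such a union is saturated once every fraction in it has an admissible denominator and equal
  degrees, and saturation is what \<open>stalk_map\<close> asks for.\<close>

lemma hloc_mult_saturated:
  assumes P: "P \<in> Proj_points B" and S: "S \<in> carrier (hloc B P)" and T: "T \<in> carrier (hloc B P)"
  shows "saturated P (S \<otimes>\<^bsub>hloc B P\<^esub> T)" "saturated P (S \<oplus>\<^bsub>hloc B P\<^esub> T)"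
proof -
  have cr: "cring B" using Proj_points_cring P by auto
  interpret primeideal P B using P by (auto simp: Proj_points_def)
  have *: "S \<subseteq> fracs P" "T \<subseteq> fracs P"
    using hloc_saturated[OF P S] hloc_saturated[OF P T] by (auto simp: saturated_def)
  have "(a \<otimes>\<^bsub>B\<^esub> b, s \<otimes>\<^bsub>B\<^esub> t) \<in> fracs P \<and> (a \<otimes>\<^bsub>B\<^esub> t \<oplus>\<^bsub>B\<^esub> b \<otimes>\<^bsub>B\<^esub> s, s \<otimes>\<^bsub>B\<^esub> t) \<in> fracs P"
    if as: "(a, s) \<in> S" and bt: "(b, t) \<in> T" for a s b t
  proof -
    obtain m n where 1: "a \<in> homog B m" "s \<in> homog B m" "s \<notin> P" "b \<in> homog B n" "t \<in> homog B n" "t \<notin> P"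
      using subsetD[OF *(1) as] subsetD[OF *(2) bt] unfolding fracs_def by blast
    then have "s \<otimes>\<^bsub>B\<^esub> t \<notin> P" using I_prime homog_carrier by blast
    moreover have "b \<otimes>\<^bsub>B\<^esub> s \<in> homog B (m + n)"
      using homog_mult[OF cr 1(4) 1(2)] by (simp add: add.commute)
    moreover note homog_mult[OF cr 1(1) 1(5)] homog_mult[OF cr 1(1) 1(4)] homog_mult[OF cr 1(2) 1(5)]
    ultimately show ?thesis using homog_add[OF cr] unfolding fracs_def by blast
  qed
  then show "saturated P (S \<otimes>\<^bsub>hloc B P\<^esub> T)" "saturated P (S \<oplus>\<^bsub>hloc B P\<^esub> T)"
    unfolding hloc_def by (auto intro!: saturated_UN hfrac_saturated[OF P] simp: case_prod_beta)
qed

lemma UN_pair_image: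
  "(\<And>b t. (b, t) \<in> S \<Longrightarrow> f b t = h ` g b t) \<Longrightarrow> (\<Union>(b, t)\<in>S. f b t) = h ` (\<Union>(b, t)\<in>S. g b t)"
  by fastforce

lemma stalk_map:
  assumes P: "P \<in> Proj_points A" and S: "saturated (pmap P) S"
  shows "(\<Union>(b, t)\<in>S. hfrac A P (\<phi> b) (\<phi> t)) = map_prod \<phi> \<phi> ` S"
proof -
  have "S \<subseteq> carrier B \<times> carrier B" using S homog_carrier by (auto simp: saturated_def fracs_def)
  then have "(\<Union>(b, t)\<in>S. hfrac A P (\<phi> b) (\<phi> t)) = map_prod \<phi> \<phi> ` (\<Union>(b, t)\<in>S. hfrac B (pmap P) b t)"
    by (intro UN_pair_image hfrac_image[OF P, symmetric]) auto
  also have "\<dots> = map_prod \<phi> \<phi> ` S"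
    using S by (simp add: saturated_def)
  finally show ?thesis .
qed

lemma stalk_closed:
  assumes P: "P \<in> Proj_points A" and S: "S \<in> carrier (hloc B (pmap P))"
  shows "map_prod \<phi> \<phi> ` S \<in> carrier (hloc A P)"
proof -
  obtain a s n where as: "S = hfrac B (pmap P) a s" "a \<in> homog B n" "s \<in> homog B n" "s \<notin> pmap P"
    using S by (auto simp: hloc_elem)
  then have "map_prod \<phi> \<phi> ` S = hfrac A P (\<phi> a) (\<phi> s)"
    using hfrac_image[OF P homog_carrier(1) homog_carrier(1)] by simp
  moreover have "\<phi> s \<notin> P" using as(3,4) homog_carrier pmap_iff by blast
  ultimately show ?thesis unfolding hloc_elem using as(2,3) homog_phi by blast
qed

lemma stalk_surj:
  assumes P: "P \<in> Proj_points A" and T: "T \<in> carrier (hloc A P)"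
  obtains S where "S \<in> carrier (hloc B (pmap P))" "T = map_prod \<phi> \<phi> ` S"
proof -
  obtain a s n where as: "T = hfrac A P a s" "a \<in> homog A n" "s \<in> homog A n" "s \<notin> P"
    using T by (auto simp: hloc_elem)
  obtain a' s' where as': "a' \<in> homog B n" "s' \<in> homog B n" "a = \<phi> a'" "s = \<phi> s'"
    using as homog_surj by metis
  have "s' \<notin> pmap P" using as as' homog_carrier pmap_iff by blast
  moreover have "T = map_prod \<phi> \<phi> ` hfrac B (pmap P) a' s'"
    using as as' hfrac_image[OF P homog_carrier(1) homog_carrier(1)] by simp
  ultimately show thesis using that as' hloc_elem by blast
qed

lemma stalk_inj:
  assumes "S \<in> carrier (hloc B Q)" "T \<in> carrier (hloc B Q)" "map_prod \<phi> \<phi> ` S = map_prod \<phi> \<phi> ` T"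
  shows "S = T"
proof -
  have "inj_on (map_prod \<phi> \<phi>) (carrier B \<times> carrier B)"
    using phi_bij by (auto simp: inj_on_def bij_betw_def)
  then show ?thesis using assms hloc_subset inj_on_image_eq_iff by metis
qed

lemma stalk_mult:
  assumes P: "P \<in> Proj_points A"
    and S: "S \<in> carrier (hloc B (pmap P))" and T: "T \<in> carrier (hloc B (pmap P))"
  shows "map_prod \<phi> \<phi> ` (S \<otimes>\<^bsub>hloc B (pmap P)\<^esub> T)
      = (map_prod \<phi> \<phi> ` S) \<otimes>\<^bsub>hloc A P\<^esub> (map_prod \<phi> \<phi> ` T)" (is ?m)
    "map_prod \<phi> \<phi> ` (S \<oplus>\<^bsub>hloc B (pmap P)\<^esub> T)
      = (map_prod \<phi> \<phi> ` S) \<oplus>\<^bsub>hloc A P\<^esub> (map_prod \<phi> \<phi> ` T)" (is ?a)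
proof -
  interpret B: cring B using Proj_points_cring P by auto
  have c: "\<And>a s. (a, s) \<in> S \<Longrightarrow> a \<in> carrier B \<and> s \<in> carrier B"
     "\<And>a s. (a, s) \<in> T \<Longrightarrow> a \<in> carrier B \<and> s \<in> carrier B"
    using hloc_subset S T by blast+
  have "map_prod \<phi> \<phi> ` (S \<otimes>\<^bsub>hloc B (pmap P)\<^esub> T)
    = (\<Union>(a, s)\<in>S. \<Union>(b, t)\<in>T. hfrac A P (\<phi> a \<otimes>\<^bsub>A\<^esub> \<phi> b) (\<phi> s \<otimes>\<^bsub>A\<^esub> \<phi> t))"
    unfolding hloc_def using c
    by (simp, intro sym[OF UN_pair_image] UN_pair_image) (simp add: hfrac_image[OF P] phi_mult)
  also have "\<dots> = (map_prod \<phi> \<phi> ` S) \<otimes>\<^bsub>hloc A P\<^esub> (map_prod \<phi> \<phi> ` T)"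
    by (simp add: hloc_def case_prod_beta)
  finally show ?m .
  have "map_prod \<phi> \<phi> ` (S \<oplus>\<^bsub>hloc B (pmap P)\<^esub> T)
    = (\<Union>(a, s)\<in>S. \<Union>(b, t)\<in>T.
      hfrac A P ((\<phi> a \<otimes>\<^bsub>A\<^esub> \<phi> t) \<oplus>\<^bsub>A\<^esub> (\<phi> b \<otimes>\<^bsub>A\<^esub> \<phi> s)) (\<phi> s \<otimes>\<^bsub>A\<^esub> \<phi> t))"
    unfolding hloc_def using c
    by (simp, intro sym[OF UN_pair_image] UN_pair_image) (simp add: hfrac_image[OF P] phi_mult phi_add)
  also have "\<dots> = (map_prod \<phi> \<phi> ` S) \<oplus>\<^bsub>hloc A P\<^esub> (map_prod \<phi> \<phi> ` T)"
    by (simp add: hloc_def case_prod_beta)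
  finally show ?a .
qed

lemma stalk_one: assumes P: "P \<in> Proj_points A"
  shows "map_prod \<phi> \<phi> ` \<one>\<^bsub>hloc B (pmap P)\<^esub> = \<one>\<^bsub>hloc A P\<^esub>" "\<one>\<^bsub>hloc B (pmap P)\<^esub> \<in> carrier (hloc B (pmap P))"
proof -
  interpret B: cring B using Proj_points_cring P by auto
  interpret primeideal "pmap P" B using pmap_points[OF P] by (auto simp: Proj_points_def)
  show "map_prod \<phi> \<phi> ` \<one>\<^bsub>hloc B (pmap P)\<^esub> = \<one>\<^bsub>hloc A P\<^esub>"
    using hfrac_image[OF P] by (simp add: hloc_def phi_one)
  have "\<one>\<^bsub>B\<^esub> \<notin> pmap P" using I_notcarr one_imp_carrier by blast
  moreover have "\<one>\<^bsub>B\<^esub> \<in> homog B 0" by (rule one_homog) unfold_locales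
  ultimately show "\<one>\<^bsub>hloc B (pmap P)\<^esub> \<in> carrier (hloc B (pmap P))" by (auto simp: hloc_def)
qed


section \<open>Sections and the comorphism\<close>

lemma cpre_Proj: "cpre (Proj A \<kappa>) pmap U = {P \<in> topspace (Proj_top A). pmap P \<in> U}"
  by (simp add: cpre_def Proj_def)

text \<open>\<open>Proj_comorphism\<close> with the union of classes replaced by an image. The two
  agree on saturated values, and for images injectivity and compatibility with the operations are
  easier to see.\<close>

definition como where
  "como U \<sigma> = (\<lambda>P\<in>{P \<in> topspace (Proj_top A). pmap P \<in> U}. map_prod \<phi> \<phi> ` \<sigma> (pmap P))"

lemma Proj_comorphism_eq:
  assumes "\<And>P. P \<in> U \<Longrightarrow> P \<in> Proj_points B \<Longrightarrow> saturated P (\<sigma> P)"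
  shows "Proj_comorphism A B \<phi> U \<sigma> = como U \<sigma>"
  unfolding Proj_comorphism_def como_def using assms topspace_subset stalk_map pmap_points
  by (intro restrict_ext) (simp add: subset_iff)

lemma sections_saturated:
  assumes "\<sigma> \<in> carrier (Proj_sections B U)" "P \<in> U" "P \<in> Proj_points B"
  shows "saturated P (\<sigma> P)"
  using assms hloc_saturated by (auto simp: Proj_sections_def)

lemma openin_vimage:
  assumes "openin (Proj_top B) U"
  shows "openin (Proj_top A) {P \<in> topspace (Proj_top A). pmap P \<in> U}"
  using pmap_homeomorphic_maps assms by (auto simp: homeomorphic_maps_def openin_continuous_map_preimage)

lemma openin_image:
  assumes "openin (Proj_top A) V"
  shows "openin (Proj_top B) {P \<in> topspace (Proj_top B). \<phi> ` P \<in> V}"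
  using pmap_homeomorphic_maps assms by (auto simp: homeomorphic_maps_def openin_continuous_map_preimage)

lemma pmap_image_topspace:
  "P \<in> topspace (Proj_top B) \<Longrightarrow> \<phi> ` P \<in> topspace (Proj_top A) \<and> pmap (\<phi> ` P) = P"
  "Q \<in> topspace (Proj_top A) \<Longrightarrow> pmap Q \<in> topspace (Proj_top B) \<and> \<phi> ` pmap Q = Q"
  using pmap_homeomorphic_maps
  by (auto simp: homeomorphic_maps_def continuous_map_def Pi_iff)

lemma como_closed:
  assumes U: "openin (Proj_top B) U" and \<sigma>: "\<sigma> \<in> carrier (Proj_sections B U)"
  shows "como U \<sigma> \<in> carrier (Proj_sections A {P \<in> topspace (Proj_top A). pmap P \<in> U})"
proof -
  let ?W = "{P \<in> topspace (Proj_top A). pmap P \<in> U}"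
  have 1: "\<sigma> P \<in> carrier (hloc B P)" if "P \<in> U" for P
    using \<sigma> that by (auto simp: Proj_sections_def)
  have "como U \<sigma> \<in> Pi\<^sub>E ?W (\<lambda>P. carrier (hloc A P))"
    unfolding como_def using stalk_closed 1 topspace_subset by auto
  moreover have "\<exists>V a s n. openin (Proj_top A) V \<and> P \<in> V \<and> V \<subseteq> ?W \<and>
          a \<in> homog A n \<and> s \<in> homog A n \<and> (\<forall>P'\<in>V. s \<notin> P' \<and> como U \<sigma> P' = hfrac A P' a s)"
    if P: "P \<in> ?W" for P
  proof -
    have "pmap P \<in> U" using P by simp
    from Proj_sections_local[OF \<sigma> this] obtain V a s n where V: "openin (Proj_top B) V" "pmap P \<in> V" "V \<subseteq> U"
      "a \<in> homog B n" "s \<in> homog B n" and Vs: "\<And>P'. P' \<in> V \<Longrightarrow> s \<notin> P' \<and> \<sigma> P' = hfrac B P' a s"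
      by metis
    let ?V = "{P \<in> topspace (Proj_top A). pmap P \<in> V}"
    have "\<phi> s \<notin> P' \<and> como U \<sigma> P' = hfrac A P' (\<phi> a) (\<phi> s)" if P': "P' \<in> ?V" for P'
    proof
      have *: "pmap P' \<in> V" "P' \<in> Proj_points A" using P' topspace_subset by auto
      show "\<phi> s \<notin> P'" using Vs[OF *(1)] pmap_iff[of s P'] V homog_carrier by blast
      have "como U \<sigma> P' = map_prod \<phi> \<phi> ` \<sigma> (pmap P')"
        using P' V(3) by (auto simp: como_def)
      then show "como U \<sigma> P' = hfrac A P' (\<phi> a) (\<phi> s)"
        using Vs[OF *(1)] hfrac_image[OF *(2) homog_carrier(1) homog_carrier(1)] V by simp
    qed
    moreover have "openin (Proj_top A) ?V" "P \<in> ?V" "?V \<subseteq> ?W"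
      using openin_vimage V P by auto
    moreover have "\<phi> a \<in> homog A n" "\<phi> s \<in> homog A n" using homog_phi V by auto
    ultimately show ?thesis by blast
  qed
  ultimately show ?thesis by (simp add: Proj_sections_def)
qed

text \<open>The stalk maps are inverted point by point. To see that the result is a section, a local
  fraction of \<open>\<tau>\<close> is lifted to \<open>B\<close>, and \<open>stalk_inj\<close>
  forces the pointwise choice to be that lift.\<close>

lemma como_surj:
  assumes U: "openin (Proj_top B) U"
    and \<tau>: "\<tau> \<in> carrier (Proj_sections A {P \<in> topspace (Proj_top A). pmap P \<in> U})"
  shows "\<exists>\<sigma>\<in>carrier (Proj_sections B U). \<tau> = como U \<sigma>"
proof -
  let ?W = "{P \<in> topspace (Proj_top A). pmap P \<in> U}"
  have Usub: "U \<subseteq> topspace (Proj_top B)" using U openin_subset by blast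
  have \<tau>1: "\<tau> P \<in> carrier (hloc A P)" if "P \<in> ?W" for P
    using \<tau> that by (auto simp: Proj_sections_def)
  have "\<exists>S. S \<in> carrier (hloc B P) \<and> \<tau> (\<phi> ` P) = map_prod \<phi> \<phi> ` S" if P: "P \<in> U" for P
  proof -
    have *: "\<phi> ` P \<in> ?W" "\<phi> ` P \<in> Proj_points A" "pmap (\<phi> ` P) = P"
      using P Usub pmap_image_topspace topspace_subset by (simp_all add: subset_iff)
    show ?thesis using stalk_surj[OF *(2) \<tau>1[OF *(1)]] *(3) by metis
  qed
  then obtain S where S: "\<And>P. P \<in> U \<Longrightarrow> S P \<in> carrier (hloc B P)"
     "\<And>P. P \<in> U \<Longrightarrow> \<tau> (\<phi> ` P) = map_prod \<phi> \<phi> ` S P"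
    by metis
  let ?\<sigma> = "restrict S U"
  have "?\<sigma> \<in> Pi\<^sub>E U (\<lambda>P. carrier (hloc B P))" using S by auto
  moreover have "\<exists>V a s n. openin (Proj_top B) V \<and> P \<in> V \<and> V \<subseteq> U \<and>
          a \<in> homog B n \<and> s \<in> homog B n \<and> (\<forall>P'\<in>V. s \<notin> P' \<and> ?\<sigma> P' = hfrac B P' a s)"
    if P: "P \<in> U" for P
  proof -
    have "\<phi> ` P \<in> ?W" using P Usub pmap_image_topspace by auto
    from Proj_sections_local[OF \<tau> this] obtain V a s n where "openin (Proj_top A) V \<and> \<phi> ` P \<in> V
      \<and> V \<subseteq> ?W \<and> a \<in> homog A n \<and> s \<in> homog A n \<and> (\<forall>P'\<in>V. s \<notin> P' \<and> \<tau> P' = hfrac A P' a s)"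
      by (elim exE) (rule that)
    then have V: "openin (Proj_top A) V" "\<phi> ` P \<in> V" "V \<subseteq> ?W"
      "a \<in> homog A n" "s \<in> homog A n" and Vs: "\<And>P'. P' \<in> V \<Longrightarrow> s \<notin> P' \<and> \<tau> P' = hfrac A P' a s"
      by auto
    obtain a' s' where as: "a' \<in> homog B n" "s' \<in> homog B n" "a = \<phi> a'" "s = \<phi> s'"
      using homog_surj[OF V(4)] homog_surj[OF V(5)] by metis
    let ?V = "{P \<in> topspace (Proj_top B). \<phi> ` P \<in> V}"
    have VU: "?V \<subseteq> U" using V(3) pmap_image_topspace by auto
    have "s' \<notin> P' \<and> ?\<sigma> P' = hfrac B P' a' s'" if P': "P' \<in> ?V" for P'
    proof
      have *: "\<phi> ` P' \<in> V" "\<phi> ` P' \<in> Proj_points A" "pmap (\<phi> ` P') = P'" "P' \<in> U" "P' \<in> Proj_points B"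
        using P' VU topspace_subset pmap_image_topspace(1)[of P'] by (simp_all add: subset_iff)
      show s': "s' \<notin> P'" using Vs[OF *(1)] as by blast
      have "map_prod \<phi> \<phi> ` S P' = \<tau> (\<phi> ` P')" using S(2)[OF *(4)] by simp
      also have "\<dots> = map_prod \<phi> \<phi> ` hfrac B P' a' s'"
        using Vs[OF *(1)] hfrac_image[OF *(2) homog_carrier(1) homog_carrier(1)] as *(3) by simp
      finally have "map_prod \<phi> \<phi> ` S P' = map_prod \<phi> \<phi> ` hfrac B P' a' s'" .
      moreover have "hfrac B P' a' s' \<in> carrier (hloc B P')" unfolding hloc_elem using as s' by blast
      ultimately have "S P' = hfrac B P' a' s'"
        using stalk_inj[OF S(1)[OF *(4)]] by blast
      then show "?\<sigma> P' = hfrac B P' a' s'" using *(4) by simp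
    qed
    moreover have "openin (Proj_top B) ?V" "P \<in> ?V"
      using openin_image V P Usub by auto
    ultimately show ?thesis using as VU by blast
  qed
  ultimately have "?\<sigma> \<in> carrier (Proj_sections B U)" by (simp add: Proj_sections_def)
  moreover have "\<tau> = como U ?\<sigma>"
  proof
    fix P show "\<tau> P = como U ?\<sigma> P"
    proof (cases "P \<in> ?W")
      case True
      then show ?thesis using S(2)[of "pmap P"] pmap_image_topspace by (auto simp: como_def)
    next
      case False
      then show ?thesis using \<tau> by (auto simp: Proj_sections_def como_def PiE_iff extensional_def)
    qed
  qed
  ultimately show ?thesis by blast
qed

lemma como_inj:
  assumes U: "openin (Proj_top B) U"
  shows "inj_on (como U) (carrier (Proj_sections B U))"
proof (rule inj_onI)
  have Usub: "U \<subseteq> topspace (Proj_top B)" using U openin_subset by blast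
  fix \<sigma> \<tau> assume \<sigma>: "\<sigma> \<in> carrier (Proj_sections B U)" and \<tau>: "\<tau> \<in> carrier (Proj_sections B U)"
    and eq: "como U \<sigma> = como U \<tau>"
  show "\<sigma> = \<tau>"
  proof
    fix P show "\<sigma> P = \<tau> P"
    proof (cases "P \<in> U")
      case True
      have *: "\<phi> ` P \<in> topspace (Proj_top A)" "pmap (\<phi> ` P) = P"
        using True Usub pmap_image_topspace by auto
      have "map_prod \<phi> \<phi> ` \<sigma> P = map_prod \<phi> \<phi> ` \<tau> P"
        using fun_cong[OF eq, of "\<phi> ` P"] * True by (simp add: como_def)
      moreover have "\<sigma> P \<in> carrier (hloc B P)" "\<tau> P \<in> carrier (hloc B P)"
        using \<sigma> \<tau> True by (auto simp: Proj_sections_def)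
      ultimately show ?thesis using stalk_inj by blast
    next
      case False
      then show ?thesis using \<sigma> \<tau> by (auto simp: Proj_sections_def PiE_iff extensional_def)
    qed
  qed
qed

lemma como_ring_iso:
  assumes U: "openin (Proj_top B) U"
  shows "como U \<in> ring_iso (Proj_sections B U)
           (Proj_sections A {P \<in> topspace (Proj_top A). pmap P \<in> U})"
proof (rule ring_iso_memI)
  fix \<sigma> \<tau> assume \<sigma>: "\<sigma> \<in> carrier (Proj_sections B U)" and \<tau>: "\<tau> \<in> carrier (Proj_sections B U)"
  show "como U \<sigma> \<in> carrier (Proj_sections A {P \<in> topspace (Proj_top A). pmap P \<in> U})"
    using como_closed U \<sigma> by simp
  have 1: "\<sigma> P \<in> carrier (hloc B P)" "\<tau> P \<in> carrier (hloc B P)" if "P \<in> U" for P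
    using \<sigma> \<tau> that by (auto simp: Proj_sections_def)
  show "como U (\<sigma> \<otimes>\<^bsub>Proj_sections B U\<^esub> \<tau>) =
    como U \<sigma> \<otimes>\<^bsub>Proj_sections A {P \<in> topspace (Proj_top A). pmap P \<in> U}\<^esub> como U \<tau>"
    using 1 topspace_subset by (simp add: Proj_sections_def como_def fun_eq_iff restrict_def stalk_mult subset_iff)
  show "como U (\<sigma> \<oplus>\<^bsub>Proj_sections B U\<^esub> \<tau>) =
    como U \<sigma> \<oplus>\<^bsub>Proj_sections A {P \<in> topspace (Proj_top A). pmap P \<in> U}\<^esub> como U \<tau>"
    using 1 topspace_subset by (simp add: Proj_sections_def como_def fun_eq_iff restrict_def stalk_mult subset_iff)
next
  show "como U \<one>\<^bsub>Proj_sections B U\<^esub> = \<one>\<^bsub>Proj_sections A {P \<in> topspace (Proj_top A). pmap P \<in> U}\<^esub>"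
    using topspace_subset by (simp add: Proj_sections_def como_def fun_eq_iff restrict_def stalk_one subset_iff)
  show "bij_betw (como U) (carrier (Proj_sections B U))
     (carrier (Proj_sections A {P \<in> topspace (Proj_top A). pmap P \<in> U}))"
    using como_inj[OF U] como_closed[OF U] como_surj[OF U] by (auto simp: bij_betw_def image_iff)
qed

text \<open>On sections the comorphism is \<open>como\<close>. Products, sums, the unit and the
  constants are reached through saturation of their values, without first showing that they are
  sections.\<close>

theorem Proj_iso:
  assumes \<kappa>: "\<And>c. cring B \<Longrightarrow> \<kappa>B c \<in> homog B 0" "\<And>c. cring B \<Longrightarrow> \<phi> (\<kappa>B c) = \<kappa>A c"
  shows "cspace_iso (Proj A \<kappa>A) (Proj B \<kappa>B) pmap (Proj_comorphism A B \<phi>)"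
  unfolding cspace_iso_def
proof (intro conjI allI impI)
  show "homeomorphic_map (ctop (Proj A \<kappa>A)) (ctop (Proj B \<kappa>B)) pmap"
    using pmap_homeomorphic_maps homeomorphic_maps_imp_map by (simp add: Proj_def) blast
next
  fix U assume "openin (ctop (Proj B \<kappa>B)) U"
  then have U: "openin (Proj_top B) U" by (simp add: Proj_def)
  let ?W = "{P \<in> topspace (Proj_top A). pmap P \<in> U}"
  have Usub: "U \<subseteq> Proj_points B" using U openin_subset topspace_subset by blast
  have sec: "Proj_comorphism A B \<phi> U \<sigma> = como U \<sigma>" if "\<sigma> \<in> carrier (Proj_sections B U)" for \<sigma>
    using that sections_saturated by (intro Proj_comorphism_eq) auto
  have hl: "\<sigma> P \<in> carrier (hloc B P)" if "P \<in> U" "\<sigma> \<in> carrier (Proj_sections B U)" for \<sigma> P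
    using that by (auto simp: Proj_sections_def)
  have "Proj_comorphism A B \<phi> U \<in> ring_iso (Proj_sections B U) (Proj_sections A ?W)"
  proof (rule ring_iso_memI)
    note iso = como_ring_iso[OF U]
    fix \<sigma> \<tau> assume \<sigma>: "\<sigma> \<in> carrier (Proj_sections B U)" and \<tau>: "\<tau> \<in> carrier (Proj_sections B U)"
    show "Proj_comorphism A B \<phi> U \<sigma> \<in> carrier (Proj_sections A ?W)"
      using \<sigma> sec ring_iso_memE(1)[OF iso] by simp
    have "Proj_comorphism A B \<phi> U (\<sigma> \<otimes>\<^bsub>Proj_sections B U\<^esub> \<tau>) = como U (\<sigma> \<otimes>\<^bsub>Proj_sections B U\<^esub> \<tau>)"
      using hl \<sigma> \<tau> hloc_mult_saturated
      by (intro Proj_comorphism_eq) (simp add: Proj_sections_def)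
    then show "Proj_comorphism A B \<phi> U (\<sigma> \<otimes>\<^bsub>Proj_sections B U\<^esub> \<tau>)
      = Proj_comorphism A B \<phi> U \<sigma> \<otimes>\<^bsub>Proj_sections A ?W\<^esub> Proj_comorphism A B \<phi> U \<tau>"
      using ring_iso_memE(2)[OF iso \<sigma> \<tau>] \<sigma> \<tau> sec by simp
    have "Proj_comorphism A B \<phi> U (\<sigma> \<oplus>\<^bsub>Proj_sections B U\<^esub> \<tau>) = como U (\<sigma> \<oplus>\<^bsub>Proj_sections B U\<^esub> \<tau>)"
      using hl \<sigma> \<tau> hloc_mult_saturated
      by (intro Proj_comorphism_eq) (simp add: Proj_sections_def)
    then show "Proj_comorphism A B \<phi> U (\<sigma> \<oplus>\<^bsub>Proj_sections B U\<^esub> \<tau>)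
      = Proj_comorphism A B \<phi> U \<sigma> \<oplus>\<^bsub>Proj_sections A ?W\<^esub> Proj_comorphism A B \<phi> U \<tau>"
      using ring_iso_memE(3)[OF iso \<sigma> \<tau>] \<sigma> \<tau> sec by simp
  next
    have one: "saturated P (\<one>\<^bsub>Proj_sections B U\<^esub> P)" if "P \<in> U" for P
      using that Usub image_points[of P] stalk_one(2)[of "\<phi> ` P"] hloc_saturated[of P]
      by (auto simp: Proj_sections_def)
    then show "Proj_comorphism A B \<phi> U \<one>\<^bsub>Proj_sections B U\<^esub> = \<one>\<^bsub>Proj_sections A ?W\<^esub>"
      using Proj_comorphism_eq ring_iso_memE(4)[OF como_ring_iso[OF U]] by simp
    show "bij_betw (Proj_comorphism A B \<phi> U) (carrier (Proj_sections B U)) (carrier (Proj_sections A ?W))"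
      using ring_iso_memE(5)[OF como_ring_iso[OF U]] sec by (simp cong: bij_betw_cong)
  qed
  then show "Proj_comorphism A B \<phi> U \<in> ring_iso (sections (Proj B \<kappa>B) U)
      (sections (Proj A \<kappa>A) (cpre (Proj A \<kappa>A) pmap U))"
    by (simp add: cpre_Proj) (simp add: Proj_def)
  have \<kappa>: "saturated P (hfrac B P (\<kappa>B c) \<one>\<^bsub>B\<^esub>)" if "P \<in> U" for P c
  proof -
    have P: "P \<in> Proj_points B" using that Usub by auto
    then have cr: "cring B" using Proj_points_cring by auto
    interpret primeideal P B using P by (auto simp: Proj_points_def)
    have "\<one>\<^bsub>B\<^esub> \<notin> P" using I_notcarr one_imp_carrier by blast
    then have "(\<kappa>B c, \<one>\<^bsub>B\<^esub>) \<in> fracs P"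
      using \<kappa>(1)[OF cr] one_homog[OF cr] by (auto simp: fracs_def)
    then show ?thesis using hfrac_saturated P by simp
  qed
  have eq: "como U (\<lambda>P\<in>U. hfrac B P (\<kappa>B c) \<one>\<^bsub>B\<^esub>) = (\<lambda>P\<in>?W. hfrac A P (\<kappa>A c) \<one>\<^bsub>A\<^esub>)" for c
  proof -
    have "map_prod \<phi> \<phi> ` hfrac B (pmap P) (\<kappa>B c) \<one>\<^bsub>B\<^esub> = hfrac A P (\<kappa>A c) \<one>\<^bsub>A\<^esub>" if "P \<in> ?W" for P
    proof -
      have P: "P \<in> Proj_points A" using that topspace_subset by auto
      then have cr: "cring B" using Proj_points_cring by auto
      interpret B: cring B by fact
      show ?thesis using hfrac_image[OF P homog_carrier(1)[OF assms(1)[OF cr]] B.one_closed]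
        phi_one assms(2)[OF cr] by simp
    qed
    then show ?thesis by (auto simp: como_def fun_eq_iff)
  qed
  fix c
  have "Proj_comorphism A B \<phi> U (\<lambda>P\<in>U. hfrac B P (\<kappa>B c) \<one>\<^bsub>B\<^esub>) = (\<lambda>P\<in>?W. hfrac A P (\<kappa>A c) \<one>\<^bsub>A\<^esub>)"
    using \<kappa> eq by (subst Proj_comorphism_eq) auto
  then show "Proj_comorphism A B \<phi> U (cconst (Proj B \<kappa>B) U c)
    = cconst (Proj A \<kappa>A) (cpre (Proj A \<kappa>A) pmap U) c"
    by (simp add: cpre_Proj) (simp add: Proj_def)
next
  fix U V s
  assume "openin (ctop (Proj B \<kappa>B)) U"
    "openin (ctop (Proj B \<kappa>B)) V \<and> V \<subseteq> U \<and> s \<in> carrier (sections (Proj B \<kappa>B) U)"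
  then show "Proj_comorphism A B \<phi> V (cres (Proj B \<kappa>B) U V s) =
    cres (Proj A \<kappa>A) (cpre (Proj A \<kappa>A) pmap U) (cpre (Proj A \<kappa>A) pmap V) (Proj_comorphism A B \<phi> U s)"
    by (simp add: cpre_Proj) (auto simp: Proj_def Proj_comorphism_def fun_eq_iff)
qed

end

section \<open>Isomorphic GIT problems\<close>

lemma polyfun_diff: "f \<in> polyfun G \<Longrightarrow> g \<in> polyfun G \<Longrightarrow> (\<lambda>p. f p - g p) \<in> polyfun G"
  using polyfun.add[OF _ polyfun.mult[OF polyfun.const[of "- 1"]], of f G g] by simp

lemma polyfun_cmult: "f \<in> polyfun G \<Longrightarrow> (\<lambda>p. c * f p) \<in> polyfun G"
  by (intro polyfun.mult polyfun.const)

lemma polyfun_sum: "(\<And>i. i \<in> I \<Longrightarrow> f i \<in> polyfun G) \<Longrightarrow> (\<lambda>p. \<Sum>i\<in>I. f i p) \<in> polyfun G"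
  by (induction I rule: infinite_finite_induct) (auto intro: polyfun.intros)

lemma amb_ring_carrier: "f \<in> carrier (amb_ring D) \<longleftrightarrow> (\<exists>f0\<in>polyfun (coords D). f = restrict f0 (amb D))"
  by (auto simp: amb_ring_def)

lemma amb_ring_ext: "f \<in> carrier (amb_ring D) \<Longrightarrow> f \<in> extensional (amb D)"
  by (auto simp: amb_ring_carrier)

lemma amb_ring_cring: "cring (amb_ring D)"
proof -
  have closed: "(\<lambda>p\<in>amb D. f p + g p) \<in> (\<lambda>f. restrict f (amb D)) ` polyfun (coords D)"
    "(\<lambda>p\<in>amb D. f p * g p) \<in> (\<lambda>f. restrict f (amb D)) ` polyfun (coords D)"
    if "f \<in> polyfun (coords D)" "g \<in> polyfun (coords D)" for f g
    using polyfun.add[OF that] polyfun.mult[OF that] by blast+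
  show ?thesis
  proof (intro cringI abelian_groupI comm_monoidI)
    fix x y assume "x \<in> carrier (amb_ring D)" "y \<in> carrier (amb_ring D)"
    then show "x \<oplus>\<^bsub>amb_ring D\<^esub> y \<in> carrier (amb_ring D)" "x \<otimes>\<^bsub>amb_ring D\<^esub> y \<in> carrier (amb_ring D)"
      using closed by (auto simp: amb_ring_def cong: restrict_cong)
  next
    show "\<zero>\<^bsub>amb_ring D\<^esub> \<in> carrier (amb_ring D)" "\<one>\<^bsub>amb_ring D\<^esub> \<in> carrier (amb_ring D)"
      unfolding amb_ring_carrier using polyfun.const by (auto simp: amb_ring_def)
  next
    fix x assume "x \<in> carrier (amb_ring D)"
    then obtain f where f: "f \<in> polyfun (coords D)" "x = restrict f (amb D)"
      by (auto simp: amb_ring_carrier)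
    have "(\<lambda>p\<in>amb D. - 1 * f p) \<in> carrier (amb_ring D)"
      using polyfun_cmult[OF f(1)] unfolding amb_ring_carrier by blast
    then show "\<exists>y\<in>carrier (amb_ring D). y \<oplus>\<^bsub>amb_ring D\<^esub> x = \<zero>\<^bsub>amb_ring D\<^esub>"
      by (rule bexI[rotated]) (auto simp: f amb_ring_def fun_eq_iff)
  qed (auto simp: amb_ring_def fun_eq_iff algebra_simps)
qed

lemma defining_ideal:
  assumes "eqs D \<subseteq> polyfun (coords D)"
  shows "ideal (defining_ideal red D) (amb_ring D)"
proof (cases red)
  case True
  interpret cring "amb_ring D" by (rule amb_ring_cring)
  have "ideal {f \<in> carrier (amb_ring D). \<forall>p\<in>zero_locus D. f p = 0} (amb_ring D)"
  proof (rule idealI)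
    show "subgroup {f \<in> carrier (amb_ring D). \<forall>p\<in>zero_locus D. f p = 0} (add_monoid (amb_ring D))"
    proof
      fix x assume x: "x \<in> {f \<in> carrier (amb_ring D). \<forall>p\<in>zero_locus D. f p = 0}"
      have "(\<ominus>\<^bsub>amb_ring D\<^esub> x) p = 0" if "p \<in> zero_locus D" for p
      proof -
        have "(x \<oplus>\<^bsub>amb_ring D\<^esub> (\<ominus>\<^bsub>amb_ring D\<^esub> x)) p = \<zero>\<^bsub>amb_ring D\<^esub> p" using x by (simp add: r_neg)
        then show ?thesis using x that by (auto simp: amb_ring_def zero_locus_def)
      qed
      then show "inv\<^bsub>add_monoid (amb_ring D)\<^esub> x \<in> {f \<in> carrier (amb_ring D). \<forall>p\<in>zero_locus D. f p = 0}"
        using x a_inv_closed unfolding a_inv_def by auto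
    qed (use a_closed zero_closed in \<open>auto simp: amb_ring_def zero_locus_def\<close>)
  next
    fix a x assume *: "a \<in> {f \<in> carrier (amb_ring D). \<forall>p\<in>zero_locus D. f p = 0}" "x \<in> carrier (amb_ring D)"
    then have "x \<otimes>\<^bsub>amb_ring D\<^esub> a \<in> carrier (amb_ring D)" "a \<otimes>\<^bsub>amb_ring D\<^esub> x \<in> carrier (amb_ring D)" by auto
    then show "x \<otimes>\<^bsub>amb_ring D\<^esub> a \<in> {f \<in> carrier (amb_ring D). \<forall>p\<in>zero_locus D. f p = 0}"
      "a \<otimes>\<^bsub>amb_ring D\<^esub> x \<in> {f \<in> carrier (amb_ring D). \<forall>p\<in>zero_locus D. f p = 0}"
      using * by (auto simp: amb_ring_def zero_locus_def)
  qed (rule ring_axioms)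
  then show ?thesis using True by (simp add: defining_ideal_def)
next
  case False
  interpret cring "amb_ring D" by (rule amb_ring_cring)
  show ?thesis using False assms
    by (simp add: defining_ideal_def, intro genideal_ideal) (unfold amb_ring_def, auto)
qed

text \<open>Restricted to \<open>S\<close>, so that pulled back functions are extensional like the
  elements of \<open>amb_ring\<close>.\<close>

definition fpull :: "'p set \<Rightarrow> ('p \<Rightarrow> 'q) \<Rightarrow> ('q \<Rightarrow> complex) \<Rightarrow> 'p \<Rightarrow> complex" where
  "fpull S F f = (\<lambda>p\<in>S. f (F p))"

text \<open>Equations correspond up to scalars, which gives equality of the generated ideals and not only of
  the zero loci. The zero function accounts for the entries of the moment map outside the diagonal
  blocks.\<close>

locale closed_iso =
  fixes D :: "('p, 'g) git_problem" and D' :: "('q, 'h) git_problem" and F :: "'p \<Rightarrow> 'q"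
  assumes F_bij: "bij_betw F (amb D) (amb D')"
    and pull_coords: "f \<in> coords D' \<Longrightarrow> \<exists>p\<in>polyfun (coords D). \<forall>x\<in>amb D. f (F x) = p x"
    and push_coords: "f0 \<in> coords D \<Longrightarrow> \<exists>p\<in>polyfun (coords D'). \<forall>x\<in>amb D. f0 x = p (F x)"
    and eqs_poly: "eqs D \<subseteq> polyfun (coords D)" "eqs D' \<subseteq> polyfun (coords D')"
    and pull_eqs: "e \<in> eqs D' \<Longrightarrow> \<exists>c. \<exists>e0\<in>insert (\<lambda>_. 0) (eqs D). \<forall>x\<in>amb D. e (F x) = c * e0 x"
    and push_eqs: "e0 \<in> eqs D \<Longrightarrow> \<exists>c. \<exists>e\<in>insert (\<lambda>_. 0) (eqs D'). \<forall>x\<in>amb D. e0 x = c * e (F x)"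
begin

abbreviation G where "G \<equiv> inv_into (amb D) F"

lemma F_closed: "x \<in> amb D \<Longrightarrow> F x \<in> amb D'" and G_closed: "y \<in> amb D' \<Longrightarrow> G y \<in> amb D"
  and GF: "x \<in> amb D \<Longrightarrow> G (F x) = x" and FG: "y \<in> amb D' \<Longrightarrow> F (G y) = y"
  using F_bij by (auto simp: bij_betw_def inv_into_into f_inv_into_f)

text \<open>The hypotheses are symmetric, so every fact about pulling back along \<open>F\<close> is
  also available for \<open>G\<close>.\<close>

lemma closed_iso_inverse: "closed_iso D' D G"
proof
  show "bij_betw G (amb D') (amb D)" using F_bij bij_betw_inv_into by blast
  show "\<exists>p\<in>polyfun (coords D'). \<forall>x\<in>amb D'. f (G x) = p x" if "f \<in> coords D" for f
    using push_coords[OF that] G_closed FG by metis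
  show "\<exists>p\<in>polyfun (coords D). \<forall>x\<in>amb D'. f x = p (G x)" if "f \<in> coords D'" for f
    using pull_coords[OF that] G_closed FG by metis
  show "\<exists>c. \<exists>e0\<in>insert (\<lambda>_. 0) (eqs D'). \<forall>x\<in>amb D'. e (G x) = c * e0 x" if "e \<in> eqs D" for e
    using push_eqs[OF that] G_closed FG by metis
  show "\<exists>c. \<exists>e\<in>insert (\<lambda>_. 0) (eqs D). \<forall>x\<in>amb D'. e0 x = c * e (G x)" if "e0 \<in> eqs D'" for e0
    using pull_eqs[OF that] G_closed FG by metis
qed (use eqs_poly in auto)

abbreviation "pl \<equiv> fpull (amb D) F"
abbreviation "pr \<equiv> fpull (amb D') G"

lemma pr_pl: "f \<in> extensional (amb D') \<Longrightarrow> pr (pl f) = f"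
  by (auto simp: fpull_def fun_eq_iff G_closed FG extensional_def)

lemma pl_pr: "f \<in> extensional (amb D) \<Longrightarrow> pl (pr f) = f"
  by (auto simp: fpull_def fun_eq_iff F_closed GF extensional_def)

lemma pl_closed: assumes "f \<in> carrier (amb_ring D')" shows "pl f \<in> carrier (amb_ring D)"
proof -
  obtain f0 where f: "f = restrict f0 (amb D')" "f0 \<in> polyfun (coords D')"
    using assms by (auto simp: amb_ring_carrier)
  from f(2) have "\<exists>p\<in>polyfun (coords D). \<forall>x\<in>amb D. f0 (F x) = p x"
  proof induction
    case (const c)
    then show ?case using polyfun.const by (auto intro!: bexI[of _ "\<lambda>_. c"])
  next
    case (gen f)
    then show ?case by (rule pull_coords)
  next
    case (add f g)
    then obtain p r where "p \<in> polyfun (coords D)" "r \<in> polyfun (coords D)"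
      "\<forall>x\<in>amb D. f (F x) = p x" "\<forall>x\<in>amb D. g (F x) = r x" by blast
    then show ?case using polyfun.add by (intro bexI[of _ "\<lambda>x. p x + r x"]) auto
  next
    case (mult f g)
    then obtain p r where "p \<in> polyfun (coords D)" "r \<in> polyfun (coords D)"
      "\<forall>x\<in>amb D. f (F x) = p x" "\<forall>x\<in>amb D. g (F x) = r x" by blast
    then show ?case using polyfun.mult by (intro bexI[of _ "\<lambda>x. p x * r x"]) auto
  qed
  then obtain p where "p \<in> polyfun (coords D)" "\<forall>x\<in>amb D. f0 (F x) = p x" by blast
  then show ?thesis unfolding amb_ring_carrier
    by (intro bexI[of _ p]) (auto simp: f fpull_def fun_eq_iff F_closed)
qed

lemma pl_hom: "ring_hom_cring (amb_ring D') (amb_ring D) pl"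
  by (intro ring_hom_cring.intro ring_hom_cring_axioms.intro ring_hom_memI amb_ring_cring pl_closed)
    (auto simp: amb_ring_def fpull_def fun_eq_iff F_closed)

lemma zero_locus_closed: "x \<in> zero_locus D \<Longrightarrow> F x \<in> zero_locus D'"
  using pull_eqs F_closed by (fastforce simp: zero_locus_def)

text \<open>For the variety, \<open>F\<close> maps zero locus into zero locus. For the
  scheme-theoretic fibre, the preimage of the ideal of \<open>D\<close> is an ideal that contains
  every generator, since each equation pulls back to a scalar multiple of an equation or to
  zero.\<close>

lemma pl_ideal: assumes "f \<in> defining_ideal red D'" shows "pl f \<in> defining_ideal red D"
proof (cases red)
  case True
  then show ?thesis using assms pl_closed zero_locus_closed
    by (auto simp: defining_ideal_def) (auto simp: fpull_def zero_locus_def)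
next
  case False
  interpret h: ring_hom_cring "amb_ring D'" "amb_ring D" pl by (rule pl_hom)
  let ?I = "defining_ideal red D"
  interpret I: ideal ?I "amb_ring D" by (rule defining_ideal[OF eqs_poly(1)])
  have "ring_hom_ring (amb_ring D') (amb_ring D) pl"
    by (rule ring_hom_ringI2) (use h.homh h.R.ring_axioms h.S.ring_axioms in auto)
  then have id: "ideal {r \<in> carrier (amb_ring D'). pl r \<in> ?I} (amb_ring D')"
    by (rule ring_hom_ring.ideal_vimage) (rule I.is_ideal)
  have "(\<lambda>f. restrict f (amb D')) ` eqs D' \<subseteq> {r \<in> carrier (amb_ring D'). pl r \<in> ?I}"
  proof (rule image_subsetI)
    fix e assume e: "e \<in> eqs D'"
    then have c: "restrict e (amb D') \<in> carrier (amb_ring D')"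
      using eqs_poly(2) unfolding amb_ring_carrier by blast
    obtain c e0 where e0: "e0 \<in> insert (\<lambda>_. 0) (eqs D)" "\<forall>x\<in>amb D. e (F x) = c * e0 x"
      using pull_eqs[OF e] by blast
    have "restrict e0 (amb D) \<in> ?I"
    proof (cases "e0 \<in> eqs D")
      case True
      have "(\<lambda>f. restrict f (amb D)) ` eqs D \<subseteq> carrier (amb_ring D)"
        unfolding amb_ring_def using eqs_poly(1) by auto
      from h.S.genideal_self[OF this] show ?thesis using True \<open>\<not> red\<close> by (auto simp: defining_ideal_def)
    next
      case False
      then have "restrict e0 (amb D) = \<zero>\<^bsub>amb_ring D\<^esub>" using e0 by (simp add: amb_ring_def)
      then show ?thesis by simp
    qed
    moreover have "(\<lambda>_\<in>amb D. c) \<in> carrier (amb_ring D)"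
      unfolding amb_ring_carrier using polyfun.const by blast
    ultimately have "(\<lambda>_\<in>amb D. c) \<otimes>\<^bsub>amb_ring D\<^esub> restrict e0 (amb D) \<in> ?I"
      by (rule I.I_l_closed)
    also have "(\<lambda>_\<in>amb D. c) \<otimes>\<^bsub>amb_ring D\<^esub> restrict e0 (amb D) = pl (restrict e (amb D'))"
      using e0 by (auto simp: amb_ring_def fpull_def fun_eq_iff F_closed)
    finally show "restrict e (amb D') \<in> {r \<in> carrier (amb_ring D'). pl r \<in> ?I}" using c by simp
  qed
  from h.R.genideal_minimal[OF id this] show ?thesis using assms False by (auto simp: defining_ideal_def)
qed

end

section \<open>Isomorphism of the coordinate rings and of polynomial rings over them\<close>

context closed_iso begin

interpretation inv: closed_iso D' D G by (rule closed_iso_inverse)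

lemma pr_ideal: "f \<in> defining_ideal red D \<Longrightarrow> pr f \<in> defining_ideal red D'"
  by (rule inv.pl_ideal)

lemma pl_ideal_iff: "f \<in> extensional (amb D') \<Longrightarrow> pl f \<in> defining_ideal red D \<longleftrightarrow> f \<in> defining_ideal red D'"
  using pl_ideal pr_ideal pr_pl by metis

lemma ideals: "ideal (defining_ideal red D) (amb_ring D)" "ideal (defining_ideal red D') (amb_ring D')"
  using defining_ideal eqs_poly by auto

lemma pl_image_ideal: "pl ` defining_ideal red D' = defining_ideal red D"
proof -
  have "f \<in> pl ` defining_ideal red D'" if f: "f \<in> defining_ideal red D" for f
  proof -
    interpret I: ideal "defining_ideal red D" "amb_ring D" by (rule ideals)
    have "pl (pr f) = f" using f I.a_subset amb_ring_ext pl_pr by blast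
    then show ?thesis using pr_ideal[OF f] by force
  qed
  then show ?thesis using pl_ideal by blast
qed

lemma pl_image_coset:
  assumes "f \<in> carrier (amb_ring D')"
  shows "pl ` (defining_ideal red D' +>\<^bsub>amb_ring D'\<^esub> f) = defining_ideal red D +>\<^bsub>amb_ring D\<^esub> pl f"
proof -
  interpret h: ring_hom_cring "amb_ring D'" "amb_ring D" pl by (rule pl_hom)
  interpret I': ideal "defining_ideal red D'" "amb_ring D'" by (rule ideals)
  show ?thesis
    using assms I'.a_subset by (auto simp: a_r_coset_def' image_iff simp flip: pl_image_ideal[of red])
qed

lemma coord_ring_carrier:
  "c \<in> carrier (coord_ring red E) \<longleftrightarrow> (\<exists>f\<in>carrier (amb_ring E). c = defining_ideal red E +>\<^bsub>amb_ring E\<^esub> f)"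
  by (auto simp: coord_ring_def FactRing_def A_RCOSETS_def')

lemma coord_ring_cring: "cring (coord_ring red D)" "cring (coord_ring red D')"
  unfolding coord_ring_def using ideals amb_ring_cring ideal.quotient_is_cring by blast+

abbreviation q where "q c \<equiv> pl ` c"

lemma q_hom: "ring_hom_cring (coord_ring red D') (coord_ring red D) q"
proof -
  interpret h: ring_hom_cring "amb_ring D'" "amb_ring D" pl by (rule pl_hom)
  interpret I: ideal "defining_ideal red D" "amb_ring D" by (rule ideals)
  interpret I': ideal "defining_ideal red D'" "amb_ring D'" by (rule ideals)
  show ?thesis
  proof (intro ring_hom_cring.intro ring_hom_cring_axioms.intro ring_hom_memI)
    fix c assume "c \<in> carrier (coord_ring red D')"
    then show "q c \<in> carrier (coord_ring red D)"
      using pl_closed pl_image_coset by (force simp: coord_ring_carrier)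
  next
    fix c d assume "c \<in> carrier (coord_ring red D')" "d \<in> carrier (coord_ring red D')"
    then obtain f g where fg: "f \<in> carrier (amb_ring D')" "g \<in> carrier (amb_ring D')"
      "c = defining_ideal red D' +>\<^bsub>amb_ring D'\<^esub> f" "d = defining_ideal red D' +>\<^bsub>amb_ring D'\<^esub> g"
      by (auto simp: coord_ring_carrier)
    show "q (c \<otimes>\<^bsub>coord_ring red D'\<^esub> d) = q c \<otimes>\<^bsub>coord_ring red D\<^esub> q d"
      using fg(1,2) by (simp add: fg(3,4) coord_ring_def FactRing_def pl_image_coset
        I.rcoset_mult_add I'.rcoset_mult_add pl_closed)
    show "q (c \<oplus>\<^bsub>coord_ring red D'\<^esub> d) = q c \<oplus>\<^bsub>coord_ring red D\<^esub> q d"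
      using fg(1,2) by (simp add: fg(3,4) coord_ring_def FactRing_def pl_image_coset
        I.a_rcos_sum I'.a_rcos_sum pl_closed)
  next
    show "q \<one>\<^bsub>coord_ring red D'\<^esub> = \<one>\<^bsub>coord_ring red D\<^esub>"
      by (simp add: coord_ring_def FactRing_def pl_image_coset)
  qed (auto intro: coord_ring_cring)
qed

lemma q_inverse: "c \<in> carrier (coord_ring red D') \<Longrightarrow> pr ` q c = c"
proof -
  assume c: "c \<in> carrier (coord_ring red D')"
  interpret I': ideal "defining_ideal red D'" "amb_ring D'" by (rule ideals)
  have "c \<subseteq> carrier (amb_ring D')"
    using c I'.a_rcosets_carrier by (auto simp: coord_ring_def FactRing_def)
  then have "(pr \<circ> pl) ` c = id ` c" using pr_pl amb_ring_ext by (intro image_cong) auto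
  then show ?thesis by (simp add: image_comp)
qed

end

context closed_iso begin

interpretation inv: closed_iso D' D G by (rule closed_iso_inverse)

lemma q_surj:
  assumes "c \<in> carrier (coord_ring red D)"
  shows "pr ` c \<in> carrier (coord_ring red D')" "q (pr ` c) = c"
proof -
  interpret h: ring_hom_cring "coord_ring red D" "coord_ring red D'" "\<lambda>c. pr ` c" by (rule inv.q_hom)
  show "pr ` c \<in> carrier (coord_ring red D')" using assms by simp
  \<comment> \<open>The inverse of \<open>G\<close> agrees with \<open>F\<close> on
    \<open>amb D\<close>, so pulling back along it is \<open>pl\<close>.\<close>
  have "fpull (amb D) (inv_into (amb D') G) = pl"
    by (auto simp: fpull_def fun_eq_iff F_closed GF) (metis F_closed GF bij_betw_inv_into_left closed_iso.F_bij closed_iso_inverse)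
  then show "q (pr ` c) = c" using inv.q_inverse[OF assms] by simp
qed

lemma Phi_up: "a \<in> up (coord_ring red D') \<Longrightarrow> (\<lambda>m. q (a m)) \<in> up (coord_ring red D)"
proof -
  interpret h: ring_hom_cring "coord_ring red D'" "coord_ring red D" q by (rule q_hom)
  assume a: "a \<in> up (coord_ring red D')"
  then obtain n where "bound \<zero>\<^bsub>coord_ring red D'\<^esub> n a" by (auto simp: up_def)
  then have "bound \<zero>\<^bsub>coord_ring red D\<^esub> n (\<lambda>m. q (a m))"
    using h.hom_zero by (auto simp: bound_def)
  then show ?thesis using a by (auto simp: up_def)
qed

lemma q_inj:
  "c \<in> carrier (coord_ring red D') \<Longrightarrow> d \<in> carrier (coord_ring red D') \<Longrightarrow> q c = q d \<Longrightarrow> c = d"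
  using q_inverse by metis

lemma Phi_ring_iso: "(\<lambda>a m. q (a m)) \<in> ring_iso (UP (coord_ring red D')) (UP (coord_ring red D))"
proof (rule ring_iso_memI)
  let ?R' = "coord_ring red D'" and ?R = "coord_ring red D"
  interpret h: ring_hom_cring ?R' ?R q by (rule q_hom)
  fix a b assume ab: "a \<in> carrier (UP ?R')" "b \<in> carrier (UP ?R')"
  then have up: "a \<in> up ?R'" "b \<in> up ?R'" by (auto simp: UP_def)
  have c: "a i \<in> carrier ?R'" "b i \<in> carrier ?R'" for i using up by (auto simp: up_def)
  show "(\<lambda>m. q (a m)) \<in> carrier (UP ?R)" using Phi_up[OF up(1)] by (simp add: UP_def)
  show "(\<lambda>m. q ((a \<otimes>\<^bsub>UP ?R'\<^esub> b) m)) = (\<lambda>m. q (a m)) \<otimes>\<^bsub>UP ?R\<^esub> (\<lambda>m. q (b m))"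
  proof
    fix m
    have "q ((a \<otimes>\<^bsub>UP ?R'\<^esub> b) m) = q (\<Oplus>\<^bsub>?R'\<^esub>i\<in>{..m}. a i \<otimes>\<^bsub>?R'\<^esub> b (m - i))"
      using up by (simp add: UP_def)
    also have "\<dots> = (\<Oplus>\<^bsub>?R\<^esub>i\<in>{..m}. q (a i \<otimes>\<^bsub>?R'\<^esub> b (m - i)))"
      using h.hom_finsum[of "\<lambda>i. a i \<otimes>\<^bsub>?R'\<^esub> b (m - i)" "{..m}"] c by (simp add: comp_def)
    also have "\<dots> = ((\<lambda>m. q (a m)) \<otimes>\<^bsub>UP ?R\<^esub> (\<lambda>m. q (b m))) m"
      using Phi_up[OF up(1)] Phi_up[OF up(2)] c by (simp add: UP_def)
    finally show "q ((a \<otimes>\<^bsub>UP ?R'\<^esub> b) m) = ((\<lambda>m. q (a m)) \<otimes>\<^bsub>UP ?R\<^esub> (\<lambda>m. q (b m))) m" .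
  qed
  show "(\<lambda>m. q ((a \<oplus>\<^bsub>UP ?R'\<^esub> b) m)) = (\<lambda>m. q (a m)) \<oplus>\<^bsub>UP ?R\<^esub> (\<lambda>m. q (b m))"
    using up Phi_up[OF up(1)] Phi_up[OF up(2)] c by (simp add: UP_def)
next
  let ?R' = "coord_ring red D'" and ?R = "coord_ring red D"
  interpret h: ring_hom_cring ?R' ?R q by (rule q_hom)
  interpret ih: ring_hom_cring ?R ?R' "\<lambda>c. pr ` c" by (rule closed_iso.q_hom[OF closed_iso_inverse])
  show "(\<lambda>m. q (\<one>\<^bsub>UP ?R'\<^esub> m)) = \<one>\<^bsub>UP ?R\<^esub>"
    using h.hom_one h.hom_zero by (auto simp: UP_def fun_eq_iff)
  have "inj_on (\<lambda>a m. q (a m)) (carrier (UP ?R'))"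
    by (intro inj_onI ext) (rule q_inj, auto simp: UP_def up_def fun_eq_iff Pi_iff)
  moreover have "b \<in> (\<lambda>a m. q (a m)) ` carrier (UP ?R')" if b: "b \<in> carrier (UP ?R)" for b
  proof (rule image_eqI)
    have b': "b \<in> up ?R" using b by (simp add: UP_def)
    show "(\<lambda>m. pr ` b m) \<in> carrier (UP ?R')"
      using closed_iso.Phi_up[OF closed_iso_inverse b'] by (simp add: UP_def)
    have "b m \<in> carrier ?R" for m using b' by (auto simp: up_def)
    then show "b = (\<lambda>m. q (pr ` b m))" by (intro ext) (rule q_surj(2)[symmetric])
  qed
  ultimately show "bij_betw (\<lambda>a m. q (a m)) (carrier (UP ?R')) (carrier (UP ?R))"
    using Phi_up by (auto simp: bij_betw_def UP_def)
qed

text \<open>\<open>pullback\<close> is a union over all representatives of a class. Since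
  \<open>pl\<close> carries the ideal onto the ideal, every representative contributes the same
  coset.\<close>

lemma pullback_eq:
  assumes "a \<in> carrier (UP (coord_ring red D'))"
  shows "pullback red D F a = (\<lambda>m. q (a m))"
proof
  fix m
  interpret h: ring_hom_cring "amb_ring D'" "amb_ring D" pl by (rule pl_hom)
  interpret I: ideal "defining_ideal red D" "amb_ring D" by (rule ideals)
  interpret I': ideal "defining_ideal red D'" "amb_ring D'" by (rule ideals)
  have "a m \<in> carrier (coord_ring red D')" using assms by (auto simp: UP_def up_def)
  then obtain f0 where f0: "f0 \<in> carrier (amb_ring D')" "a m = defining_ideal red D' +>\<^bsub>amb_ring D'\<^esub> f0"
    by (auto simp: coord_ring_carrier)
  have "fun_class red D (\<lambda>p. f (F p)) = q (a m)" if f: "f \<in> a m" for f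
  proof -
    have fc: "f \<in> carrier (amb_ring D')" using f f0 h.R.a_r_coset_subset_G I'.a_subset by blast
    have "a m = defining_ideal red D' +>\<^bsub>amb_ring D'\<^esub> f"
      using I'.a_repr_independence'[of f f0] f f0 by simp
    then show ?thesis using pl_image_coset[OF fc] by (simp add: fun_class_def fpull_def)
  qed
  moreover have "f0 \<in> a m" using f0 I'.a_rcos_self by simp
  ultimately show "pullback red D F a m = q (a m)" unfolding pullback_def by blast
qed

end

text \<open>Semi-invariance is a condition on each group element by itself, so it transfers along
  any map \<open>\<rho>\<close> onto the other group that intertwines actions and
  characters.\<close>

locale git_iso = closed_iso D D' F
  for D :: "('p, 'g) git_problem" and D' :: "('q, 'h) git_problem" and F :: "'p \<Rightarrow> 'q" +
  fixes \<rho> :: "'g \<Rightarrow> 'h"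
  assumes grp: "\<rho> ` grp D = grp D'"
    and gop_closed: "g \<in> grp D \<Longrightarrow> y \<in> amb D \<Longrightarrow> gop D g y \<in> amb D"
    and gop_F: "g \<in> grp D \<Longrightarrow> y \<in> amb D \<Longrightarrow> F (gop D g y) = gop D' (\<rho> g) (F y)"
    and chi: "g \<in> grp D \<Longrightarrow> gchi D' (\<rho> g) = gchi D g"
begin

text \<open>The defect of semi-invariance of \<open>f\<close> pulls back to the defect of
  \<open>pl f\<close>, and \<open>pl\<close> reflects membership in the ideal.\<close>

lemma semi_invariants_iff:
  assumes "c \<in> carrier (coord_ring red D')"
  shows "q c \<in> semi_invariants red D m \<longleftrightarrow> c \<in> semi_invariants red D' m"
proof -
  interpret h: ring_hom_cring "coord_ring red D'" "coord_ring red D" q by (rule q_hom)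
  have "(\<lambda>y\<in>amb D. pl f (gop D g y) - gchi D g ^ m * pl f y) \<in> defining_ideal red D
     \<longleftrightarrow> (\<lambda>y\<in>amb D'. f (gop D' (\<rho> g) y) - gchi D' (\<rho> g) ^ m * f y) \<in> defining_ideal red D'"
    if g: "g \<in> grp D" for f g
  proof -
    have "pl (\<lambda>y\<in>amb D'. f (gop D' (\<rho> g) y) - gchi D' (\<rho> g) ^ m * f y)
      = (\<lambda>y\<in>amb D. pl f (gop D g y) - gchi D g ^ m * pl f y)"
      using g by (auto simp: fpull_def fun_eq_iff F_closed gop_closed gop_F chi)
    then show ?thesis
      using pl_ideal_iff[of "\<lambda>y\<in>amb D'. f (gop D' (\<rho> g) y) - gchi D' (\<rho> g) ^ m * f y" red] by simp
  qed
  then show ?thesis using assms by (auto simp: semi_invariants_def grp[symmetric])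
qed

section \<open>Isomorphism of the rings of semi-invariants\<close>

abbreviation "A red \<equiv> semi_inv_ring red D"
abbreviation "B red \<equiv> semi_inv_ring red D'"

lemma semi_inv_carrier:
  "a \<in> carrier (semi_inv_ring red E) \<longleftrightarrow>
     a \<in> carrier (UP (coord_ring red E)) \<and> (\<forall>m. a m \<in> semi_invariants red E m)"
  by (simp add: semi_inv_ring_def)

lemma semi_inv_ops: "mult (semi_inv_ring red E) = mult (UP (coord_ring red E))"
  "add (semi_inv_ring red E) = add (UP (coord_ring red E))"
  "one (semi_inv_ring red E) = one (UP (coord_ring red E))"
  "zero (semi_inv_ring red E) = zero (UP (coord_ring red E))"
  by (simp_all add: semi_inv_ring_def)

lemma Phi_semi:
  assumes "a \<in> carrier (UP (coord_ring red D'))"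
  shows "(\<lambda>m. q (a m)) \<in> carrier (A red) \<longleftrightarrow> a \<in> carrier (B red)"
proof -
  have "a m \<in> carrier (coord_ring red D')" for m using assms by (auto simp: UP_def up_def)
  then show ?thesis using assms semi_invariants_iff ring_iso_memE(1)[OF Phi_ring_iso assms]
    by (auto simp: semi_inv_carrier)
qed

lemma UP_closed:
  assumes "a \<in> carrier (UP (coord_ring red D'))" "b \<in> carrier (UP (coord_ring red D'))"
  shows "a \<otimes>\<^bsub>UP (coord_ring red D')\<^esub> b \<in> carrier (UP (coord_ring red D'))"
    "a \<oplus>\<^bsub>UP (coord_ring red D')\<^esub> b \<in> carrier (UP (coord_ring red D'))"
    "\<one>\<^bsub>UP (coord_ring red D')\<^esub> \<in> carrier (UP (coord_ring red D'))"
    "\<zero>\<^bsub>UP (coord_ring red D')\<^esub> \<in> carrier (UP (coord_ring red D'))"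
proof -
  interpret UP_cring "coord_ring red D'" "UP (coord_ring red D')"
    by (rule UP_cring.intro) (rule coord_ring_cring)
  show "a \<otimes>\<^bsub>UP (coord_ring red D')\<^esub> b \<in> carrier (UP (coord_ring red D'))"
    "a \<oplus>\<^bsub>UP (coord_ring red D')\<^esub> b \<in> carrier (UP (coord_ring red D'))"
    "\<one>\<^bsub>UP (coord_ring red D')\<^esub> \<in> carrier (UP (coord_ring red D'))"
    "\<zero>\<^bsub>UP (coord_ring red D')\<^esub> \<in> carrier (UP (coord_ring red D'))"
    using assms by (auto simp: P.m_closed)
qed

lemma Phi_surj:
  assumes "b \<in> carrier (A red)"
  obtains a where "a \<in> carrier (B red)" "b = (\<lambda>m. q (a m))"
proof -
  have "b \<in> carrier (UP (coord_ring red D))" using assms by (simp add: semi_inv_carrier)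
  then obtain a where "a \<in> carrier (UP (coord_ring red D'))" "b = (\<lambda>m. q (a m))"
    using ring_iso_memE(5)[OF Phi_ring_iso] by (auto simp: bij_betw_def)
  then show thesis using that Phi_semi assms by blast
qed

lemma Phi_iso: "(\<lambda>a m. q (a m)) \<in> ring_iso (B red) (A red)"
proof (rule ring_iso_memI)
  have "inj_on (\<lambda>a m. q (a m)) (carrier (B red))"
    using ring_iso_memE(5)[OF Phi_ring_iso] by (auto simp: bij_betw_def inj_on_def semi_inv_carrier)
  then show "bij_betw (\<lambda>a m. q (a m)) (carrier (B red)) (carrier (A red))"
    using Phi_semi by (auto simp: bij_betw_def semi_inv_carrier elim: Phi_surj)
qed (use Phi_semi ring_iso_memE(2-4)[OF Phi_ring_iso] in \<open>auto simp: semi_inv_ops semi_inv_carrier\<close>)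

lemma pullback_iso: "pullback red D F \<in> ring_iso (B red) (A red)"
proof (rule ring_iso_memI)
  have eq: "pullback red D F a = (\<lambda>m. q (a m))" if "a \<in> carrier (B red)" for a
    using that pullback_eq by (simp add: semi_inv_carrier)
  note iso = Phi_iso[of red]
  show "bij_betw (pullback red D F) (carrier (B red)) (carrier (A red))"
    using ring_iso_memE(5)[OF iso] eq by (simp cong: bij_betw_cong)
  fix a b assume ab: "a \<in> carrier (B red)" "b \<in> carrier (B red)"
  then have ab': "a \<in> carrier (UP (coord_ring red D'))" "b \<in> carrier (UP (coord_ring red D'))"
    by (auto simp: semi_inv_carrier)
  show "pullback red D F a \<in> carrier (A red)" using eq ab ring_iso_memE(1)[OF iso] by simp
  show "pullback red D F (a \<otimes>\<^bsub>B red\<^esub> b) = pullback red D F a \<otimes>\<^bsub>A red\<^esub> pullback red D F b"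
    using ab eq ring_iso_memE(2)[OF iso] pullback_eq[OF UP_closed(1)[OF ab']] by (simp add: semi_inv_ops)
  show "pullback red D F (a \<oplus>\<^bsub>B red\<^esub> b) = pullback red D F a \<oplus>\<^bsub>A red\<^esub> pullback red D F b"
    using ab eq ring_iso_memE(3)[OF iso] pullback_eq[OF UP_closed(2)[OF ab']] by (simp add: semi_inv_ops)
next
  have "\<one>\<^bsub>UP (coord_ring red D')\<^esub> \<in> carrier (UP (coord_ring red D'))"
    using UP_ring.UP_one_closed[of "coord_ring red D'"] coord_ring_cring(2)[of red]
    by (auto simp: UP_ring_def cring_def)
  then show "pullback red D F \<one>\<^bsub>B red\<^esub> = \<one>\<^bsub>A red\<^esub>"
    using ring_iso_memE(4)[OF Phi_iso[of red]] pullback_eq by (simp add: semi_inv_ops)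
qed

text \<open>The general fact that the inverse of a ring isomorphism is one presupposes that the
  source is a ring, which is the claim here. So the laws for the inverse are checked by hand:
  closure of \<open>B red\<close> under an operation is deduced from closure of \<open>A red\<close>
  by \<open>Phi_semi\<close>.\<close>

lemma cring_pullback:
  assumes "cring (A red)" shows "cring (B red)"
proof -
  interpret A: cring "A red" by fact
  let ?g = "inv_into (carrier (B red)) (\<lambda>a m. q (a m))"
  have bij: "bij_betw (\<lambda>a m. q (a m)) (carrier (B red)) (carrier (A red))"
    by (rule ring_iso_memE(5)[OF Phi_iso])
  then have gq: "?g (\<lambda>m. q (a m)) = a" if "a \<in> carrier (B red)" for a
    using that by (metis (no_types, lifting) bij_betw_inv_into_left)
  have mem: "a \<in> carrier (B red)" if "a \<in> carrier (UP (coord_ring red D'))" "(\<lambda>m. q (a m)) \<in> carrier (A red)" for a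
    using Phi_semi that by blast
  have "?g \<in> ring_iso (A red) (B red)"
  proof (rule ring_iso_memI)
    show "bij_betw ?g (carrier (A red)) (carrier (B red))" using bij bij_betw_inv_into by blast
    fix x y assume xy: "x \<in> carrier (A red)" "y \<in> carrier (A red)"
    obtain a where a: "a \<in> carrier (B red)" "x = (\<lambda>m. q (a m))" by (rule Phi_surj[OF xy(1)])
    obtain b where b: "b \<in> carrier (B red)" "y = (\<lambda>m. q (b m))" by (rule Phi_surj[OF xy(2)])
    note ab = a b
    have ab': "a \<in> carrier (UP (coord_ring red D'))" "b \<in> carrier (UP (coord_ring red D'))"
      using ab by (auto simp: semi_inv_carrier)
    show "?g x \<in> carrier (B red)" using ab gq by simp
    have "(\<lambda>m. q ((a \<otimes>\<^bsub>B red\<^esub> b) m)) = x \<otimes>\<^bsub>A red\<^esub> y"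
      using ring_iso_memE(2)[OF Phi_iso ab(1,3)] ab by simp
    moreover from this have "a \<otimes>\<^bsub>B red\<^esub> b \<in> carrier (B red)"
      using xy UP_closed[OF ab'] by (intro mem) (auto simp: semi_inv_ops(1)[of red D'])
    ultimately show "?g (x \<otimes>\<^bsub>A red\<^esub> y) = ?g x \<otimes>\<^bsub>B red\<^esub> ?g y" using gq ab by metis
    have "(\<lambda>m. q ((a \<oplus>\<^bsub>B red\<^esub> b) m)) = x \<oplus>\<^bsub>A red\<^esub> y"
      using ring_iso_memE(3)[OF Phi_iso ab(1,3)] ab by simp
    moreover from this have "a \<oplus>\<^bsub>B red\<^esub> b \<in> carrier (B red)"
      using xy UP_closed[OF ab'] by (intro mem) (auto simp: semi_inv_ops(2)[of red D'])
    ultimately show "?g (x \<oplus>\<^bsub>A red\<^esub> y) = ?g x \<oplus>\<^bsub>B red\<^esub> ?g y" using gq ab by metis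
  next
    obtain a where a: "a \<in> carrier (B red)" by (rule Phi_surj[OF A.one_closed])
    then have a': "a \<in> carrier (UP (coord_ring red D'))" by (simp add: semi_inv_carrier)
    have "(\<lambda>m. q (\<one>\<^bsub>B red\<^esub> m)) = \<one>\<^bsub>A red\<^esub>" by (rule ring_iso_memE(4)[OF Phi_iso])
    moreover from this have "\<one>\<^bsub>B red\<^esub> \<in> carrier (B red)"
      using UP_closed[OF a' a'] by (intro mem) (auto simp: semi_inv_ops(3)[of red D'])
    ultimately show "?g \<one>\<^bsub>A red\<^esub> = \<one>\<^bsub>B red\<^esub>" using gq by metis
  qed
  then have *: "cring ((B red)\<lparr>zero := ?g \<zero>\<^bsub>A red\<^esub>\<rparr>)" by (rule A.ring_iso_imp_img_cring)
  interpret h: ring_hom_cring "coord_ring red D'" "coord_ring red D" q by (rule q_hom)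
  obtain a where a: "a \<in> carrier (B red)" by (rule Phi_surj[OF A.one_closed])
  then have a': "a \<in> carrier (UP (coord_ring red D'))" by (simp add: semi_inv_carrier)
  have "(\<lambda>m. q (\<zero>\<^bsub>B red\<^esub> m)) = \<zero>\<^bsub>A red\<^esub>" using h.hom_zero by (simp add: semi_inv_ops UP_def)
  moreover from this have "\<zero>\<^bsub>B red\<^esub> \<in> carrier (B red)"
    using UP_closed[OF a' a'] by (intro mem) (auto simp: semi_inv_ops(4)[of red D'])
  ultimately have "?g \<zero>\<^bsub>A red\<^esub> = \<zero>\<^bsub>B red\<^esub>" using gq by metis
  then show ?thesis using * by simp
qed

text \<open>The zero class is the ideal itself, so its semi-invariance is stability of the ideal
  under the group. For an abstract problem this is extracted from the ring axioms, which put zero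
  among the semi-invariants.\<close>

lemma semi_inv_zero: assumes "cring (B red)" shows "\<zero>\<^bsub>coord_ring red D'\<^esub> \<in> semi_invariants red D' m"
proof -
  interpret B: cring "B red" by fact
  have "\<zero>\<^bsub>B red\<^esub> m \<in> semi_invariants red D' m" using B.zero_closed unfolding semi_inv_carrier by blast
  then show ?thesis by (simp add: semi_inv_ops UP_def)
qed

lemma homog_iff: "a \<in> homog (B red) m \<longleftrightarrow> a \<in> carrier (B red) \<and> (\<forall>n. n \<noteq> m \<longrightarrow> a n = \<zero>\<^bsub>coord_ring red D'\<^esub>)"
  by (simp add: homog_def semi_inv_ops UP_def)

lemma upD: assumes "a \<in> carrier (B red)" shows "a \<in> up (coord_ring red D')" "a m \<in> carrier (coord_ring red D')"
  using assms by (auto simp: semi_inv_carrier UP_def up_def)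

lemma graded: "graded_iso (A red) (B red) (pullback red D F) q"
proof (rule graded_iso.intro)
  interpret h: ring_hom_cring "coord_ring red D'" "coord_ring red D" q by (rule q_hom)
  note iso = ring_iso_memE[OF pullback_iso]
  show "pullback red D F \<in> ring_iso (B red) (A red)" by (rule pullback_iso)
  show "cring (A red) \<Longrightarrow> cring (B red)" by (rule cring_pullback)
  show "pullback red D F a m = q (a m)" if "a \<in> carrier (B red)" for a m
    using that pullback_eq by (simp add: semi_inv_carrier)
  show "q (\<zero>\<^bsub>B red\<^esub> m) = \<zero>\<^bsub>A red\<^esub> m" for m
    using h.hom_zero by (simp add: semi_inv_ops UP_def)
  show "a m = \<zero>\<^bsub>B red\<^esub> m" if "a \<in> carrier (B red)" "q (a m) = \<zero>\<^bsub>A red\<^esub> m" for a m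
  proof -
    have "a m \<in> carrier (coord_ring red D')" using that(1) by (auto simp: semi_inv_carrier UP_def up_def)
    then show ?thesis using that(2) h.hom_zero q_inj by (simp add: semi_inv_ops UP_def)
  qed
  assume cr: "cring (B red)"
  interpret B: cring "B red" by fact
  show "\<one>\<^bsub>B red\<^esub> \<in> homog (B red) 0" using B.one_closed by (simp add: homog_iff) (simp add: semi_inv_ops UP_def)
  fix m show "hcomp (B red) m a \<in> carrier (B red)" if "a \<in> carrier (B red)" for a
  proof -
    have "bound \<zero>\<^bsub>coord_ring red D'\<^esub> m (hcomp (B red) m a)"
      by (auto simp: bound_def hcomp_def semi_inv_ops UP_def)
    then show ?thesis using that semi_inv_zero[OF cr] upD[OF that]
      by (auto simp: semi_inv_carrier hcomp_def UP_def up_def semi_inv_ops)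
  qed
  fix a b n assume a: "a \<in> homog (B red) m"
  have ac: "a \<in> carrier (B red)" using a by (simp add: homog_def)
  show "a \<oplus>\<^bsub>B red\<^esub> b \<in> homog (B red) m" if b: "b \<in> homog (B red) m"
  proof -
    have bc: "b \<in> carrier (B red)" using b by (simp add: homog_def)
    have "(a \<oplus>\<^bsub>B red\<^esub> b) k = a k \<oplus>\<^bsub>coord_ring red D'\<^esub> b k" for k
      using upD[OF ac] upD[OF bc] by (simp add: semi_inv_ops UP_def)
    then show ?thesis using a b B.a_closed[OF ac bc] by (simp add: homog_iff)
  qed
  show "a \<otimes>\<^bsub>B red\<^esub> b \<in> homog (B red) (m + n)" if b: "b \<in> homog (B red) n"
  proof -
    have bc: "b \<in> carrier (B red)" using b by (simp add: homog_def)
    have "(a \<otimes>\<^bsub>B red\<^esub> b) k = \<zero>\<^bsub>coord_ring red D'\<^esub>" if k: "k \<noteq> m + n" for k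
    proof -
      have "(a \<otimes>\<^bsub>B red\<^esub> b) k = (\<Oplus>\<^bsub>coord_ring red D'\<^esub>i \<in> {..k}. a i \<otimes>\<^bsub>coord_ring red D'\<^esub> b (k-i))"
        using upD[OF ac] upD[OF bc] by (simp add: semi_inv_ops UP_def)
      also have "\<dots> = (\<Oplus>\<^bsub>coord_ring red D'\<^esub>i \<in> {..k}. \<zero>\<^bsub>coord_ring red D'\<^esub>)"
      proof (rule h.R.finsum_cong')
        fix i assume i: "i \<in> {..k}"
        \<comment> \<open>The degrees \<open>i\<close> and \<open>k - i\<close> add up to
          \<open>k\<close>, which is not \<open>m + n\<close>, so one of the two coefficients
          vanishes.\<close>
        have "i \<noteq> m \<or> k - i \<noteq> n" using i k by auto
        then show "a i \<otimes>\<^bsub>coord_ring red D'\<^esub> b (k-i) = \<zero>\<^bsub>coord_ring red D'\<^esub>"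
          by (rule disjE) (use a b upD(2)[OF ac] upD(2)[OF bc] in \<open>simp_all add: homog_iff\<close>)
      qed auto
      finally show ?thesis by simp
    qed
    then show ?thesis using B.m_closed[OF ac bc] by (simp add: homog_iff)
  qed
qed

lemma fun_class_const:
  "fun_class red D' (\<lambda>_. c) \<in> carrier (coord_ring red D')"
  "q (fun_class red D' (\<lambda>_. c)) = fun_class red D (\<lambda>_. c)"
proof -
  have *: "restrict (\<lambda>_. c) (amb D') \<in> carrier (amb_ring D')"
    unfolding amb_ring_carrier using polyfun.const by blast
  then show "fun_class red D' (\<lambda>_. c) \<in> carrier (coord_ring red D')"
    by (auto simp: coord_ring_carrier fun_class_def)
  have "pl (restrict (\<lambda>_. c) (amb D')) = restrict (\<lambda>_. c) (amb D)"
    by (auto simp: fpull_def fun_eq_iff F_closed)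
  then show "q (fun_class red D' (\<lambda>_. c)) = fun_class red D (\<lambda>_. c)"
    using pl_image_coset[OF *] by (simp add: fun_class_def)
qed

text \<open>A representative is \<open>c\<close> plus an element of the ideal. The constant cancels
  because the character enters with exponent zero, and the rest is stability of the ideal, from
  \<open>semi_inv_zero\<close>.\<close>

lemma fun_class_const_semi:
  assumes "cring (B red)"
  shows "fun_class red D' (\<lambda>_. c) \<in> semi_invariants red D' 0"
proof -
  interpret I': ideal "defining_ideal red D'" "amb_ring D'" by (rule ideals)
  have "(\<lambda>y\<in>amb D'. f (gop D' h y) - gchi D' h ^ 0 * f y) \<in> defining_ideal red D'"
    if f: "f \<in> fun_class red D' (\<lambda>_. c)" and h: "h \<in> grp D'" for f h
  proof -
    obtain i where i: "i \<in> defining_ideal red D'" "f = i \<oplus>\<^bsub>amb_ring D'\<^esub> restrict (\<lambda>_. c) (amb D')"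
      using f by (auto simp: fun_class_def a_r_coset_def')
    have "i \<in> \<zero>\<^bsub>coord_ring red D'\<^esub>" using i by (simp add: coord_ring_def FactRing_def)
    then have "(\<lambda>y\<in>amb D'. i (gop D' h y) - gchi D' h ^ 0 * i y) \<in> defining_ideal red D'"
      using semi_inv_zero[OF assms, of 0] h unfolding semi_invariants_def by blast
    also have "(\<lambda>y\<in>amb D'. i (gop D' h y) - gchi D' h ^ 0 * i y)
      = (\<lambda>y\<in>amb D'. f (gop D' h y) - gchi D' h ^ 0 * f y)"
    proof -
      obtain g where g: "g \<in> grp D" "h = \<rho> g" using h grp by blast
      have "gop D' h y \<in> amb D'" if "y \<in> amb D'" for y
        using gop_F[OF g(1), of "G y"] gop_closed[OF g(1), of "G y"] FG[OF that] G_closed[OF that] F_closed g(2)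
        by metis
      then show ?thesis by (auto simp: i(2) amb_ring_def fun_eq_iff)
    qed
    finally show ?thesis .
  qed
  then show ?thesis using fun_class_const by (simp add: semi_invariants_def)
qed

theorem induces_git_iso: "induces_git_iso red D D' F"
  unfolding induces_git_iso_def
proof (intro conjI)
  show "F ` amb D \<subseteq> amb D'" using F_closed by blast
  show "F ` zero_locus D \<subseteq> zero_locus D'" using zero_locus_closed by blast
  show "\<forall>f\<in>carrier (amb_ring D'). (\<lambda>p\<in>amb D. f (F p)) \<in> carrier (amb_ring D)"
    using pl_closed by (simp add: fpull_def)
  show "\<forall>f\<in>defining_ideal red D'. (\<lambda>p\<in>amb D. f (F p)) \<in> defining_ideal red D"
    using pl_ideal by (simp add: fpull_def)
  show "pullback red D F \<in> ring_hom (semi_inv_ring red D') (semi_inv_ring red D)"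
    using pullback_iso by (simp add: ring_iso_def)
  interpret h: ring_hom_cring "coord_ring red D'" "coord_ring red D" q by (rule q_hom)
  have "semi_inv_const red D' c \<in> homog (B red) 0" if "cring (B red)" for c
  proof -
    have "bound \<zero>\<^bsub>coord_ring red D'\<^esub> 0 (semi_inv_const red D' c)"
      by (auto simp: bound_def semi_inv_const_def)
    then show ?thesis using fun_class_const fun_class_const_semi[OF that] semi_inv_zero[OF that]
      by (auto simp: homog_iff semi_inv_carrier UP_def up_def semi_inv_const_def)
  qed
  moreover have "pullback red D F (semi_inv_const red D' c) = semi_inv_const red D c" if "cring (B red)" for c
  proof -
    have "semi_inv_const red D' c \<in> carrier (UP (coord_ring red D'))"
      using calculation[OF that] by (auto simp: homog_def semi_inv_carrier)
    then show ?thesis using pullback_eq fun_class_const h.hom_zero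
      by (auto simp: semi_inv_const_def fun_eq_iff)
  qed
  ultimately show "cspace_iso (git_quotient red D) (git_quotient red D')
      (Proj_map (semi_inv_ring red D') (pullback red D F))
      (Proj_comorphism (semi_inv_ring red D) (semi_inv_ring red D') (pullback red D F))"
    unfolding git_quotient_def by (rule graded_iso.Proj_iso[OF graded])
qed

end

section \<open>The comparison of the two quotients\<close>

lemma nak_coords_gen:
  "(\<lambda>p. fst p h ij) \<in> polyfun nak_coords" "(\<lambda>p. fst (snd p) \<psi> ij) \<in> polyfun nak_coords"
  "(\<lambda>p. snd (snd p) \<psi> ij) \<in> polyfun nak_coords"
proof -
  show "(\<lambda>p. fst p h ij) \<in> polyfun nak_coords" unfolding nak_coords_def split_def
    by (rule polyfun.gen[OF UnI1[OF UnI1[OF image_eqI[of _ _ "(h, ij)"]]]]) simp_all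
  show "(\<lambda>p. fst (snd p) \<psi> ij) \<in> polyfun nak_coords" unfolding nak_coords_def split_def
    by (rule polyfun.gen[OF UnI1[OF UnI2[OF image_eqI[of _ _ "(\<psi>, ij)"]]]]) simp_all
  show "(\<lambda>p. snd (snd p) \<psi> ij) \<in> polyfun nak_coords" unfolding nak_coords_def split_def
    by (rule polyfun.gen[OF UnI2[OF image_eqI[of _ _ "(\<psi>, ij)"]]]) simp_all
qed

lemma gm_coords_gen:
  "(\<lambda>p. fst p k) \<in> polyfun gm_coords" "(\<lambda>p. fst (snd p) k') \<in> polyfun gm_coords"
  "(\<lambda>p. snd (snd p) k'') \<in> polyfun gm_coords"
  unfolding gm_coords_def by (auto intro!: polyfun.gen simp: split_def)

context mckay begin

lemma nak_moment_poly: "(\<lambda>p. nak_moment Q d df p \<psi> (i', i)) \<in> polyfun nak_coords"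
proof -
  have "(\<lambda>p. nak_moment Q d df p \<psi> (i', i)) = (\<lambda>p.
    (\<Sum>h | h \<in> Ar \<and> tgt h = \<psi>. asign h * (\<Sum>k<d (src h). fst p h (i', k) * fst p (arev h) (k, i)))
     + (\<Sum>k<df \<psi>. fst (snd p) \<psi> (i', k) * snd (snd p) \<psi> (k, i)))"
    by (simp add: nak_moment_def split_def sum_apply cscale_def mmul_apply)
  then show ?thesis by (simp add: polyfun.add polyfun_sum polyfun_cmult polyfun.mult nak_coords_gen)
qed

lemma gm_moment_poly: "(\<lambda>p. gm_moment N Nf p (r, s)) \<in> polyfun gm_coords"
proof -
  have "(\<lambda>p. gm_moment N Nf p (r, s)) = (\<lambda>p.
    (\<Sum>k\<in>gidx N. fst p (r, (1, k)) * fst p (k, (2, s))) - (\<Sum>k\<in>gidx N. fst p (r, (2, k)) * fst p (k, (1, s)))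
     + (\<Sum>k\<in>gidx Nf. fst (snd p) (r, k) * snd (snd p) (k, s)))"
    by (simp add: gm_moment_def split_def mmul_apply bcol_def)
  then show ?thesis by (simp add: polyfun.add polyfun_sum polyfun_diff polyfun.mult gm_coords_gen)
qed

theorem git_iso:
  "git_iso (nakajima_problem Q lam \<theta> d df) (gmodule_problem \<Gamma> X lam \<theta> (M d) (M df)) Fm bd" (is "git_iso ?D ?D' _ _")
proof
  have [simp]: "amb ?D = nak_space Q d df" "coords ?D = nak_coords" "grp ?D = nak_group Q d"
    "gop ?D = nak_action Q d" "gchi ?D = nak_character Q d \<theta>"
    "eqs ?D = {\<lambda>p. nak_moment Q d df p \<psi> ij - cscale (lam \<psi>) (mone {..<d \<psi>}) ij | \<psi> ij. \<psi> \<in> Irr \<Gamma>}"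
    "amb ?D' = gm_space \<Gamma> (M d) (M df)" "coords ?D' = gm_coords" "grp ?D' = gaut \<Gamma> (M d)"
    "gop ?D' = gm_action (M d)" "gchi ?D' = gm_character \<Gamma> X (M d) \<theta>"
    "eqs ?D' = range (\<lambda>ij p. gm_moment (M d) (M df) p ij - gm_lambda \<Gamma> X (M d) lam ij)"
    by (simp_all add: nakajima_problem_def gmodule_problem_def verts)
  show "bij_betw Fm (amb ?D) (amb ?D')" by (simp add: F_bij)
  show "bd ` grp ?D = grp ?D'" using bd_minv(4) gaut_surj by (auto simp: image_iff) metis
  fix g p assume "g \<in> grp ?D" "p \<in> amb ?D"
  then show "gop ?D g p \<in> amb ?D" "Fm (gop ?D g p) = gop ?D' (bd g) (Fm p)"
    by (simp_all add: nak_action_closed F_map_action)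
next
  fix g assume "g \<in> grp (nakajima_problem Q lam \<theta> d df)"
  then show "gchi (gmodule_problem \<Gamma> X lam \<theta> (M d) (M df)) (bd g) = gchi (nakajima_problem Q lam \<theta> d df) g"
    using gm_character_blockmat bd_minv(1) by (simp add: nakajima_problem_def gmodule_problem_def)
next
  fix f assume "f \<in> coords (gmodule_problem \<Gamma> X lam \<theta> (M d) (M df))"
  then have "f \<in> gm_coords" by (simp add: gmodule_problem_def)
  then consider k where "f = (\<lambda>p. fst p k)" | k where "f = (\<lambda>p. fst (snd p) k)" | k where "f = (\<lambda>p. snd (snd p) k)"
    unfolding gm_coords_def by (auto simp: split_def)
  then have "\<exists>p\<in>polyfun nak_coords. \<forall>x. f (Fm x) = p x"
  proof cases
    case 1
    obtain \<psi>' i' j' r \<psi> i j where k: "k = ((\<psi>', i', j'), (r, (\<psi>, i, j)))" by (metis surj_pair)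
    have "(\<lambda>p. \<Sum>h\<in>arr \<psi> \<psi>'. y h (j', (r, j)) * fst p h (i', i)) \<in> polyfun nak_coords"
      by (intro polyfun_sum polyfun_cmult nak_coords_gen)
    then show ?thesis by (rule bexI[rotated]) (auto simp: 1 k Fm_apply F_Delta_def mult.commute)
  next
    case 2
    obtain \<psi>' i' j' \<psi> i j where k: "k = ((\<psi>', i', j'), (\<psi>, i, j))" by (metis surj_pair)
    \<comment> \<open>The pulled back coordinate is a multiple of a single coordinate; the factor is
      zero where the block matrix has no entry.\<close>
    let ?c = "if \<psi> \<in> Irr \<Gamma> \<and> \<psi> = \<psi>' \<and> j \<in> I \<psi> \<and> j' = j then 1 / of_nat (n \<psi>) else 0 :: complex"
    have "(\<lambda>p. ?c * fst (snd p) \<psi> (i', i)) \<in> polyfun nak_coords"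
      by (intro polyfun_cmult nak_coords_gen)
    then show ?thesis by (rule bexI[rotated]) (auto simp: 2 k Fm_apply bd_apply cscale_def)
  next
    case 3
    obtain \<psi>' i' j' \<psi> i j where k: "k = ((\<psi>', i', j'), (\<psi>, i, j))" by (metis surj_pair)
    let ?c = "if \<psi> \<in> Irr \<Gamma> \<and> \<psi> = \<psi>' \<and> j \<in> I \<psi> \<and> j' = j then 1 else 0 :: complex"
    have "(\<lambda>p. ?c * snd (snd p) \<psi> (i', i)) \<in> polyfun nak_coords"
      by (intro polyfun_cmult nak_coords_gen)
    then show ?thesis by (rule bexI[rotated]) (auto simp: 3 k Fm_apply bd_apply)
  qed
  then show "\<exists>p\<in>polyfun (coords (nakajima_problem Q lam \<theta> d df)). \<forall>x\<in>amb (nakajima_problem Q lam \<theta> d df). f (Fm x) = p x"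
    by (auto simp: nakajima_problem_def)
next
  fix f assume "f \<in> coords (nakajima_problem Q lam \<theta> d df)"
  then have "f \<in> nak_coords" by (simp add: nakajima_problem_def)
  then consider h i' i where "f = (\<lambda>p. fst p h (i', i))" | \<psi> i' i where "f = (\<lambda>p. fst (snd p) \<psi> (i', i))"
    | \<psi> i' i where "f = (\<lambda>p. snd (snd p) \<psi> (i', i))"
    unfolding nak_coords_def by (auto simp: split_def)
  then have "\<exists>p\<in>polyfun gm_coords. \<forall>x\<in>nak_space Q d df. f x = p (Fm x)"
  proof cases
    case 1
    show ?thesis
    proof (cases "h \<in> Ar")
      case True
      \<comment> \<open>\<open>coef\<close> is linear in the matrix entries and inverts
        \<open>F_Delta\<close>, so a coordinate of \<open>x\<close> is a polynomial in the
        coordinates of the image.\<close>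
      have "(\<lambda>p. coef (fst p) h i' i) \<in> polyfun gm_coords"
        unfolding coef_def by (intro polyfun_sum polyfun_cmult gm_coords_gen)
      then show ?thesis by (rule bexI[rotated]) (auto simp: 1 Fm_apply coef_F_Delta[OF True])
    next
      case False
      have "f (x, v1, v2) = 0" if "(x, v1, v2) \<in> nak_space Q d df" for x v1 v2
        using that False unfolding nak_space_iff 1 by (metis fst_conv zero_fun_apply)
      then have "\<forall>x\<in>nak_space Q d df. f x = 0" by auto
      then show ?thesis by (intro bexI[OF _ polyfun.const[of 0]])
    qed
  next
    case 2
    show ?thesis
    proof (cases "\<psi> \<in> Irr \<Gamma>")
      case True
      have "(\<lambda>p. of_nat (n \<psi>) * fst (snd p) ((\<psi>, i', 0), (\<psi>, i, 0))) \<in> polyfun gm_coords"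
        by (intro polyfun_cmult gm_coords_gen)
      then show ?thesis using True zero_idx[OF True] n_pos[OF True]
        by (rule_tac bexI[rotated]) (auto simp: 2 Fm_apply bd_apply cscale_def)
    next
      case False
      then have "\<forall>x\<in>nak_space Q d df. f x = 0" by (auto simp: 2 nak_space_iff)
      then show ?thesis by (intro bexI[OF _ polyfun.const[of 0]])
    qed
  next
    case 3
    show ?thesis
    proof (cases "\<psi> \<in> Irr \<Gamma>")
      case True
      have "(\<lambda>p. snd (snd p) ((\<psi>, i', 0), (\<psi>, i, 0))) \<in> polyfun gm_coords"
        by (intro gm_coords_gen)
      then show ?thesis using True zero_idx[OF True]
        by (rule_tac bexI[rotated]) (auto simp: 3 Fm_apply bd_apply)
    next
      case False
      then have "\<forall>x\<in>nak_space Q d df. f x = 0" by (auto simp: 3 nak_space_iff)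
      then show ?thesis by (intro bexI[OF _ polyfun.const[of 0]])
    qed
  qed
  then show "\<exists>p\<in>polyfun (coords (gmodule_problem \<Gamma> X lam \<theta> (M d) (M df))).
      \<forall>x\<in>amb (nakajima_problem Q lam \<theta> d df). f x = p (Fm x)"
    by (simp add: nakajima_problem_def gmodule_problem_def)
next
  show "eqs (nakajima_problem Q lam \<theta> d df) \<subseteq> polyfun (coords (nakajima_problem Q lam \<theta> d df))"
    by (auto simp: nakajima_problem_def intro!: polyfun_diff nak_moment_poly polyfun.const)
  show "eqs (gmodule_problem \<Gamma> X lam \<theta> (M d) (M df)) \<subseteq> polyfun (coords (gmodule_problem \<Gamma> X lam \<theta> (M d) (M df)))"
    by (auto simp: gmodule_problem_def intro!: polyfun_diff gm_moment_poly polyfun.const)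
next
  let ?a = "\<lambda>\<psi> ij p. nak_moment Q d df p \<psi> ij - cscale (lam \<psi>) (mone {..<d \<psi>}) ij"
    and ?b = "\<lambda>ij p. gm_moment (M d) (M df) p ij - gm_lambda \<Gamma> X (M d) lam ij"
  have eqs: "eqs (nakajima_problem Q lam \<theta> d df) = {?a \<psi> ij | \<psi> ij. \<psi> \<in> Irr \<Gamma>}"
    "eqs (gmodule_problem \<Gamma> X lam \<theta> (M d) (M df)) = range ?b"
    "amb (nakajima_problem Q lam \<theta> d df) = nak_space Q d df"
    by (simp_all add: nakajima_problem_def gmodule_problem_def verts)
  \<comment> \<open>Each entry of the target equation is \<open>1 / n \<psi>\<close> times one
    source equation, or identically zero if the vertices or the module indices differ or lie out of
    range.\<close>
  have e: "?b ((\<psi>', i', j'), (\<psi>, i, j)) (Fm p) = (if \<psi> \<in> Irr \<Gamma> \<and> \<psi> = \<psi>' \<and> j \<in> I \<psi> \<and> j' = j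
      then 1 / of_nat (n \<psi>) else 0) * ?a \<psi> (i', i) p"
    if "p \<in> nak_space Q d df" for p \<psi>' i' j' \<psi> i j
    unfolding gm_moment_F_map(1)[OF that] gm_lambda_blockmat bd_apply
    by (cases "\<psi> \<in> Irr \<Gamma> \<and> \<psi> = \<psi>' \<and> j \<in> I \<psi> \<and> j' = j") (simp_all only: if_True if_False, simp_all add: cscale_def diff_divide_distrib)
  {
    fix f assume "f \<in> eqs (gmodule_problem \<Gamma> X lam \<theta> (M d) (M df))"
    then obtain k where f: "f = ?b k" unfolding eqs by blast
    obtain \<psi>' i' j' \<psi> i j where k: "k = ((\<psi>', i', j'), (\<psi>, i, j))" by (metis surj_pair)
    show "\<exists>c. \<exists>e0\<in>insert (\<lambda>_. 0) (eqs (nakajima_problem Q lam \<theta> d df)).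
        \<forall>x\<in>amb (nakajima_problem Q lam \<theta> d df). f (Fm x) = c * e0 x"
    proof (cases "\<psi> \<in> Irr \<Gamma>")
      case True
      then have a: "?a \<psi> (i', i) \<in> insert (\<lambda>_. 0) {?a \<psi> ij | \<psi> ij. \<psi> \<in> Irr \<Gamma>}" by blast
      show ?thesis unfolding eqs f k by (rule exI, rule bexI[OF _ a], rule ballI, erule e)
    next
      case False
      then have "\<forall>x\<in>nak_space Q d df. f (Fm x) = 0 * 0" unfolding f k by (simp add: e)
      then show ?thesis unfolding eqs by - (rule exI, rule bexI[OF _ insertI1])
    qed
  next
    fix f assume "f \<in> eqs (nakajima_problem Q lam \<theta> d df)"
    then obtain \<psi> i' i where f: "f = ?a \<psi> (i', i)" and \<psi>: "\<psi> \<in> Irr \<Gamma>" unfolding eqs by auto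
    \<comment> \<open>The entry with both module indices \<open>0\<close> lies on the diagonal of a
      nonempty module block, and the factor \<open>n \<psi>\<close> recovers the source equation
      from it.\<close>
    have "\<forall>x\<in>nak_space Q d df. f x = of_nat (n \<psi>) * ?b ((\<psi>, i', 0), (\<psi>, i, 0)) (Fm x)"
      using \<psi> zero_idx[OF \<psi>] n_pos[OF \<psi>] by (simp add: e f)
    then show "\<exists>c. \<exists>e\<in>insert (\<lambda>_. 0) (eqs (gmodule_problem \<Gamma> X lam \<theta> (M d) (M df))).
        \<forall>x\<in>amb (nakajima_problem Q lam \<theta> d df). f x = c * e (Fm x)"
      unfolding eqs by - (rule exI, rule bexI[OF _ insertI2[OF rangeI]])
  }
qed

end

text \<open>\<open>N\<close> clears the denominators of \<open>\<theta>\<close>, so the floor merely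
  turns an integral rational into an integer. Both structures on the fibre are covered, as
  \<open>red\<close> is arbitrary.\<close>

theorem theorem2p28:
  fixes \<Gamma> :: "mat2 set"
    and Q :: "(chr, 'e) pre_digraph"
    and X :: "chr \<Rightarrow> nat gmodule"
    and y0 :: "'e \<times> bool \<Rightarrow> (nat, 2 \<times> nat) cmat"
    and l :: "'e \<times> bool \<Rightarrow> complex"
    and d df :: "chr \<Rightarrow> nat"
    and \<theta> :: "chr \<Rightarrow> rat"
    and lam :: "chr \<Rightarrow> complex"
    and N :: nat
    and red :: bool
  assumes "subgroup \<Gamma> SL2" and "finite \<Gamma>"
    and "oriented_McKay \<Gamma> Q"
    and "irr_family \<Gamma> X"
    and "arrow_maps \<Gamma> X Q y0"
    and "\<forall>h\<in>arcs (double_quiver Q). l h \<noteq> 0"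
    and "normalised_arrow_maps X Q (\<lambda>h. cscale (l h) (y0 h))"
    and "N > 0" and "\<forall>\<psi>\<in>Irr \<Gamma>. of_nat N * \<theta> \<psi> \<in> \<int>"
  shows "induces_git_iso red
           (nakajima_problem Q lam (\<lambda>\<psi>. \<lfloor>of_nat N * \<theta> \<psi>\<rfloor>) d df)
           (gmodule_problem \<Gamma> X lam (\<lambda>\<psi>. \<lfloor>of_nat N * \<theta> \<psi>\<rfloor>) (F_module \<Gamma> X d) (F_module \<Gamma> X df))
           (F_map \<Gamma> X Q (\<lambda>h. cscale (l h) (y0 h)))"
proof -
  interpret mckay \<Gamma> Q X y0 l
    using assms by (simp add: mckay_def mckay_axioms_def finite_SL2_def)
  have "y = (\<lambda>h. cscale (l h) (y0 h))" by (rule ext) (rule y_def)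
  then show ?thesis using git_iso.induces_git_iso[OF git_iso[where d = d and df = df]] by simp
qed

end
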